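(* Let $V\in L^\infty(\mathbb R;\mathbb R)$, let $u\in L^\infty(\mathbb R)$ be a distributional solution of $(-\Delta)^{1/4}u+Vu=0$ in $\mathbb R$, let $U$ be the Caffarelli--Silvestre extension of $u$, and set $W(x,z)=U(x,z^2/2)$ for $z>0$. Put \[ b=\kappa_{1/4}V,\qquad \kappa_{1/4}=\frac{\sqrt2}{d_{1/4}}>0 . \] Then $W(\cdot,0)=u$, $W_{zz}+z^2W_{xx}=0$ in $\{z>0\}$, and \[ \int_{z>0}\left(W_z\Psi_z+z^2W_x\Psi_x\right)dx\,dz=-\int_{\mathbb R}b(x)W(x,0)\Psi(x,0)\,dx\qquad(\ast) \] for every $\Psi\in C_c^\infty(\overline{\mathbb R^2_+})$. Equivalently, $-\partial_zW|_{z=0}=-b\,W(\cdot,0)$ in the conormal distributional sense (and in the local negative trace space, i.e. the local dual of the trace space of the finite-energy functions, once the local finite-energy realization is used). Conversely, if $W(x,z)=U(x,z^2/2)$ where $U$ is the finite-energy Caffarelli--Silvestre extension of its trace $W(\cdot,0)$, and $W$ satisfies $(\ast)$ for every $\Psi\in C_c^\infty(\overline{\mathbb R^2_+})$, then the trace $f=W(\cdot,0)$ satisfies $(-\Delta)^{1/4}f+Vf=0$ in $\mathbb R$ in the sense of distributions.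
   Context: $\mathbb R^2_+=\{(x,z):z>0\}$. $(-\Delta)^{1/4}$ has Fourier multiplier $|\xi|^{1/2}$ and is defined on bounded functions by duality: $\langle(-\Delta)^{1/4}u,\phi\rangle=\int u\,(-\Delta)^{1/4}\phi\,dx$ for Schwartz $\phi$. The Caffarelli--Silvestre (Poisson) extension of $f$ is $U(x,y)=\int_{\mathbb R}P_y(h)f(x-h)\,dh$, $y>0$, with $P_y(h)=c_*\,y^{1/2}(h^2+y^2)^{-3/4}$, where $c_*>0$ is fixed by $\int_{\mathbb R}P_y(h)\,dh=1$; it solves $\partial_y(y^{1/2}U_y)+y^{1/2}U_{xx}=0$ for $y>0$ with boundary value $f$. The extension is called finite-energy if $\int_{y>0}y^{1/2}|\nabla U|^2\,dx\,dy<\infty$. The constant $d_{1/4}>0$ is the normalization constant in the Dirichlet-to-Neumann identity $(-\Delta)^{1/4}f=-d_{1/4}\lim_{y\downarrow0}y^{1/2}U_y(\cdot,y)$, valid for finite-energy data in the dual trace space. The conormal derivative is understood weakly: $\langle-\partial_zW|_{z=0},\Psi(\cdot,0)\rangle:=\int_{z>0}(W_z\Psi_z+z^2W_x\Psi_x)\,dx\,dz$. *)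

theory Defs
  imports "HOL-Analysis.Analysis"
begin

text \<open>Functions on the plane take a pair; the half-plane variables are \<open>(x, y)\<close> for the
  extension \<open>U\<close> and \<open>(x, z)\<close> for \<open>W\<close>. Elements of \<open>L\<^sup>\<infinity>\<close> are
  represented by Lebesgue measurable functions. The unknown and the test functions are complex
  valued; the potential is real.\<close>

definition Linfty :: "(real \<Rightarrow> 'a::real_normed_vector) \<Rightarrow> bool" where
  "Linfty f \<longleftrightarrow> f \<in> borel_measurable lebesgue \<and> (\<exists>C. AE x in lebesgue. norm (f x) \<le> C)"

definition half_plane :: "(real \<times> real) set" where
  "half_plane = {p. 0 < snd p}"

subsection \<open>Smooth functions\<close>

definition D1 :: "(real \<Rightarrow> complex) \<Rightarrow> real \<Rightarrow> complex" where
  "D1 \<phi> x = vector_derivative \<phi> (at x)"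

text \<open>Partial derivatives in the first and in the second variable.\<close>

definition Dfst :: "(real \<times> real \<Rightarrow> complex) \<Rightarrow> real \<times> real \<Rightarrow> complex" where
  "Dfst F p = vector_derivative (\<lambda>t. F (t, snd p)) (at (fst p))"

definition Dsnd :: "(real \<times> real \<Rightarrow> complex) \<Rightarrow> real \<times> real \<Rightarrow> complex" where
  "Dsnd F p = vector_derivative (\<lambda>t. F (fst p, t)) (at (snd p))"

text \<open>Class \<open>C\<^sup>k\<close> on an open set.\<close>

fun Ck_on :: "nat \<Rightarrow> (real \<times> real) set \<Rightarrow> (real \<times> real \<Rightarrow> complex) \<Rightarrow> bool" where
  "Ck_on 0 S F \<longleftrightarrow> continuous_on S F"
| "Ck_on (Suc k) S F \<longleftrightarrow>
     (\<forall>p\<in>S. F differentiable (at p)) \<and> Ck_on k S (Dfst F) \<and> Ck_on k S (Dsnd F)"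

text \<open>Smooth, compactly supported functions on the closed half-plane are the restrictions to it of
  smooth, compactly supported functions on the whole plane. Below, such functions are only
  evaluated where the second coordinate is nonnegative.\<close>

definition test_function :: "(real \<times> real \<Rightarrow> complex) \<Rightarrow> bool" where
  "test_function \<Psi> \<longleftrightarrow> (\<forall>k. Ck_on k UNIV \<Psi>) \<and> compact (closure {p. \<Psi> p \<noteq> 0})"

definition schwartz :: "(real \<Rightarrow> complex) \<Rightarrow> bool" where
  "schwartz \<phi> \<longleftrightarrow>
     (\<forall>n x. (D1 ^^ n) \<phi> differentiable (at x)) \<and>
     (\<forall>m n. bounded (range (\<lambda>x. of_real (x ^ m) * (D1 ^^ n) \<phi> x)))"

subsection \<open>The operator \<open>(-\<Delta>)\<close> to the power 1/4\<close>

definition fourier :: "(real \<Rightarrow> complex) \<Rightarrow> real \<Rightarrow> complex" where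
  "fourier \<phi> \<xi> = (LINT x|lebesgue. exp (- (\<i> * of_real (x * \<xi>))) * \<phi> x)"

text \<open>The normalization of the Fourier transform is the one for which \<open>-\<Delta>\<close> has multiplier
  \<open>\<bar>\<xi>\<bar>\<^sup>2\<close>.\<close>

definition frac_lap :: "(real \<Rightarrow> complex) \<Rightarrow> real \<Rightarrow> complex" where
  "frac_lap \<phi> x =
     of_real (1 / (2 * pi)) *
     (LINT \<xi>|lebesgue. exp (\<i> * of_real (x * \<xi>)) * of_real (\<bar>\<xi>\<bar> powr (1/2)) * fourier \<phi> \<xi>)"

text \<open>The equation \<open>(-\<Delta>)\<^sup>1\<^sup>/\<^sup>4 f + V f = 0\<close>, the operator being defined by duality. The
  integrability clauses are automatic for bounded \<open>f\<close>; they make the pairings meaningful for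
  unbounded finite-energy \<open>f\<close>.\<close>

definition distr_solution :: "(real \<Rightarrow> real) \<Rightarrow> (real \<Rightarrow> complex) \<Rightarrow> bool" where
  "distr_solution V f \<longleftrightarrow>
     (\<forall>\<phi>. schwartz \<phi> \<longrightarrow>
        integrable lebesgue (\<lambda>x. f x * frac_lap \<phi> x) \<and>
        integrable lebesgue (\<lambda>x. of_real (V x) * f x * \<phi> x) \<and>
        (LINT x|lebesgue. f x * frac_lap \<phi> x) +
        (LINT x|lebesgue. of_real (V x) * f x * \<phi> x) = 0)"

subsection \<open>The Caffarelli--Silvestre extension\<close>

definition c_star :: real where
  "c_star = (THE c. 0 < c \<and> (\<forall>y>0. has_bochner_integral lebesgue
     (\<lambda>h. c * y powr (1/2) * (h\<^sup>2 + y\<^sup>2) powr (-3/4)) 1))"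

definition poisson_kernel :: "real \<Rightarrow> real \<Rightarrow> real" where
  "poisson_kernel y h = c_star * y powr (1/2) * (h\<^sup>2 + y\<^sup>2) powr (-3/4)"

definition cs_ext :: "(real \<Rightarrow> complex) \<Rightarrow> real \<times> real \<Rightarrow> complex" where
  "cs_ext f p = (LINT h|lebesgue. of_real (poisson_kernel (snd p) h) * f (fst p - h))"

definition has_cs_ext :: "(real \<Rightarrow> complex) \<Rightarrow> bool" where
  "has_cs_ext f \<longleftrightarrow>
     (\<forall>x. \<forall>y>0. integrable lebesgue (\<lambda>h. of_real (poisson_kernel y h) * f (x - h)))"

definition energy_density :: "(real \<times> real \<Rightarrow> complex) \<Rightarrow> real \<times> real \<Rightarrow> real" where
  "energy_density U p = snd p powr (1/2) * ((norm (Dfst U p))\<^sup>2 + (norm (Dsnd U p))\<^sup>2)"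

definition finite_energy :: "(real \<times> real \<Rightarrow> complex) \<Rightarrow> bool" where
  "finite_energy U \<longleftrightarrow> set_integrable lebesgue half_plane (energy_density U)"

text \<open>The space of traces of finite-energy functions, and its energy (semi)norm.\<close>

definition trace_space :: "(real \<Rightarrow> complex) set" where
  "trace_space = {f. has_cs_ext f \<and> finite_energy (cs_ext f)}"

definition trace_norm :: "(real \<Rightarrow> complex) \<Rightarrow> real" where
  "trace_norm f = sqrt (LINT p:half_plane|lebesgue. energy_density (cs_ext f) p)"

text \<open>The Dirichlet-to-Neumann identity \<open>(-\<Delta>)\<^sup>1\<^sup>/\<^sup>4 f = - d lim y\<^sup>1\<^sup>/\<^sup>2 U\<^sub>y\<close> for finite-energy data,
  the limit \<open>y \<down> 0\<close> being taken in the dual pairing; \<open>d_quarter\<close> is the constant for which it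
  holds.\<close>

definition dtn_identity :: "real \<Rightarrow> bool" where
  "dtn_identity d \<longleftrightarrow>
     (\<forall>f\<in>trace_space. \<forall>\<phi>. schwartz \<phi> \<longrightarrow>
        ((\<lambda>y. - of_real d * (LINT x|lebesgue. of_real (y powr (1/2)) * Dsnd (cs_ext f) (x, y) * \<phi> x))
           \<longlongrightarrow> (LINT x|lebesgue. f x * frac_lap \<phi> x)) (at_right 0))"

definition d_quarter :: real where
  "d_quarter = (THE d. 0 < d \<and> dtn_identity d)"

definition kappa_quarter :: real where
  "kappa_quarter = sqrt 2 / d_quarter"

subsection \<open>The half-plane function \<open>W\<close> and its boundary behaviour\<close>

definition lift :: "(real \<times> real \<Rightarrow> complex) \<Rightarrow> real \<times> real \<Rightarrow> complex" where
  "lift U p = U (fst p, (snd p)\<^sup>2 / 2)"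

text \<open>\<open>W(\<cdot>,0) = f\<close> as a trace: convergence of \<open>W(\<cdot>,z)\<close> to \<open>f\<close> in
  \<open>L\<^sup>1\<close> on bounded intervals as \<open>z \<down> 0\<close>. It determines \<open>f\<close> almost everywhere.\<close>

definition has_trace :: "(real \<times> real \<Rightarrow> complex) \<Rightarrow> (real \<Rightarrow> complex) \<Rightarrow> bool" where
  "has_trace W f \<longleftrightarrow>
     (\<forall>R. (\<forall>z>0. set_integrable lebesgue {-R..R} (\<lambda>x. W (x, z) - f x)) \<and>
          ((\<lambda>z. LINT x:{-R..R}|lebesgue. norm (W (x, z) - f x)) \<longlongrightarrow> 0) (at_right 0))"

definition conormal_integrand ::
    "(real \<times> real \<Rightarrow> complex) \<Rightarrow> (real \<times> real \<Rightarrow> complex) \<Rightarrow> real \<times> real \<Rightarrow> complex" where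
  "conormal_integrand W \<Psi> p =
     Dsnd W p * Dsnd \<Psi> p + of_real ((snd p)\<^sup>2) * Dfst W p * Dfst \<Psi> p"

text \<open>\<open>T\<close> is the distribution \<open>- \<partial>\<^sub>z W\<close> on the boundary line.\<close>

definition neg_conormal_distr ::
    "(real \<times> real \<Rightarrow> complex) \<Rightarrow> ((real \<Rightarrow> complex) \<Rightarrow> complex) \<Rightarrow> bool" where
  "neg_conormal_distr W T \<longleftrightarrow>
     (\<forall>\<Psi>. test_function \<Psi> \<longrightarrow>
        set_integrable lebesgue half_plane (conormal_integrand W \<Psi>) \<and>
        T (\<lambda>x. \<Psi> (x, 0)) = (LINT p:half_plane|lebesgue. conormal_integrand W \<Psi> p))"

text \<open>In the \<open>(x,z)\<close> variables the energy density is \<open>\<bar>W\<^sub>z\<bar>\<^sup>2 + z\<^sup>2 \<bar>W\<^sub>x\<bar>\<^sup>2\<close>.\<close>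

definition locally_finite_energy :: "(real \<times> real \<Rightarrow> complex) \<Rightarrow> bool" where
  "locally_finite_energy W \<longleftrightarrow>
     (\<forall>R. set_integrable lebesgue ({-R..R} \<times> {0<..R})
        (\<lambda>p. (norm (Dsnd W p))\<^sup>2 + (snd p)\<^sup>2 * (norm (Dfst W p))\<^sup>2))"

definition local_trace_space :: "real \<Rightarrow> (real \<Rightarrow> complex) set" where
  "local_trace_space R = {g \<in> trace_space. \<forall>x. R < \<bar>x\<bar> \<longrightarrow> g x = 0}"

text \<open>The local dual of the trace space: linear functionals on its compactly supported elements,
  bounded on those supported in any fixed compact interval.\<close>

definition local_trace_dual :: "((real \<Rightarrow> complex) \<Rightarrow> complex) set" where
  "local_trace_dual = {T. \<forall>R.
     (\<forall>g\<in>local_trace_space R. \<forall>h\<in>local_trace_space R. T (\<lambda>x. g x + h x) = T g + T h) \<and>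
     (\<forall>g\<in>local_trace_space R. \<forall>c. T (\<lambda>x. c * g x) = c * T g) \<and>
     (\<exists>C. \<forall>g\<in>local_trace_space R. norm (T g) \<le> C * trace_norm g)}"

text \<open>\<open>T\<close> is \<open>- \<partial>\<^sub>z W\<close> on the boundary line, as a functional on compactly supported elements
  \<open>g\<close> of the trace space: the defining integral is taken against the finite-energy extension of
  \<open>g\<close>, cut off by any test function \<open>\<eta>\<close> which leaves the boundary value \<open>g\<close>
  unchanged.\<close>

definition neg_conormal_dual ::
    "(real \<times> real \<Rightarrow> complex) \<Rightarrow> ((real \<Rightarrow> complex) \<Rightarrow> complex) \<Rightarrow> bool" where
  "neg_conormal_dual W T \<longleftrightarrow>
     (\<forall>R. \<forall>g\<in>local_trace_space R. \<forall>\<eta>. test_function \<eta> \<and> (\<forall>x. \<eta> (x, 0) * g x = g x) \<longrightarrow>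
        (let \<Psi> = (\<lambda>p. \<eta> p * lift (cs_ext g) p) in
          set_integrable lebesgue half_plane (conormal_integrand W \<Psi>) \<and>
          T g = (LINT p:half_plane|lebesgue. conormal_integrand W \<Psi> p)))"

end

theory Submission imports Defs "HOL-Probability.Probability" begin


lemma has_bochner_integral_nonneg_has_integral:
  fixes f :: "real \<Rightarrow> real"
  assumes [measurable]: "f \<in> borel_measurable borel" "S \<in> sets borel"
    and "\<And>x. 0 \<le> f x" "(f has_integral I) S"
  shows "has_bochner_integral lborel (\<lambda>x. indicator S x * f x) I"
proof -
  have n: "integral\<^sup>N lborel (\<lambda>x. indicator S x * f x) = I"
    using nn_integral_has_integral_lebesgue[OF assms(3,4)] .
  have "0 \<le> I" using has_integral_nonneg[OF assms(4)] assms(3) by auto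
  then show ?thesis
    using n assms(3) by (intro has_bochner_integral_nn_integral) auto
qed

lemma has_bochner_integral_reflect:
  fixes f :: "real \<Rightarrow> 'a :: {banach, second_countable_topology}"
  assumes "has_bochner_integral lborel f I"
  shows "has_bochner_integral lborel (\<lambda>x. f (- x)) I"
  using assms lborel_integrable_real_affine[of f "-1" 0] lborel_integral_real_affine[of "-1" f 0]
  by (simp add: has_bochner_integral_iff)

lemma integrable_reflect_shift:
  fixes f :: "real \<Rightarrow> 'a :: {banach, second_countable_topology}"
  assumes "integrable lborel f"
  shows "integrable lborel (\<lambda>x. f (t - x))"
  using lborel_integrable_real_affine[OF assms, of "-1" t] by simp

lemma integral_reflect_shift:
  fixes f :: "real \<Rightarrow> 'a :: {banach, second_countable_topology}"
  shows "(LINT x|lborel. f (t - x)) = integral\<^sup>L lborel f"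
  using lborel_integral_real_affine[of "-1" f t] by simp

lemma integrable_shift:
  fixes f :: "real \<Rightarrow> 'a :: {banach, second_countable_topology}"
  assumes "integrable lborel f"
  shows "integrable lborel (\<lambda>x. f (x - t))"
  using lborel_integrable_real_affine[OF assms, of 1 "-t"] by simp

lemma integral_shift:
  fixes f :: "real \<Rightarrow> 'a :: {banach, second_countable_topology}"
  shows "(LINT x|lborel. f (x - t)) = integral\<^sup>L lborel f"
  using lborel_integral_real_affine[of 1 f "-t"] by simp

lemma has_bochner_integral_abs_powr_tail:
  fixes a r :: real
  assumes "1 < a" "0 < r"
  shows "has_bochner_integral lborel (\<lambda>h. indicator {h. r \<le> \<bar>h\<bar>} h * \<bar>h\<bar> powr (- a))
           (2 * r powr (1 - a) / (a - 1))"
proof -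
  let ?I = "- (r powr (- a + 1)) / (- a + 1)"
  have "((\<lambda>x. \<bar>x\<bar> powr (- a)) has_integral ?I) {r..}"
    using has_integral_powr_to_inf[of "-a" r] assms
    by (subst has_integral_cong[where g = "\<lambda>x. x powr (- a)"]) auto
  then have b: "has_bochner_integral lborel (\<lambda>x. indicator {r..} x * \<bar>x\<bar> powr (- a)) ?I"
    by (intro has_bochner_integral_nonneg_has_integral) auto
  have "has_bochner_integral lborel
     (\<lambda>x. indicator {r..} x * \<bar>x\<bar> powr (- a) + indicator {r..} (- x) * \<bar>- x\<bar> powr (- a)) (?I + ?I)"
    by (intro has_bochner_integral_add b has_bochner_integral_reflect[OF b])
  moreover have "indicator {r..} x * \<bar>x\<bar> powr (- a) + indicator {r..} (- x) * \<bar>- x\<bar> powr (- a)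
     = indicator {h. r \<le> \<bar>h\<bar>} x * \<bar>x\<bar> powr (- a)" for x
    using assms by (auto simp: indicator_def)
  moreover have "?I = r powr (1 - a) / (a - 1)"
    by (metis add.commute minus_diff_eq minus_divide_divide uminus_add_conv_diff)
  then have "?I + ?I = 2 * r powr (1 - a) / (a - 1)" by linarith
  ultimately show ?thesis by simp
qed

lemma has_bochner_integral_abs_powr_local:
  fixes a r :: real
  assumes "a < 1" "0 < r"
  shows "has_bochner_integral lborel (\<lambda>h. indicator {h. \<bar>h\<bar> \<le> r} h * \<bar>h\<bar> powr (- a))
           (2 * r powr (1 - a) / (1 - a))"
proof -
  let ?I = "r powr (- a + 1) / (- a + 1)"
  have "((\<lambda>x. \<bar>x\<bar> powr (- a)) has_integral ?I) {0..r}"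
    using has_integral_powr_from_0[of "-a" r] assms
    by (subst has_integral_cong[where g = "\<lambda>x. x powr (- a)"]) auto
  then have b: "has_bochner_integral lborel (\<lambda>x. indicator {0..r} x * \<bar>x\<bar> powr (- a)) ?I"
    by (intro has_bochner_integral_nonneg_has_integral) auto
  have "has_bochner_integral lborel
     (\<lambda>x. indicator {0..r} x * \<bar>x\<bar> powr (- a) + indicator {0..r} (- x) * \<bar>- x\<bar> powr (- a)) (?I + ?I)"
    by (intro has_bochner_integral_add b has_bochner_integral_reflect[OF b])
  moreover have "indicator {0..r} x * \<bar>x\<bar> powr (- a) + indicator {0..r} (- x) * \<bar>- x\<bar> powr (- a)
     = indicator {h. \<bar>h\<bar> \<le> r} x * \<bar>x\<bar> powr (- a)" for x
    using assms by (auto simp: indicator_def)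
  moreover have "?I + ?I = 2 * r powr (1 - a) / (1 - a)"
    by (simp add: add.commute flip: add_divide_distrib)
  ultimately show ?thesis by simp
qed

lemma integrable_one_plus_square_powr:
  assumes "1/2 < a"
  shows "integrable lborel (\<lambda>s::real. (1 + s\<^sup>2) powr (- a))"
proof (rule Bochner_Integration.integrable_bound)
  have "integrable lborel (\<lambda>h. indicator {h. \<bar>h\<bar> \<le> 1} h * \<bar>h\<bar> powr (- 0) +
      indicator {h. 1 \<le> \<bar>h\<bar>} h * \<bar>h\<bar> powr (- (2 * a)) :: real)"
    using has_bochner_integral_abs_powr_local[of 0 1] has_bochner_integral_abs_powr_tail[of "2*a" 1] assms
    by (intro Bochner_Integration.integrable_add) (auto simp: has_bochner_integral_iff)
  then show "integrable lborel (\<lambda>h. indicator {h. \<bar>h\<bar> \<le> 1} h * \<bar>h\<bar> powr (- 0) +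
      indicator {h. 1 \<le> \<bar>h\<bar>} h * \<bar>h\<bar> powr (- (2 * a)) :: real)" .
  have "(1 + s\<^sup>2) powr (- a) \<le> indicator {h. \<bar>h\<bar> \<le> 1} s * \<bar>s\<bar> powr (- 0) +
      indicator {h. 1 \<le> \<bar>h\<bar>} s * \<bar>s\<bar> powr (- (2 * a))" if "s \<noteq> 0" for s :: real
  proof (cases "\<bar>s\<bar> \<le> 1")
    case True
    have "(1 + s\<^sup>2) powr (- a) \<le> 1 powr (- a)"
      using assms by (intro powr_mono2') auto
    with True that show ?thesis by (auto simp: indicator_def intro: order_trans)
  next
    case False
    have "(1 + s\<^sup>2) powr (- a) \<le> (\<bar>s\<bar>\<^sup>2) powr (- a)"
      using assms that by (intro powr_mono2') auto
    also have "\<bar>s\<bar>\<^sup>2 = \<bar>s\<bar> powr 2" using that by (simp add: powr_numeral)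
    also have "\<dots> powr (- a) = \<bar>s\<bar> powr (- (2 * a))" by (subst powr_powr) simp
    finally show ?thesis using False by (auto simp: indicator_def)
  qed
  moreover have "AE s in lborel. s \<noteq> (0::real)"
    by (rule AE_lborel_singleton)
  ultimately show "AE s in lborel. norm ((1 + s\<^sup>2) powr (- a)) \<le>
     norm (indicator {h. \<bar>h\<bar> \<le> 1} s * \<bar>s\<bar> powr (- 0) + indicator {h. 1 \<le> \<bar>h\<bar>} s * \<bar>s\<bar> powr (- (2 * a)) :: real)"
    by (auto elim!: eventually_mono intro: order_trans[OF _ abs_ge_self])
qed auto

definition japanese_integral :: "real \<Rightarrow> real" where
  "japanese_integral a = (LINT s|lborel. (1 + s\<^sup>2) powr (- a))"

lemma japanese_integral_pos:
  assumes "1/2 < a"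
  shows "0 < japanese_integral a"
proof -
  have "(LINT s|lborel. (1 + s\<^sup>2) powr (- a)) \<noteq> (0::real)"
  proof
    assume "(LINT s|lborel. (1 + s\<^sup>2) powr (- a)) = (0::real)"
    then have "AE s in lborel. (1 + s\<^sup>2) powr (- a) = (0::real)"
      using integral_nonneg_eq_0_iff_AE[OF integrable_one_plus_square_powr[OF assms]] by simp
    moreover have "(1 + s\<^sup>2) powr (- a) \<noteq> 0" for s :: real
      by (smt (verit) powr_gt_zero zero_le_power2)
    ultimately have "AE s::real in lborel. False" by simp
    then show False
      by (simp add: ae_filter_eq_bot_iff eventually_False)
  qed
  moreover have "0 \<le> (LINT s|lborel. (1 + s\<^sup>2) powr (- a) :: real)"
    by (intro integral_nonneg_AE) auto
  ultimately show ?thesis unfolding japanese_integral_def by linarith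
qed

lemma has_bochner_integral_square_plus_powr:
  assumes "1/2 < a" "0 < y"
  shows "has_bochner_integral lborel (\<lambda>h. (h\<^sup>2 + y\<^sup>2) powr (- a))
     (y powr (1 - 2 * a) * japanese_integral a)"
proof -
  have eq: "(h\<^sup>2 + y\<^sup>2) powr (- a) = y powr (- 2 * a) * (1 + (0 + (1 / y) * h)\<^sup>2) powr (- a)" for h
  proof -
    have "h\<^sup>2 + y\<^sup>2 = y\<^sup>2 * (1 + (0 + (1 / y) * h)\<^sup>2)" using assms by (simp add: field_simps)
    then have "(h\<^sup>2 + y\<^sup>2) powr (- a) = (y\<^sup>2) powr (- a) * (1 + (0 + (1 / y) * h)\<^sup>2) powr (- a)"
      by (simp add: powr_mult)
    then show ?thesis using assms by (simp add: powr_powr flip: powr_numeral)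
  qed
  have i: "integrable lborel (\<lambda>h. (1 + (0 + (1 / y) * h)\<^sup>2) powr (- a))"
    using lborel_integrable_real_affine[OF integrable_one_plus_square_powr[OF assms(1)], of "1/y" 0]
      assms by simp
  have "japanese_integral a = (1 / y) * (LINT h|lborel. (1 + (0 + (1 / y) * h)\<^sup>2) powr (- a))"
    using lborel_integral_real_affine[of "1/y" "\<lambda>s. (1 + s\<^sup>2) powr (- a)" 0] assms
    by (simp add: japanese_integral_def)
  then have "(LINT h|lborel. (1 + (0 + (1 / y) * h)\<^sup>2) powr (- a)) = y * japanese_integral a"
    using assms by (simp add: field_simps)
  moreover have "y powr (1 - 2 * a) = y powr (-2*a) * y"
    using assms by (simp add: powr_diff powr_minus field_simps)
  ultimately show ?thesis unfolding eq using i
    by (simp add: has_bochner_integral_iff)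
qed

lemma c_star_eq: "c_star = 1 / japanese_integral (3/4)"
  and c_star_pos: "0 < c_star"
proof -
  have J: "0 < japanese_integral (3/4)" by (rule japanese_integral_pos) simp
  have *: "has_bochner_integral lebesgue (\<lambda>h. c * y powr (1/2) * (h\<^sup>2 + y\<^sup>2) powr (-3/4))
      (c * japanese_integral (3/4))" if "0 < y" for c y
  proof -
    have "has_bochner_integral lborel (\<lambda>h. (c * y powr (1/2)) * (h\<^sup>2 + y\<^sup>2) powr (- (3/4)))
      ((c * y powr (1/2)) * (y powr (1 - 2 * (3/4)) * japanese_integral (3/4)))"
      by (intro has_bochner_integral_mult_right has_bochner_integral_square_plus_powr that) auto
    moreover have "y powr (1/2) * y powr (1 - 2 * (3/4)) = 1"
      using that by (simp flip: powr_add)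
    then have "(c * y powr (1/2)) * (y powr (1 - 2 * (3/4)) * japanese_integral (3/4)) = c * japanese_integral (3/4)"
      by (metis mult.assoc mult.right_neutral)
    ultimately have "has_bochner_integral lborel (\<lambda>h. c * y powr (1/2) * (h\<^sup>2 + y\<^sup>2) powr (-3/4))
      (c * japanese_integral (3/4))" by (metis (no_types) minus_divide_left)
    then show ?thesis
      by (simp add: has_bochner_integral_iff integrable_completion integral_completion)
  qed
  show "c_star = 1 / japanese_integral (3/4)"
    unfolding c_star_def
  proof (rule the_equality)
    show "0 < 1 / japanese_integral (3/4) \<and> (\<forall>y>0. has_bochner_integral lebesgue
      (\<lambda>h. 1 / japanese_integral (3/4) * y powr (1/2) * (h\<^sup>2 + y\<^sup>2) powr (-3/4)) 1)"
      using J *[of _ "1 / japanese_integral (3/4)"] by auto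
  next
    fix c :: real assume "0 < c \<and> (\<forall>y>0. has_bochner_integral lebesgue
      (\<lambda>h. c * y powr (1/2) * (h\<^sup>2 + y\<^sup>2) powr (-3/4)) 1)"
    then have "has_bochner_integral lebesgue
      (\<lambda>h. c * (1::real) powr (1/2) * (h\<^sup>2 + 1\<^sup>2) powr (-3/4)) 1" by (meson zero_less_one)
    with *[of 1 c] have "c * japanese_integral (3/4) = 1"
      using has_bochner_integral_eq by force
    then show "c = 1 / japanese_integral (3/4)" using J by (simp add: field_simps)
  qed
  then show "0 < c_star" using J by (metis zero_less_divide_1_iff)
qed

definition weight :: "real \<Rightarrow> real" where "weight x = (1 + x\<^sup>2) powr (- (3/4))"

lemma weight_pos [simp]: "0 < weight x"
  unfolding weight_def by (smt (verit) powr_gt_zero zero_le_power2)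

lemma weight_nonneg [simp]: "0 \<le> weight x" using weight_pos[of x] by linarith

lemma weight_neq_0 [simp]: "weight x \<noteq> 0" using weight_pos[of x] by linarith

lemma weight_le_1: "weight x \<le> 1"
  unfolding weight_def using powr_mono2'[of "-(3/4)" 1 "1 + x\<^sup>2"] by simp

lemma weight_minus [simp]: "weight (- x) = weight x" by (simp add: weight_def)

lemma weight_measurable [measurable]: "weight \<in> borel_measurable borel"
  unfolding weight_def[abs_def] by measurable

lemma integrable_weight: "integrable lborel weight"
  unfolding weight_def[abs_def] by (rule integrable_one_plus_square_powr) simp

lemma peetre: "1 + (t::real)\<^sup>2 \<le> 2 * (1 + x\<^sup>2) * (1 + (x - t)\<^sup>2)"
proof -
  have "0 \<le> (2 * x - t)\<^sup>2 + 1 + 2 * x\<^sup>2 * (x - t)\<^sup>2" by simp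
  then show ?thesis by (simp add: power2_eq_square algebra_simps)
qed

lemma weight_shift: "weight (x - t) \<le> 2 * (1 + x\<^sup>2) * weight t"
proof -
  have p: "0 < 2 * (1 + x\<^sup>2)" "0 < 1 + t\<^sup>2" "0 < 1 + (x - t)\<^sup>2"
    by (auto intro: add_pos_nonneg)
  have "(1 + (x - t)\<^sup>2) powr (- (3/4)) \<le> ((1 + t\<^sup>2) / (2 * (1 + x\<^sup>2))) powr (- (3/4))"
    using p peetre[of t x] by (intro powr_mono2') (auto simp: field_simps)
  also have "\<dots> = (2 * (1 + x\<^sup>2)) powr (3/4) * (1 + t\<^sup>2) powr (- (3/4))"
    using p by (simp add: powr_divide powr_minus_divide)
  also have "\<dots> \<le> (2 * (1 + x\<^sup>2)) powr 1 * (1 + t\<^sup>2) powr (- (3/4))"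
    by (intro mult_right_mono powr_mono) auto
  finally show ?thesis using p by (simp add: weight_def)
qed

lemma powr_neg_le_weight:
  assumes "0 < k" "k * (1 + h\<^sup>2) \<le> S" "3/4 \<le> e"
  shows "S powr (- e) \<le> k powr (- e) * weight h"
proof -
  have p: "0 < 1 + h\<^sup>2" by (auto intro: add_pos_nonneg)
  have "S powr (- e) \<le> (k * (1 + h\<^sup>2)) powr (- e)"
    using assms p by (intro powr_mono2') auto
  also have "\<dots> = k powr (- e) * (1 + h\<^sup>2) powr (- e)" using assms p by (simp add: powr_mult)
  also have "\<dots> \<le> k powr (- e) * (1 + h\<^sup>2) powr (- (3/4))"
    using assms by (intro mult_left_mono powr_mono) auto
  finally show ?thesis by (simp add: weight_def)
qed


lemma has_derivative_lebesgue_integral: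
  fixes H :: "'a::euclidean_space \<Rightarrow> real \<Rightarrow> complex"
  assumes U: "open U" "convex U" "p \<in> U"
    and int: "\<And>q. q \<in> U \<Longrightarrow> integrable lborel (H q)"
    and der: "\<And>q t. q \<in> U \<Longrightarrow> ((\<lambda>q. H q t) has_derivative D q t) (at q)"
    and bd: "\<And>q t v. q \<in> U \<Longrightarrow> norm (D q t v) \<le> g t * norm v"
    and g: "integrable lborel g"
    and Dint: "\<And>v. integrable lborel (\<lambda>t. D p t v)"
  shows "((\<lambda>q. LINT t|lborel. H q t) has_derivative (\<lambda>v. LINT t|lborel. D p t v)) (at p)"
  unfolding has_derivative_iff_norm
proof
  have lin: "linear (D p t)" for t using der[OF U(3), of t] has_derivative_linear by blast
  have gpos: "0 \<le> g t" for t
  proof -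
    obtain b :: 'a where "b \<in> Basis" using nonempty_Basis by blast
    then have "norm (D p t b) \<le> g t" using bd[OF U(3), of t b] by simp
    then show ?thesis using norm_ge_zero order_trans by blast
  qed
  have nb: "norm (LINT t|lborel. D p t v) \<le> norm v * (LINT t|lborel. g t)" for v
  proof -
    have "norm (LINT t|lborel. D p t v) \<le> (LINT t|lborel. norm (D p t v))" by simp
    also have "\<dots> \<le> (LINT t|lborel. g t * norm v)"
      using Dint g bd[OF U(3)] by (intro integral_mono integrable_mult_left) auto
    finally show ?thesis by (simp add: mult.commute)
  qed
  show bl: "bounded_linear (\<lambda>v. LINT t|lborel. D p t v)"
    by (rule bounded_linear_intro[OF _ _ nb])
      (simp_all add: linear_add[OF lin] linear_scale[OF lin] Dint)
  show "((\<lambda>q. norm ((LINT t|lborel. H q t) - (LINT t|lborel. H p t) - (LINT t|lborel. D p t (q - p))) /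
      norm (q - p)) \<longlongrightarrow> 0) (at p)"
    unfolding tendsto_at_iff_sequentially
  proof (intro allI impI)
    fix X :: "nat \<Rightarrow> 'a" assume X: "\<forall>i. X i \<in> UNIV - {p}" "X \<longlonglongrightarrow> p"
    have "eventually (\<lambda>i. X i \<in> U) sequentially" using topological_tendstoD[OF X(2) U(1,3)] .
    then obtain N where N: "\<And>i. N \<le> i \<Longrightarrow> X i \<in> U" by (auto simp: eventually_sequentially)
    define Y where "Y i = X (i + N)" for i
    have Y: "Y i \<in> U" "Y i \<noteq> p" "Y \<longlonglongrightarrow> p" for i
      using N[of "i + N"] X by (auto simp: Y_def[abs_def] intro: LIMSEQ_ignore_initial_segment)
    define r where "r i t = (H (Y i) t - H p t - D p t (Y i - p)) /\<^sub>R norm (Y i - p)" for i t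
    have rint: "integrable lborel (r i)" for i
      unfolding r_def using int[OF Y(1)] int[OF U(3)] Dint by (intro integrable_scaleR_right Bochner_Integration.integrable_diff) auto
    have rbd: "norm (r i t) \<le> 2 * g t" for i t
    proof -
      have "norm (H (Y i) t - H p t) \<le> g t * norm (Y i - p)"
      proof (rule differentiable_bound[OF U(2) _ _ Y(1) U(3)])
        show "((\<lambda>q. H q t) has_derivative D q t) (at q within U)" if "q \<in> U" for q
          using der[OF that] has_derivative_at_withinI by blast
        show "onorm (D q t) \<le> g t" if "q \<in> U" for q
          using bd[OF that] gpos by (intro onorm_bound) auto
      qed
      moreover have "norm (D p t (Y i - p)) \<le> g t * norm (Y i - p)" using bd[OF U(3)] .
      ultimately have "norm (H (Y i) t - H p t - D p t (Y i - p)) \<le> 2 * g t * norm (Y i - p)"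
        using norm_triangle_ineq4[of "H (Y i) t - H p t" "D p t (Y i - p)"] by linarith
      then show ?thesis using Y(2)[of i] by (simp add: r_def divide_simps mult.commute)
    qed
    have rlim: "(\<lambda>i. r i t) \<longlonglongrightarrow> 0" for t
    proof -
      have "((\<lambda>q. norm (H q t - H p t - D p t (q - p)) / norm (q - p)) \<longlongrightarrow> 0) (at p)"
        using der[OF U(3), of t] unfolding has_derivative_iff_norm by blast
      then have "(\<lambda>i. norm (H (Y i) t - H p t - D p t (Y i - p)) / norm (Y i - p)) \<longlonglongrightarrow> 0"
        unfolding tendsto_at_iff_sequentially using Y by (auto simp: o_def)
      then have "(\<lambda>i. norm (r i t)) \<longlonglongrightarrow> 0"
        by (simp add: r_def divide_inverse mult.commute)
      then show ?thesis by (simp add: tendsto_norm_zero_iff)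
    qed
    have "(\<lambda>i. LINT t|lborel. r i t) \<longlonglongrightarrow> (LINT (t::real)|lborel. (0::complex))"
      by (rule integral_dominated_convergence[where w = "\<lambda>t. 2 * g t"])
        (use rint rbd rlim g in \<open>auto intro!: borel_measurable_integrable\<close>)
    then have "(\<lambda>i. norm (LINT t|lborel. r i t)) \<longlonglongrightarrow> 0" by (simp add: tendsto_norm_zero)
    moreover have "norm (LINT t|lborel. r i t) = norm ((LINT t|lborel. H (Y i) t) - (LINT t|lborel. H p t) - (LINT t|lborel. D p t (Y i - p))) /
      norm (Y i - p)" for i
      using int[OF Y(1)] int[OF U(3)] Dint
      by (simp add: r_def divide_inverse mult.commute Bochner_Integration.integral_diff)
    ultimately have "(\<lambda>i. norm ((LINT t|lborel. H (Y i) t) - (LINT t|lborel. H p t) - (LINT t|lborel. D p t (Y i - p))) /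
      norm (Y i - p)) \<longlonglongrightarrow> 0" by simp
    then have "(\<lambda>i. ((\<lambda>q. norm ((LINT t|lborel. H q t) - (LINT t|lborel. H p t) - (LINT t|lborel. D p t (q - p))) /
      norm (q - p)) \<circ> X) (i + N)) \<longlonglongrightarrow> 0" by (simp add: Y_def o_def)
    then show "((\<lambda>q. norm ((LINT t|lborel. H q t) - (LINT t|lborel. H p t) - (LINT t|lborel. D p t (q - p))) /
      norm (q - p)) \<circ> X) \<longlonglongrightarrow> 0" by (rule LIMSEQ_offset)
  qed
qed

definition ker :: "nat \<Rightarrow> nat \<Rightarrow> real \<Rightarrow> real \<Rightarrow> real \<Rightarrow> real" where
  "ker p m r z h = z ^ p * h ^ m * (h\<^sup>2 + z ^ 4 / 4) powr (- r)"

definition weighted_L1 :: "(real \<Rightarrow> complex) \<Rightarrow> bool" where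
  "weighted_L1 f \<longleftrightarrow> f \<in> borel_measurable borel \<and> integrable lborel (\<lambda>t. of_real (weight t) * f t)"

definition pot :: "nat \<Rightarrow> nat \<Rightarrow> real \<Rightarrow> (real \<Rightarrow> complex) \<Rightarrow> real \<times> real \<Rightarrow> complex" where
  "pot p m r f q = (LINT t|lborel. of_real (ker p m r (snd q) (fst q - t)) * f t)"

lemma ker_measurable [measurable]: "(\<lambda>t. ker p m r z (x - t)) \<in> borel_measurable borel"
  "ker p m r z \<in> borel_measurable borel"
  "(\<lambda>(x,t). ker p m r z (x - t)) \<in> borel_measurable (borel \<Otimes>\<^sub>M borel)"
  unfolding ker_def[abs_def] by measurable

lemma square_plus_pos: "0 < z \<Longrightarrow> 0 < (h::real)\<^sup>2 + z ^ 4 / 4"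
  by (auto intro: add_nonneg_pos)

lemma ker_bound_weight:
  assumes "0 < za" "za \<le> z" "z \<le> zb" "m + 3/2 \<le> 2 * r"
  shows "\<bar>ker p m r z h\<bar> \<le> zb ^ p * (min 1 (za ^ 4 / 4)) powr (- (r - m / 2)) * weight h"
proof -
  let ?S = "h\<^sup>2 + z ^ 4 / 4" and ?k = "min 1 (za ^ 4 / 4)"
  have S: "0 < ?S" using square_plus_pos assms by auto
  have "za ^ 4 \<le> z ^ 4" using assms by (intro power_mono) auto
  moreover have "?k * h\<^sup>2 \<le> 1 * h\<^sup>2" by (intro mult_right_mono) auto
  ultimately have k: "?k * (1 + h\<^sup>2) \<le> ?S" by (simp add: algebra_simps min_def split: if_splits)
  have "\<bar>h\<bar> = sqrt (h\<^sup>2)" by simp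
  also have "\<dots> \<le> sqrt ?S" using assms by (intro real_sqrt_le_mono) auto
  also have "\<dots> = ?S powr (1/2)" using S by (simp add: powr_half_sqrt)
  finally have "\<bar>h\<bar> ^ m \<le> (?S powr (1/2)) ^ m" by (intro power_mono) auto
  also have "\<dots> = ?S powr (m / 2)" using S by (simp add: powr_power)
  finally have "\<bar>h\<bar> ^ m * ?S powr (- r) \<le> ?S powr (m / 2) * ?S powr (- r)"
    by (intro mult_right_mono) auto
  also have "\<dots> = ?S powr (- (r - m / 2))" by (simp flip: powr_add)
  also have "\<dots> \<le> ?k powr (- (r - m / 2)) * weight h"
    using assms by (intro powr_neg_le_weight k) auto
  finally have *: "\<bar>h\<bar> ^ m * ?S powr (- r) \<le> ?k powr (- (r - m / 2)) * weight h" .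
  have "\<bar>ker p m r z h\<bar> = z ^ p * (\<bar>h\<bar> ^ m * ?S powr (- r))"
    using assms by (simp add: ker_def abs_mult power_abs)
  also have "\<dots> \<le> zb ^ p * (?k powr (- (r - m / 2)) * weight h)"
    using assms by (intro mult_mono power_mono *) auto
  finally show ?thesis by simp
qed

lemma ker_bound_weight_uniform:
  assumes "0 < za" "m + 3/2 \<le> 2 * r"
  obtains C where "0 \<le> C"
    "\<And>z x t. \<lbrakk>za \<le> z; z \<le> zb; \<bar>x\<bar> \<le> R\<rbrakk> \<Longrightarrow> \<bar>ker p m r z (x - t)\<bar> \<le> C * weight t"
proof
  let ?C = "\<bar>zb\<bar> ^ p * (min 1 (za ^ 4 / 4)) powr (- (r - m / 2))"
  show "0 \<le> ?C * (2 * (1 + R\<^sup>2))" by simp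
  fix z x t assume zx: "za \<le> z" "z \<le> zb" "\<bar>x\<bar> \<le> R"
  have "\<bar>ker p m r z (x - t)\<bar> \<le> ?C * weight (x - t)"
    using ker_bound_weight[of za z zb m r p "x - t"] assms zx by auto
  also have "\<dots> \<le> ?C * (2 * (1 + R\<^sup>2) * weight t)"
  proof (intro mult_left_mono)
    have "x\<^sup>2 \<le> R\<^sup>2" using zx by (metis abs_le_square_iff abs_ge_zero abs_of_nonneg order_trans)
    then have "2 * (1 + x\<^sup>2) * weight t \<le> 2 * (1 + R\<^sup>2) * weight t" by (intro mult_right_mono) auto
    then show "weight (x - t) \<le> 2 * (1 + R\<^sup>2) * weight t" using weight_shift[of x t] by linarith
  qed simp
  finally show "\<bar>ker p m r z (x - t)\<bar> \<le> ?C * (2 * (1 + R\<^sup>2)) * weight t" by (simp add: mult.assoc)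
qed

lemma integrable_weighted_bound:
  assumes f: "weighted_L1 f" and [measurable]: "k \<in> borel_measurable borel"
    and "\<And>t. \<bar>k t\<bar> \<le> C * weight t"
  shows "integrable lborel (\<lambda>t. of_real (k t) * f t)"
proof (rule Bochner_Integration.integrable_bound)
  show "integrable lborel (\<lambda>t. of_real C * (of_real (weight t) * f t))"
    using f by (intro integrable_mult_right) (auto simp: weighted_L1_def)
  show "(\<lambda>t. of_real (k t) * f t) \<in> borel_measurable lborel"
    using f by (auto simp: weighted_L1_def)
  show "AE t in lborel. norm (of_real (k t) * f t) \<le> norm (of_real C * (of_real (weight t) * f t))"
  proof (intro AE_I2)
    fix t
    have "\<bar>k t\<bar> \<le> \<bar>C\<bar> * weight t"
      using assms(3)[of t] by (meson abs_ge_self mult_right_mono order_trans weight_nonneg)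
    then have "\<bar>k t\<bar> * norm (f t) \<le> \<bar>C\<bar> * weight t * norm (f t)" by (intro mult_right_mono) auto
    then show "norm (of_real (k t) * f t) \<le> norm (of_real C * (of_real (weight t) * f t))"
      by (simp add: norm_mult mult.assoc)
  qed
qed

lemma integrable_pot:
  assumes "weighted_L1 f" "0 < z" "m + 3/2 \<le> 2 * r"
  shows "integrable lborel (\<lambda>t. of_real (ker p m r z (x - t)) * f t)"
proof -
  obtain C where C: "\<And>z' x' t. \<lbrakk>z \<le> z'; z' \<le> z; \<bar>x'\<bar> \<le> \<bar>x\<bar>\<rbrakk> \<Longrightarrow> \<bar>ker p m r z' (x' - t)\<bar> \<le> C * weight t"
    using ker_bound_weight_uniform[OF assms(2,3), of z "\<bar>x\<bar>" p] by metis
  show ?thesis by (rule integrable_weighted_bound[OF assms(1), where C = C]) (auto intro: C)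
qed

definition ker_dx where
  "ker_dx p m r z h = m * ker p (m - 1) r z h - 2 * r * ker p (m + 1) (r + 1) z h"

definition ker_dz where
  "ker_dz p m r z h = p * ker (p - 1) m r z h - r * ker (p + 3) m (r + 1) z h"

lemma ker_has_derivative:
  assumes "0 < snd q"
  shows "((\<lambda>q. ker p m r (snd q) (fst q - t)) has_derivative
    (\<lambda>v. fst v * ker_dx p m r (snd q) (fst q - t) + snd v * ker_dz p m r (snd q) (fst q - t))) (at q)"
proof -
  let ?S = "\<lambda>q. (fst q - t)\<^sup>2 + snd q ^ 4 / 4"
  have S: "0 < ?S q" using square_plus_pos assms by auto
  have e: "?S q powr (- (r + 1)) = ?S q powr (- r - 1)" by (rule arg_cong[where f = "\<lambda>a. ?S q powr a"]) simp
  have p1: "((\<lambda>q. ?S q powr (- r)) has_derivative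
      (\<lambda>v. (- r) * ?S q powr (- r - 1) * (2 * (fst q - t) * fst v + snd q ^ 3 * snd v))) (at q)"
    using S by (auto intro!: derivative_eq_intros simp: fun_eq_iff powr_diff field_simps)
  show ?thesis unfolding ker_def[abs_def] ker_dx_def ker_dz_def e
    by (rule has_derivative_eq_rhs[OF has_derivative_mult[OF has_derivative_mult[OF has_derivative_power[OF has_derivative_snd[OF has_derivative_ident]] has_derivative_power[OF has_derivative_diff[OF has_derivative_fst[OF has_derivative_ident] has_derivative_const]]] p1]])
      (auto simp: fun_eq_iff ker_def e algebra_simps power_add power3_eq_cube diff_diff_eq)
qed

lemma pot_has_derivative:
  assumes f: "weighted_L1 f" and z: "0 < snd q" and m: "m + 3/2 \<le> 2 * r"
  shows "(pot p m r f has_derivative (\<lambda>v.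
    of_real (fst v) * (of_nat m * pot p (m - 1) r f q - of_real (2 * r) * pot p (m + 1) (r + 1) f q) +
    of_real (snd v) * (of_nat p * pot (p - 1) m r f q - of_real r * pot (p + 3) m (r + 1) f q))) (at q)"
proof -
  have m': "m - 1 + 3/2 \<le> 2 * r" "real (m + 1) + 3/2 \<le> 2 * (r + 1)" "m + 3/2 \<le> 2 * (r + 1)"
    "real (m - 1) + 3/2 \<le> 2 * r"
    using m by auto
  define za zb R where "za = snd q / 2" and "zb = 2 * snd q" and "R = \<bar>fst q\<bar> + 1"
  define U where "U = {- R<..<R} \<times> {za<..<zb}"
  have za: "0 < za" using z by (simp add: za_def)
  obtain C1 where C1: "0 \<le> C1"
    "\<And>z x t. \<lbrakk>za \<le> z; z \<le> zb; \<bar>x\<bar> \<le> R\<rbrakk> \<Longrightarrow> \<bar>ker p (m - 1) r z (x - t)\<bar> \<le> C1 * weight t"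
    using ker_bound_weight_uniform[OF za m'(4), where zb = zb and R = R and p = p] by metis
  obtain C2 where C2: "0 \<le> C2"
    "\<And>z x t. \<lbrakk>za \<le> z; z \<le> zb; \<bar>x\<bar> \<le> R\<rbrakk> \<Longrightarrow> \<bar>ker p (m + 1) (r + 1) z (x - t)\<bar> \<le> C2 * weight t"
    using ker_bound_weight_uniform[OF za m'(2), where zb = zb and R = R and p = p] by metis
  obtain C3 where C3: "0 \<le> C3"
    "\<And>z x t. \<lbrakk>za \<le> z; z \<le> zb; \<bar>x\<bar> \<le> R\<rbrakk> \<Longrightarrow> \<bar>ker (p - 1) m r z (x - t)\<bar> \<le> C3 * weight t"
    using ker_bound_weight_uniform[OF za m, where zb = zb and R = R and p = "p - 1"] by metis
  obtain C4 where C4: "0 \<le> C4"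
    "\<And>z x t. \<lbrakk>za \<le> z; z \<le> zb; \<bar>x\<bar> \<le> R\<rbrakk> \<Longrightarrow> \<bar>ker (p + 3) m (r + 1) z (x - t)\<bar> \<le> C4 * weight t"
    using ker_bound_weight_uniform[OF za m'(3), where zb = zb and R = R and p = "p + 3"] by metis
  define C where "C = m * C1 + \<bar>2 * r\<bar> * C2 + p * C3 + \<bar>r\<bar> * C4"
  define D where "D q' t v = of_real (fst v * ker_dx p m r (snd q') (fst q' - t) +
     snd v * ker_dz p m r (snd q') (fst q' - t)) * f t" for q' :: "real \<times> real" and t v
  have U: "open U" "convex U" "q \<in> U" "\<And>q'. q' \<in> U \<Longrightarrow> 0 < snd q'"
    using z by (auto simp: U_def za_def zb_def R_def mem_Times_iff intro!: open_Times convex_Times)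
  have bound: "\<bar>fst v * ker_dx p m r (snd q') (fst q' - t) + snd v * ker_dz p m r (snd q') (fst q' - t)\<bar>
      \<le> C * weight t * norm v" if "q' \<in> U" for q' t v
  proof -
    have q': "za \<le> snd q'" "snd q' \<le> zb" "\<bar>fst q'\<bar> \<le> R" using that by (auto simp: U_def mem_Times_iff)
    note b = C1(2)[OF q', of t] C2(2)[OF q', of t] C3(2)[OF q', of t] C4(2)[OF q', of t]
    have "\<bar>ker_dx p m r (snd q') (fst q' - t)\<bar> \<le> m * \<bar>ker p (m - 1) r (snd q') (fst q' - t)\<bar> +
       \<bar>2 * r\<bar> * \<bar>ker p (m + 1) (r + 1) (snd q') (fst q' - t)\<bar>"
      unfolding ker_dx_def by (rule order_trans[OF abs_triangle_ineq4]) (simp add: abs_mult)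
    also have "\<dots> \<le> m * (C1 * weight t) + \<bar>2 * r\<bar> * (C2 * weight t)"
      by (intro add_mono mult_left_mono b) auto
    finally have 1: "\<bar>ker_dx p m r (snd q') (fst q' - t)\<bar> \<le> m * (C1 * weight t) + \<bar>2 * r\<bar> * (C2 * weight t)" .
    have "\<bar>ker_dz p m r (snd q') (fst q' - t)\<bar> \<le> p * \<bar>ker (p - 1) m r (snd q') (fst q' - t)\<bar> +
       \<bar>r\<bar> * \<bar>ker (p + 3) m (r + 1) (snd q') (fst q' - t)\<bar>"
      unfolding ker_dz_def by (rule order_trans[OF abs_triangle_ineq4]) (simp add: abs_mult)
    also have "\<dots> \<le> p * (C3 * weight t) + \<bar>r\<bar> * (C4 * weight t)"
      by (intro add_mono mult_left_mono b) auto
    finally have 2: "\<bar>ker_dz p m r (snd q') (fst q' - t)\<bar> \<le> p * (C3 * weight t) + \<bar>r\<bar> * (C4 * weight t)" .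
    have "\<bar>fst v * ker_dx p m r (snd q') (fst q' - t) + snd v * ker_dz p m r (snd q') (fst q' - t)\<bar>
       \<le> \<bar>fst v\<bar> * \<bar>ker_dx p m r (snd q') (fst q' - t)\<bar> + \<bar>snd v\<bar> * \<bar>ker_dz p m r (snd q') (fst q' - t)\<bar>"
      by (rule order_trans[OF abs_triangle_ineq]) (simp add: abs_mult)
    also have "\<dots> \<le> norm v * (m * (C1 * weight t) + \<bar>2 * r\<bar> * (C2 * weight t)) +
       norm v * (p * (C3 * weight t) + \<bar>r\<bar> * (C4 * weight t))"
      using 1 2 norm_fst_le[of "fst v" "snd v"] norm_snd_le[of "snd v" "fst v"] C1 C2 C3 C4
      by (intro add_mono mult_mono) (auto intro!: add_nonneg_nonneg mult_nonneg_nonneg)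
    finally show ?thesis by (simp add: C_def algebra_simps)
  qed
  have Dm: "integrable lborel (\<lambda>t. D q' t v)" if "q' \<in> U" for q' v
    unfolding D_def ker_dx_def ker_dz_def
    by (rule integrable_weighted_bound[OF f, where C = "C * norm v"])
      (use bound[OF that, of v, unfolded ker_dx_def ker_dz_def] in \<open>auto simp: mult.commute mult.left_commute\<close>)
  have "((\<lambda>q. LINT t|lborel. of_real (ker p m r (snd q) (fst q - t)) * f t) has_derivative
     (\<lambda>v. LINT t|lborel. D q t v)) (at q)"
  proof (rule has_derivative_lebesgue_integral[OF U(1-3), where g = "\<lambda>t. C * (weight t * norm (f t))"])
    show "integrable lborel (\<lambda>t. of_real (ker p m r (snd q') (fst q' - t)) * f t)" if "q' \<in> U" for q'
      using integrable_pot[OF f U(4)[OF that] m] .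
    show "((\<lambda>q. of_real (ker p m r (snd q) (fst q - t)) * f t) has_derivative D q' t) (at q')" if "q' \<in> U" for q' t
      unfolding D_def using ker_has_derivative[OF U(4)[OF that], of p m r t]
      by (intro has_derivative_mult_left has_derivative_of_real)
    show "norm (D q' t v) \<le> C * (weight t * norm (f t)) * norm v" if "q' \<in> U" for q' t v
    proof -
      have "norm (D q' t v) \<le> (C * weight t * norm v) * norm (f t)"
        unfolding D_def norm_mult norm_of_real by (intro mult_right_mono bound[OF that]) auto
      then show ?thesis by (simp add: mult.commute mult.left_commute)
    qed
    have "integrable lborel (\<lambda>t. norm (of_real (weight t) * f t))"
      using f by (auto simp: weighted_L1_def)
    then show "integrable lborel (\<lambda>t. C * (weight t * norm (f t)))"
      by (simp add: norm_mult)
    show "integrable lborel (\<lambda>t. D q t v)" for v using Dm[OF U(3)] .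
  qed
  moreover have "(LINT t|lborel. D q t v) = of_real (fst v) * (of_nat m * pot p (m - 1) r f q - of_real (2 * r) * pot p (m + 1) (r + 1) f q) +
    of_real (snd v) * (of_nat p * pot (p - 1) m r f q - of_real r * pot (p + 3) m (r + 1) f q)" for v
  proof -
    note i = integrable_pot[OF f z m'(4), of p] integrable_pot[OF f z m'(2), of p] 
      integrable_pot[OF f z m, of "p-1"] integrable_pot[OF f z m'(3), of "p+3"]
    have "D q t v = of_real (fst v) * (of_nat m * (of_real (ker p (m - 1) r (snd q) (fst q - t)) * f t)
       - of_real (2 * r) * (of_real (ker p (m + 1) (r + 1) (snd q) (fst q - t)) * f t)) +
       of_real (snd v) * (of_nat p * (of_real (ker (p - 1) m r (snd q) (fst q - t)) * f t)
       - of_real r * (of_real (ker (p + 3) m (r + 1) (snd q) (fst q - t)) * f t))" for t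
      by (simp add: D_def ker_dx_def ker_dz_def algebra_simps)
    then show ?thesis using i unfolding pot_def
      by (simp add: Bochner_Integration.integral_diff Bochner_Integration.integral_add del: of_real_mult)
  qed
  ultimately show ?thesis unfolding pot_def[abs_def] by simp
qed


lemma Dfst_eq: "(F has_derivative F') (at p) \<Longrightarrow> Dfst F p = F' (1, 0)"
  and Dsnd_eq: "(F has_derivative F') (at p) \<Longrightarrow> Dsnd F p = F' (0, 1)"
proof -
  assume F: "(F has_derivative F') (at p)"
  interpret bounded_linear F' using F by (rule has_derivative_bounded_linear)
  have "((\<lambda>t. F (t, snd p)) has_derivative (\<lambda>s. F' (s, 0))) (at (fst p))"
    using F by (intro has_derivative_compose[of "\<lambda>t. (t, snd p)" "\<lambda>s. (s, 0)" _ _ F F'])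
      (auto intro!: derivative_eq_intros)
  moreover have "(\<lambda>s. F' (s, 0)) = (\<lambda>s. s *\<^sub>R F' (1, 0))"
  proof
    fix s
    have "(s, 0::real) = s *\<^sub>R (1, 0)" by simp
    then show "F' (s, 0) = s *\<^sub>R F' (1, 0)" using scaleR[of s "(1, 0)"] by (simp only:)
  qed
  ultimately have "((\<lambda>t. F (t, snd p)) has_vector_derivative F' (1, 0)) (at (fst p))"
    unfolding has_vector_derivative_def by simp
  then show "Dfst F p = F' (1, 0)" unfolding Dfst_def by (rule vector_derivative_at)
  have "((\<lambda>t. F (fst p, t)) has_derivative (\<lambda>s. F' (0, s))) (at (snd p))"
    using F by (intro has_derivative_compose[of "\<lambda>t. (fst p, t)" "\<lambda>s. (0, s)" _ _ F F'])
      (auto intro!: derivative_eq_intros)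
  moreover have "(\<lambda>s. F' (0, s)) = (\<lambda>s. s *\<^sub>R F' (0, 1))"
  proof
    fix s
    have "(0::real, s) = s *\<^sub>R (0, 1)" by simp
    then show "F' (0, s) = s *\<^sub>R F' (0, 1)" using scaleR[of s "(0, 1)"] by (simp only:)
  qed
  ultimately have "((\<lambda>t. F (fst p, t)) has_vector_derivative F' (0, 1)) (at (snd p))"
    unfolding has_vector_derivative_def by simp
  then show "Dsnd F p = F' (0, 1)" unfolding Dsnd_def by (rule vector_derivative_at)
qed

lemma open_half_plane: "open half_plane"
  unfolding half_plane_def by (intro open_Collect_less continuous_intros)

lemma half_plane_sets [measurable]: "half_plane \<in> sets borel"
  using open_half_plane by simp

lemma half_plane_iff [simp]: "p \<in> half_plane \<longleftrightarrow> 0 < snd p"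
  by (simp add: half_plane_def)

definition ext_const :: real where "ext_const = c_star / sqrt 2"

definition W_fun where "W_fun f q = of_real ext_const * pot 1 0 (3/4) f q"
definition W_x where "W_x f q = of_real ext_const * (- (3/2) * pot 1 1 (7/4) f q)"
definition W_z where "W_z f q = of_real ext_const * (pot 0 0 (3/4) f q - 3/4 * pot 4 0 (7/4) f q)"
definition W_xx where "W_xx f q = of_real ext_const * (- (3/2) * pot 1 0 (7/4) f q + 21/4 * pot 1 2 (11/4) f q)"
definition W_xz where "W_xz f q = of_real ext_const * (- (3/2) * pot 0 1 (7/4) f q + 21/8 * pot 4 1 (11/4) f q)"
definition W_zz where "W_zz f q = of_real ext_const * (- (15/4) * pot 3 0 (7/4) f q + 21/16 * pot 7 0 (11/4) f q)"

lemma powr_quarter_power4: "0 < z \<Longrightarrow> ((z\<^sup>2 / 2)\<^sup>2 :: real) = z ^ 4 / 4"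
  by (simp add: power2_eq_square power4_eq_xxxx)

lemma poisson_kernel_eq_ker:
  assumes "0 < z" shows "poisson_kernel (z\<^sup>2 / 2) h = ext_const * ker 1 0 (3/4) z h"
proof -
  have "(z\<^sup>2 / 2) powr (1/2) = z / sqrt 2"
    using assms by (simp add: powr_half_sqrt real_sqrt_divide)
  then show ?thesis
    unfolding poisson_kernel_def ker_def ext_const_def powr_quarter_power4[OF assms] by simp
qed

lemma poisson_kernel_measurable [measurable]: "poisson_kernel y \<in> borel_measurable borel"
  unfolding poisson_kernel_def[abs_def] by measurable

lemma lift_cs_ext:
  assumes [measurable]: "f \<in> borel_measurable borel" and "0 < snd q"
  shows "lift (cs_ext f) q = W_fun f q"
proof -
  have "lift (cs_ext f) q = (LINT h|lborel. of_real (poisson_kernel ((snd q)\<^sup>2/2) h) * f (fst q - h))"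
    unfolding lift_def cs_ext_def by (simp add: integral_completion)
  also have "\<dots> = (LINT h|lborel. (\<lambda>t. of_real (poisson_kernel ((snd q)\<^sup>2/2) (fst q - t)) * f t) (fst q - h))"
    by simp
  also have "\<dots> = (LINT t|lborel. of_real (poisson_kernel ((snd q)\<^sup>2/2) (fst q - t)) * f t)"
    by (rule integral_reflect_shift)
  also have "\<dots> = W_fun f q"
    unfolding W_fun_def pot_def using assms(2)
    by (simp add: poisson_kernel_eq_ker mult.assoc)
  finally show ?thesis .
qed

lemma pot_Suc_decomp:
  assumes "weighted_L1 f" "0 < snd q" "m + 3/2 \<le> 2 * r"
  shows "pot p m r f q = pot p (m + 2) (r + 1) f q + pot (p + 4) m (r + 1) f q / 4"
proof -
  have i: "integrable lborel (\<lambda>t. of_real (ker p (m+2) (r+1) (snd q) (fst q - t)) * f t)"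
    "integrable lborel (\<lambda>t. of_real (ker (p+4) m (r+1) (snd q) (fst q - t)) * f t)"
    using assms by (auto intro!: integrable_pot)
  have "ker p m r (snd q) h = ker p (m+2) (r+1) (snd q) h + ker (p+4) m (r+1) (snd q) h / 4" for h
  proof -
    let ?S = "h\<^sup>2 + snd q ^ 4 / 4"
    have "?S powr (- r) = ?S powr (- (r + 1) + 1)" by simp
    also have "\<dots> = ?S powr (- (r + 1)) * ?S"
      using square_plus_pos[OF assms(2), of h] by (subst powr_add) simp
    finally have "?S powr (- r) = ?S powr (- (r + 1)) * ?S" .
    then show ?thesis by (simp add: ker_def algebra_simps power_add power2_eq_square)
  qed
  then show ?thesis using i unfolding pot_def
    by (simp add: Bochner_Integration.integral_add add_divide_distrib distrib_right del: of_real_mult)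
qed

context
  fixes f :: "real \<Rightarrow> complex" and q :: "real \<times> real"
  assumes f: "weighted_L1 f" and q: "0 < snd q"
begin

lemma W_fun_has_derivative:
  "(W_fun f has_derivative (\<lambda>v. of_real (fst v) * W_x f q + of_real (snd v) * W_z f q)) (at q)"
  unfolding W_fun_def[abs_def] W_x_def W_z_def
  by (rule has_derivative_eq_rhs[OF has_derivative_mult_right[OF pot_has_derivative[OF f q]]])
    (auto simp: fun_eq_iff algebra_simps)

lemma W_x_has_derivative:
  "(W_x f has_derivative (\<lambda>v. of_real (fst v) * W_xx f q + of_real (snd v) * W_xz f q)) (at q)"
  unfolding W_x_def[abs_def] W_xx_def W_xz_def
  by (rule has_derivative_eq_rhs[OF has_derivative_mult_right[OF has_derivative_mult_right[OF pot_has_derivative[OF f q]]]])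
    (auto simp: fun_eq_iff algebra_simps numeral_eq_Suc)

lemma W_z_has_derivative:
  "(W_z f has_derivative (\<lambda>v. of_real (fst v) * W_xz f q + of_real (snd v) * W_zz f q)) (at q)"
  unfolding W_z_def[abs_def] W_xz_def W_zz_def
  by (rule has_derivative_eq_rhs[OF has_derivative_mult_right[OF has_derivative_diff[OF pot_has_derivative[OF f q] has_derivative_mult_right[OF pot_has_derivative[OF f q]]]]])
    (auto simp: fun_eq_iff algebra_simps numeral_eq_Suc)

lemma W_equation: "W_zz f q + of_real ((snd q)\<^sup>2) * W_xx f q = 0"
proof -
  have "of_real ((snd q)\<^sup>2) * pot 1 m r f q = pot 3 m r f q" for m r
    unfolding pot_def
    by (subst integral_mult_right_zero[symmetric])
      (auto simp: ker_def power3_eq_cube power2_eq_square mult.assoc)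
  moreover have "pot 3 0 (7/4) f q = pot 3 2 (11/4) f q + pot 7 0 (11/4) f q / 4"
    using pot_Suc_decomp[OF f q, of 0 "7/4" 3] by (simp add: numeral_eq_Suc)
  moreover have "w * (e * (- (3/2) * a + 21/4 * b)) = e * (- (3/2) * (w * a) + 21/4 * (w * b))" for w e a b :: complex
    by (simp add: algebra_simps)
  moreover have "e * (- (15/4) * (b + c / 4) + 21/16 * c) + e * (- (3/2) * (b + c / 4) + 21/4 * b) = 0" for e b c :: complex
    by (simp add: algebra_simps)
  ultimately show ?thesis
    unfolding W_zz_def W_xx_def by (simp only:)
qed

lemma lift_has_derivative:
  "(lift (cs_ext f) has_derivative (\<lambda>v. of_real (fst v) * W_x f q + of_real (snd v) * W_z f q)) (at q)"
proof (rule has_derivative_transform_within_open[OF W_fun_has_derivative open_half_plane])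
  show "q \<in> half_plane" using q by simp
  show "W_fun f p = lift (cs_ext f) p" if "p \<in> half_plane" for p
    using lift_cs_ext[of f p] that f by (auto simp: weighted_L1_def)
qed

lemma isCont_W:
  "isCont (W_fun f) q" "isCont (W_x f) q" "isCont (W_z f) q"
  "isCont (W_xx f) q" "isCont (W_xz f) q" "isCont (W_zz f) q"
proof -
  have p: "isCont (pot p m r f) q" if "m + 3/2 \<le> 2 * r" for p m r
    using pot_has_derivative[OF f q that] has_derivative_continuous by blast
  have g: "isCont (\<lambda>q. c * (a * F q + b * G q)) q" if "isCont F q" "isCont G q" for F G :: "real \<times> real \<Rightarrow> complex" and a b c
    using that by (intro continuous_intros)
  show "isCont (W_fun f) q" "isCont (W_x f) q" "isCont (W_z f) q"
    using W_fun_has_derivative W_x_has_derivative W_z_has_derivative has_derivative_continuous by blast+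
  have p1: "isCont (pot 1 0 (7/4) f) q" and p2: "isCont (pot 1 2 (11/4) f) q"
    and p3: "isCont (pot 0 1 (7/4) f) q" and p4: "isCont (pot 4 1 (11/4) f) q"
    and p5: "isCont (pot 3 0 (7/4) f) q" and p6: "isCont (pot 7 0 (11/4) f) q"
    by (rule p; simp)+
  show "isCont (W_xx f) q" "isCont (W_xz f) q" "isCont (W_zz f) q"
    using g[OF p1 p2] g[OF p3 p4] g[OF p5 p6]
    unfolding W_xx_def[abs_def] W_xz_def[abs_def] W_zz_def[abs_def] by blast+
qed

lemma Dfst_lift: "Dfst (lift (cs_ext f)) q = W_x f q"
  and Dsnd_lift: "Dsnd (lift (cs_ext f)) q = W_z f q"
  using Dfst_eq[OF lift_has_derivative] Dsnd_eq[OF lift_has_derivative] by simp_all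

end

lemma continuous_on_W:
  assumes "weighted_L1 f"
  shows "continuous_on half_plane (W_fun f)" "continuous_on half_plane (W_x f)" "continuous_on half_plane (W_z f)"
  "continuous_on half_plane (W_xx f)" "continuous_on half_plane (W_xz f)" "continuous_on half_plane (W_zz f)"
  using isCont_W[OF assms] by (auto intro!: continuous_at_imp_continuous_on)

lemma Dfst_cong_open: "\<lbrakk>open S; p \<in> S; \<And>q. q \<in> S \<Longrightarrow> F q = G q\<rbrakk> \<Longrightarrow> (G has_derivative G') (at p) \<Longrightarrow> 
   (F has_derivative G') (at p)"
  by (rule has_derivative_transform_within_open[of G G' p UNIV S F]) auto

lemma Ck_on_cong:
  assumes "open S" "\<And>p. p \<in> S \<Longrightarrow> F p = G p"
  shows "Ck_on k S F \<longleftrightarrow> Ck_on k S G"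
  using assms(2)
proof (induction k arbitrary: F G)
  case 0
  then show ?case by (auto cong: continuous_on_cong)
next
  case (Suc k)
  have d: "(F has_derivative D) (at p) \<longleftrightarrow> (G has_derivative D) (at p)" if "p \<in> S" for p D
    using Dfst_cong_open[OF assms(1) that, of F G] Dfst_cong_open[OF assms(1) that, of G F] Suc.prems by metis
  have e: "eventually (\<lambda>t. F (t, snd p) = G (t, snd p)) (nhds (fst p))"
    "eventually (\<lambda>t. F (fst p, t) = G (fst p, t)) (nhds (snd p))" if "p \<in> S" for p
  proof -
    have "open ((\<lambda>t. (t, snd p)) -` S)" "open ((\<lambda>t. (fst p, t)) -` S)"
      by (auto intro!: open_vimage assms(1) continuous_intros)
    then show "eventually (\<lambda>t. F (t, snd p) = G (t, snd p)) (nhds (fst p))"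
      "eventually (\<lambda>t. F (fst p, t) = G (fst p, t)) (nhds (snd p))"
      using that Suc.prems by (auto simp: eventually_nhds)
  qed
  have "Dfst F p = Dfst G p" "Dsnd F p = Dsnd G p" if "p \<in> S" for p
    unfolding Dfst_def Dsnd_def using e[OF that]
    by (auto intro!: vector_derivative_cong_eq)
  then have "Ck_on k S (Dfst F) = Ck_on k S (Dfst G)" "Ck_on k S (Dsnd F) = Ck_on k S (Dsnd G)"
    by (auto intro!: Suc.IH)
  then show ?case using d by (auto simp: differentiable_def)
qed

lemma lift_Ck2:
  assumes f: "weighted_L1 f"
  shows "Ck_on 2 half_plane (lift (cs_ext f))"
    and "p \<in> half_plane \<Longrightarrow> Dsnd (Dsnd (lift (cs_ext f))) p + of_real ((snd p)\<^sup>2) * Dfst (Dfst (lift (cs_ext f))) p = 0"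
proof -
  note fst_snd = Dfst_lift[OF f] Dsnd_lift[OF f]
  have dd: "(Dfst (lift (cs_ext f)) has_derivative (\<lambda>v. of_real (fst v) * W_xx f q + of_real (snd v) * W_xz f q)) (at q)"
    "(Dsnd (lift (cs_ext f)) has_derivative (\<lambda>v. of_real (fst v) * W_xz f q + of_real (snd v) * W_zz f q)) (at q)"
    if "q \<in> half_plane" for q
    by (rule Dfst_cong_open[OF open_half_plane that _ W_x_has_derivative[OF f]]
        Dfst_cong_open[OF open_half_plane that _ W_z_has_derivative[OF f]]; use that fst_snd in simp)+
  have d2: "Dfst (Dfst (lift (cs_ext f))) q = W_xx f q" "Dsnd (Dfst (lift (cs_ext f))) q = W_xz f q"
    "Dfst (Dsnd (lift (cs_ext f))) q = W_xz f q" "Dsnd (Dsnd (lift (cs_ext f))) q = W_zz f q" if "q \<in> half_plane" for q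
    using Dfst_eq[OF dd(1)[OF that]] Dfst_eq[OF dd(2)[OF that]] Dsnd_eq[OF dd(1)[OF that]] Dsnd_eq[OF dd(2)[OF that]]
    by simp_all
  have c: "continuous_on half_plane (Dfst (Dfst (lift (cs_ext f))))" "continuous_on half_plane (Dsnd (Dfst (lift (cs_ext f))))"
    "continuous_on half_plane (Dfst (Dsnd (lift (cs_ext f))))" "continuous_on half_plane (Dsnd (Dsnd (lift (cs_ext f))))"
    using continuous_on_W(4-6)[OF f] d2 by (metis (no_types, lifting) continuous_on_cong)+
  have df: "lift (cs_ext f) differentiable (at q)" if "q \<in> half_plane" for q
    using lift_has_derivative[OF f, of q] that by (auto intro: differentiableI)
  have df2: "Dfst (lift (cs_ext f)) differentiable (at q)" "Dsnd (lift (cs_ext f)) differentiable (at q)" if "q \<in> half_plane" for q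
    using dd that unfolding differentiable_def by blast+
  show "Ck_on 2 half_plane (lift (cs_ext f))"
    using df df2 c by (simp add: numeral_2_eq_2)
  show "Dsnd (Dsnd (lift (cs_ext f))) p + of_real ((snd p)\<^sup>2) * Dfst (Dfst (lift (cs_ext f))) p = 0" if "p \<in> half_plane"
    using W_equation[OF f, of p] d2[OF that] that by simp
qed

lemma cs_ext_has_derivative:
  assumes f: "weighted_L1 f" and p: "0 < snd p"
  defines "q \<equiv> (fst p, sqrt (2 * snd p))"
  shows "(cs_ext f has_derivative (\<lambda>v. of_real (fst v) * W_x f q + of_real (snd v) * (W_z f q / of_real (sqrt (2 * snd p))))) (at p)"
proof -
  have q: "0 < snd q" using p by (simp add: q_def)
  have "((\<lambda>p. (fst p, sqrt (2 * snd p))) has_derivative (\<lambda>v. (fst v, snd v / sqrt (2 * snd p)))) (at p)"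
    using p by (auto intro!: derivative_eq_intros simp: fun_eq_iff real_sqrt_mult field_simps)
  from has_derivative_compose[OF this lift_has_derivative[OF f q[unfolded q_def]]]
  have "((\<lambda>p. lift (cs_ext f) (fst p, sqrt (2 * snd p))) has_derivative
    (\<lambda>v. of_real (fst v) * W_x f q + of_real (snd v / sqrt (2 * snd p)) * W_z f q)) (at p)"
    by (simp add: q_def)
  then have "((\<lambda>p. lift (cs_ext f) (fst p, sqrt (2 * snd p))) has_derivative
    (\<lambda>v. of_real (fst v) * W_x f q + of_real (snd v) * (W_z f q / of_real (sqrt (2 * snd p))))) (at p)"
    by simp
  then show ?thesis
  proof (rule has_derivative_transform_within_open[OF _ open_half_plane])
    show "p \<in> half_plane" using p by simp
    show "lift (cs_ext f) (fst r, sqrt (2 * snd r)) = cs_ext f r" if "r \<in> half_plane" for r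
      using that by (simp add: lift_def)
  qed
qed

lemma Dfst_cs_ext: "weighted_L1 f \<Longrightarrow> 0 < y \<Longrightarrow> Dfst (cs_ext f) (x, y) = W_x f (x, sqrt (2 * y))"
  and Dsnd_cs_ext: "weighted_L1 f \<Longrightarrow> 0 < y \<Longrightarrow> Dsnd (cs_ext f) (x, y) = W_z f (x, sqrt (2 * y)) / of_real (sqrt (2 * y))"
  using Dfst_eq[OF cs_ext_has_derivative[of f "(x,y)"]] Dsnd_eq[OF cs_ext_has_derivative[of f "(x,y)"]] by simp_all

lemma exists_borel_version:
  fixes f :: "real \<Rightarrow> complex"
  assumes f: "f \<in> borel_measurable lebesgue"
  obtains g where "g \<in> borel_measurable borel" "AE x in lebesgue. f x = g x"
proof -
  have "(\<lambda>x. Re (f x)) \<in> borel_measurable lebesgue" "(\<lambda>x. Im (f x)) \<in> borel_measurable lebesgue"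
    using f by measurable
  then obtain a b where "a \<in> borel_measurable lborel" "AE x in lborel. Re (f x) = a x"
    "b \<in> borel_measurable lborel" "AE x in lborel. Im (f x) = b x"
    using completion_ex_borel_measurable_real by metis
  then have "(\<lambda>x. of_real (a x) + \<i> * of_real (b x)) \<in> borel_measurable borel"
    "AE x in lborel. f x = of_real (a x) + \<i> * of_real (b x)"
    by (auto simp: complex_eq_iff)
  then show ?thesis using that AE_completion by blast
qed

lemma AE_lebesgue_reflect_shift:
  fixes P :: "real \<Rightarrow> bool"
  assumes "AE t in lebesgue. P t"
  shows "AE h in lebesgue. P (x - h)"
proof -
  have "AE t in lborel. P t" using assms by (simp add: AE_completion_iff)
  then obtain N where N: "{t \<in> space lborel. \<not> P t} \<subseteq> N" "emeasure lborel N = 0" "N \<in> sets lborel"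
    by (rule AE_E)
  have [measurable]: "N \<in> sets borel" using N(3) by simp
  have "(\<integral>\<^sup>+h. indicator N (x - h) \<partial>lborel) = (\<integral>\<^sup>+h. indicator N h \<partial>lborel)"
    using nn_integral_real_affine[of "indicator N" "-1" x] by simp
  also have "\<dots> = 0" using N by simp
  finally have "AE h in lborel. indicator N (x - h) = (0::ennreal)"
    by (subst (asm) nn_integral_0_iff_AE) auto
  then have "AE h in lborel. P (x - h)"
    using N(1) by (auto elim!: eventually_mono simp: indicator_def split: if_splits)
  then show ?thesis by (rule AE_completion)
qed


definition translation_modulus :: "(real \<Rightarrow> complex) \<Rightarrow> real \<Rightarrow> real" where
  "translation_modulus g h = (LINT x|lborel. norm (g (x - h) - g x))"

lemma integrable_translation_diff:
  fixes g :: "real \<Rightarrow> complex"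
  assumes "integrable lborel g"
  shows "integrable lborel (\<lambda>x. g (x - h) - g x)"
  using assms integrable_shift[OF assms] by (intro Bochner_Integration.integrable_diff)

lemma translation_modulus_triangle:
  assumes "integrable lborel f" "integrable lborel g"
  shows "translation_modulus f h \<le> translation_modulus g h + 2 * (LINT x|lborel. norm (f x - g x))"
proof -
  have i: "integrable lborel (\<lambda>x. norm (f x - g x))" using assms by auto
  have "translation_modulus f h \<le> (LINT x|lborel. norm (g (x - h) - g x) + norm (f (x - h) - g (x - h)) + norm (f x - g x))"
    unfolding translation_modulus_def
  proof (intro integral_mono)
    show "norm (f (x - h) - f x) \<le> norm (g (x - h) - g x) + norm (f (x - h) - g (x - h)) + norm (f x - g x)" for x
    proof -
      have "f (x - h) - f x = (g (x - h) - g x) + (f (x - h) - g (x - h)) - (f x - g x)" by simp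
      then show ?thesis by (metis norm_triangle_ineq norm_triangle_ineq4 add_right_mono order_trans)
    qed
  qed (use assms i integrable_translation_diff integrable_shift[OF i, of h] in auto)
  also have "\<dots> = translation_modulus g h + (LINT x|lborel. norm (f (x - h) - g (x - h))) + (LINT x|lborel. norm (f x - g x))"
    unfolding translation_modulus_def
    using assms i integrable_translation_diff integrable_shift[OF i, of h] by simp
  also have "(LINT x|lborel. norm (f (x - h) - g (x - h))) = (LINT x|lborel. norm (f x - g x))"
    using integral_shift[of "\<lambda>x. norm (f x - g x)" h] by simp
  finally show ?thesis by simp
qed

lemma translation_modulus_indicator_open:
  assumes U: "open U" "emeasure lborel U < \<infinity>"
  shows "((\<lambda>h. translation_modulus (\<lambda>x. indicator U x *\<^sub>R 1) h) \<longlongrightarrow> 0) (at 0)"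
  unfolding tendsto_at_iff_sequentially
proof (intro allI impI)
  fix X :: "nat \<Rightarrow> real" assume X: "\<forall>i. X i \<in> UNIV - {0}" "X \<longlonglongrightarrow> 0"
  have [measurable]: "U \<in> sets borel" using U by simp
  have i: "integrable lborel (indicator U :: real \<Rightarrow> real)" using U by simp
  have i2: "integrable lborel (\<lambda>x. indicator U x * indicator U (x - h) :: real)" for h
    by (rule Bochner_Integration.integrable_bound[OF i]) (auto simp: indicator_def)
  have "(\<lambda>n. LINT x|lborel. indicator U x * indicator U (x - X n) :: real) \<longlonglongrightarrow> (LINT x|lborel. indicator U x)"
  proof (rule integral_dominated_convergence[where w = "indicator U"])
    show "AE x in lborel. (\<lambda>n. indicator U x * indicator U (x - X n) :: real) \<longlonglongrightarrow> indicator U x"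
    proof (intro AE_I2)
      fix x
      show "(\<lambda>n. indicator U x * indicator U (x - X n) :: real) \<longlonglongrightarrow> indicator U x"
      proof (cases "x \<in> U")
        case True
        have "(\<lambda>n. x - X n) \<longlonglongrightarrow> x" using tendsto_diff[OF tendsto_const X(2), of x] by simp
        then have "eventually (\<lambda>n. x - X n \<in> U) sequentially" by (rule topological_tendstoD[OF _ U(1) True])
        then show ?thesis using True by (intro tendsto_eventually) (auto elim: eventually_mono)
      qed auto
    qed
  qed (use i in \<open>auto simp: indicator_def\<close>)
  then have "(\<lambda>n. 2 * (LINT x|lborel. indicator U x) - 2 * (LINT x|lborel. indicator U x * indicator U (x - X n) :: real)) \<longlonglongrightarrow>
     2 * (LINT x|lborel. indicator U x) - 2 * (LINT x|lborel. indicator U x)"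
    by (intro tendsto_intros)
  moreover have "translation_modulus (\<lambda>x. indicator U x *\<^sub>R 1) h =
      2 * (LINT x|lborel. indicator U x) - 2 * (LINT x|lborel. indicator U x * indicator U (x - h) :: real)" for h
  proof -
    have "translation_modulus (\<lambda>x. indicator U x *\<^sub>R 1) h =
      (LINT x|lborel. indicator U (x - h) + indicator U x - 2 * (indicator U x * indicator U (x - h)) :: real)"
      unfolding translation_modulus_def by (intro Bochner_Integration.integral_cong) (auto simp: indicator_def)
    also have "\<dots> = (LINT x|lborel. indicator U (x - h)) + (LINT x|lborel. indicator U x) - 2 * (LINT x|lborel. indicator U x * indicator U (x - h) :: real)"
      using i integrable_shift[OF i, of h] i2[of h] by simp
    also have "(LINT x|lborel. indicator U (x - h)) = (LINT x|lborel. indicator U x :: real)"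
      using integral_shift[of "indicator U :: real \<Rightarrow> real" h] by simp
    finally show ?thesis by simp
  qed
  ultimately show "((\<lambda>h. translation_modulus (\<lambda>x. indicator U x *\<^sub>R 1) h) \<circ> X) \<longlonglongrightarrow> 0"
    by (simp add: o_def)
qed

lemma translation_modulus_nonneg: "0 \<le> translation_modulus f h"
  unfolding translation_modulus_def by simp

lemma tendsto_translation_modulus_approx:
  assumes f: "integrable lborel f"
    and "\<And>e. 0 < e \<Longrightarrow> \<exists>g. integrable lborel g \<and> (translation_modulus g \<longlongrightarrow> 0) (at 0) \<and>
        (LINT x|lborel. norm (f x - g x)) < e"
  shows "(translation_modulus f \<longlongrightarrow> 0) (at 0)"
proof (rule tendstoI)
  fix e :: real assume "0 < e"
  then obtain g where g: "integrable lborel g" "(translation_modulus g \<longlongrightarrow> 0) (at 0)" "(LINT x|lborel. norm (f x - g x)) < e / 4"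
    using assms(2)[of "e/4"] by auto
  have "eventually (\<lambda>h. dist (translation_modulus g h) 0 < e / 2) (at 0)"
    using \<open>0 < e\<close> by (intro tendstoD[OF g(2)]) auto
  then show "eventually (\<lambda>h. dist (translation_modulus f h) 0 < e) (at 0)"
  proof eventually_elim
    case (elim h)
    then show ?case
      using translation_modulus_triangle[OF f g(1), of h] g(3) translation_modulus_nonneg[of f h] translation_modulus_nonneg[of g h]
      by (simp add: dist_real_def)
  qed
qed

lemma translation_modulus_cmult:
  "translation_modulus (\<lambda>x. f x * c) h = translation_modulus f h * norm c"
  unfolding translation_modulus_def by (simp add: norm_mult flip: left_diff_distrib)

lemma tendsto_translation_modulus:
  assumes "integrable lborel f"
  shows "(translation_modulus f \<longlongrightarrow> 0) (at 0)"
  using assms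
proof (induction rule: integrable_induct)
  case (base A c)
  have [measurable]: "A \<in> sets borel" using base by simp
  have "(translation_modulus (\<lambda>x. indicator A x *\<^sub>R 1) \<longlongrightarrow> 0) (at 0)"
  proof (rule tendsto_translation_modulus_approx)
    show "integrable lborel (\<lambda>x. indicator A x *\<^sub>R (1::complex))"
      using base by simp
    fix e :: real assume e: "0 < e"
    obtain U where U: "open U" "A \<subseteq> U" "emeasure lborel (U - A) < e"
      using outer_regular_lborel[of A e] e by auto
    have [measurable]: "U \<in> sets borel" using U by simp
    have "emeasure lborel U = emeasure lborel A + emeasure lborel (U - A)"
      using U(2) by (subst plus_emeasure) (auto simp: Un_absorb1)
    also have "\<dots> < \<infinity>"
      using base U(3) less_trans[OF U(3) ennreal_less_top] by simp
    finally have fin: "emeasure lborel U < \<infinity>" .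
    have "(LINT x|lborel. norm (indicator A x *\<^sub>R 1 - indicator U x *\<^sub>R (1::complex))) = (LINT x|lborel. indicator (U - A) x)"
      using U(2) by (intro Bochner_Integration.integral_cong) (auto simp: indicator_def)
    also have "\<dots> = measure lborel (U - A)" by simp
    also have "\<dots> < e" using U(3) e by (cases "emeasure lborel (U - A)") (auto simp: measure_def ennreal_less_iff)
    finally have "(LINT x|lborel. norm (indicator A x *\<^sub>R 1 - indicator U x *\<^sub>R (1::complex))) < e" .
    then show "\<exists>g. integrable lborel g \<and> (translation_modulus g \<longlongrightarrow> 0) (at 0) \<and>
        (LINT x|lborel. norm (indicator A x *\<^sub>R 1 - g x)) < e"
      using translation_modulus_indicator_open[OF U(1) fin] fin
      by (intro exI[of _ "\<lambda>x. indicator U x *\<^sub>R (1::complex)"]) (auto simp: eta_contract_eq)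
  qed
  then have "((\<lambda>h. translation_modulus (\<lambda>x. indicator A x *\<^sub>R 1) h * norm c) \<longlongrightarrow> 0 * norm c) (at 0)"
    by (intro tendsto_intros)
  moreover have "translation_modulus (\<lambda>x. indicator A x *\<^sub>R c) h = translation_modulus (\<lambda>x. indicator A x *\<^sub>R 1) h * norm c" for h
    using translation_modulus_cmult[of "\<lambda>x. indicator A x *\<^sub>R 1" c h] by simp
  ultimately show ?case by simp
next
  case (add f g)
  have le: "translation_modulus (\<lambda>x. f x + g x) h \<le> translation_modulus f h + translation_modulus g h" for h
  proof -
    have "translation_modulus (\<lambda>x. f x + g x) h \<le> (LINT x|lborel. norm (f (x - h) - f x) + norm (g (x - h) - g x))"
      unfolding translation_modulus_def
    proof (intro integral_mono)
      show "norm (f (x - h) + g (x - h) - (f x + g x)) \<le> norm (f (x - h) - f x) + norm (g (x - h) - g x)" for x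
        by (metis add_diff_add norm_triangle_ineq)
      show "integrable lborel (\<lambda>x. norm (f (x - h) + g (x - h) - (f x + g x)))"
        using integrable_translation_diff[of "\<lambda>x. f x + g x" h] add by auto
    qed (use add integrable_translation_diff in auto)
    also have "\<dots> = translation_modulus f h + translation_modulus g h"
      unfolding translation_modulus_def using add integrable_translation_diff by simp
    finally show ?thesis .
  qed
  have "((\<lambda>h. translation_modulus f h + translation_modulus g h) \<longlongrightarrow> 0) (at 0)"
    using tendsto_add[OF add.IH] by simp
  then show ?case
    by (rule tendsto_sandwich[OF _ _ tendsto_const, rotated 2]) (auto simp: translation_modulus_nonneg le)
next
  case (lim f s)
  have s: "integrable lborel (s i)" "(translation_modulus (s i) \<longlongrightarrow> 0) (at 0)" "(\<lambda>i. s i x) \<longlonglongrightarrow> f x"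
    "norm (s i x) \<le> 2 * norm (f x)" and fi: "integrable lborel f" for i x
    using lim by auto
  show ?case
  proof (rule tendsto_translation_modulus_approx[OF fi])
    fix e :: real assume "0 < e"
    have "(\<lambda>i. LINT x|lborel. norm (f x - s i x)) \<longlonglongrightarrow> (LINT (x::real)|lborel. 0)"
    proof (rule integral_dominated_convergence[where w = "\<lambda>x. 3 * norm (f x)"])
      show "AE x in lborel. (\<lambda>i. norm (f x - s i x)) \<longlonglongrightarrow> 0"
        using s(3) by (auto intro!: AE_I2 tendsto_eq_intros)
      show "AE x in lborel. norm (norm (f x - s i x)) \<le> 3 * norm (f x)" for i
      proof (intro AE_I2)
        fix x show "norm (norm (f x - s i x)) \<le> 3 * norm (f x)"
          using s(4)[of i x] norm_triangle_ineq4[of "f x" "s i x"] by simp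
      qed
    qed (use s fi in auto)
    then have "eventually (\<lambda>i. dist (LINT x|lborel. norm (f x - s i x)) 0 < e) sequentially"
      using \<open>0 < e\<close> tendstoD by fastforce
    then obtain i where "dist (LINT x|lborel. norm (f x - s i x)) 0 < e"
      by (auto simp: eventually_sequentially)
    then have "(LINT x|lborel. norm (f x - s i x)) < e" by (simp add: dist_real_def)
    then show "\<exists>g. integrable lborel g \<and> (translation_modulus g \<longlongrightarrow> 0) (at 0) \<and> (LINT x|lborel. norm (f x - g x)) < e"
      using s(1,2) by blast
  qed
qed

definition gen_poisson :: "real \<Rightarrow> real \<Rightarrow> real \<Rightarrow> real" where
  "gen_poisson a y h = y powr (2 * a - 1) * (h\<^sup>2 + y\<^sup>2) powr (- a) / japanese_integral a"

definition gen_conv :: "real \<Rightarrow> real \<Rightarrow> (real \<Rightarrow> complex) \<Rightarrow> real \<Rightarrow> complex" where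
  "gen_conv a y f x = (LINT t|lborel. of_real (gen_poisson a y (x - t)) * f t)"

lemma gen_poisson_measurable [measurable]: "gen_poisson a y \<in> borel_measurable borel"
  unfolding gen_poisson_def[abs_def] by measurable

lemma gen_poisson_even: "gen_poisson a y (- h) = gen_poisson a y h"
  by (simp add: gen_poisson_def)

lemma gen_poisson_commute: "gen_poisson a y (x - t) = gen_poisson a y (t - x)"
  using gen_poisson_even[of a y "t - x"] by simp

lemma poisson_kernel_eq_gen: "poisson_kernel y = gen_poisson (3/4) y"
  by (rule ext) (simp add: poisson_kernel_def gen_poisson_def c_star_eq)

lemma integrable_bounded_mult:
  fixes k :: "real \<Rightarrow> complex"
  assumes "integrable lborel k" "f \<in> borel_measurable borel" "\<And>x. norm (f x) \<le> B"
  shows "integrable lborel (\<lambda>x. k x * f x)"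
proof (rule Bochner_Integration.integrable_bound[where f = "\<lambda>x. B * norm (k x)"])
  show "AE x in lborel. norm (k x * f x) \<le> norm (B * norm (k x))"
  proof (intro AE_I2)
    fix x have "norm (k x) * norm (f x) \<le> norm (k x) * \<bar>B\<bar>"
      using assms(3)[of x] by (intro mult_left_mono) auto
    then show "norm (k x * f x) \<le> norm (B * norm (k x))" by (simp add: norm_mult abs_mult mult.commute)
  qed
qed (use assms in auto)

lemma gen_conv_measurable [measurable]:
  assumes [measurable]: "f \<in> borel_measurable borel"
  shows "gen_conv a y f \<in> borel_measurable borel"
proof -
  have "(\<lambda>x. LINT t|lborel. of_real (gen_poisson a y (x - t)) * f t) \<in> borel_measurable borel"
    by (rule lborel.borel_measurable_lebesgue_integral) measurable
  then show ?thesis by (simp add: gen_conv_def[abs_def])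
qed

lemma translation_modulus_le: "integrable lborel f \<Longrightarrow> translation_modulus f h \<le> 2 * (LINT x|lborel. norm (f x))"
  using translation_modulus_triangle[of f "\<lambda>x. 0" h] by (simp add: translation_modulus_def)

lemma nn_integral_translation_modulus:
  assumes "integrable lborel f"
  shows "(\<integral>\<^sup>+x. norm (f (x - h) - f x) \<partial>lborel) = ennreal (translation_modulus f h)"
  unfolding translation_modulus_def using integrable_translation_diff[OF assms]
  by (intro nn_integral_eq_integral) auto

context
  fixes a :: real
  assumes a: "1/2 < a"
begin

lemma gen_poisson_nonneg: "0 \<le> gen_poisson a y h"
  using japanese_integral_pos[OF a] by (simp add: gen_poisson_def)

lemma has_bochner_integral_gen_poisson:
  assumes "0 < y" shows "has_bochner_integral lborel (gen_poisson a y) 1"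
proof -
  have "has_bochner_integral lborel (\<lambda>h. y powr (2 * a - 1) / japanese_integral a * (h\<^sup>2 + y\<^sup>2) powr (- a))
     (y powr (2 * a - 1) / japanese_integral a * (y powr (1 - 2 * a) * japanese_integral a))"
    by (intro has_bochner_integral_mult_right has_bochner_integral_square_plus_powr a assms)
  moreover have "y powr (2 * a - 1) * y powr (1 - 2 * a) = 1"
    using assms by (simp flip: powr_add)
  ultimately show ?thesis
    using japanese_integral_pos[OF a] by (simp add: gen_poisson_def[abs_def] field_simps)
qed

lemma integrable_gen_poisson: "0 < y \<Longrightarrow> integrable lborel (gen_poisson a y)"
  and integral_gen_poisson: "0 < y \<Longrightarrow> integral\<^sup>L lborel (gen_poisson a y) = 1"
  using has_bochner_integral_gen_poisson by (auto simp: has_bochner_integral_iff)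

lemma nn_integral_gen_poisson: "0 < y \<Longrightarrow> (\<integral>\<^sup>+h. gen_poisson a y h \<partial>lborel) = 1"
  using nn_integral_eq_integral[OF integrable_gen_poisson] integral_gen_poisson gen_poisson_nonneg by simp

lemma gen_poisson_scale:
  assumes "0 < y" shows "y * gen_poisson a y (y * s) = gen_poisson a 1 s"
proof -
  have "(y * s)\<^sup>2 + y\<^sup>2 = y\<^sup>2 * (s\<^sup>2 + 1)" by (simp add: power_mult_distrib algebra_simps)
  then have "((y * s)\<^sup>2 + y\<^sup>2) powr (- a) = (y\<^sup>2) powr (- a) * (s\<^sup>2 + 1) powr (- a)"
    by (simp add: powr_mult)
  also have "y\<^sup>2 = y powr 2" using assms by (simp add: powr_numeral)
  also have "(y powr 2) powr (- a) = y powr (- 2 * a)" by (subst powr_powr) simp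
  finally have "y * gen_poisson a y (y * s) = (y powr 1 * y powr (2 * a - 1) * y powr (- 2 * a)) * (s\<^sup>2 + 1) powr (- a) / japanese_integral a"
    using assms by (simp add: gen_poisson_def)
  also have "y powr 1 * y powr (2 * a - 1) * y powr (- 2 * a) = 1"
    using assms by (simp only: powr_add[symmetric]) simp
  finally show ?thesis by (simp add: gen_poisson_def)
qed

lemma gen_poisson_le:
  assumes "0 < y"
  shows "gen_poisson a y h \<le> y powr (2 * a - 1) * (y\<^sup>2) powr (- a) / japanese_integral a"
  unfolding gen_poisson_def using japanese_integral_pos[OF a] assms a
  by (intro divide_right_mono mult_left_mono powr_mono2') auto

lemma gen_conv_eq_scaled:
  assumes "0 < y"
  shows "gen_conv a y f x = (LINT s|lborel. of_real (gen_poisson a 1 s) * f (x - y * s))"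
proof -
  have "gen_conv a y f x = y *\<^sub>R (LINT s|lborel. of_real (gen_poisson a y (x - (x - y * s))) * f (x - y * s))"
    unfolding gen_conv_def
    using lborel_integral_real_affine[of "-y" "\<lambda>t. of_real (gen_poisson a y (x - t)) * f t" x] assms by simp
  also have "\<dots> = (LINT s|lborel. y *\<^sub>R (of_real (gen_poisson a y (x - (x - y * s))) * f (x - y * s)))"
    by simp
  also have "\<dots> = (LINT s|lborel. of_real (gen_poisson a 1 s) * f (x - y * s))"
    using gen_poisson_scale[OF assms]
    by (intro Bochner_Integration.integral_cong) (simp_all add: scaleR_conv_of_real flip: mult.assoc of_real_mult)
  finally show ?thesis .
qed

lemma integrable_gen_conv_bounded:
  fixes f :: "real \<Rightarrow> complex"
  assumes "0 < y" "f \<in> borel_measurable borel" "\<And>x. norm (f x) \<le> B"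
  shows "integrable lborel (\<lambda>t. of_real (gen_poisson a y (x - t)) * f t)"
  using integrable_reflect_shift[OF integrable_gen_poisson[OF assms(1)], of x] assms(2,3)
  by (intro integrable_bounded_mult[where B = B]) auto

lemma integrable_gen_conv_L1:
  fixes f :: "real \<Rightarrow> complex"
  assumes "0 < y" "integrable lborel f"
  shows "integrable lborel (\<lambda>t. of_real (gen_poisson a y (x - t)) * f t)"
proof -
  have "integrable lborel (\<lambda>t. f t * of_real (gen_poisson a y (x - t)))"
    using gen_poisson_le[OF assms(1)] gen_poisson_nonneg assms
    by (intro integrable_bounded_mult[where B = "y powr (2 * a - 1) * (y\<^sup>2) powr (- a) / japanese_integral a"]) auto
  then show ?thesis by (simp add: mult.commute)
qed

lemma gen_conv_bounded:
  assumes "0 < y" "f \<in> borel_measurable borel" "\<And>x. norm (f x) \<le> B"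
  shows "norm (gen_conv a y f x) \<le> B"
proof -
  have "norm (gen_conv a y f x) \<le> (LINT t|lborel. norm (of_real (gen_poisson a y (x - t)) * f t))"
    unfolding gen_conv_def by simp
  also have "\<dots> \<le> (LINT t|lborel. gen_poisson a y (x - t) * B)"
    using integrable_gen_conv_bounded[OF assms, of x] integrable_reflect_shift[OF integrable_gen_poisson[OF assms(1)], of x]
      gen_poisson_nonneg assms(3)
    by (intro integral_mono integrable_norm integrable_mult_left) (auto simp: norm_mult intro!: mult_left_mono)
  also have "\<dots> = B" using integral_reflect_shift[of "gen_poisson a y" x] integral_gen_poisson[OF assms(1)] by simp
  finally show ?thesis .
qed

lemma gen_conv_tendsto_pointwise:
  assumes f: "f \<in> borel_measurable borel" "\<And>x. norm (f x) \<le> B" "isCont f x"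
    and y: "\<And>n. 0 < y n" "y \<longlonglongrightarrow> 0"
  shows "(\<lambda>n. gen_conv a (y n) f x) \<longlonglongrightarrow> f x"
proof -
  have [measurable]: "f \<in> borel_measurable borel" by fact
  have "(\<lambda>n. LINT s|lborel. of_real (gen_poisson a 1 s) * f (x - y n * s)) \<longlonglongrightarrow> (LINT s|lborel. of_real (gen_poisson a 1 s) * f x)"
  proof (rule integral_dominated_convergence[where w = "\<lambda>s. gen_poisson a 1 s * B"])
    show "integrable lborel (\<lambda>s. gen_poisson a 1 s * B)" using integrable_gen_poisson[of 1] by simp
    show "AE s in lborel. (\<lambda>n. of_real (gen_poisson a 1 s) * f (x - y n * s)) \<longlonglongrightarrow> of_real (gen_poisson a 1 s) * f x"
    proof (intro AE_I2 tendsto_mult tendsto_const)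
      fix s
      have "(\<lambda>n. x - y n * s) \<longlonglongrightarrow> x - 0 * s" by (intro tendsto_intros y)
      then show "(\<lambda>n. f (x - y n * s)) \<longlonglongrightarrow> f x" using isCont_tendsto_compose[OF f(3)] by simp
    qed
    show "AE s in lborel. norm (of_real (gen_poisson a 1 s) * f (x - y n * s)) \<le> gen_poisson a 1 s * B" for n
      using f(2) gen_poisson_nonneg by (auto simp: norm_mult intro!: mult_left_mono)
  qed measurable
  moreover have "(LINT s|lborel. of_real (gen_poisson a 1 s) * f x) = f x"
    using integral_gen_poisson[of 1] by simp
  ultimately show ?thesis unfolding gen_conv_eq_scaled[OF y(1)] by (simp only:)
qed

text \<open>The deviation of an average of translates of \<open>f\<close> from \<open>f\<close> is at most the average of the
  deviations of the translates.\<close>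

lemma gen_conv_tendsto_nn:
  assumes f [measurable]: "f \<in> borel_measurable borel" and S [measurable]: "S \<in> sets borel"
    and int: "\<And>y x. 0 < y \<Longrightarrow> integrable lborel (\<lambda>t. of_real (gen_poisson a y (x - t)) * f t)"
    and m: "\<And>h. (\<integral>\<^sup>+x. indicator S x * norm (f (x - h) - f x) \<partial>lborel) = ennreal (m h)"
    and B: "\<And>h. m h \<le> B" "\<And>h. 0 \<le> m h" and lim: "(m \<longlongrightarrow> 0) (at 0)"
    and y: "\<And>n. 0 < y n" "y \<longlonglongrightarrow> 0"
  shows "(\<lambda>n. \<integral>\<^sup>+x. indicator S x * norm (gen_conv a (y n) f x - f x) \<partial>lborel) \<longlonglongrightarrow> 0"
proof -
  let ?k = "gen_poisson a 1"
  have m0: "m 0 = 0" using m[of 0] B(2)[of 0] by simp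
  have [measurable]: "(\<lambda>h. ennreal (m h)) \<in> borel_measurable borel"
    unfolding m[symmetric] by measurable
  have le: "(\<integral>\<^sup>+x. indicator S x * norm (gen_conv a (y n) f x - f x) \<partial>lborel) \<le> (\<integral>\<^sup>+s. ?k s * ennreal (m (y n * s)) \<partial>lborel)" for n
  proof -
    have i: "integrable lborel (\<lambda>s. of_real (?k s) * f (x - y n * s))" for x
    proof -
      have "integrable lborel (\<lambda>s. (\<lambda>t. of_real (gen_poisson a (y n) (x - t)) * f t) (x + (- y n) * s))"
        using lborel_integrable_real_affine[OF int[OF y(1)[of n], of x], of "- y n" x] y(1)[of n] by simp
      then have "integrable lborel (\<lambda>s. of_real (y n) * (of_real (gen_poisson a (y n) (y n * s)) * f (x - y n * s)))"
        by simp
      then show ?thesis using gen_poisson_scale[OF y(1)] by (simp flip: mult.assoc of_real_mult)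
    qed
    have i2: "integrable lborel (\<lambda>s. of_real (?k s) * f x)" for x
      using integrable_gen_poisson[of 1] by simp
    have "norm (gen_conv a (y n) f x - f x) \<le> (\<integral>\<^sup>+s. ?k s * norm (f (x - y n * s) - f x) \<partial>lborel)" for x
    proof -
      have "gen_conv a (y n) f x - f x = (LINT s|lborel. of_real (?k s) * f (x - y n * s)) - (LINT s|lborel. of_real (?k s) * f x)"
        using integral_gen_poisson[of 1] gen_conv_eq_scaled[OF y(1)] by simp
      also have "\<dots> = (LINT s|lborel. of_real (?k s) * f (x - y n * s) - of_real (?k s) * f x)"
        using i i2 by simp
      finally have "norm (gen_conv a (y n) f x - f x) \<le> (\<integral>\<^sup>+s. norm (of_real (?k s) * f (x - y n * s) - of_real (?k s) * f x) \<partial>lborel)"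
        using integral_norm_bound_ennreal[OF Bochner_Integration.integrable_diff[OF i[of x] i2[of x]]] by simp
      also have "\<dots> = (\<integral>\<^sup>+s. ?k s * norm (f (x - y n * s) - f x) \<partial>lborel)"
        using gen_poisson_nonneg by (intro nn_integral_cong) (simp add: norm_mult flip: right_diff_distrib)
      finally show ?thesis .
    qed
    then have "(\<integral>\<^sup>+x. indicator S x * norm (gen_conv a (y n) f x - f x) \<partial>lborel) \<le>
       (\<integral>\<^sup>+x. indicator S x * (\<integral>\<^sup>+s. ?k s * norm (f (x - y n * s) - f x) \<partial>lborel) \<partial>lborel)"
      by (intro nn_integral_mono) (auto intro!: mult_left_mono simp: indicator_def)
    also have "\<dots> = (\<integral>\<^sup>+x. (\<integral>\<^sup>+s. ?k s * (indicator S x * norm (f (x - y n * s) - f x)) \<partial>lborel) \<partial>lborel)"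
      by (intro nn_integral_cong) (auto simp: indicator_def)
    also have "\<dots> = (\<integral>\<^sup>+s. (\<integral>\<^sup>+x. ?k s * (indicator S x * norm (f (x - y n * s) - f x)) \<partial>lborel) \<partial>lborel)"
      by (rule lborel_pair.Fubini') measurable
    also have "\<dots> = (\<integral>\<^sup>+s. ?k s * ennreal (m (y n * s)) \<partial>lborel)"
    proof (intro nn_integral_cong)
      fix s
      show "(\<integral>\<^sup>+x. ?k s * (indicator S x * norm (f (x - y n * s) - f x)) \<partial>lborel) = ?k s * ennreal (m (y n * s))"
        using gen_poisson_nonneg[of 1 s] unfolding m[symmetric]
        by (simp add: ennreal_mult ennreal_indicator nn_integral_cmult)
    qed
    finally show ?thesis .
  qed
  have "(\<lambda>n. \<integral>\<^sup>+s. ?k s * ennreal (m (y n * s)) \<partial>lborel) \<longlonglongrightarrow> (\<integral>\<^sup>+s. 0 \<partial>(lborel :: real measure))"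
  proof (rule nn_integral_dominated_convergence[where w = "\<lambda>s. ?k s * ennreal B"])
    show "AE s in lborel. ?k s * ennreal (m (y n * s)) \<le> ?k s * ennreal B" for n
      using B by (intro AE_I2 mult_left_mono ennreal_leI) auto
    show "(\<integral>\<^sup>+s. ?k s * ennreal B \<partial>lborel) < \<infinity>"
      using nn_integral_gen_poisson[of 1] by (simp add: nn_integral_multc)
    show "AE s in lborel. (\<lambda>n. ?k s * ennreal (m (y n * s))) \<longlonglongrightarrow> 0"
    proof (intro AE_I2)
      fix s
      have "isCont m 0" using lim m0 by (simp add: isCont_def)
      moreover have "(\<lambda>n. y n * s) \<longlonglongrightarrow> 0 * s" by (intro tendsto_intros y)
      ultimately have "(\<lambda>n. m (y n * s)) \<longlonglongrightarrow> 0" using isCont_tendsto_compose[of 0 m] m0 by fastforce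
      then have "(\<lambda>n. ennreal (?k s * m (y n * s))) \<longlonglongrightarrow> ennreal (?k s * 0)"
        by (intro tendsto_ennrealI tendsto_mult tendsto_const)
      then show "(\<lambda>n. ?k s * ennreal (m (y n * s))) \<longlonglongrightarrow> 0"
        using gen_poisson_nonneg[of 1 s] B by (simp add: ennreal_mult)
    qed
  qed measurable
  then have "(\<lambda>n. \<integral>\<^sup>+s. ?k s * ennreal (m (y n * s)) \<partial>lborel) \<longlonglongrightarrow> 0" by simp
  then show ?thesis
    by (rule tendsto_sandwich[OF _ _ tendsto_const, rotated 2]) (auto simp: le)
qed

lemma nn_integral_gen_conv_le:
  assumes y: "0 < y" and f: "integrable lborel f"
  shows "(\<integral>\<^sup>+x. norm (gen_conv a y f x) \<partial>lborel) \<le> (\<integral>\<^sup>+t. norm (f t) \<partial>lborel)"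
proof -
  have [measurable]: "f \<in> borel_measurable borel" using f by auto
  have "norm (gen_conv a y f x) \<le> (\<integral>\<^sup>+t. gen_poisson a y (x - t) * norm (f t) \<partial>lborel)" for x
    using integral_norm_bound_ennreal[OF integrable_gen_conv_L1[OF y f, of x]] gen_poisson_nonneg
    by (simp add: gen_conv_def norm_mult)
  then have "(\<integral>\<^sup>+x. norm (gen_conv a y f x) \<partial>lborel) \<le> (\<integral>\<^sup>+x. (\<integral>\<^sup>+t. gen_poisson a y (x - t) * norm (f t) \<partial>lborel) \<partial>lborel)"
    by (intro nn_integral_mono)
  also have "\<dots> = (\<integral>\<^sup>+t. (\<integral>\<^sup>+x. gen_poisson a y (x - t) * norm (f t) \<partial>lborel) \<partial>lborel)"
    by (rule lborel_pair.Fubini') measurable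
  also have "\<dots> = (\<integral>\<^sup>+t. norm (f t) \<partial>lborel)"
  proof (intro nn_integral_cong)
    fix t
    have "(\<integral>\<^sup>+x. gen_poisson a y (x - t) \<partial>lborel) = 1"
      using nn_integral_real_affine[of "\<lambda>x. ennreal (gen_poisson a y x)" 1 "-t"] nn_integral_gen_poisson[OF y] by simp
    then show "(\<integral>\<^sup>+x. gen_poisson a y (x - t) * norm (f t) \<partial>lborel) = norm (f t)"
      using gen_poisson_nonneg by (simp add: ennreal_mult nn_integral_multc)
  qed
  finally show ?thesis .
qed

lemma gen_conv_tendsto_L1:
  assumes f: "integrable lborel f" and y: "\<And>n. 0 < y n" "y \<longlonglongrightarrow> 0"
  shows "integrable lborel (gen_conv a (y n) f)"
    and "(\<lambda>n. LINT x|lborel. norm (gen_conv a (y n) f x - f x)) \<longlonglongrightarrow> 0"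
proof -
  have [measurable]: "f \<in> borel_measurable borel" using f by auto
  show i: "integrable lborel (gen_conv a (y n) f)" for n
  proof (rule integrableI_bounded)
    have "(\<integral>\<^sup>+x. norm (gen_conv a (y n) f x) \<partial>lborel) \<le> (\<integral>\<^sup>+t. norm (f t) \<partial>lborel)"
      by (rule nn_integral_gen_conv_le[OF y(1) f])
    also have "\<dots> < \<infinity>" using f by (simp add: integrable_iff_bounded)
    finally show "(\<integral>\<^sup>+x. norm (gen_conv a (y n) f x) \<partial>lborel) < \<infinity>" .
  qed measurable
  have "(\<lambda>n. \<integral>\<^sup>+x. indicator UNIV x * norm (gen_conv a (y n) f x - f x) \<partial>lborel) \<longlonglongrightarrow> 0"
    using f y nn_integral_translation_modulus[OF f] translation_modulus_le[OF f] translation_modulus_nonneg tendsto_translation_modulus[OF f]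
    by (intro gen_conv_tendsto_nn[where m = "translation_modulus f" and B = "2 * (LINT x|lborel. norm (f x))"] integrable_gen_conv_L1) auto
  then have "(\<lambda>n. enn2real (\<integral>\<^sup>+x. norm (gen_conv a (y n) f x - f x) \<partial>lborel)) \<longlonglongrightarrow> enn2real 0"
    by (intro tendsto_enn2real) auto
  then show "(\<lambda>n. LINT x|lborel. norm (gen_conv a (y n) f x - f x)) \<longlonglongrightarrow> 0"
    by (simp add: integral_eq_nn_integral)
qed

lemma gen_conv_tendsto_local:
  assumes f [measurable]: "f \<in> borel_measurable borel" and B: "\<And>x. norm (f x) \<le> B"
    and y: "\<And>n. 0 < y n" "y \<longlonglongrightarrow> 0"
  shows "(\<lambda>n. LINT x:{-R..R}|lborel. norm (gen_conv a (y n) f x - f x)) \<longlonglongrightarrow> 0"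
proof -
  define m where "m h = (LINT x:{-R..R}|lborel. norm (f (x - h) - f x))" for h
  have d: "norm (f (x - h) - f x) \<le> 2 * B" for x h
    using norm_triangle_ineq4[of "f (x - h)" "f x"] B[of x] B[of "x - h"] by linarith
  have c: "integrable lborel (\<lambda>x::real. indicator {l..u} x *\<^sub>R (C::real))" for l u C
    by (intro integrable_scaleR_left) (simp add: emeasure_lborel_Icc_eq)
  have i: "set_integrable lborel {-R..R} (\<lambda>x. norm (f (x - h) - f x))" for h
    unfolding set_integrable_def
    by (rule Bochner_Integration.integrable_bound[OF c[of "-R" R "2 * B"]])
      (auto simp: indicator_def intro!: order_trans[OF d])
  have m: "(\<integral>\<^sup>+x. indicator {-R..R} x * norm (f (x - h) - f x) \<partial>lborel) = ennreal (m h)" for h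
    using nn_integral_eq_integral[OF i[of h, unfolded set_integrable_def]]
    by (simp add: m_def set_lebesgue_integral_def)
  have mB: "m h \<le> (LINT x:{-R..R}|lborel. 2 * B)" for h
    unfolding m_def set_lebesgue_integral_def
    using i[of h, unfolded set_integrable_def] c d by (intro integral_mono) (auto simp: indicator_def)
  have m0: "0 \<le> m h" for h
    unfolding m_def set_lebesgue_integral_def by (intro integral_nonneg_AE) auto
  \<comment> \<open>Near the interval, \<open>f\<close> agrees with an integrable function, whose translations are continuous.\<close>
  define g where "g x = indicator {-R-1..R+1} x *\<^sub>R f x" for x
  have g: "integrable lborel g"
    unfolding g_def by (rule Bochner_Integration.integrable_bound[OF c[of "-R-1" "R+1" B]])
      (auto simp: indicator_def intro!: order_trans[OF B])
  have "m h \<le> translation_modulus g h" if "\<bar>h\<bar> < 1" for h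
    unfolding m_def translation_modulus_def set_lebesgue_integral_def
  proof (rule integral_mono)
    show "integrable lborel (\<lambda>x. indicator {-R..R} x *\<^sub>R norm (f (x - h) - f x))" using i[of h] by (simp add: set_integrable_def)
    show "integrable lborel (\<lambda>x. norm (g (x - h) - g x))" using integrable_translation_diff[OF g] by auto
    show "indicator {-R..R} x *\<^sub>R norm (f (x - h) - f x) \<le> norm (g (x - h) - g x)" for x
      using that by (auto simp: g_def indicator_def)
  qed
  then have "eventually (\<lambda>h. m h \<le> translation_modulus g h) (at 0)"
    unfolding eventually_at by (intro exI[of _ 1]) (auto simp: dist_real_def)
  then have lim: "(m \<longlongrightarrow> 0) (at 0)"
    using m0 by (intro tendsto_sandwich[OF _ _ tendsto_const tendsto_translation_modulus[OF g]]) auto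
  have "(\<lambda>n. \<integral>\<^sup>+x. indicator {-R..R} x * norm (gen_conv a (y n) f x - f x) \<partial>lborel) \<longlonglongrightarrow> 0"
    by (intro gen_conv_tendsto_nn[OF f _ integrable_gen_conv_bounded[OF _ f B] m mB m0 lim y]) auto
  then have "(\<lambda>n. enn2real (\<integral>\<^sup>+x. indicator {-R..R} x * norm (gen_conv a (y n) f x - f x) \<partial>lborel)) \<longlonglongrightarrow> enn2real 0"
    by (intro tendsto_enn2real) auto
  then show ?thesis
    by (simp add: integral_eq_nn_integral set_lebesgue_integral_def)
qed

lemma integral_gen_conv_commute:
  assumes y: "0 < y" and v [measurable]: "v \<in> borel_measurable borel" and B: "\<And>x. norm (v x) \<le> B" and g: "integrable lborel g"
  shows "(LINT x|lborel. gen_conv a y v x * g x) = (LINT x|lborel. v x * gen_conv a y g x)"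
proof -
  have [measurable]: "g \<in> borel_measurable borel" using g by auto
  have B0: "0 \<le> B" using B norm_ge_zero order_trans by blast
  have k1: "(\<integral>\<^sup>+t. gen_poisson a y (x - t) \<partial>lborel) = 1" for x
    using nn_integral_real_affine[of "\<lambda>t. ennreal (gen_poisson a y t)" "-1" x] nn_integral_gen_poisson[OF y] by simp
  have i: "integrable (lborel \<Otimes>\<^sub>M lborel) (\<lambda>(x, t). of_real (gen_poisson a y (x - t)) * v t * g x)"
  proof (rule integrableI_bounded)
    have "(\<integral>\<^sup>+p. norm (case p of (x, t) \<Rightarrow> of_real (gen_poisson a y (x - t)) * v t * g x) \<partial>(lborel \<Otimes>\<^sub>M lborel)) =
      (\<integral>\<^sup>+x. (\<integral>\<^sup>+t. norm (of_real (gen_poisson a y (x - t)) * v t * g x) \<partial>lborel) \<partial>lborel)"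
      by (subst lborel.nn_integral_fst[symmetric]) auto
    also have "\<dots> \<le> (\<integral>\<^sup>+x. (\<integral>\<^sup>+t. gen_poisson a y (x - t) * ennreal (B * norm (g x)) \<partial>lborel) \<partial>lborel)"
      using gen_poisson_nonneg B B0
      by (intro nn_integral_mono)
         (auto simp: norm_mult mult.assoc ennreal_mult[symmetric] intro!: ennreal_leI mult_left_mono mult_right_mono)
    also have "\<dots> = (\<integral>\<^sup>+x. ennreal (B * norm (g x)) \<partial>lborel)"
      by (intro nn_integral_cong) (simp add: nn_integral_multc k1)
    also have "\<dots> < \<infinity>" using g B0
      by (simp add: ennreal_mult nn_integral_cmult ennreal_mult_less_top integrable_iff_bounded)
    finally show "(\<integral>\<^sup>+p. norm (case p of (x, t) \<Rightarrow> of_real (gen_poisson a y (x - t)) * v t * g x) \<partial>(lborel \<Otimes>\<^sub>M lborel)) < \<infinity>" .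
  qed measurable
  have "(LINT x|lborel. gen_conv a y v x * g x) = (LINT x|lborel. LINT t|lborel. of_real (gen_poisson a y (x - t)) * v t * g x)"
    unfolding gen_conv_def using integrable_gen_conv_bounded[OF y v B] by simp
  also have "\<dots> = (LINT t|lborel. LINT x|lborel. of_real (gen_poisson a y (x - t)) * v t * g x)"
    by (rule lborel_pair.Fubini_integral[OF i, symmetric])
  also have "\<dots> = (LINT t|lborel. v t * gen_conv a y g t)"
    unfolding gen_conv_def
  proof (intro Bochner_Integration.integral_cong refl)
    fix t
    have "(LINT x|lborel. of_real (gen_poisson a y (x - t)) * v t * g x) = (LINT x|lborel. v t * (of_real (gen_poisson a y (t - x)) * g x))"
      by (intro Bochner_Integration.integral_cong refl) (simp add: gen_poisson_commute[of a y t])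
    then show "(LINT x|lborel. of_real (gen_poisson a y (x - t)) * v t * g x) = v t * (LINT x|lborel. of_real (gen_poisson a y (t - x)) * g x)"
      by simp
  qed
  finally show ?thesis .
qed

end

lemma W_fun_eq_gen_conv:
  assumes "0 < z" shows "W_fun f (x, z) = gen_conv (3/4) (z\<^sup>2 / 2) f x"
  unfolding W_fun_def pot_def gen_conv_def poisson_kernel_eq_gen[symmetric]
  using assms by (simp add: poisson_kernel_eq_ker mult.assoc)


definition ft :: "(real \<Rightarrow> complex) \<Rightarrow> real \<Rightarrow> complex" where
  "ft k \<xi> = (LINT x|lborel. exp (- (\<i> * of_real (x * \<xi>))) * k x)"

lemma norm_exp_i [simp]: "norm (exp (\<i> * of_real x)) = 1" "norm (exp (- (\<i> * of_real x))) = 1"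
  using norm_exp_i_times[of x] norm_exp_i_times[of "- x"] by simp_all

lemma integrable_exp_i_mult:
  fixes k :: "real \<Rightarrow> complex"
  assumes "integrable lborel k"
  shows "integrable lborel (\<lambda>x. exp (- (\<i> * of_real (x * \<xi>))) * k x)"
    and "integrable lborel (\<lambda>x. exp (\<i> * of_real (x * \<xi>)) * k x)"
  by (rule Bochner_Integration.integrable_bound[OF assms]; use assms in \<open>simp add: norm_mult del: of_real_mult\<close>)+

lemma ft_gaussian:
  assumes "0 < s"
  shows "ft (\<lambda>h. of_real (exp (- s * h\<^sup>2))) \<xi> = of_real (sqrt (pi / s) * exp (- \<xi>\<^sup>2 / (4 * s)))"
proof -
  define c where "c = sqrt (2 * s)"
  have c: "0 < c" "c\<^sup>2 = 2 * s" using assms by (auto simp: c_def)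
  define t where "t = - \<xi> / c"
  have "of_real (exp (- (t\<^sup>2) / 2)) = char std_normal_distribution t"
    by (simp add: char_std_normal_distribution)
  also have "\<dots> = (LINT x|lborel. std_normal_density x *\<^sub>R exp (\<i> * of_real (t * x)))"
    unfolding char_def by (subst integral_density) (auto simp: normal_density_nonneg)
  also have "\<dots> = c *\<^sub>R (LINT h|lborel. std_normal_density (0 + c * h) *\<^sub>R exp (\<i> * of_real (t * (0 + c * h))))"
    using lborel_integral_real_affine[of c "\<lambda>x. std_normal_density x *\<^sub>R exp (\<i> * of_real (t * x))" 0] c by simp
  also have "(LINT h|lborel. std_normal_density (0 + c * h) *\<^sub>R exp (\<i> * of_real (t * (0 + c * h)))) =
     (LINT h|lborel. of_real (1 / sqrt (2 * pi)) * (exp (- (\<i> * of_real (h * \<xi>))) * of_real (exp (- s * h\<^sup>2))))"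
  proof (intro Bochner_Integration.integral_cong refl)
    fix h
    have "t * (0 + c * h) = - (h * \<xi>)" using c by (simp add: t_def field_simps)
    moreover have "std_normal_density (0 + c * h) = 1 / sqrt (2 * pi) * exp (- s * h\<^sup>2)"
      using c by (simp add: normal_density_def power_mult_distrib)
    ultimately show "std_normal_density (0 + c * h) *\<^sub>R exp (\<i> * of_real (t * (0 + c * h))) =
      of_real (1 / sqrt (2 * pi)) * (exp (- (\<i> * of_real (h * \<xi>))) * of_real (exp (- s * h\<^sup>2)))"
      by (simp only: scaleR_conv_of_real of_real_mult) simp
  qed
  also have "\<dots> = of_real (1 / sqrt (2 * pi)) * ft (\<lambda>h. of_real (exp (- s * h\<^sup>2))) \<xi>"
    unfolding ft_def by (rule integral_mult_right_zero)
  finally have "of_real (exp (- (t\<^sup>2) / 2)) = of_real (c / sqrt (2 * pi)) * ft (\<lambda>h. of_real (exp (- s * h\<^sup>2))) \<xi>"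
    by (simp add: scaleR_conv_of_real)
  then have "of_real (sqrt (2 * pi) / c * exp (- (t\<^sup>2) / 2)) = ft (\<lambda>h. of_real (exp (- s * h\<^sup>2))) \<xi>"
    using c by (simp add: field_simps)
  moreover have "sqrt (2 * pi) / c = sqrt (pi / s)" by (simp add: c_def real_sqrt_mult real_sqrt_divide)
  moreover have "- (t\<^sup>2) / 2 = - \<xi>\<^sup>2 / (4 * s)" using c by (simp add: t_def power_divide)
  ultimately show ?thesis by simp
qed

lemma has_bochner_integral_Gamma_scaled:
  fixes a b :: real
  assumes "0 < a" "0 < b"
  shows "has_bochner_integral lborel (\<lambda>s. indicator {0<..} s * (s powr (a - 1) * exp (- (s * b)))) (Gamma a * b powr (- a))"
proof -
  have "((\<lambda>t. t powr (a - 1) / exp t) has_integral Gamma a) {0..}" by (rule Gamma_integral_real[OF assms(1)])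
  then have 1: "has_bochner_integral lborel (\<lambda>x. indicator {0..} x * (x powr (a - 1) / exp x)) (Gamma a)"
    by (intro has_bochner_integral_nonneg_has_integral) auto
  let ?f = "\<lambda>x. indicator {0..} x * (x powr (a - 1) / exp x) :: real"
  have i: "integrable lborel (\<lambda>s. ?f (0 + b * s))"
    using lborel_integrable_real_affine[of ?f b 0] 1 assms by (simp add: has_bochner_integral_iff)
  have "integral\<^sup>L lborel ?f = b * (LINT s|lborel. ?f (0 + b * s))"
    using lborel_integral_real_affine[of b ?f 0] assms by simp
  then have "b powr (1 - a) * (LINT s|lborel. ?f (0 + b * s)) = Gamma a * b powr (- a)"
    using 1 assms by (simp add: has_bochner_integral_iff powr_diff powr_minus field_simps)
  then have "has_bochner_integral lborel (\<lambda>s. b powr (1 - a) * ?f (0 + b * s)) (Gamma a * b powr (- a))"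
    using has_bochner_integral_mult_right[OF has_bochner_integral_integrable[OF i], of "b powr (1 - a)"] by metis
  moreover have "b powr (1 - a) * ?f (0 + b * s) = indicator {0<..} s * (s powr (a - 1) * exp (- (s * b)))" for s
  proof (cases "0 < s")
    case True
    have "b powr (1 - a) * b powr (a - 1) = 1" using assms by (simp flip: powr_add)
    then show ?thesis using True assms by (simp add: powr_mult exp_minus field_simps)
  next
    case False
    then show ?thesis using assms by (auto simp: indicator_def zero_le_mult_iff)
  qed
  ultimately show ?thesis by simp
qed

definition bessel_integrand :: "real \<Rightarrow> real \<Rightarrow> real \<Rightarrow> real \<Rightarrow> real" where
  "bessel_integrand b A \<xi> s = indicator {0<..} s * (s powr b * exp (- (s * A) - \<xi>\<^sup>2 / (4 * s)))"

definition bessel_integral :: "real \<Rightarrow> real \<Rightarrow> real \<Rightarrow> real" where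
  "bessel_integral b A \<xi> = integral\<^sup>L lborel (bessel_integrand b A \<xi>)"

lemma bessel_integrand_measurable [measurable]: "bessel_integrand b A \<xi> \<in> borel_measurable borel"
  unfolding bessel_integrand_def[abs_def] by measurable

lemma integrable_bessel_integrand:
  assumes "- 1 < b" "0 < A"
  shows "integrable lborel (bessel_integrand b A \<xi>)"
proof (rule Bochner_Integration.integrable_bound)
  show "integrable lborel (\<lambda>s. indicator {0<..} s * (s powr b * exp (- (s * A))))"
    using has_bochner_integral_Gamma_scaled[of "b + 1" A] assms by (simp add: has_bochner_integral_iff)
  show "AE s in lborel. norm (bessel_integrand b A \<xi> s) \<le> norm (indicator {0<..} s * (s powr b * exp (- (s * A))))"
    by (intro AE_I2) (auto simp: bessel_integrand_def indicator_def abs_mult)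
qed measurable

lemma ft_square_plus_powr:
  assumes a: "1/2 < a" and A: "0 < A"
  shows "ft (\<lambda>h. of_real ((h\<^sup>2 + A) powr (- a))) \<xi> = of_real (sqrt pi / Gamma a * bessel_integral (a - 3/2) A \<xi>)"
proof -
  have Ga: "0 < Gamma a" using a by (intro Gamma_real_pos) auto
  have p: "0 < h\<^sup>2 + A" for h using A by (auto intro: add_nonneg_pos)
  note G = has_bochner_integral_Gamma_scaled[OF _ p, of a]
  define F where "F h s = exp (- (\<i> * of_real (h * \<xi>))) * of_real (indicator {0<..} s * (s powr (a - 1) * exp (- (s * (h\<^sup>2 + A)))))" for h s
  have i0: "integrable lborel (\<lambda>h. (h\<^sup>2 + A) powr (- a))"
    using has_bochner_integral_square_plus_powr[OF a, of "sqrt A"] A by (simp add: has_bochner_integral_iff)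
  have iF: "integrable (lborel \<Otimes>\<^sub>M lborel) (\<lambda>(h, s). F h s)"
  proof (rule lborel_pair.Fubini_integrable)
    show "(\<lambda>(h, s). F h s) \<in> borel_measurable (lborel \<Otimes>\<^sub>M lborel)" unfolding F_def by measurable
    have nF: "norm (F h s) = indicator {0<..} s * (s powr (a - 1) * exp (- (s * (h\<^sup>2 + A))))" for h s
      by (simp add: F_def norm_mult del: of_real_mult) 
    show "integrable lborel (\<lambda>h. LINT s|lborel. norm (case (h, s) of (h, s) \<Rightarrow> F h s))"
      using i0 G a by (simp add: nF has_bochner_integral_iff)
    show "AE h in lborel. integrable lborel (\<lambda>s. case (h, s) of (h, s) \<Rightarrow> F h s)"
    proof (intro AE_I2)
      fix h
      have "integrable lborel (\<lambda>s. of_real (indicator {0<..} s * (s powr (a - 1) * exp (- (s * (h\<^sup>2 + A))))) :: complex)"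
        using G[of h] a by (simp add: has_bochner_integral_iff del: of_real_mult)
      then have "integrable lborel (\<lambda>s. F h s)" unfolding F_def by (rule integrable_mult_right)
      then show "integrable lborel (\<lambda>s. case (h, s) of (h, s) \<Rightarrow> F h s)" by simp
    qed
  qed
  have "of_real (Gamma a) * ft (\<lambda>h. of_real ((h\<^sup>2 + A) powr (- a))) \<xi> =
      (LINT h|lborel. of_real (Gamma a) * (exp (- (\<i> * of_real (h * \<xi>))) * of_real ((h\<^sup>2 + A) powr (- a))))"
    unfolding ft_def by simp
  also have "\<dots> = (LINT h|lborel. LINT s|lborel. F h s)"
  proof (intro Bochner_Integration.integral_cong refl)
    fix h
    have "(LINT s|lborel. F h s) = exp (- (\<i> * of_real (h * \<xi>))) * (LINT s|lborel. of_real (indicator {0<..} s * (s powr (a - 1) * exp (- (s * (h\<^sup>2 + A))))))"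
      unfolding F_def by (rule integral_mult_right_zero)
    also have "\<dots> = exp (- (\<i> * of_real (h * \<xi>))) * of_real (Gamma a * (h\<^sup>2 + A) powr (- a))"
      unfolding integral_complex_of_real using G[of h] a by (simp add: has_bochner_integral_iff)
    finally show "of_real (Gamma a) * (exp (- (\<i> * of_real (h * \<xi>))) * of_real ((h\<^sup>2 + A) powr (- a))) = (LINT s|lborel. F h s)"
      by simp
  qed
  also have "\<dots> = (LINT s|lborel. LINT h|lborel. F h s)"
    using lborel_pair.Fubini_integral[OF iF] by simp
  also have "\<dots> = (LINT s|lborel. of_real (sqrt pi * bessel_integrand (a - 3/2) A \<xi> s))"
  proof (intro Bochner_Integration.integral_cong refl)
    fix s :: real
    show "(LINT h|lborel. F h s) = of_real (sqrt pi * bessel_integrand (a - 3/2) A \<xi> s)"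
    proof (cases "0 < s")
      case True
      have "(LINT h|lborel. F h s) = (LINT h|lborel. of_real (s powr (a - 1) * exp (- (s * A))) * (exp (- (\<i> * of_real (h * \<xi>))) * of_real (exp (- s * h\<^sup>2))))"
      proof (intro Bochner_Integration.integral_cong refl)
        fix h
        have "exp (- (s * (h\<^sup>2 + A))) = exp (- (s * A)) * exp (- s * h\<^sup>2)"
          by (simp add: algebra_simps flip: exp_add)
        then show "F h s = of_real (s powr (a - 1) * exp (- (s * A))) * (exp (- (\<i> * of_real (h * \<xi>))) * of_real (exp (- s * h\<^sup>2)))"
          using True by (simp add: F_def)
      qed
      also have "\<dots> = of_real (s powr (a - 1) * exp (- (s * A))) * ft (\<lambda>h. of_real (exp (- s * h\<^sup>2))) \<xi>"
        unfolding ft_def by (rule integral_mult_right_zero)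
      also have "\<dots> = of_real (s powr (a - 1) * exp (- (s * A)) * (sqrt (pi / s) * exp (- \<xi>\<^sup>2 / (4 * s))))"
        by (simp only: ft_gaussian[OF True] of_real_mult)
      also have "s powr (a - 1) * exp (- (s * A)) * (sqrt (pi / s) * exp (- \<xi>\<^sup>2 / (4 * s))) = sqrt pi * bessel_integrand (a - 3/2) A \<xi> s"
      proof -
        have "a - 3/2 = (a - 1) - 1/2" by simp
        then have "s powr (a - 3/2) = s powr (a - 1) / sqrt s"
          using True by (simp only: powr_diff powr_half_sqrt)
        moreover have "exp (- (s * A) - \<xi>\<^sup>2 / (4 * s)) = exp (- (s * A)) * exp (- \<xi>\<^sup>2 / (4 * s))"
          by (simp flip: exp_add)
        ultimately show ?thesis using True by (simp add: bessel_integrand_def real_sqrt_divide)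
      qed
      finally show ?thesis .
    qed (simp add: F_def bessel_integrand_def)
  qed
  also have "\<dots> = of_real (sqrt pi * bessel_integral (a - 3/2) A \<xi>)"
    unfolding integral_complex_of_real bessel_integral_def by simp
  finally show ?thesis using Ga by (simp add: field_simps)
qed

lemma bessel_integral_reflect:
  assumes A: "0 < A" and "\<xi> \<noteq> 0"
  shows "integrable lborel (bessel_integrand (- 7/4) A \<xi>)"
    and "bessel_integral (- 7/4) A \<xi> = (\<xi>\<^sup>2 / (4 * A)) powr (- 3/4) * bessel_integral (- 1/4) A \<xi>"
proof -
  define q where "q = \<xi>\<^sup>2 / (4 * A)"
  have q: "0 < q" using assms by (simp add: q_def)
  let ?e = "\<lambda>s. exp (- (s * A) - \<xi>\<^sup>2 / (4 * s))"
  let ?f = "\<lambda>s. s powr (- 7/4) * ?e s"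
  let ?h = "\<lambda>t. q powr (- 3/4) * (t powr (- 1/4) * ?e t)"
  have img: "(\<lambda>t. q / t) ` {0<..} = {0<..}"
  proof
    show "{0<..} \<subseteq> (\<lambda>t. q / t) ` {0<..}"
      using q by (auto intro!: image_eqI[of _ _ "q / x" for x])
  qed (use q in auto)
  have eq: "\<bar>- q / t\<^sup>2\<bar> * ?f (q / t) = ?h t" if "t \<in> {0<..}" for t
  proof -
    have t: "0 < t" using that by simp
    have e: "?e (q / t) = ?e t"
    proof -
      have "q / t * A = \<xi>\<^sup>2 / (4 * t)" "\<xi>\<^sup>2 / (4 * (q / t)) = t * A"
        using assms t by (simp_all add: q_def)
      then show ?thesis by (simp add: algebra_simps)
    qed
    have "\<bar>- q / t\<^sup>2\<bar> * (q / t) powr (- 7/4) = (q powr 1 * q powr (- 7/4)) * (t powr (7/4) * t powr (- 2))"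
    proof -
      have "\<bar>- q / t\<^sup>2\<bar> = q powr 1 * t powr (- 2)"
        using q t by (simp add: powr_minus powr_numeral divide_inverse)
      moreover have "(q / t) powr (- 7/4) = q powr (- 7/4) * t powr (7/4)"
      proof -
        have "(q / t) powr (- 7/4) = q powr (- 7/4) / t powr (- 7/4)" by (rule powr_divide)
        moreover have "t powr (7/4) = 1 / t powr (- 7/4)" using powr_minus_divide[of t "- 7/4"] by simp
        ultimately show ?thesis by (metis mult.right_neutral times_divide_eq_right)
      qed
      ultimately show ?thesis by (simp only: mult_ac)
    qed
    also have "\<dots> = q powr (- 3/4) * t powr (- 1/4)"
      by (simp only: powr_add[symmetric]) simp
    finally have fin: "\<bar>- q / t\<^sup>2\<bar> * (q / t) powr (- 7/4) = q powr (- 3/4) * t powr (- 1/4)" .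
    show ?thesis by (simp only: e mult.assoc[symmetric] fin)
  qed
  have ih: "integrable lborel (bessel_integrand (- 1/4) A \<xi>)"
    by (rule integrable_bessel_integrand) (use A in auto)
  have b: "bessel_integrand b A \<xi> s = indicator {0<..} s *\<^sub>R (s powr b * ?e s)" for b s
    by (simp add: bessel_integrand_def)
  have sb: "set_integrable lebesgue {0<..} (\<lambda>s. s powr b * ?e s) \<longleftrightarrow> integrable lborel (bessel_integrand b A \<xi>)" for b
    unfolding set_integrable_def b[symmetric] by (simp add: integrable_completion)
  have li: "integral {0<..} (\<lambda>s. s powr b * ?e s) = bessel_integral b A \<xi>" if "integrable lborel (bessel_integrand b A \<xi>)" for b
  proof -
    have "set_integrable lebesgue {0<..} (\<lambda>s. s powr b * ?e s)" using that sb by simp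
    then have "integral {0<..} (\<lambda>s. s powr b * ?e s) = set_lebesgue_integral lebesgue {0<..} (\<lambda>s. s powr b * ?e s)"
      by (rule set_lebesgue_integral_eq_integral(2)[symmetric])
    also have "\<dots> = bessel_integral b A \<xi>"
      unfolding set_lebesgue_integral_def b[symmetric] bessel_integral_def by (simp add: integral_completion)
    finally show ?thesis .
  qed
  have ha: "?h absolutely_integrable_on {0<..}" "integral {0<..} ?h = q powr (- 3/4) * bessel_integral (- 1/4) A \<xi>"
    using sb[of "- 1/4"] ih li[of "- 1/4"] by auto
  have cv: "(\<lambda>t. \<bar>- q / t\<^sup>2\<bar> * ?f (q / t)) absolutely_integrable_on {0<..} \<and>
      integral {0<..} (\<lambda>t. \<bar>- q / t\<^sup>2\<bar> * ?f (q / t)) = q powr (- 3/4) * bessel_integral (- 1/4) A \<xi> \<longleftrightarrow>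
    ?f absolutely_integrable_on ((\<lambda>t. q / t) ` {0<..}) \<and> integral ((\<lambda>t. q / t) ` {0<..}) ?f = q powr (- 3/4) * bessel_integral (- 1/4) A \<xi>"
  proof (rule has_absolute_integral_change_of_variables_1')
    show "((\<lambda>t. q / t) has_field_derivative - q / t\<^sup>2) (at t within {0<..})" if "t \<in> {0<..}" for t
      using that by (auto intro!: derivative_eq_intros simp: power2_eq_square)
    show "inj_on (\<lambda>t. q / t) {0<..}" using q by (auto simp: inj_on_def)
  qed auto
  have "(\<lambda>t. \<bar>- q / t\<^sup>2\<bar> * ?f (q / t)) absolutely_integrable_on {0<..} \<longleftrightarrow> ?h absolutely_integrable_on {0<..}"
    by (rule set_integrable_cong) (use eq in auto)
  moreover have "integral {0<..} (\<lambda>t. \<bar>- q / t\<^sup>2\<bar> * ?f (q / t)) = integral {0<..} ?h"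
    by (rule Henstock_Kurzweil_Integration.integral_cong) (use eq in auto)
  ultimately have f: "?f absolutely_integrable_on {0<..}" "integral {0<..} ?f = q powr (- 3/4) * bessel_integral (- 1/4) A \<xi>"
    using cv ha unfolding img by auto
  show i: "integrable lborel (bessel_integrand (- 7/4) A \<xi>)" using f(1) sb by simp
  show "bessel_integral (- 7/4) A \<xi> = (\<xi>\<^sup>2 / (4 * A)) powr (- 3/4) * bessel_integral (- 1/4) A \<xi>"
    using li[OF i] f(2) by (simp add: q_def)
qed

lemma bessel_integral_by_parts:
  assumes A: "0 < A"
  shows "bessel_integral (- 3/4) A \<xi> - 4 * A * bessel_integral (1/4) A \<xi> + \<xi>\<^sup>2 * bessel_integral (- 7/4) A \<xi> = 0"
proof -
  let ?e = "\<lambda>s. exp (- (s * A) - \<xi>\<^sup>2 / (4 * s))"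
  let ?G = "\<lambda>s. 4 * (s powr (1/4) * ?e s)"
  let ?g = "\<lambda>s. s powr (- 3/4) * ?e s - 4 * A * (s powr (1/4) * ?e s) + \<xi>\<^sup>2 * (s powr (- 7/4) * ?e s)"
  have i: "integrable lborel (bessel_integrand (- 3/4) A \<xi>)" "integrable lborel (bessel_integrand (1/4) A \<xi>)"
    "integrable lborel (\<lambda>s. \<xi>\<^sup>2 * bessel_integrand (- 7/4) A \<xi> s)"
    using A bessel_integral_reflect(1)[OF A, of \<xi>]
    by (cases "\<xi> = 0"; simp add: integrable_bessel_integrand)+
  have ge: "indicator {0<..} s *\<^sub>R ?g s = bessel_integrand (- 3/4) A \<xi> s - 4 * A * bessel_integrand (1/4) A \<xi> s + \<xi>\<^sup>2 * bessel_integrand (- 7/4) A \<xi> s" for s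
    by (simp add: bessel_integrand_def algebra_simps)
  have e: "einterval 0 \<infinity> = {0::real<..}" by (auto simp: einterval_def)
  have gi: "set_integrable lborel (einterval 0 \<infinity>) ?g"
    unfolding e set_integrable_def ge using i by auto
  have "(LBINT s=0..\<infinity>. ?g s) = 0 - 0"
  proof (rule interval_integral_FTC_integrable[where F = ?G])
    show "(?G has_vector_derivative ?g s) (at s)" if "0 < ereal s" for s
    proof -
      have s: "0 < s" using that by simp
      have "s powr (1/4) / s\<^sup>2 = s powr (- 7/4)" "s powr (1/4) / s = s powr (- 3/4)"
        using s powr_diff[of s "1/4" 2] powr_diff[of s "1/4" 1] by (simp_all add: powr_numeral)
      then show ?thesis
        unfolding has_real_derivative_iff_has_vector_derivative[symmetric]
        using s by (auto intro!: derivative_eq_intros simp: power2_eq_square field_simps)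
    qed
    show "isCont ?g s" if "0 < ereal s" for s
      using that by (auto intro!: continuous_intros)
    have "((\<lambda>s. ?G s) \<longlongrightarrow> 0) (at_right 0)"
    proof (rule tendsto_sandwich[of "\<lambda>s. 0" _ _ "\<lambda>s. 4 * s powr (1/4)"])
      have "((\<lambda>s::real. s powr (1/4)) \<longlongrightarrow> 0 powr (1/4)) (at_right 0)"
        by (rule tendsto_powr') (auto simp: eventually_at_right_less eventually_at_filter intro: tendsto_ident_at)
      then show "((\<lambda>s::real. 4 * s powr (1/4)) \<longlongrightarrow> 0) (at_right 0)"
        using tendsto_mult_right_zero by fastforce
      show "eventually (\<lambda>s. ?G s \<le> 4 * s powr (1/4)) (at_right 0)"
        unfolding eventually_at_right_field using A by (intro exI[of _ 1]) (auto simp: mult_le_cancel_left1 intro: order_trans[of _ 0])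
    qed auto
    then show "((?G \<circ> real_of_ereal) \<longlongrightarrow> 0) (at_right 0)"
      by (simp only: zero_ereal_def ereal_tendsto_simps)
    have "((\<lambda>s. ?G s) \<longlongrightarrow> 0) at_top"
    proof (rule tendsto_sandwich[of "\<lambda>s. 0" _ _ "\<lambda>s. 8 / A\<^sup>2 * inverse s"])
      have "((\<lambda>s::real. 8 / A\<^sup>2 * inverse s) \<longlongrightarrow> 8 / A\<^sup>2 * 0) at_top"
        by (intro tendsto_intros tendsto_inverse_0_at_top filterlim_ident)
      then show "((\<lambda>s::real. 8 / A\<^sup>2 * inverse s) \<longlongrightarrow> 0) at_top" by simp
      have "?G s \<le> 8 / A\<^sup>2 * inverse s" if "1 < s" for s
      proof -
        have "(s * A)\<^sup>2 / 2 \<le> exp (s * A)"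
        proof -
          have "0 < s * A" using that A by simp
          then show ?thesis using exp_lower_Taylor_quadratic[of "s * A"] by linarith
        qed
        then have "inverse (exp (s * A)) \<le> inverse ((s * A)\<^sup>2 / 2)"
          using that A by (intro le_imp_inverse_le) auto
        then have 1: "exp (- (s * A)) \<le> 2 / (s * A)\<^sup>2" by (metis exp_minus inverse_divide)
        have "?e s \<le> exp (- (s * A))" using that by simp
        then have 2: "?e s \<le> 2 / (s * A)\<^sup>2" using 1 by (rule order_trans)
        moreover have "s powr (1/4) \<le> s powr 1" using that by (intro powr_mono) auto
        ultimately have "s powr (1/4) * ?e s \<le> s * (2 / (s * A)\<^sup>2)"
          using that by (intro mult_mono 2) auto
        also have "\<dots> = 2 / A\<^sup>2 * inverse s" using that by (simp add: power2_eq_square divide_inverse)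
        finally show ?thesis by simp
      qed
      then show "eventually (\<lambda>s. ?G s \<le> 8 / A\<^sup>2 * inverse s) at_top"
        using eventually_gt_at_top[of 1] by (rule eventually_mono[rotated]) auto
    qed auto
    then show "((?G \<circ> real_of_ereal) \<longlongrightarrow> 0) (at_left \<infinity>)"
      by (simp only: ereal_tendsto_simps)
  qed (use gi in auto)
  then have "(LINT s|lborel. indicator {0<..} s *\<^sub>R ?g s) = 0"
    by (simp add: interval_lebesgue_integral_def e set_lebesgue_integral_def)
  then show ?thesis unfolding ge using i by (simp add: bessel_integral_def)
qed


definition flux_kernel :: "real \<Rightarrow> real \<Rightarrow> real" where
  "flux_kernel z h = ext_const * (ker 0 0 (3/4) z h - 3/4 * ker 4 0 (7/4) z h)"

definition flux_const :: real where
  "flux_const = 2 * c_star * japanese_integral (5/4) * Gamma (5/4) / Gamma (3/4)"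

lemma flux_const_pos: "0 < flux_const"
  unfolding flux_const_def using c_star_pos japanese_integral_pos[of "5/4"]
  by (intro divide_pos_pos mult_pos_pos Gamma_real_pos) auto

lemma ext_const_pos: "0 < ext_const"
  unfolding ext_const_def using c_star_pos by simp

lemma flux_kernel_measurable [measurable]: "flux_kernel z \<in> borel_measurable borel"
  unfolding flux_kernel_def[abs_def] by measurable

lemma flux_kernel_even: "flux_kernel z (- h) = flux_kernel z h"
  by (simp add: flux_kernel_def ker_def)

lemma flux_kernel_commute: "flux_kernel z (x - t) = flux_kernel z (t - x)"
  using flux_kernel_even[of z "t - x"] by simp

lemma abs_flux_kernel_le:
  assumes "0 < z"
  shows "\<bar>flux_kernel z h\<bar> \<le> 2 * ext_const * (h\<^sup>2 + z ^ 4 / 4) powr (- (3/4))"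
proof -
  let ?S = "h\<^sup>2 + z ^ 4 / 4"
  have S: "0 < ?S" using square_plus_pos assms by auto
  have "?S powr (- (3/4)) = ?S powr (- (7/4) + 1)" by simp
  also have "\<dots> = ?S powr (- (7/4)) * ?S" using S by (subst powr_add) simp
  finally have e: "?S powr (- (3/4)) = ?S powr (- (7/4)) * ?S" .
  have "flux_kernel z h = ext_const * (?S powr (- (7/4)) * (?S - 3/4 * z ^ 4))"
    by (simp add: flux_kernel_def ker_def e algebra_simps)
  then have "\<bar>flux_kernel z h\<bar> = ext_const * (?S powr (- (7/4)) * \<bar>?S - 3/4 * z ^ 4\<bar>)"
    using ext_const_pos by (simp add: abs_mult)
  also have "\<dots> \<le> ext_const * (?S powr (- (7/4)) * (2 * ?S))"
  proof (intro mult_left_mono)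
    have "\<bar>b + a / 4 - 3/4 * a\<bar> \<le> 2 * (b + a / 4)" if "0 \<le> a" "0 \<le> b" for a b :: real
      using that by (auto simp: abs_if)
    from this[of "z ^ 4" "h\<^sup>2"] show "\<bar>?S - 3/4 * z ^ 4\<bar> \<le> 2 * ?S" by simp
  qed (use ext_const_pos in auto)
  finally show ?thesis unfolding e by (simp only: mult_ac)
qed

lemma abs_flux_kernel_le_powr:
  assumes "0 < z" "h \<noteq> 0"
  shows "\<bar>flux_kernel z h\<bar> \<le> 2 * ext_const * \<bar>h\<bar> powr (- (3/2))"
proof -
  have "(h\<^sup>2 + z ^ 4 / 4) powr (- (3/4)) \<le> (\<bar>h\<bar>\<^sup>2) powr (- (3/4))"
    using assms by (intro powr_mono2') auto
  also have "\<bar>h\<bar>\<^sup>2 = \<bar>h\<bar> powr 2" using assms by (simp add: powr_numeral)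
  also have "\<dots> powr (- (3/4)) = \<bar>h\<bar> powr (- (3/2))" by (subst powr_powr) simp
  finally have "2 * ext_const * (h\<^sup>2 + z ^ 4 / 4) powr (- (3/4)) \<le> 2 * ext_const * \<bar>h\<bar> powr (- (3/2))"
    using ext_const_pos by (intro mult_left_mono) auto
  then show ?thesis using abs_flux_kernel_le[OF assms(1), of h] by linarith
qed

lemma flux_kernel_weight_bound:
  assumes "0 < z"
  obtains C where "0 \<le> C" "\<And>h. \<bar>flux_kernel z h\<bar> \<le> C * weight h"
    "\<And>x t. \<bar>flux_kernel z (x - t)\<bar> \<le> C * (1 + x\<^sup>2) * weight t"
proof -
  let ?k = "min 1 (z ^ 4 / 4)"
  define C where "C = 2 * ext_const * ?k powr (- (3/4))"
  have C: "0 \<le> C" unfolding C_def using ext_const_pos by simp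
  have 1: "\<bar>flux_kernel z h\<bar> \<le> C * weight h" for h
  proof -
    have "?k * h\<^sup>2 \<le> 1 * h\<^sup>2" by (intro mult_right_mono) auto
    then have "?k * (1 + h\<^sup>2) \<le> h\<^sup>2 + z ^ 4 / 4" by (simp add: algebra_simps min_def split: if_splits)
    then have "(h\<^sup>2 + z ^ 4 / 4) powr (- (3/4)) \<le> ?k powr (- (3/4)) * weight h"
      using assms by (intro powr_neg_le_weight) auto
    then have "2 * ext_const * (h\<^sup>2 + z ^ 4 / 4) powr (- (3/4)) \<le> 2 * ext_const * (?k powr (- (3/4)) * weight h)"
      using ext_const_pos by (intro mult_left_mono) auto
    then show ?thesis using abs_flux_kernel_le[OF assms, of h] by (simp add: C_def mult.assoc)
  qed
  show ?thesis
  proof (rule that[of "2 * C"])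
    show "\<bar>flux_kernel z h\<bar> \<le> 2 * C * weight h" for h
      using 1[of h] mult_nonneg_nonneg[OF C weight_nonneg[of h]] by linarith
    show "\<bar>flux_kernel z (x - t)\<bar> \<le> 2 * C * (1 + x\<^sup>2) * weight t" for x t
    proof -
      have "\<bar>flux_kernel z (x - t)\<bar> \<le> C * (2 * (1 + x\<^sup>2) * weight t)"
        using 1[of "x - t"] mult_left_mono[OF weight_shift[of x t] C] by linarith
      also have "\<dots> = 2 * C * (1 + x\<^sup>2) * weight t" by (simp only: mult_ac)
      finally show ?thesis .
    qed
  qed (use C in simp)
qed

lemma integrable_flux_kernel: "0 < z \<Longrightarrow> integrable lborel (flux_kernel z)"
proof -
  assume "0 < z"
  then obtain C where C: "0 \<le> C" "\<And>h. \<bar>flux_kernel z h\<bar> \<le> C * weight h"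
    using flux_kernel_weight_bound by metis
  show ?thesis
    by (rule Bochner_Integration.integrable_bound[where f = "\<lambda>h. C * weight h"])
      (use C integrable_weight in \<open>auto intro!: order_trans[OF C(2)]\<close>)
qed

lemma integrable_flux_conv:
  assumes "weighted_L1 f" "0 < z"
  shows "integrable lborel (\<lambda>t. of_real (flux_kernel z (x - t)) * f t)"
proof -
  obtain C where C: "\<And>x t. \<bar>flux_kernel z (x - t)\<bar> \<le> C * (1 + x\<^sup>2) * weight t"
    using flux_kernel_weight_bound[OF assms(2)] by metis
  show ?thesis by (rule integrable_weighted_bound[OF assms(1) _ C]) measurable
qed

lemma W_z_eq_flux:
  assumes "weighted_L1 f" "0 < z"
  shows "W_z f (x, z) = (LINT t|lborel. of_real (flux_kernel z (x - t)) * f t)"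
proof -
  have "integrable lborel (\<lambda>t. of_real (ker 0 0 (3/4) z (x - t)) * f t)" "integrable lborel (\<lambda>t. of_real (ker 4 0 (7/4) z (x - t)) * f t)"
    using assms by (auto intro!: integrable_pot)
  then have "(LINT t|lborel. of_real ext_const * (of_real (ker 0 0 (3/4) z (x - t)) * f t - 3/4 * (of_real (ker 4 0 (7/4) z (x - t)) * f t))) = W_z f (x, z)"
    by (simp add: W_z_def pot_def)
  then show ?thesis by (simp add: flux_kernel_def algebra_simps)
qed

lemma ft_cmult: "ft (\<lambda>x. c * k x) \<xi> = c * ft k \<xi>"
  unfolding ft_def by (subst integral_mult_right_zero[symmetric]) (simp add: mult.left_commute)

lemma ft_flux_kernel:
  assumes z: "0 < z"
  shows "ft (\<lambda>h. of_real (flux_kernel z h)) \<xi> =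
    - of_real (flux_const * \<bar>\<xi>\<bar> powr (1/2)) * ft (\<lambda>h. of_real (gen_poisson (5/4) (z\<^sup>2 / 2) h)) \<xi>"
proof -
  define A where "A = z ^ 4 / 4"
  define y where "y = z\<^sup>2 / 2"
  have A: "0 < A" "z ^ 4 = 4 * A" and y: "0 < y" "y\<^sup>2 = A"
    using z powr_quarter_power4[OF z] by (auto simp: A_def y_def)
  have G34: "0 < Gamma (3/4 :: real)" "0 < Gamma (5/4 :: real)" by (auto intro!: Gamma_real_pos)
  have "Gamma (3/4 + 1 :: real) = 3/4 * Gamma (3/4)" by (rule Gamma_plus1) (auto dest: nonpos_Ints_nonpos)
  then have G: "Gamma (7/4 :: real) = 3/4 * Gamma (3/4)" by simp
  have J: "0 < japanese_integral (5/4)" by (rule japanese_integral_pos) simp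
  let ?B = "\<lambda>b. bessel_integral b A \<xi>"
  let ?k1 = "\<lambda>h. (h\<^sup>2 + A) powr (- (3/4))" and ?k2 = "\<lambda>h. (h\<^sup>2 + A) powr (- (7/4))" 
  have i: "integrable lborel (\<lambda>h. of_real (?k1 h) :: complex)" "integrable lborel (\<lambda>h. of_real (?k2 h) :: complex)"
    using has_bochner_integral_square_plus_powr[of "3/4" y] has_bochner_integral_square_plus_powr[of "7/4" y] y
    by (simp_all add: has_bochner_integral_iff)
  have fk: "(\<lambda>h. of_real (flux_kernel z h)) = (\<lambda>h. of_real ext_const * (of_real (?k1 h) - of_real (3 * A) * of_real (?k2 h) :: complex))"
    by (simp add: fun_eq_iff flux_kernel_def ker_def A(2))
  have "ft (\<lambda>h. of_real (flux_kernel z h)) \<xi> = of_real ext_const * ft (\<lambda>h. of_real (?k1 h) - of_real (3 * A) * of_real (?k2 h)) \<xi>"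
    unfolding fk by (rule ft_cmult)
  also have "ft (\<lambda>h. of_real (?k1 h) - of_real (3 * A) * of_real (?k2 h)) \<xi> = ft (\<lambda>h. of_real (?k1 h)) \<xi> - of_real (3 * A) * ft (\<lambda>h. of_real (?k2 h)) \<xi>"
  proof -
    have "ft (\<lambda>h. of_real (?k1 h) - of_real (3 * A) * of_real (?k2 h)) \<xi> = ft (\<lambda>h. of_real (?k1 h)) \<xi> - ft (\<lambda>h. of_real (3 * A) * of_real (?k2 h)) \<xi>"
      unfolding ft_def right_diff_distrib
      by (intro Bochner_Integration.integral_diff integrable_exp_i_mult i integrable_mult_right)
    then show ?thesis unfolding ft_cmult .
  qed
  also have "ft (\<lambda>h. of_real (?k1 h)) \<xi> = of_real (sqrt pi / Gamma (3/4) * ?B (- 3/4))"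
    using ft_square_plus_powr[of "3/4" A \<xi>] A by simp
  also have "ft (\<lambda>h. of_real (?k2 h)) \<xi> = of_real (sqrt pi / Gamma (7/4) * ?B (1/4))"
    using ft_square_plus_powr[of "7/4" A \<xi>] A by simp
  finally have 1: "ft (\<lambda>h. of_real (flux_kernel z h)) \<xi> =
     of_real (ext_const * (sqrt pi / Gamma (3/4) * ?B (- 3/4) - 3 * A * (sqrt pi / Gamma (7/4) * ?B (1/4))))"
    by simp
  have "sqrt pi / Gamma (3/4) * ?B (- 3/4) - 3 * A * (sqrt pi / Gamma (7/4) * ?B (1/4)) =
      sqrt pi / Gamma (3/4) * (?B (- 3/4) - 4 * A * ?B (1/4))"
    unfolding G using G34 by (simp add: field_simps, simp add: diff_divide_distrib)
  also have "?B (- 3/4) - 4 * A * ?B (1/4) = - (\<xi>\<^sup>2 * ?B (- 7/4))"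
    using bessel_integral_by_parts[OF A(1), of \<xi>] by linarith
  also have "\<xi>\<^sup>2 * ?B (- 7/4) = \<bar>\<xi>\<bar> powr (1/2) * z ^ 3 * ?B (- 1/4)"
  proof (cases "\<xi> = 0")
    case False
    have p: "0 < \<xi>\<^sup>2" using False by simp
    have "\<xi>\<^sup>2 * (\<xi>\<^sup>2 / (4 * A)) powr (- 3/4) = (\<xi>\<^sup>2) powr 1 * ((\<xi>\<^sup>2) powr (- 3/4) / (z ^ 4) powr (- 3/4))"
      using p z A by (simp add: powr_divide)
    also have "\<dots> = (\<xi>\<^sup>2) powr (1/4) * (1 / (z ^ 4) powr (- (3/4)))"
    proof -
      have "(\<xi>\<^sup>2) powr 1 * (\<xi>\<^sup>2) powr (- 3/4) = (\<xi>\<^sup>2) powr (1/4)"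
        by (simp only: powr_add[symmetric]) simp
      then show ?thesis by (simp only: times_divide_eq_right) simp
    qed
    also have "(\<xi>\<^sup>2) powr (1/4) = \<bar>\<xi>\<bar> powr (1/2)"
    proof -
      have "\<xi>\<^sup>2 = \<bar>\<xi>\<bar> powr 2" using False by (simp add: powr_numeral)
      then show ?thesis by (simp only: powr_powr) simp
    qed
    also have "1 / (z ^ 4) powr (- (3/4)) = z ^ 3"
    proof -
      have "z ^ 4 = z powr 4" "z ^ 3 = z powr 3" using z by (simp_all add: powr_numeral)
      then show ?thesis by (simp only: powr_minus_divide[symmetric] powr_powr) simp
    qed
    finally show ?thesis using bessel_integral_reflect(2)[OF A(1) False] by (simp add: mult.assoc[symmetric])
  qed simp
  finally have 2: "ft (\<lambda>h. of_real (flux_kernel z h)) \<xi> =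
     of_real (- (ext_const * sqrt pi / Gamma (3/4) * \<bar>\<xi>\<bar> powr (1/2) * z ^ 3 * ?B (- 1/4)))"
    unfolding 1 by simp
  have gp: "(\<lambda>h. of_real (gen_poisson (5/4) y h)) = (\<lambda>h. of_real (y powr (3/2) / japanese_integral (5/4)) * of_real ((h\<^sup>2 + A) powr (- (5/4))) :: complex)"
    using y by (simp add: fun_eq_iff gen_poisson_def)
  have "ft (\<lambda>h. of_real (gen_poisson (5/4) y h)) \<xi> = of_real (y powr (3/2) / japanese_integral (5/4)) * of_real (sqrt pi / Gamma (5/4) * ?B (- 1/4))"
    using ft_square_plus_powr[of "5/4" A \<xi>] A unfolding gp ft_cmult by simp
  then have 3: "ft (\<lambda>h. of_real (gen_poisson (5/4) y h)) \<xi> = of_real (y powr (3/2) / japanese_integral (5/4) * (sqrt pi / Gamma (5/4) * ?B (- 1/4)))"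
    by simp
  have "y powr (3/2) = z ^ 3 / (2 * sqrt 2)"
  proof -
    have "y powr (3/2) = y powr (1 + 1/2)" by simp
    also have "\<dots> = y * sqrt y" using y by (subst powr_add) (simp add: powr_half_sqrt)
    also have "\<dots> = z ^ 3 / (2 * sqrt 2)" using z by (simp add: y_def real_sqrt_divide power3_eq_cube power2_eq_square)
    finally show ?thesis .
  qed
  moreover have "Gamma (3/4 :: real) \<noteq> 0" "Gamma (5/4 :: real) \<noteq> 0" "japanese_integral (5/4) \<noteq> 0"
    using less_imp_neq[OF G34(1), THEN not_sym] less_imp_neq[OF G34(2), THEN not_sym] less_imp_neq[OF J, THEN not_sym] .
  moreover have "sqrt 2 * sqrt 2 = (2 :: real)" by simp
  ultimately have "ext_const * sqrt pi / Gamma (3/4) * \<bar>\<xi>\<bar> powr (1/2) * z ^ 3 * ?B (- 1/4) =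
     (flux_const * \<bar>\<xi>\<bar> powr (1/2)) * (y powr (3/2) / japanese_integral (5/4) * (sqrt pi / Gamma (5/4) * ?B (- 1/4)))"
    by (simp only: flux_const_def ext_const_def) (simp add: divide_simps)
  then show ?thesis unfolding 2 3 y_def[symmetric] by (simp only: of_real_minus of_real_mult minus_mult_left)
qed

lemma integral_flux_kernel: "0 < z \<Longrightarrow> integral\<^sup>L lborel (flux_kernel z) = 0"
  using ft_flux_kernel[of z 0] by (simp add: ft_def)

definition quadratic_decay :: "real \<Rightarrow> (real \<Rightarrow> complex) \<Rightarrow> bool" where
  "quadratic_decay N \<phi> \<longleftrightarrow> (\<forall>x. \<phi> differentiable (at x)) \<and>
     (\<forall>x. norm (\<phi> x) \<le> N / (1 + x\<^sup>2)) \<and> (\<forall>x. norm (D1 \<phi> x) \<le> N / (1 + x\<^sup>2))"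

lemma D1_has_vector_derivative: "\<phi> differentiable (at x) \<Longrightarrow> (\<phi> has_vector_derivative D1 \<phi> x) (at x)"
  unfolding D1_def by (simp add: vector_derivative_works)

lemma one_plus_square_pos [simp]: "0 < 1 + (x::real)\<^sup>2" by (auto intro: add_pos_nonneg)

lemma borel_measurable_differentiable:
  fixes \<phi> :: "real \<Rightarrow> complex"
  assumes "\<And>x. \<phi> differentiable (at x)" shows "\<phi> \<in> borel_measurable borel"
  using assms by (intro borel_measurable_continuous_onI continuous_at_imp_continuous_on)
    (auto intro: differentiable_imp_continuous_within)

lemma integrable_inverse_one_plus_square: "integrable lborel (\<lambda>x::real. 1 / (1 + x\<^sup>2))"
proof -
  have "(1 + x\<^sup>2) powr (- 1) = 1 / (1 + x\<^sup>2)" for x :: real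
    using one_plus_square_pos[of x] by (simp add: powr_minus divide_inverse)
  then show ?thesis using integrable_one_plus_square_powr[of 1] by simp
qed

lemma integral_inverse_one_plus_square: "(LINT x|lborel. 1 / (1 + x\<^sup>2)) = japanese_integral 1"
proof -
  have "(1 + x\<^sup>2) powr (- 1) = 1 / (1 + x\<^sup>2)" for x :: real
    using one_plus_square_pos[of x] by (simp add: powr_minus divide_inverse)
  then show ?thesis by (simp add: japanese_integral_def)
qed

lemma integrable_quadratic_decay:
  fixes \<phi> :: "real \<Rightarrow> complex"
  assumes [measurable]: "\<phi> \<in> borel_measurable borel" and "\<And>x. norm (\<phi> x) \<le> N / (1 + x\<^sup>2)"
  shows "integrable lborel \<phi>" "(LINT x|lborel. norm (\<phi> x)) \<le> N * japanese_integral 1"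
proof -
  have i: "integrable lborel (\<lambda>x. N * (1 / (1 + x\<^sup>2)))"
    using integrable_inverse_one_plus_square by (rule integrable_mult_right)
  show 1: "integrable lborel \<phi>"
    by (rule Bochner_Integration.integrable_bound[OF i])
      (auto intro!: order_trans[OF assms(2)] divide_right_mono)
  have "(LINT x|lborel. norm (\<phi> x)) \<le> (LINT x|lborel. N * (1 / (1 + x\<^sup>2)))"
    using assms(2) by (intro integral_mono integrable_norm 1 i) auto
  also have "\<dots> = N * japanese_integral 1" by (subst integral_mult_right_zero) (simp only: integral_inverse_one_plus_square)
  finally show "(LINT x|lborel. norm (\<phi> x)) \<le> N * japanese_integral 1" .
qed

definition flux_bound_const :: real where
  "flux_bound_const = (48 + 8 * japanese_integral 1) * ext_const"

lemma flux_bound_const_nonneg: "0 \<le> flux_bound_const"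
  unfolding flux_bound_const_def using ext_const_pos japanese_integral_pos[of 1] by simp

lemma norm_flux_conv_le:
  assumes z: "0 < z" and \<phi>: "quadratic_decay N \<phi>"
  shows "norm (LINT t|lborel. of_real (flux_kernel z (x - t)) * \<phi> t) \<le> flux_bound_const * N * weight x"
proof -
  have d: "\<And>x. \<phi> differentiable (at x)" and b: "\<And>x. norm (\<phi> x) \<le> N / (1 + x\<^sup>2)" "\<And>x. norm (D1 \<phi> x) \<le> N / (1 + x\<^sup>2)"
    using \<phi> by (auto simp: quadratic_decay_def)
  have [measurable]: "\<phi> \<in> borel_measurable borel" using d by (rule borel_measurable_differentiable)
  have N: "0 \<le> N" using order_trans[OF norm_ge_zero b(1)[of 0]] by simp
  have B: "norm (\<phi> x) \<le> N" for x
  proof -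
    have "N / (1 + x\<^sup>2) \<le> N / 1" using N by (intro divide_left_mono) auto
    then show ?thesis using b(1)[of x] by simp
  qed
  note \<phi>i = integrable_quadratic_decay[OF \<open>\<phi> \<in> borel_measurable borel\<close> b(1)]
  define R where "R = sqrt (1 + x\<^sup>2)"
  define r where "r = R / 2"
  have R: "1 \<le> R" "R\<^sup>2 = 1 + x\<^sup>2" by (auto simp: R_def)
  have r: "0 < r" using R by (simp add: r_def)
  define e where "e = ext_const"
  have e: "0 < e" using ext_const_pos by (simp add: e_def)
  have mv: "norm (\<phi> (x - h) - \<phi> x) \<le> 4 * N / R\<^sup>2 * \<bar>h\<bar>" if "\<bar>h\<bar> \<le> r" for h
  proof -
    have D: "norm (D1 \<phi> t) \<le> 4 * N / R\<^sup>2" if "\<bar>t - x\<bar> \<le> r" for t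
    proof -
      have "(x - t)\<^sup>2 \<le> r\<^sup>2" using that by (metis abs_minus_commute abs_le_square_iff abs_of_pos r)
      then have "(x - t)\<^sup>2 \<le> R\<^sup>2 / 4" by (simp add: r_def power_divide)
      moreover have "0 \<le> (2 * t - x)\<^sup>2" by simp
      moreover have "x\<^sup>2 = 2 * t\<^sup>2 + 2 * (x - t)\<^sup>2 - (2 * t - x)\<^sup>2" by (simp add: power2_eq_square algebra_simps)
      ultimately have "R\<^sup>2 / 4 \<le> 1 + t\<^sup>2" using R(2) zero_le_power2[of t] by linarith
      then have "N / (1 + t\<^sup>2) \<le> N / (R\<^sup>2 / 4)" using N R by (intro divide_left_mono) auto
      then show ?thesis using b(2)[of t] by (simp add: mult.commute)
    qed
    have "norm (\<phi> (x - h) - \<phi> x) \<le> 4 * N / R\<^sup>2 * norm (x - h - x)"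
    proof (rule differentiable_bound[of "{x - r..x + r}" \<phi> "\<lambda>t s. s *\<^sub>R D1 \<phi> t"])
      show "(\<phi> has_derivative (\<lambda>s. s *\<^sub>R D1 \<phi> t)) (at t within {x - r..x + r})" for t
        using D1_has_vector_derivative[OF d, of t] unfolding has_vector_derivative_def
        by (rule has_derivative_at_withinI)
      show "onorm (\<lambda>s. s *\<^sub>R D1 \<phi> t) \<le> 4 * N / R\<^sup>2" if "t \<in> {x - r..x + r}" for t
      proof (rule onorm_bound)
        show "norm (s *\<^sub>R D1 \<phi> t) \<le> 4 * N / R\<^sup>2 * norm s" for s
        proof -
          have "\<bar>t - x\<bar> \<le> r" using that by (auto simp: abs_le_iff)
          then show ?thesis using mult_right_mono[OF D[of t], of "norm s"] by (simp add: mult.commute)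
        qed
      qed (use N in auto)
    qed (use that in auto)
    then show ?thesis by simp
  qed
  let ?k = "\<lambda>h. of_real (flux_kernel z h) :: complex"
  define J where "J h = 8 * e * N / R\<^sup>2 * (indicator {h. \<bar>h\<bar> \<le> r} h * \<bar>h\<bar> powr (- (1/2))) +
     2 * e * r powr (- (3/2)) * norm (\<phi> (x - h)) +
     2 * e * norm (\<phi> x) * (indicator {h. r \<le> \<bar>h\<bar>} h * \<bar>h\<bar> powr (- (3/2)))" for h
  have Ji: "has_bochner_integral lborel J (8 * e * N / R\<^sup>2 * (2 * r powr (1 - 1/2) / (1 - 1/2)) +
     2 * e * r powr (- (3/2)) * (LINT t|lborel. norm (\<phi> t)) + 2 * e * norm (\<phi> x) * (2 * r powr (1 - 3/2) / (3/2 - 1)))"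
  proof -
    have "has_bochner_integral lborel (\<lambda>h. norm (\<phi> (x - h))) (LINT t|lborel. norm (\<phi> t))"
      using integrable_reflect_shift[OF integrable_norm[OF \<phi>i(1)], of x] integral_reflect_shift[of "\<lambda>t. norm (\<phi> t)" x]
      by (simp add: has_bochner_integral_iff)
    then show ?thesis unfolding J_def[abs_def]
      using has_bochner_integral_abs_powr_local[of "1/2" r] has_bochner_integral_abs_powr_tail[of "3/2" r] r
      by (intro has_bochner_integral_add has_bochner_integral_mult_right) auto
  qed
  have JB: "norm (?k h * (\<phi> (x - h) - \<phi> x)) \<le> J h" if "h \<noteq> 0" for h
  proof -
    have k: "\<bar>flux_kernel z h\<bar> \<le> 2 * e * \<bar>h\<bar> powr (- (3/2))"
      using abs_flux_kernel_le_powr[OF z that] by (simp add: e_def)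
    have J0: "0 \<le> 8 * e * N / R\<^sup>2 * (indicator {h. \<bar>h\<bar> \<le> r} h * \<bar>h\<bar> powr (- (1/2)))"
      "0 \<le> 2 * e * r powr (- (3/2)) * norm (\<phi> (x - h))"
      "0 \<le> 2 * e * norm (\<phi> x) * (indicator {h. r \<le> \<bar>h\<bar>} h * \<bar>h\<bar> powr (- (3/2)))"
      using e N by auto
    show ?thesis
    proof (cases "\<bar>h\<bar> \<le> r")
      case True
      have "norm (?k h * (\<phi> (x - h) - \<phi> x)) \<le> (2 * e * \<bar>h\<bar> powr (- (3/2))) * (4 * N / R\<^sup>2 * \<bar>h\<bar>)"
        unfolding norm_mult norm_of_real using k mv[OF True] e by (intro mult_mono) auto
      also have "\<dots> = 8 * e * N / R\<^sup>2 * (\<bar>h\<bar> powr (- (3/2)) * \<bar>h\<bar> powr 1)" using that by simp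
      also have "\<bar>h\<bar> powr (- (3/2)) * \<bar>h\<bar> powr 1 = \<bar>h\<bar> powr (- (1/2))"
        by (simp only: powr_add[symmetric]) simp
      finally have le: "norm (?k h * (\<phi> (x - h) - \<phi> x)) \<le> 8 * e * N / R\<^sup>2 * \<bar>h\<bar> powr (- (1/2))" .
      have "J h = 8 * e * N / R\<^sup>2 * \<bar>h\<bar> powr (- (1/2)) + 2 * e * r powr (- (3/2)) * norm (\<phi> (x - h)) +
          2 * e * norm (\<phi> x) * (indicator {h. r \<le> \<bar>h\<bar>} h * \<bar>h\<bar> powr (- (3/2)))"
        using True by (simp add: J_def)
      then show ?thesis using le J0(2,3) by linarith
    next
      case False
      have "\<bar>h\<bar> powr (- (3/2)) \<le> r powr (- (3/2))" using False r by (intro powr_mono2') auto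
      then have k2: "\<bar>flux_kernel z h\<bar> \<le> 2 * e * r powr (- (3/2))"
        using k e by (meson mult_left_mono order_trans less_imp_le mult_nonneg_nonneg zero_le_numeral)
      have "norm (?k h * (\<phi> (x - h) - \<phi> x)) \<le> \<bar>flux_kernel z h\<bar> * (norm (\<phi> (x - h)) + norm (\<phi> x))"
        unfolding norm_mult norm_of_real by (intro mult_left_mono norm_triangle_ineq4) auto
      also have "\<dots> = \<bar>flux_kernel z h\<bar> * norm (\<phi> (x - h)) + \<bar>flux_kernel z h\<bar> * norm (\<phi> x)" by (simp add: distrib_left)
      also have "\<dots> \<le> (2 * e * r powr (- (3/2))) * norm (\<phi> (x - h)) + (2 * e * \<bar>h\<bar> powr (- (3/2))) * norm (\<phi> x)"
        using k k2 by (intro add_mono mult_right_mono) auto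
      also have "\<dots> = J h" using False by (simp add: J_def)
      finally show ?thesis .
    qed
  qed
  have ki: "integrable lborel ?k" using integrable_flux_kernel[OF z] by simp
  have kpi: "integrable lborel (\<lambda>h. ?k h * \<phi> (x - h))"
    by (rule integrable_bounded_mult[OF ki]) (use B in auto)
  have "(LINT t|lborel. of_real (flux_kernel z (x - t)) * \<phi> t) = (LINT h|lborel. ?k h * \<phi> (x - h))"
    using integral_reflect_shift[of "\<lambda>t. of_real (flux_kernel z (x - t)) * \<phi> t" x] by simp
  also have "\<dots> = (LINT h|lborel. ?k h * \<phi> (x - h)) - (LINT h|lborel. ?k h * \<phi> x)"
    using integral_flux_kernel[OF z] by simp
  also have "\<dots> = (LINT h|lborel. ?k h * (\<phi> (x - h) - \<phi> x))"
    using kpi ki by (simp add: right_diff_distrib)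
  finally have "norm (LINT t|lborel. of_real (flux_kernel z (x - t)) * \<phi> t) \<le> (LINT h|lborel. norm (?k h * (\<phi> (x - h) - \<phi> x)))"
    by simp
  also have "\<dots> \<le> integral\<^sup>L lborel J"
  proof (rule integral_mono_AE)
    show "integrable lborel (\<lambda>h. norm (?k h * (\<phi> (x - h) - \<phi> x)))"
      using Bochner_Integration.integrable_diff[OF kpi integrable_mult_left[OF ki, of "\<phi> x"]] by (simp add: right_diff_distrib)
    show "integrable lborel J" using Ji by (simp add: has_bochner_integral_iff)
    show "AE h in lborel. norm (?k h * (\<phi> (x - h) - \<phi> x)) \<le> J h"
      using AE_lborel_singleton[of 0] by eventually_elim (rule JB)
  qed
  also have "\<dots> = 8 * e * N / R\<^sup>2 * (4 * r powr (1/2)) +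
     2 * e * r powr (- (3/2)) * (LINT t|lborel. norm (\<phi> t)) + 2 * e * norm (\<phi> x) * (4 * r powr (- (1/2)))"
    using has_bochner_integral_integral_eq[OF Ji] by simp
  also have "\<dots> \<le> 8 * e * N / R\<^sup>2 * (4 * R powr (1/2)) +
     2 * e * (4 * R powr (- (3/2))) * (N * japanese_integral 1) + 2 * e * (N / R\<^sup>2) * (4 * (2 * R powr (1/2)))"
  proof (intro add_mono mult_left_mono mult_mono)
    show "r powr (1/2) \<le> R powr (1/2)" using r R by (intro powr_mono2) (auto simp: r_def)
    have "(1/2 :: real) powr (- (3/2)) = 2 powr (3/2)" by (simp add: powr_divide powr_minus)
    also have "\<dots> \<le> 2 powr 2" by (intro powr_mono) auto
    finally show "r powr (- (3/2)) \<le> 4 * R powr (- (3/2))"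
      using powr_mult[of "1/2" R "- (3/2)"] by (simp add: r_def mult_right_mono powr_numeral)
    have "(1/2 :: real) powr (- (1/2)) = 2 powr (1/2)" by (simp add: powr_divide powr_minus)
    also have "\<dots> \<le> 2 powr 1" by (intro powr_mono) auto
    finally have "r powr (- (1/2)) \<le> 2 * R powr (- (1/2))"
      using powr_mult[of "1/2" R "- (1/2)"] by (simp add: r_def mult_right_mono)
    also have "R powr (- (1/2)) \<le> R powr (1/2)" using R by (intro powr_mono) auto
    finally show "r powr (- (1/2)) \<le> 2 * R powr (1/2)" by simp
    show "norm (\<phi> x) \<le> N / R\<^sup>2" using b(1)[of x] by (simp add: R)
  qed (use e N \<phi>i(2) in auto)
  also have "\<dots> = 48 * e * N * (R powr (1/2) / R\<^sup>2) + 8 * japanese_integral 1 * e * N * R powr (- (3/2))"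
    by (simp add: field_simps)
  also have "R powr (1/2) / R\<^sup>2 = R powr (- (3/2))"
  proof -
    have "R powr (1/2 - 2) = R powr (1/2) / R powr 2" by (rule powr_diff)
    then show ?thesis using R by (simp add: powr_numeral)
  qed
  also have "R powr (- (3/2)) = weight x"
  proof -
    have "R = (1 + x\<^sup>2) powr (1/2)" by (simp add: R_def powr_half_sqrt)
    then show ?thesis by (simp add: powr_powr weight_def)
  qed
  finally show ?thesis by (simp add: flux_bound_const_def e_def algebra_simps)
qed


lemma schwartz_differentiable: "schwartz \<phi> \<Longrightarrow> (D1 ^^ n) \<phi> differentiable (at x)"
  by (simp add: schwartz_def)

lemma schwartz_decay:
  assumes "schwartz \<phi>"
  obtains N where "\<And>x. norm ((D1 ^^ n) \<phi> x) \<le> N / (1 + x\<^sup>2)"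
proof -
  have "bounded (range (\<lambda>x. of_real (x ^ 0) * (D1 ^^ n) \<phi> x))" "bounded (range (\<lambda>x. of_real (x ^ 2) * (D1 ^^ n) \<phi> x))"
    using assms unfolding schwartz_def by blast+
  then obtain A B where AB: "\<And>x. norm (of_real (x ^ 0) * (D1 ^^ n) \<phi> x) \<le> A" "\<And>x. norm (of_real (x ^ 2) * (D1 ^^ n) \<phi> x) \<le> B"
    unfolding bounded_iff by auto
  have "norm ((D1 ^^ n) \<phi> x) \<le> (A + B) / (1 + x\<^sup>2)" for x
  proof -
    have "norm ((D1 ^^ n) \<phi> x) * (1 + x\<^sup>2) \<le> A + B"
      using AB(1)[of x] AB(2)[of x] by (simp add: norm_mult norm_power algebra_simps)
    then show ?thesis by (simp add: pos_le_divide_eq)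
  qed
  then show ?thesis using that by blast
qed

lemma schwartz_quadratic_decay:
  assumes "schwartz \<phi>" obtains N where "quadratic_decay N \<phi>"
proof -
  obtain A where A: "\<And>x. norm ((D1 ^^ 0) \<phi> x) \<le> A / (1 + x\<^sup>2)" using schwartz_decay[OF assms] by blast
  obtain B where B: "\<And>x. norm ((D1 ^^ 1) \<phi> x) \<le> B / (1 + x\<^sup>2)" using schwartz_decay[OF assms] by blast
  have le: "A / (1 + x\<^sup>2) \<le> max A B / (1 + x\<^sup>2)" "B / (1 + x\<^sup>2) \<le> max A B / (1 + x\<^sup>2)" for x :: real
    by (intro divide_right_mono; simp)+
  have "quadratic_decay (max A B) \<phi>"
    unfolding quadratic_decay_def
    using schwartz_differentiable[OF assms, of 0] order_trans[OF A le(1)] order_trans[OF B le(2)] by simp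
  then show ?thesis using that by blast
qed

lemma schwartz_D1: "schwartz \<phi> \<Longrightarrow> schwartz (D1 \<phi>)"
  unfolding schwartz_def
proof (intro conjI allI)
  assume \<phi>: "(\<forall>n x. (D1 ^^ n) \<phi> differentiable at x) \<and> (\<forall>m n. bounded (range (\<lambda>x. of_real (x ^ m) * (D1 ^^ n) \<phi> x)))"
  have e: "(D1 ^^ n) (D1 \<phi>) = (D1 ^^ Suc n) \<phi>" for n by (simp add: funpow_swap1)
  show "(D1 ^^ n) (D1 \<phi>) differentiable at x" for n x using \<phi> unfolding e by blast
  show "bounded (range (\<lambda>x. of_real (x ^ m) * (D1 ^^ n) (D1 \<phi>) x))" for m n using \<phi> unfolding e by blast
qed

lemma quadratic_decayD:
  assumes "quadratic_decay N \<phi>"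
  shows "\<phi> differentiable (at x)" "norm (\<phi> x) \<le> N / (1 + x\<^sup>2)" "norm (D1 \<phi> x) \<le> N / (1 + x\<^sup>2)"
    "0 \<le> N" "norm (\<phi> x) \<le> N" "\<phi> \<in> borel_measurable borel" "integrable lborel \<phi>"
    "(LINT x|lborel. norm (\<phi> x)) \<le> N * japanese_integral 1"
proof -
  show d: "\<phi> differentiable (at x)" and b: "norm (\<phi> x) \<le> N / (1 + x\<^sup>2)" and "norm (D1 \<phi> x) \<le> N / (1 + x\<^sup>2)" for x
    using assms by (auto simp: quadratic_decay_def)
  show N: "0 \<le> N" using order_trans[OF norm_ge_zero b[of 0]] by simp
  show m: "\<phi> \<in> borel_measurable borel" using d by (rule borel_measurable_differentiable)
  have "N / (1 + x\<^sup>2) \<le> N / 1" using N by (intro divide_left_mono) auto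
  then show "norm (\<phi> x) \<le> N" using b[of x] by simp
  show "integrable lborel \<phi>" "(LINT x|lborel. norm (\<phi> x)) \<le> N * japanese_integral 1"
    using integrable_quadratic_decay[OF m b] by auto
qed

lemma tendsto_zero_quadratic:
  fixes \<phi> :: "real \<Rightarrow> complex"
  assumes "\<And>x. norm (\<phi> x) \<le> N / (1 + x\<^sup>2)"
  shows "(\<phi> \<longlongrightarrow> 0) at_top" "(\<phi> \<longlongrightarrow> 0) at_bot"
proof -
  have "filterlim (\<lambda>x::real. 1 + x\<^sup>2) at_top at_top"
    by (intro filterlim_tendsto_add_at_top[OF tendsto_const] filterlim_pow_at_top filterlim_ident) auto
  then have 1: "((\<lambda>x::real. N / (1 + x\<^sup>2)) \<longlongrightarrow> 0) at_top"
    by (rule real_tendsto_divide_at_top[OF tendsto_const])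
  then show "(\<phi> \<longlongrightarrow> 0) at_top"
    by (rule Lim_null_comparison[rotated]) (auto intro: assms always_eventually)
  have "((\<lambda>x::real. N / (1 + x\<^sup>2)) \<longlongrightarrow> 0) at_bot"
    unfolding filterlim_at_bot_mirror using 1 by simp
  then show "(\<phi> \<longlongrightarrow> 0) at_bot"
    by (rule Lim_null_comparison[rotated]) (auto intro: assms always_eventually)
qed

lemma integral_derivative_eq_0:
  fixes F f :: "real \<Rightarrow> complex"
  assumes "\<And>x. (F has_vector_derivative f x) (at x)" "\<And>x. isCont f x" "integrable lborel f"
    and "(F \<longlongrightarrow> 0) at_top" "(F \<longlongrightarrow> 0) at_bot"
  shows "integral\<^sup>L lborel f = 0"
proof -
  have "(LBINT x=-\<infinity>..\<infinity>. f x) = 0 - 0"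
  proof (rule interval_integral_FTC_integrable[where F = F])
    show "set_integrable lborel (einterval (- \<infinity>) \<infinity>) f" using assms(3) by (simp add: set_integrable_def einterval_def)
    show "((F \<circ> real_of_ereal) \<longlongrightarrow> 0) (at_right (- \<infinity>))" "((F \<circ> real_of_ereal) \<longlongrightarrow> 0) (at_left \<infinity>)"
      using assms(4,5) by (simp_all only: ereal_tendsto_simps)
  qed (use assms in auto)
  then show ?thesis by (simp add: interval_lebesgue_integral_def set_lebesgue_integral_def einterval_def)
qed

lemma ft_D1:
  assumes \<phi>: "schwartz \<phi>"
  shows "ft (D1 \<phi>) \<xi> = \<i> * of_real \<xi> * ft \<phi> \<xi>"
proof -
  obtain N where N: "quadratic_decay N \<phi>" using schwartz_quadratic_decay[OF \<phi>] by blast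
  obtain M where M: "quadratic_decay M (D1 \<phi>)" using schwartz_quadratic_decay[OF schwartz_D1[OF \<phi>]] by blast
  let ?e = "\<lambda>x. exp (- (\<i> * of_real (x * \<xi>)))"
  have i: "integrable lborel (\<lambda>x. ?e x * D1 \<phi> x)" "integrable lborel (\<lambda>x. ?e x * \<phi> x)"
    using integrable_exp_i_mult(1)[OF quadratic_decayD(7)[OF N]] integrable_exp_i_mult(1)[OF quadratic_decayD(7)[OF M]] by auto
  have "(LINT x|lborel. ?e x * D1 \<phi> x - \<i> * of_real \<xi> * (?e x * \<phi> x)) = 0"
  proof (rule integral_derivative_eq_0[where F = "\<lambda>x. ?e x * \<phi> x"])
    show "((\<lambda>x. ?e x * \<phi> x) has_vector_derivative ?e x * D1 \<phi> x - \<i> * of_real \<xi> * (?e x * \<phi> x)) (at x)" for x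
    proof -
      have "((\<lambda>x. exp (- (\<i> * (of_real x * of_real \<xi>)))) has_vector_derivative - (\<i> * of_real \<xi>) * exp (- (\<i> * (of_real x * of_real \<xi>)))) (at x)"
        by (rule has_vector_derivative_real_field) (auto intro!: derivative_eq_intros)
      from has_vector_derivative_mult[OF this D1_has_vector_derivative[OF quadratic_decayD(1)[OF N]]]
      show ?thesis by (simp add: algebra_simps)
    qed
    have c: "isCont \<phi> x" "isCont (D1 \<phi>) x" for x
      using differentiable_imp_continuous_within quadratic_decayD(1)[OF N] quadratic_decayD(1)[OF M] by blast+
    then show "isCont (\<lambda>x. ?e x * D1 \<phi> x - \<i> * of_real \<xi> * (?e x * \<phi> x)) x" for x
      by (intro continuous_intros)
    show "integrable lborel (\<lambda>x. ?e x * D1 \<phi> x - \<i> * of_real \<xi> * (?e x * \<phi> x))"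
      using i by (intro Bochner_Integration.integrable_diff integrable_mult_right)
    have b: "norm (?e x * \<phi> x) \<le> N / (1 + x\<^sup>2)" for x
      using quadratic_decayD(2)[OF N, of x] by (simp add: norm_mult del: of_real_mult)
    show "((\<lambda>x. ?e x * \<phi> x) \<longlongrightarrow> 0) at_top" "((\<lambda>x. ?e x * \<phi> x) \<longlongrightarrow> 0) at_bot"
      using tendsto_zero_quadratic[OF b] by auto
  qed
  then show ?thesis using i by (simp add: ft_def mult.assoc)
qed

lemma norm_ft_le: "norm (ft k \<xi>) \<le> (LINT x|lborel. norm (k x))"
proof -
  have "norm (ft k \<xi>) \<le> (LINT x|lborel. norm (exp (- (\<i> * of_real (x * \<xi>))) * k x))"
    unfolding ft_def by (rule integral_norm_bound)
  then show ?thesis by (simp add: norm_mult del: of_real_mult)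
qed

lemma ft_measurable [measurable]:
  assumes [measurable]: "k \<in> borel_measurable borel"
  shows "ft k \<in> borel_measurable borel"
proof -
  have "(\<lambda>\<xi>. LINT x|lborel. exp (- (\<i> * of_real (x * \<xi>))) * k x) \<in> borel_measurable borel"
    by (rule lborel.borel_measurable_lebesgue_integral) measurable
  then show ?thesis by (simp add: ft_def[abs_def])
qed

lemma schwartz_ft_decay:
  assumes \<phi>: "schwartz \<phi>"
  obtains K where "\<And>\<xi>. norm (ft \<phi> \<xi>) \<le> K / (1 + \<xi>\<^sup>2)"
proof
  fix \<xi> :: real
  let ?K = "(LINT x|lborel. norm (\<phi> x)) + (LINT x|lborel. norm (D1 (D1 \<phi>) x))"
  have "ft (D1 (D1 \<phi>)) \<xi> = - of_real (\<xi>\<^sup>2) * ft \<phi> \<xi>"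
  proof -
    have "ft (D1 (D1 \<phi>)) \<xi> = (\<i> * of_real \<xi>)\<^sup>2 * ft \<phi> \<xi>"
      unfolding ft_D1[OF schwartz_D1[OF \<phi>]] ft_D1[OF \<phi>] by (simp only: power2_eq_square mult.assoc)
    then show ?thesis by (simp add: power_mult_distrib)
  qed
  then have "\<xi>\<^sup>2 * norm (ft \<phi> \<xi>) = norm (ft (D1 (D1 \<phi>)) \<xi>)" by (simp add: norm_mult norm_power)
  then have "(1 + \<xi>\<^sup>2) * norm (ft \<phi> \<xi>) \<le> ?K"
    using norm_ft_le[of "D1 (D1 \<phi>)" \<xi>] norm_ft_le[of \<phi> \<xi>] by (simp add: distrib_right)
  then show "norm (ft \<phi> \<xi>) \<le> ?K / (1 + \<xi>\<^sup>2)" by (simp add: pos_le_divide_eq mult.commute)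
qed

definition half_derivative_ft :: "(real \<Rightarrow> complex) \<Rightarrow> real \<Rightarrow> complex" where
  "half_derivative_ft \<phi> \<xi> = of_real (\<bar>\<xi>\<bar> powr (1/2)) * ft \<phi> \<xi>"

lemma integrable_schwartz_ft:
  assumes \<phi>: "schwartz \<phi>"
  shows "integrable lborel (ft \<phi>)" "integrable lborel (half_derivative_ft \<phi>)"
proof -
  obtain N where N: "quadratic_decay N \<phi>" using schwartz_quadratic_decay[OF \<phi>] by blast
  note [measurable] = quadratic_decayD(6)[OF N]
  obtain K where K: "\<And>\<xi>. norm (ft \<phi> \<xi>) \<le> K / (1 + \<xi>\<^sup>2)" using schwartz_ft_decay[OF \<phi>] by blast
  show "integrable lborel (ft \<phi>)" by (rule integrable_quadratic_decay(1)[OF _ K]) measurable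
  have K0: "0 \<le> K" using order_trans[OF norm_ge_zero K[of 0]] by simp
  show "integrable lborel (half_derivative_ft \<phi>)"
  proof (rule Bochner_Integration.integrable_bound)
    show "integrable lborel (\<lambda>\<xi>. K * weight \<xi>)" using integrable_weight by simp
    show "half_derivative_ft \<phi> \<in> borel_measurable lborel" unfolding half_derivative_ft_def[abs_def] by measurable
    show "AE \<xi> in lborel. norm (half_derivative_ft \<phi> \<xi>) \<le> norm (K * weight \<xi>)"
    proof (intro AE_I2)
      fix \<xi> :: real
      have "\<bar>\<xi>\<bar> powr (1/2) \<le> ((1 + \<xi>\<^sup>2) powr (1/2)) powr (1/2)"
        by (intro powr_mono2) (auto simp: powr_half_sqrt real_le_rsqrt)
      also have "\<dots> = (1 + \<xi>\<^sup>2) powr (1/4)" by (simp add: powr_powr)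
      finally have "\<bar>\<xi>\<bar> powr (1/2) * norm (ft \<phi> \<xi>) \<le> (1 + \<xi>\<^sup>2) powr (1/4) * (K / (1 + \<xi>\<^sup>2))"
        by (intro mult_mono K) auto
      also have "\<dots> = K * ((1 + \<xi>\<^sup>2) powr (1/4) / (1 + \<xi>\<^sup>2) powr 1)" using one_plus_square_pos[of \<xi>] by simp
      also have "(1 + \<xi>\<^sup>2) powr (1/4) / (1 + \<xi>\<^sup>2) powr 1 = weight \<xi>"
        unfolding weight_def by (subst powr_diff[symmetric]) simp
      finally show "norm (half_derivative_ft \<phi> \<xi>) \<le> norm (K * weight \<xi>)"
        using K0 by (simp add: half_derivative_ft_def norm_mult)
    qed
  qed
qed

lemma integral_gaussian: "has_bochner_integral lborel (\<lambda>h::real. exp (- h\<^sup>2)) (sqrt pi)"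
proof -
  have "(LINT h|lborel. of_real (exp (- h\<^sup>2)) :: complex) = of_real (sqrt pi)"
    using ft_gaussian[of 1 0] by (simp add: ft_def)
  then have "(LINT h|lborel. exp (- h\<^sup>2)) = sqrt pi"
    unfolding integral_complex_of_real of_real_eq_iff .
  moreover from this have "integrable lborel (\<lambda>h::real. exp (- h\<^sup>2))"
    using not_integrable_integral_eq pi_gt_zero by fastforce
  ultimately show ?thesis by (simp add: has_bochner_integral_iff)
qed

lemma integrable_gaussian:
  assumes "0 < s" shows "integrable lborel (\<lambda>h::real. exp (- s * h\<^sup>2))"
proof -
  have "integrable lborel (\<lambda>h::real. exp (- (0 + sqrt s * h)\<^sup>2))"
    using lborel_integrable_real_affine[of "\<lambda>h. exp (- h\<^sup>2)" "sqrt s" 0] integral_gaussian assms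
    by (simp add: has_bochner_integral_iff)
  then show ?thesis using assms by (simp add: power_mult_distrib)
qed

lemma fourier_inversion:
  assumes \<phi>: "integrable lborel \<phi>" "\<And>x. isCont \<phi> x" "\<And>x. norm (\<phi> x) \<le> B" and ft: "integrable lborel (ft \<phi>)"
  shows "(LINT \<xi>|lborel. exp (\<i> * of_real (x * \<xi>)) * ft \<phi> \<xi>) = of_real (2 * pi) * \<phi> x"
proof -
  have [measurable]: "\<phi> \<in> borel_measurable borel" "ft \<phi> \<in> borel_measurable borel" using \<phi>(1) ft by auto
  define s where "s n = inverse (real (Suc n))" for n
  have s: "0 < s n" "s \<longlonglongrightarrow> 0" for n using LIMSEQ_inverse_real_of_nat by (auto simp: s_def[abs_def])
  let ?g = "\<lambda>n \<xi>. exp (- s n * \<xi>\<^sup>2)"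
  have eq: "(LINT \<xi>|lborel. exp (\<i> * of_real (x * \<xi>)) * ft \<phi> \<xi> * of_real (?g n \<xi>)) =
     of_real (2 * sqrt pi) * (LINT r|lborel. of_real (exp (- r\<^sup>2)) * \<phi> (x + 2 * sqrt (s n) * r))" for n
  proof -
    define F where "F \<xi> t = exp (\<i> * of_real (x * \<xi>)) * (exp (- (\<i> * of_real (t * \<xi>))) * \<phi> t) * of_real (?g n \<xi>)" for \<xi> t
    have iF: "integrable (lborel \<Otimes>\<^sub>M lborel) (\<lambda>(\<xi>, t). F \<xi> t)"
    proof (rule lborel_pair.Fubini_integrable)
      have nF: "norm (F \<xi> t) = ?g n \<xi> * norm (\<phi> t)" for \<xi> t
        by (simp add: F_def norm_mult del: of_real_mult)
      show "(\<lambda>(\<xi>, t). F \<xi> t) \<in> borel_measurable (lborel \<Otimes>\<^sub>M lborel)" unfolding F_def by measurable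
      show "integrable lborel (\<lambda>\<xi>. LINT t|lborel. norm (case (\<xi>, t) of (\<xi>, t) \<Rightarrow> F \<xi> t))"
        using integrable_gaussian[OF s(1), of n] by (simp add: nF)
      show "AE \<xi> in lborel. integrable lborel (\<lambda>t. case (\<xi>, t) of (\<xi>, t) \<Rightarrow> F \<xi> t)"
        using integrable_exp_i_mult(1)[OF \<phi>(1)] by (simp add: F_def del: of_real_mult)
    qed
    have "(LINT \<xi>|lborel. exp (\<i> * of_real (x * \<xi>)) * ft \<phi> \<xi> * of_real (?g n \<xi>)) = (LINT \<xi>|lborel. LINT t|lborel. F \<xi> t)"
      unfolding F_def ft_def by simp
    also have "\<dots> = (LINT t|lborel. LINT \<xi>|lborel. F \<xi> t)"
      using lborel_pair.Fubini_integral[OF iF] by simp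
    also have "\<dots> = (LINT t|lborel. of_real (sqrt (pi / s n) * exp (- (t - x)\<^sup>2 / (4 * s n))) * \<phi> t)"
    proof (intro Bochner_Integration.integral_cong refl)
      fix t
      have "(LINT \<xi>|lborel. F \<xi> t) = (LINT \<xi>|lborel. exp (- (\<i> * of_real (\<xi> * (t - x)))) * of_real (?g n \<xi>) * \<phi> t)"
      proof (intro Bochner_Integration.integral_cong refl)
        fix \<xi>
        have "exp (\<i> * of_real (x * \<xi>)) * exp (- (\<i> * of_real (t * \<xi>))) = exp (- (\<i> * of_real (\<xi> * (t - x))))"
          by (simp add: algebra_simps flip: exp_add)
        then show "F \<xi> t = exp (- (\<i> * of_real (\<xi> * (t - x)))) * of_real (?g n \<xi>) * \<phi> t"
          unfolding F_def by (metis mult.assoc mult.commute)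
      qed
      also have "\<dots> = ft (\<lambda>h. of_real (?g n h)) (t - x) * \<phi> t" unfolding ft_def by simp
      finally show "(LINT \<xi>|lborel. F \<xi> t) = of_real (sqrt (pi / s n) * exp (- (t - x)\<^sup>2 / (4 * s n))) * \<phi> t"
        using ft_gaussian[OF s(1)] by simp
    qed
    also have "\<dots> = (2 * sqrt (s n)) *\<^sub>R (LINT r|lborel. of_real (sqrt (pi / s n) * exp (- (x + 2 * sqrt (s n) * r - x)\<^sup>2 / (4 * s n))) * \<phi> (x + 2 * sqrt (s n) * r))"
      using lborel_integral_real_affine[of "2 * sqrt (s n)" "\<lambda>t. of_real (sqrt (pi / s n) * exp (- (t - x)\<^sup>2 / (4 * s n))) * \<phi> t" x] s(1)[of n] by simp
    also have "(LINT r|lborel. of_real (sqrt (pi / s n) * exp (- (x + 2 * sqrt (s n) * r - x)\<^sup>2 / (4 * s n))) * \<phi> (x + 2 * sqrt (s n) * r)) =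
       (LINT r|lborel. of_real (sqrt (pi / s n)) * (of_real (exp (- r\<^sup>2)) * \<phi> (x + 2 * sqrt (s n) * r)))"
    proof (intro Bochner_Integration.integral_cong refl)
      fix r
      have "(x + 2 * sqrt (s n) * r - x)\<^sup>2 / (4 * s n) = r\<^sup>2" using s(1)[of n] by (simp add: power_mult_distrib)
      then have "- (x + 2 * sqrt (s n) * r - x)\<^sup>2 / (4 * s n) = - r\<^sup>2" by (metis minus_divide_left)
      then show "of_real (sqrt (pi / s n) * exp (- (x + 2 * sqrt (s n) * r - x)\<^sup>2 / (4 * s n))) * \<phi> (x + 2 * sqrt (s n) * r) =
        of_real (sqrt (pi / s n)) * (of_real (exp (- r\<^sup>2)) * \<phi> (x + 2 * sqrt (s n) * r))" by (simp only: of_real_mult mult.assoc)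
    qed
    also have "(2 * sqrt (s n)) *\<^sub>R (LINT r|lborel. of_real (sqrt (pi / s n)) * (of_real (exp (- r\<^sup>2)) * \<phi> (x + 2 * sqrt (s n) * r))) =
        of_real (2 * (sqrt (s n) * sqrt (pi / s n))) * (LINT r|lborel. of_real (exp (- r\<^sup>2)) * \<phi> (x + 2 * sqrt (s n) * r))"
      by (simp add: scaleR_conv_of_real)
    also have "sqrt (s n) * sqrt (pi / s n) = sqrt pi" using s(1)[of n] by (simp add: real_sqrt_divide)
    finally show ?thesis .
  qed
  have "(\<lambda>n. LINT \<xi>|lborel. exp (\<i> * of_real (x * \<xi>)) * ft \<phi> \<xi> * of_real (?g n \<xi>)) \<longlonglongrightarrow> (LINT \<xi>|lborel. exp (\<i> * of_real (x * \<xi>)) * ft \<phi> \<xi>)"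
  proof (rule integral_dominated_convergence[where w = "\<lambda>\<xi>. norm (ft \<phi> \<xi>)"])
    show "AE \<xi> in lborel. (\<lambda>n. exp (\<i> * of_real (x * \<xi>)) * ft \<phi> \<xi> * of_real (?g n \<xi>)) \<longlonglongrightarrow> exp (\<i> * of_real (x * \<xi>)) * ft \<phi> \<xi>"
    proof (intro AE_I2)
      fix \<xi>
      have "(\<lambda>n. exp (\<i> * of_real (x * \<xi>)) * ft \<phi> \<xi> * of_real (?g n \<xi>)) \<longlonglongrightarrow> exp (\<i> * of_real (x * \<xi>)) * ft \<phi> \<xi> * of_real (exp (- 0 * \<xi>\<^sup>2))"
        by (intro tendsto_intros s)
      then show "(\<lambda>n. exp (\<i> * of_real (x * \<xi>)) * ft \<phi> \<xi> * of_real (?g n \<xi>)) \<longlonglongrightarrow> exp (\<i> * of_real (x * \<xi>)) * ft \<phi> \<xi>" by simp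
    qed
    show "AE \<xi> in lborel. norm (exp (\<i> * of_real (x * \<xi>)) * ft \<phi> \<xi> * of_real (?g n \<xi>)) \<le> norm (ft \<phi> \<xi>)" for n
    proof (intro AE_I2)
      fix \<xi>
      have "norm (ft \<phi> \<xi>) * ?g n \<xi> \<le> norm (ft \<phi> \<xi>) * 1" using s(1)[of n] by (intro mult_left_mono) auto
      then show "norm (exp (\<i> * of_real (x * \<xi>)) * ft \<phi> \<xi> * of_real (?g n \<xi>)) \<le> norm (ft \<phi> \<xi>)"
        by (simp add: norm_mult del: of_real_mult)
    qed
  qed (use ft in auto)
  moreover have "(\<lambda>n. of_real (2 * sqrt pi) * (LINT r|lborel. of_real (exp (- r\<^sup>2)) * \<phi> (x + 2 * sqrt (s n) * r))) \<longlonglongrightarrow>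
      of_real (2 * sqrt pi) * (LINT r|lborel. of_real (exp (- r\<^sup>2)) * \<phi> x)"
  proof (intro tendsto_mult tendsto_const, rule integral_dominated_convergence[where w = "\<lambda>r. exp (- r\<^sup>2) * B"])
    show "integrable lborel (\<lambda>r::real. exp (- r\<^sup>2) * B)" using integral_gaussian by (simp add: has_bochner_integral_iff)
    show "AE r in lborel. (\<lambda>n. of_real (exp (- r\<^sup>2)) * \<phi> (x + 2 * sqrt (s n) * r)) \<longlonglongrightarrow> of_real (exp (- r\<^sup>2)) * \<phi> x"
    proof (intro AE_I2 tendsto_mult tendsto_const)
      fix r
      have "(\<lambda>n. x + 2 * sqrt (s n) * r) \<longlonglongrightarrow> x + 2 * sqrt 0 * r" by (intro tendsto_intros s)
      then show "(\<lambda>n. \<phi> (x + 2 * sqrt (s n) * r)) \<longlonglongrightarrow> \<phi> x" using isCont_tendsto_compose[OF \<phi>(2)] by simp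
    qed
    show "AE r in lborel. norm (of_real (exp (- r\<^sup>2)) * \<phi> (x + 2 * sqrt (s n) * r)) \<le> exp (- r\<^sup>2) * B" for n
      using \<phi>(3) by (auto simp: norm_mult)
  qed measurable
  ultimately have "(LINT \<xi>|lborel. exp (\<i> * of_real (x * \<xi>)) * ft \<phi> \<xi>) = of_real (2 * sqrt pi) * (LINT r|lborel. of_real (exp (- r\<^sup>2)) * \<phi> x)"
    unfolding eq by (rule LIMSEQ_unique)
  also have "(LINT r|lborel. of_real (exp (- r\<^sup>2)) * \<phi> x) = of_real (sqrt pi) * \<phi> x"
  proof -
    have "(LINT r|lborel. of_real (exp (- r\<^sup>2)) * \<phi> x) = (LINT r|lborel. of_real (exp (- r\<^sup>2))) * \<phi> x" by simp
    also have "(LINT r|lborel. of_real (exp (- r\<^sup>2)) :: complex) = of_real (sqrt pi)"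
      unfolding integral_complex_of_real using integral_gaussian by (simp add: has_bochner_integral_iff)
    finally show ?thesis .
  qed
  finally show ?thesis by (simp flip: of_real_mult mult.assoc)
qed

lemma convolution_fourier_integral:
  assumes k: "integrable lborel k" and m: "integrable lborel m"
  shows "(LINT t|lborel. k (x - t) * (LINT \<xi>|lborel. exp (\<i> * of_real (t * \<xi>)) * m \<xi>)) =
     (LINT \<xi>|lborel. exp (\<i> * of_real (x * \<xi>)) * (ft k \<xi> * m \<xi>))"
proof -
  have [measurable]: "k \<in> borel_measurable borel" "m \<in> borel_measurable borel" using k m by auto
  define F where "F t \<xi> = k (x - t) * (exp (\<i> * of_real (t * \<xi>)) * m \<xi>)" for t \<xi>
  have iF: "integrable (lborel \<Otimes>\<^sub>M lborel) (\<lambda>(t, \<xi>). F t \<xi>)"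
  proof (rule lborel_pair.Fubini_integrable)
    have nF: "norm (F t \<xi>) = norm (k (x - t)) * norm (m \<xi>)" for \<xi> t
      by (simp add: F_def norm_mult del: of_real_mult)
    show "(\<lambda>(t, \<xi>). F t \<xi>) \<in> borel_measurable (lborel \<Otimes>\<^sub>M lborel)" unfolding F_def by measurable
    show "integrable lborel (\<lambda>t. LINT \<xi>|lborel. norm (case (t, \<xi>) of (t, \<xi>) \<Rightarrow> F t \<xi>))"
      using integrable_reflect_shift[OF integrable_norm[OF k], of x] by (simp add: nF)
    show "AE t in lborel. integrable lborel (\<lambda>\<xi>. case (t, \<xi>) of (t, \<xi>) \<Rightarrow> F t \<xi>)"
      using integrable_exp_i_mult(2)[OF m] by (auto simp: F_def mult.commute simp del: of_real_mult)
  qed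
  have "(LINT t|lborel. k (x - t) * (LINT \<xi>|lborel. exp (\<i> * of_real (t * \<xi>)) * m \<xi>)) = (LINT t|lborel. LINT \<xi>|lborel. F t \<xi>)"
    unfolding F_def by simp
  also have "\<dots> = (LINT \<xi>|lborel. LINT t|lborel. F t \<xi>)"
    using lborel_pair.Fubini_integral[OF iF] by simp
  also have "\<dots> = (LINT \<xi>|lborel. exp (\<i> * of_real (x * \<xi>)) * (ft k \<xi> * m \<xi>))"
  proof (intro Bochner_Integration.integral_cong refl)
    fix \<xi>
    have "(LINT t|lborel. F t \<xi>) = (LINT h|lborel. F (x - h) \<xi>)" by (rule integral_reflect_shift[symmetric])
    also have "\<dots> = (LINT h|lborel. exp (\<i> * of_real (x * \<xi>)) * (exp (- (\<i> * of_real (h * \<xi>))) * k h * m \<xi>))"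
    proof (intro Bochner_Integration.integral_cong refl)
      fix h
      have "exp (\<i> * of_real ((x - h) * \<xi>)) = exp (\<i> * of_real (x * \<xi>)) * exp (- (\<i> * of_real (h * \<xi>)))"
        by (simp add: algebra_simps flip: exp_add)
      then show "F (x - h) \<xi> = exp (\<i> * of_real (x * \<xi>)) * (exp (- (\<i> * of_real (h * \<xi>))) * k h * m \<xi>)"
        unfolding F_def by (simp only: mult_ac) simp
    qed
    also have "\<dots> = exp (\<i> * of_real (x * \<xi>)) * (ft k \<xi> * m \<xi>)" unfolding ft_def by simp
    finally show "(LINT t|lborel. F t \<xi>) = exp (\<i> * of_real (x * \<xi>)) * (ft k \<xi> * m \<xi>)" .
  qed
  finally show ?thesis .
qed

lemma fourier_eq_ft: "f \<in> borel_measurable borel \<Longrightarrow> fourier f = ft f"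
  by (rule ext) (simp add: fourier_def ft_def integral_completion)

lemma frac_lap_eq:
  assumes "schwartz \<phi>"
  shows "frac_lap \<phi> x = of_real (1 / (2 * pi)) * (LINT \<xi>|lborel. exp (\<i> * of_real (x * \<xi>)) * half_derivative_ft \<phi> \<xi>)"
proof -
  obtain N where N: "quadratic_decay N \<phi>" using schwartz_quadratic_decay[OF assms] by blast
  note [measurable] = quadratic_decayD(6)[OF N]
  show ?thesis
    unfolding frac_lap_def fourier_eq_ft[OF quadratic_decayD(6)[OF N]] half_derivative_ft_def
    by (subst integral_completion) (auto simp: mult.assoc)
qed

lemma isCont_fourier_integral:
  assumes m: "integrable lborel m"
  shows "isCont (\<lambda>x. LINT \<xi>|lborel. exp (\<i> * of_real (x * \<xi>)) * m \<xi>) x"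
  unfolding continuous_at_sequentially o_def
proof (intro allI impI)
  fix X :: "nat \<Rightarrow> real" assume X: "X \<longlonglongrightarrow> x"
  have [measurable]: "m \<in> borel_measurable borel" using m by auto
  show "(\<lambda>n. LINT \<xi>|lborel. exp (\<i> * of_real (X n * \<xi>)) * m \<xi>) \<longlonglongrightarrow> (LINT \<xi>|lborel. exp (\<i> * of_real (x * \<xi>)) * m \<xi>)"
  proof (rule integral_dominated_convergence[where w = "\<lambda>\<xi>. norm (m \<xi>)"])
    show "AE \<xi> in lborel. (\<lambda>n. exp (\<i> * of_real (X n * \<xi>)) * m \<xi>) \<longlonglongrightarrow> exp (\<i> * of_real (x * \<xi>)) * m \<xi>"
      by (intro AE_I2 tendsto_intros X)
  qed (use m in \<open>auto simp: norm_mult simp del: of_real_mult\<close>)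
qed

lemma isCont_frac_lap:
  assumes "schwartz \<phi>" shows "isCont (frac_lap \<phi>) x"
proof -
  have "frac_lap \<phi> = (\<lambda>x. of_real (1 / (2 * pi)) * (LINT \<xi>|lborel. exp (\<i> * of_real (x * \<xi>)) * half_derivative_ft \<phi> \<xi>))"
    using frac_lap_eq[OF assms] by blast
  moreover have "isCont (\<lambda>x. of_real (1 / (2 * pi)) * (LINT \<xi>|lborel. exp (\<i> * of_real (x * \<xi>)) * half_derivative_ft \<phi> \<xi>)) x"
    by (rule continuous_mult[OF continuous_const isCont_fourier_integral[OF integrable_schwartz_ft(2)[OF assms]]])
  ultimately show ?thesis by simp
qed

lemma frac_lap_measurable: "schwartz \<phi> \<Longrightarrow> frac_lap \<phi> \<in> borel_measurable borel"
  by (intro borel_measurable_continuous_onI continuous_at_imp_continuous_on ballI isCont_frac_lap)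

lemma frac_lap_bounded:
  assumes "schwartz \<phi>" obtains B where "\<And>x. norm (frac_lap \<phi> x) \<le> B"
proof
  fix x
  have "norm (LINT \<xi>|lborel. exp (\<i> * of_real (x * \<xi>)) * half_derivative_ft \<phi> \<xi>) \<le> (LINT \<xi>|lborel. norm (exp (\<i> * of_real (x * \<xi>)) * half_derivative_ft \<phi> \<xi>))"
    by (rule integral_norm_bound)
  then have "norm (LINT \<xi>|lborel. exp (\<i> * of_real (x * \<xi>)) * half_derivative_ft \<phi> \<xi>) \<le> (LINT \<xi>|lborel. norm (half_derivative_ft \<phi> \<xi>))"
    by (simp add: norm_mult del: of_real_mult)
  then have "1 / (2 * pi) * norm (LINT \<xi>|lborel. exp (\<i> * of_real (x * \<xi>)) * half_derivative_ft \<phi> \<xi>) \<le> 1 / (2 * pi) * (LINT \<xi>|lborel. norm (half_derivative_ft \<phi> \<xi>))"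
    by (intro mult_left_mono) auto
  then show "norm (frac_lap \<phi> x) \<le> 1 / (2 * pi) * (LINT \<xi>|lborel. norm (half_derivative_ft \<phi> \<xi>))"
    unfolding frac_lap_eq[OF assms] norm_mult norm_of_real by simp
qed

theorem flux_conv_schwartz:
  assumes \<phi>: "schwartz \<phi>" and z: "0 < z"
  shows "(LINT t|lborel. of_real (flux_kernel z (x - t)) * \<phi> t) =
    - of_real flux_const * gen_conv (5/4) (z\<^sup>2 / 2) (frac_lap \<phi>) x"
proof -
  obtain N where N: "quadratic_decay N \<phi>" using schwartz_quadratic_decay[OF \<phi>] by blast
  note [measurable] = quadratic_decayD(6)[OF N]
  have y: "0 < z\<^sup>2 / 2" using z by simp
  have inv: "\<phi> t = of_real (1 / (2 * pi)) * (LINT \<xi>|lborel. exp (\<i> * of_real (t * \<xi>)) * ft \<phi> \<xi>)" for t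
    using fourier_inversion[OF quadratic_decayD(7)[OF N] _ quadratic_decayD(5)[OF N] integrable_schwartz_ft(1)[OF \<phi>], of t]
      differentiable_imp_continuous_within[OF quadratic_decayD(1)[OF N]] pi_gt_zero by (simp add: field_simps)
  have i: "integrable lborel (\<lambda>h. of_real (flux_kernel z h) :: complex)" "integrable lborel (\<lambda>h. of_real (gen_poisson (5/4) (z\<^sup>2 / 2) h) :: complex)"
    using integrable_flux_kernel[OF z] integrable_gen_poisson[of "5/4" "z\<^sup>2/2"] y by auto
  have c: "(LINT t|lborel. of_real (k (x - t)) * (of_real (1 / (2 * pi)) * m t)) = of_real (1 / (2 * pi)) * (LINT t|lborel. of_real (k (x - t)) * m t)" for k :: "real \<Rightarrow> real" and m :: "real \<Rightarrow> complex"
    by (subst integral_mult_right_zero[symmetric]) (simp only: mult.left_commute)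
  have "(LINT t|lborel. of_real (flux_kernel z (x - t)) * \<phi> t) =
     of_real (1 / (2 * pi)) * (LINT t|lborel. of_real (flux_kernel z (x - t)) * (LINT \<xi>|lborel. exp (\<i> * of_real (t * \<xi>)) * ft \<phi> \<xi>))"
    by (subst inv) (rule c)
  also have "\<dots> = of_real (1 / (2 * pi)) * (LINT \<xi>|lborel. exp (\<i> * of_real (x * \<xi>)) * (ft (\<lambda>h. of_real (flux_kernel z h)) \<xi> * ft \<phi> \<xi>))"
    by (simp only: convolution_fourier_integral[OF i(1) integrable_schwartz_ft(1)[OF \<phi>]])
  also have "\<dots> = of_real (1 / (2 * pi)) * (LINT \<xi>|lborel. - of_real flux_const * (exp (\<i> * of_real (x * \<xi>)) * (ft (\<lambda>h. of_real (gen_poisson (5/4) (z\<^sup>2 / 2) h)) \<xi> * half_derivative_ft \<phi> \<xi>)))"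
    unfolding ft_flux_kernel[OF z] half_derivative_ft_def by (simp only: of_real_mult mult_ac minus_mult_left minus_mult_right)
  also have "\<dots> = - of_real flux_const * (of_real (1 / (2 * pi)) * (LINT \<xi>|lborel. exp (\<i> * of_real (x * \<xi>)) * (ft (\<lambda>h. of_real (gen_poisson (5/4) (z\<^sup>2 / 2) h)) \<xi> * half_derivative_ft \<phi> \<xi>)))"
    by (subst integral_mult_right_zero) (simp only: mult.left_commute)
  also have "\<dots> = - of_real flux_const * gen_conv (5/4) (z\<^sup>2 / 2) (frac_lap \<phi>) x"
  proof -
    have "gen_conv (5/4) (z\<^sup>2 / 2) (frac_lap \<phi>) x = of_real (1 / (2 * pi)) *
      (LINT t|lborel. of_real (gen_poisson (5/4) (z\<^sup>2 / 2) (x - t)) * (LINT \<xi>|lborel. exp (\<i> * of_real (t * \<xi>)) * half_derivative_ft \<phi> \<xi>))"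
      unfolding gen_conv_def frac_lap_eq[OF \<phi>] by (rule c)
    then show ?thesis
      by (simp only: convolution_fourier_integral[OF i(2) integrable_schwartz_ft(2)[OF \<phi>]])
  qed
  finally show ?thesis .
qed

lemma frac_lap_weight_bound:
  assumes \<phi>: "schwartz \<phi>" and N: "quadratic_decay N \<phi>"
  shows "norm (frac_lap \<phi> x) \<le> flux_bound_const / flux_const * N * weight x"
proof -
  obtain B where B: "\<And>x. norm (frac_lap \<phi> x) \<le> B" using frac_lap_bounded[OF \<phi>] by blast
  define z where "z n = inverse (real (Suc n))" for n
  have z: "0 < z n" "z \<longlonglongrightarrow> 0" for n using LIMSEQ_inverse_real_of_nat by (auto simp: z_def[abs_def])
  have "(\<lambda>n. (z n)\<^sup>2 / 2) \<longlonglongrightarrow> 0\<^sup>2 / 2" by (intro tendsto_intros z) auto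
  then have y: "0 < (z n)\<^sup>2 / 2" "(\<lambda>n. (z n)\<^sup>2 / 2) \<longlonglongrightarrow> 0" for n using z(1)[of n] by auto
  have "(\<lambda>n. norm (gen_conv (5/4) ((z n)\<^sup>2 / 2) (frac_lap \<phi>) x)) \<longlonglongrightarrow> norm (frac_lap \<phi> x)"
    by (intro tendsto_norm gen_conv_tendsto_pointwise[OF _ frac_lap_measurable[OF \<phi>] B isCont_frac_lap[OF \<phi>] y]) auto
  moreover have "norm (gen_conv (5/4) ((z n)\<^sup>2 / 2) (frac_lap \<phi>) x) \<le> flux_bound_const / flux_const * N * weight x" for n
  proof -
    have "flux_const * norm (gen_conv (5/4) ((z n)\<^sup>2 / 2) (frac_lap \<phi>) x) \<le> flux_bound_const * N * weight x"
      using norm_flux_conv_le[OF z(1) N, of n x] flux_const_pos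
      unfolding flux_conv_schwartz[OF \<phi> z(1)] by (simp add: norm_mult)
    then show ?thesis using flux_const_pos by (simp add: field_simps)
  qed
  ultimately show ?thesis by (intro LIMSEQ_le_const2) auto
qed


definition smooth_line :: "(real \<Rightarrow> complex) \<Rightarrow> bool" where
  "smooth_line f \<longleftrightarrow> (\<forall>n x. (D1 ^^ n) f differentiable (at x))"

definition flat_exp :: "nat \<Rightarrow> real \<Rightarrow> real" where
  "flat_exp k x = (if 0 < x then inverse x ^ k * exp (- inverse x) else 0)"

lemma flat_exp_tendsto_0: "(flat_exp k \<longlongrightarrow> 0) (at 0)"
proof -
  have "((\<lambda>x::real. inverse x ^ k / exp (inverse x)) \<longlongrightarrow> 0) (at_right 0)"
    using filterlim_compose[OF tendsto_power_div_exp_0 filterlim_inverse_at_top_right] .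
  then have "(flat_exp k \<longlongrightarrow> 0) (at_right 0)"
    by (rule Lim_transform_eventually)
      (auto simp: flat_exp_def exp_minus divide_inverse eventually_at_right_field intro: exI[of _ 1])
  moreover have "(flat_exp k \<longlongrightarrow> 0) (at_left 0)"
    by (rule tendsto_eventually) (auto simp: flat_exp_def eventually_at_left_field intro: exI[of _ "-1"])
  ultimately show ?thesis by (simp add: filterlim_split_at)
qed

lemma flat_exp_has_derivative:
  "(flat_exp k has_real_derivative (flat_exp (k + 2) x - k * flat_exp (k + 1) x)) (at x)"
proof (cases x "0 :: real" rule: linorder_cases)
  case less
  have "((\<lambda>_. 0) has_real_derivative 0) (at x)" by simp
  then have "(flat_exp k has_real_derivative 0) (at x)"
    by (rule has_field_derivative_transform_within_open[of _ _ _ "{..<0}"]) (use less in \<open>auto simp: flat_exp_def\<close>)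
  then show ?thesis using less by (simp add: flat_exp_def)
next
  case equal
  have "((\<lambda>h. (flat_exp k (0 + h) - flat_exp k 0) / h) \<longlongrightarrow> 0) (at 0)"
    by (rule Lim_transform_eventually[OF flat_exp_tendsto_0[of "k + 1"]])
      (auto simp: flat_exp_def eventually_at_filter divide_inverse)
  then show ?thesis using equal by (simp add: DERIV_def flat_exp_def)
next
  case greater
  have inv: "(inverse has_real_derivative - (inverse x * inverse x)) (at x)"
    using DERIV_inverse[of x UNIV] greater by (simp add: power2_eq_square)
  have e: "((\<lambda>x. exp (- inverse x)) has_real_derivative exp (- inverse x) * (inverse x * inverse x)) (at x)"
    using DERIV_chain2[OF DERIV_exp DERIV_minus[OF inv]] by simp
  have "((\<lambda>x. inverse x ^ k * exp (- inverse x)) has_real_derivative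
     (inverse x ^ (k + 2) * exp (- inverse x) - k * (inverse x ^ (k + 1) * exp (- inverse x)))) (at x)"
  proof (cases k)
    case 0
    then show ?thesis using e by (simp add: power2_eq_square mult.commute)
  next
    case (Suc m)
    have "((\<lambda>x. inverse x ^ Suc m) has_real_derivative (1 + of_nat m) * (- (inverse x * inverse x) * inverse x ^ m)) (at x)"
      by (rule DERIV_power_Suc[OF inv])
    from DERIV_mult[OF this e] show ?thesis by (simp add: Suc algebra_simps)
  qed
  then have "((\<lambda>x. inverse x ^ k * exp (- inverse x)) has_real_derivative (flat_exp (k + 2) x - k * flat_exp (k + 1) x)) (at x)"
    using greater by (simp add: flat_exp_def)
  then show ?thesis
    by (rule has_field_derivative_transform_within_open[of _ _ _ "{0<..}"]) (use greater in \<open>auto simp: flat_exp_def\<close>)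
qed

inductive smooth_gen :: "(real \<Rightarrow> complex) \<Rightarrow> bool" where
  flat: "smooth_gen (\<lambda>x. of_real (flat_exp k x))"
| affine: "smooth_line f \<Longrightarrow> smooth_gen (\<lambda>x. f (a * x + b))"
| add: "\<lbrakk>smooth_gen f; smooth_gen g\<rbrakk> \<Longrightarrow> smooth_gen (\<lambda>x. f x + g x)"
| mult: "\<lbrakk>smooth_gen f; smooth_gen g\<rbrakk> \<Longrightarrow> smooth_gen (\<lambda>x. f x * g x)"

lemma smooth_line_D1: "smooth_line f \<Longrightarrow> smooth_line (D1 f)"
  unfolding smooth_line_def by (metis comp_apply funpow_Suc_right)

lemma smooth_line_differentiable: "smooth_line f \<Longrightarrow> f differentiable (at x)"
  unfolding smooth_line_def by (metis funpow_0)

lemma D1_eqI: "(\<And>x. (f has_vector_derivative f' x) (at x)) \<Longrightarrow> D1 f = f'"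
  by (rule ext) (simp add: D1_def vector_derivative_at)

lemma smooth_line_const: "smooth_line (\<lambda>_. c)"
proof -
  have 1: "D1 (\<lambda>_. c) = (\<lambda>_. 0)" for c by (rule D1_eqI) auto
  have 2: "(D1 ^^ n) (\<lambda>_. 0) = (\<lambda>_. 0)" for n by (induction n) (simp_all add: 1)
  have "(D1 ^^ n) (\<lambda>_. c) = (\<lambda>_. if n = 0 then c else 0)" for n
    by (cases n) (simp_all add: funpow_Suc_right 1 2 del: funpow.simps)
  then show ?thesis by (simp add: smooth_line_def)
qed

lemma smooth_gen_const: "smooth_gen (\<lambda>_. c)"
  using affine[OF smooth_line_const] .

lemma smooth_gen_D1:
  assumes "smooth_gen f"
  shows "(\<forall>x. (f has_vector_derivative D1 f x) (at x)) \<and> smooth_gen (D1 f)"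
  using assms
proof induction
  case (flat k)
  have d: "((\<lambda>x. of_real (flat_exp k x)) has_vector_derivative (of_real (flat_exp (k + 2) x) + (- of_nat k) * of_real (flat_exp (k + 1) x) :: complex)) (at x)" for x
    using bounded_linear.has_vector_derivative[OF bounded_linear_of_real
        flat_exp_has_derivative[of k x, unfolded has_real_derivative_iff_has_vector_derivative]]
    by simp
  have "smooth_gen (\<lambda>x. of_real (flat_exp (k + 2) x) + (- of_nat k) * of_real (flat_exp (k + 1) x))"
    by (intro smooth_gen.add smooth_gen.mult smooth_gen_const smooth_gen.flat)
  then show ?case using d D1_eqI[OF d] by simp
next
  case (affine f a b)
  have d: "((\<lambda>x. f (a * x + b)) has_vector_derivative (of_real a * D1 f (a * x + b))) (at x)" for x
  proof -
    have "((\<lambda>x. a * x + b) has_vector_derivative a) (at x)"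
      by (auto intro!: derivative_eq_intros simp flip: has_real_derivative_iff_has_vector_derivative)
    from vector_diff_chain_at[OF this D1_has_vector_derivative[OF smooth_line_differentiable[OF affine]]]
    show ?thesis by (simp add: o_def scaleR_conv_of_real)
  qed
  have "smooth_gen (\<lambda>x. of_real a * D1 f (a * x + b))"
    by (intro smooth_gen.mult smooth_gen_const smooth_gen.affine smooth_line_D1 affine)
  then show ?case using d D1_eqI[OF d] by simp
next
  case (add f g)
  have d: "((\<lambda>x. f x + g x) has_vector_derivative (D1 f x + D1 g x)) (at x)" for x
    using add by (intro has_vector_derivative_add) auto
  have "smooth_gen (\<lambda>x. D1 f x + D1 g x)" using add by (intro smooth_gen.add) auto
  then show ?case using d D1_eqI[OF d] by simp
next
  case (mult f g)
  have d: "((\<lambda>x. f x * g x) has_vector_derivative (f x * D1 g x + D1 f x * g x)) (at x)" for x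
    using mult by (intro has_vector_derivative_mult) auto
  have "smooth_gen (\<lambda>x. f x * D1 g x + D1 f x * g x)" using mult by (intro smooth_gen.add smooth_gen.mult) auto
  then show ?case using d D1_eqI[OF d] by simp
qed

lemma smooth_gen_imp_smooth_line:
  assumes "smooth_gen f" shows "smooth_line f"
proof -
  have "smooth_gen ((D1 ^^ n) f)" for n
    by (induction n) (use assms smooth_gen_D1 in auto)
  then have "((D1 ^^ n) f has_vector_derivative D1 ((D1 ^^ n) f) x) (at x)" for n x
    using smooth_gen_D1 by blast
  then show ?thesis
    unfolding smooth_line_def by (intro allI differentiableI_vector)
qed

lemma smooth_line_affine: "smooth_line f \<Longrightarrow> smooth_line (\<lambda>x. f (a * x + b))"
  by (rule smooth_gen_imp_smooth_line[OF smooth_gen.affine])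

lemma smooth_line_imp_smooth_gen: "smooth_line f \<Longrightarrow> smooth_gen f"
proof -
  assume "smooth_line f"
  then have "smooth_gen (\<lambda>x. f (1 * x + 0))" by (rule smooth_gen.affine)
  then show ?thesis by simp
qed

lemma smooth_line_mult: "smooth_line f \<Longrightarrow> smooth_line g \<Longrightarrow> smooth_line (\<lambda>x. f x * g x)"
  by (rule smooth_gen_imp_smooth_line[OF smooth_gen.mult[OF smooth_line_imp_smooth_gen smooth_line_imp_smooth_gen]])

lemma smooth_line_add: "smooth_line f \<Longrightarrow> smooth_line g \<Longrightarrow> smooth_line (\<lambda>x. f x + g x)"
  by (rule smooth_gen_imp_smooth_line[OF smooth_gen.add[OF smooth_line_imp_smooth_gen smooth_line_imp_smooth_gen]])

lemma schwartz_smooth_line: "schwartz \<phi> \<Longrightarrow> smooth_line \<phi>"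
  by (simp add: schwartz_def smooth_line_def)

lemma D1_eq_0_outside:
  assumes "\<And>x. R \<le> \<bar>x\<bar> \<Longrightarrow> f x = 0" "R < \<bar>x\<bar>"
  shows "D1 f x = 0"
proof -
  have "((\<lambda>_. 0) has_vector_derivative 0) (at x)" by simp
  then have "(f has_vector_derivative 0) (at x)"
    by (rule has_vector_derivative_transform_within_open[of _ _ _ "{x. R < \<bar>x\<bar>}"])
      (use assms in \<open>auto intro!: open_Collect_less continuous_intros\<close>)
  then show ?thesis by (simp add: D1_def vector_derivative_at)
qed

lemma D1_eq_0_outside_closed:
  assumes "smooth_line f" "\<And>x. R \<le> \<bar>x\<bar> \<Longrightarrow> f x = 0" "R \<le> \<bar>x\<bar>" "0 < R"
  shows "D1 f x = 0"
proof -
  have c: "isCont (D1 f) x"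
    using smooth_line_differentiable[OF smooth_line_D1[OF assms(1)]] by (rule differentiable_imp_continuous_within)
  define X where "X n = x * (1 + inverse (real (Suc n)))" for n
  have "X \<longlonglongrightarrow> x * (1 + 0)" unfolding X_def by (intro tendsto_intros LIMSEQ_inverse_real_of_nat)
  then have "(\<lambda>n. D1 f (X n)) \<longlonglongrightarrow> D1 f x" using isCont_tendsto_compose[OF c] by simp
  moreover have "D1 f (X n) = 0" for n
  proof (rule D1_eq_0_outside[OF assms(2)])
    have "\<bar>X n\<bar> = \<bar>x\<bar> * (1 + inverse (real (Suc n)))" by (simp add: X_def abs_mult)
    moreover have "\<bar>x\<bar> * 1 < \<bar>x\<bar> * (1 + inverse (real (Suc n)))"
      using assms(3,4) by (intro mult_strict_left_mono) auto
    ultimately show "R < \<bar>X n\<bar>" using assms(3) by linarith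
  qed
  ultimately show ?thesis by (simp add: LIMSEQ_const_iff)
qed

lemma smooth_compact_bounded:
  assumes f: "smooth_line f" and R: "\<And>x. R \<le> \<bar>x\<bar> \<Longrightarrow> f x = 0"
  obtains B where "\<And>x. norm (f x) \<le> B"
proof -
  have "continuous_on {-R..R} (\<lambda>x. norm (f x))"
    using smooth_line_differentiable[OF f]
    by (intro continuous_on_norm continuous_at_imp_continuous_on ballI differentiable_imp_continuous_within)
  then have "bounded ((\<lambda>x. norm (f x)) ` {-R..R})"
    by (intro compact_imp_bounded compact_continuous_image) auto
  then obtain B where "\<And>y. y \<in> (\<lambda>x. norm (f x)) ` {-R..R} \<Longrightarrow> norm y \<le> B"
    unfolding bounded_iff by blast
  then have B: "norm (f x) \<le> B" if "x \<in> {-R..R}" for x using that by force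
  have "norm (f x) \<le> max B 0" for x using B[of x] R[of x] by (cases "x \<in> {-R..R}") auto
  then show ?thesis using that by blast
qed

lemma schwartz_compact:
  assumes f: "smooth_line f" and R: "\<And>x. R \<le> \<bar>x\<bar> \<Longrightarrow> f x = 0" "0 < R"
  shows "schwartz f"
  unfolding schwartz_def
proof (intro conjI allI)
  have D: "smooth_line ((D1 ^^ n) f) \<and> (\<forall>x. R \<le> \<bar>x\<bar> \<longrightarrow> (D1 ^^ n) f x = 0)" for n
  proof (induction n)
    case (Suc n)
    then show ?case using smooth_line_D1 D1_eq_0_outside_closed[of "(D1 ^^ n) f" R] R(2) by auto
  qed (use f R in auto)
  show "(D1 ^^ n) f differentiable at x" for n x using D smooth_line_differentiable by blast
  show "bounded (range (\<lambda>x. of_real (x ^ m) * (D1 ^^ n) f x))" for m n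
  proof -
    obtain B where B: "\<And>x. norm ((D1 ^^ n) f x) \<le> B"
      using smooth_compact_bounded[of "(D1 ^^ n) f" R] D by blast
    have B0: "0 \<le> B" using order_trans[OF norm_ge_zero B[of 0]] .
    have "norm (of_real (x ^ m) * (D1 ^^ n) f x) \<le> R ^ m * B" for x
    proof (cases "R \<le> \<bar>x\<bar>")
      case False
      then have "\<bar>x\<bar> ^ m * norm ((D1 ^^ n) f x) \<le> R ^ m * B"
        by (intro mult_mono power_mono B) auto
      then show ?thesis by (simp add: norm_mult norm_power)
    next
      case True
      then show ?thesis using D[of n] B0 R by simp
    qed
    then show ?thesis by (auto simp: bounded_iff)
  qed
qed

definition bump :: "real \<Rightarrow> real" where
  "bump x = flat_exp 0 (1 + x) * flat_exp 0 (1 - x)"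

lemma bump_nonneg: "0 \<le> bump x" and bump_0: "0 < bump 0" and bump_eq_0: "1 \<le> \<bar>x\<bar> \<Longrightarrow> bump x = 0"
  and bump_even: "bump (- x) = bump x"
  by (auto simp: bump_def flat_exp_def abs_if split: if_splits)

lemma smooth_line_bump: "smooth_line (\<lambda>x. of_real (bump x))"
proof -
  have s: "smooth_line (\<lambda>x. of_real (flat_exp 0 x))" by (rule smooth_gen_imp_smooth_line[OF smooth_gen.flat])
  have "smooth_line (\<lambda>x. of_real (flat_exp 0 (1 * x + 1)) * of_real (flat_exp 0 ((-1) * x + 1)))"
    by (intro smooth_line_mult smooth_line_affine[OF s])
  then show ?thesis by (simp add: bump_def add.commute)
qed

lemma schwartz_bump: "schwartz (\<lambda>x. of_real (bump x))"
  by (rule schwartz_compact[OF smooth_line_bump, of 1]) (auto simp: bump_eq_0)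

lemma schwartz_bump_scaled:
  assumes "0 < n" shows "schwartz (\<lambda>x. of_real (bump (n * (x - x0))))"
proof -
  have "smooth_line (\<lambda>x. of_real (bump (n * x + - n * x0)))" by (rule smooth_line_affine[OF smooth_line_bump])
  moreover have "n * x + - n * x0 = n * (x - x0)" for x by (simp add: algebra_simps)
  ultimately have s: "smooth_line (\<lambda>x. of_real (bump (n * (x - x0))))" by simp
  show ?thesis
  proof (rule schwartz_compact[OF s])
    show "0 < \<bar>x0\<bar> + 1 / n" using assms by (simp add: add_nonneg_pos)
    show "of_real (bump (n * (x - x0))) = 0" if "\<bar>x0\<bar> + 1 / n \<le> \<bar>x\<bar>" for x
    proof -
      have "1 / n \<le> \<bar>x - x0\<bar>" using that by linarith
      then have "1 \<le> n * \<bar>x - x0\<bar>" using assms by (simp add: pos_divide_le_eq mult.commute)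
      also have "\<dots> = \<bar>n * (x - x0)\<bar>" using assms by (subst abs_mult) simp
      finally have "1 \<le> \<bar>n * (x - x0)\<bar>" .
      then show ?thesis by (simp add: bump_eq_0)
    qed
  qed
qed

definition cutoff :: "real \<Rightarrow> complex" where "cutoff x = of_real (bump x / bump 0)"

lemma smooth_line_cutoff: "smooth_line cutoff"
proof -
  have "smooth_line (\<lambda>x. of_real (1 / bump 0) * of_real (bump x))"
    by (intro smooth_line_mult smooth_line_const smooth_line_bump)
  then show ?thesis by (simp add: cutoff_def[abs_def])
qed

lemma cutoff_0: "cutoff 0 = 1" using bump_0 by (simp add: cutoff_def)
lemma cutoff_eq_0: "1 \<le> \<bar>x\<bar> \<Longrightarrow> cutoff x = 0" by (simp add: cutoff_def bump_eq_0)

lemma Ck_on_tensor: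
  assumes "smooth_line f" "smooth_line g"
  shows "Ck_on k UNIV (\<lambda>p. f (fst p) * g (snd p))"
  using assms
proof (induction k arbitrary: f g)
  case 0
  have "continuous_on UNIV f" "continuous_on UNIV g"
    using 0 by (auto intro!: continuous_at_imp_continuous_on differentiable_imp_continuous_within smooth_line_differentiable)
  then show ?case
    by (auto intro!: continuous_intros continuous_on_compose2[of UNIV f] continuous_on_compose2[of UNIV g])
next
  case (Suc k)
  have d: "((\<lambda>p. f (fst p) * g (snd p)) has_derivative (\<lambda>v. f (fst p) * (snd v *\<^sub>R D1 g (snd p)) + (fst v *\<^sub>R D1 f (fst p)) * g (snd p))) (at p)" for p
  proof (rule has_derivative_mult)
    show "((\<lambda>p. f (fst p)) has_derivative (\<lambda>v. fst v *\<^sub>R D1 f (fst p))) (at p)"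
      using D1_has_vector_derivative[OF smooth_line_differentiable[OF Suc.prems(1)], of "fst p"]
      unfolding has_vector_derivative_def by (rule has_derivative_compose[rotated]) (auto intro!: derivative_eq_intros)
    show "((\<lambda>p. g (snd p)) has_derivative (\<lambda>v. snd v *\<^sub>R D1 g (snd p))) (at p)"
      using D1_has_vector_derivative[OF smooth_line_differentiable[OF Suc.prems(2)], of "snd p"]
      unfolding has_vector_derivative_def by (rule has_derivative_compose[rotated]) (auto intro!: derivative_eq_intros)
  qed
  have "Dfst (\<lambda>p. f (fst p) * g (snd p)) = (\<lambda>p. D1 f (fst p) * g (snd p))"
    "Dsnd (\<lambda>p. f (fst p) * g (snd p)) = (\<lambda>p. f (fst p) * D1 g (snd p))"
    using Dfst_eq[OF d] Dsnd_eq[OF d] by (auto simp: fun_eq_iff)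
  then show ?case
    using differentiableI[OF d] by (simp add: Suc.IH Suc.prems smooth_line_D1)
qed

lemma test_function_tensor:
  assumes f: "smooth_line f" "\<And>x. R \<le> \<bar>x\<bar> \<Longrightarrow> f x = 0" and g: "smooth_line g" "\<And>x. R \<le> \<bar>x\<bar> \<Longrightarrow> g x = 0"
  shows "test_function (\<lambda>p. f (fst p) * g (snd p))"
  unfolding test_function_def
proof (intro conjI allI Ck_on_tensor f g)
  have "{p. f (fst p) * g (snd p) \<noteq> 0} \<subseteq> {-R..R} \<times> {-R..R}"
  proof
    fix p assume "p \<in> {p. f (fst p) * g (snd p) \<noteq> 0}"
    then have "\<not> R \<le> \<bar>fst p\<bar>" "\<not> R \<le> \<bar>snd p\<bar>" using f(2) g(2) by auto
    then show "p \<in> {-R..R} \<times> {-R..R}" by (auto simp: mem_Times_iff)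
  qed
  moreover have "compact ({-R..R} \<times> {-R..R})" by (intro compact_Times) auto
  ultimately show "compact (closure {p. f (fst p) * g (snd p) \<noteq> 0})"
    unfolding compact_closure by (rule bounded_subset[OF compact_imp_bounded, rotated])
qed

lemma schwartz_bound: "schwartz \<phi> \<Longrightarrow> \<exists>A. \<forall>x. norm (of_real (x ^ m) * (D1 ^^ n) \<phi> x) \<le> A"
  unfolding schwartz_def bounded_iff by (metis rangeI)

lemma schwartz_shift:
  assumes \<phi>: "schwartz \<phi>" shows "schwartz (\<lambda>x. \<phi> (x - t))"
  unfolding schwartz_def
proof (intro conjI allI)
  have D: "(D1 ^^ n) (\<lambda>x. \<phi> (x - t)) = (\<lambda>x. (D1 ^^ n) \<phi> (x - t))" for n
  proof (induction n)
    case (Suc n)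
    have "((\<lambda>x. (D1 ^^ n) \<phi> (x - t)) has_vector_derivative D1 ((D1 ^^ n) \<phi>) (x - t)) (at x)" for x
    proof -
      have "((\<lambda>x. x - t) has_vector_derivative 1) (at x)"
        by (auto intro!: derivative_eq_intros simp flip: has_real_derivative_iff_has_vector_derivative)
      from vector_diff_chain_at[OF this D1_has_vector_derivative[OF schwartz_differentiable[OF \<phi>]]]
      show ?thesis by (simp add: o_def)
    qed
    from D1_eqI[OF this] show ?case using Suc by simp
  qed simp
  have "smooth_line (\<lambda>x. \<phi> (x - t))" using smooth_line_affine[OF schwartz_smooth_line[OF \<phi>], of 1 "- t"] by simp
  then show "(D1 ^^ n) (\<lambda>x. \<phi> (x - t)) differentiable at x" for n x by (simp add: smooth_line_def)
  show "bounded (range (\<lambda>x. of_real (x ^ m) * (D1 ^^ n) (\<lambda>x. \<phi> (x - t)) x))" for m n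
  proof -
    obtain A where A: "\<And>x. norm (of_real (x ^ 0) * (D1 ^^ n) \<phi> x) \<le> A"
      using schwartz_bound[OF \<phi>] by blast
    obtain B where B: "\<And>x. norm (of_real (x ^ m) * (D1 ^^ n) \<phi> x) \<le> B"
      using schwartz_bound[OF \<phi>] by blast
    have "norm (of_real (x ^ m) * (D1 ^^ n) \<phi> (x - t)) \<le> (2 * (1 + \<bar>t\<bar>)) ^ m * (A + B)" for x
    proof -
      let ?s = "\<bar>x - t\<bar>" and ?g = "norm ((D1 ^^ n) \<phi> (x - t))"
      have "\<bar>x\<bar> \<le> max 1 ?s * (2 * (1 + \<bar>t\<bar>))"
      proof -
        have "\<bar>x\<bar> \<le> M * (2 * (1 + \<bar>t\<bar>))" if "1 \<le> M" "?s \<le> M" for M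
        proof -
          have "1 * \<bar>t\<bar> \<le> M * \<bar>t\<bar>" using that(1) by (intro mult_right_mono) auto
          moreover have "\<bar>x\<bar> \<le> ?s + \<bar>t\<bar>" by linarith
          moreover have "M * (2 * (1 + \<bar>t\<bar>)) = 2 * M + 2 * (M * \<bar>t\<bar>)" by (simp add: algebra_simps)
          ultimately show ?thesis using that by linarith
        qed
        then show ?thesis by simp
      qed
      then have "\<bar>x\<bar> ^ m \<le> (max 1 ?s * (2 * (1 + \<bar>t\<bar>))) ^ m" by (intro power_mono) auto
      also have "\<dots> = (2 * (1 + \<bar>t\<bar>)) ^ m * max 1 ?s ^ m" by (simp add: power_mult_distrib)
      also have "\<dots> \<le> (2 * (1 + \<bar>t\<bar>)) ^ m * (1 + ?s ^ m)"
        by (intro mult_left_mono) (auto simp: max_def)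
      finally have "\<bar>x\<bar> ^ m * ?g \<le> (2 * (1 + \<bar>t\<bar>)) ^ m * (1 + ?s ^ m) * ?g" by (intro mult_right_mono) auto
      also have "\<dots> = (2 * (1 + \<bar>t\<bar>)) ^ m * (?g + ?s ^ m * ?g)" by (simp add: algebra_simps)
      also have "\<dots> \<le> (2 * (1 + \<bar>t\<bar>)) ^ m * (A + B)"
        using A[of "x - t"] B[of "x - t"]
        by (intro mult_left_mono add_mono) (auto simp: norm_mult power_abs simp del: of_real_power of_real_diff)
      finally show ?thesis by (simp add: norm_mult norm_power)
    qed
    then show ?thesis unfolding D by (auto simp: bounded_iff)
  qed
qed

lemma frac_lap_shift:
  assumes \<phi>: "schwartz \<phi>"
  shows "frac_lap (\<lambda>x. \<phi> (x - t)) x = frac_lap \<phi> (x - t)"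
proof -
  have ft: "ft (\<lambda>x. \<phi> (x - t)) \<xi> = exp (- (\<i> * of_real (t * \<xi>))) * ft \<phi> \<xi>" for \<xi>
  proof -
    have "ft (\<lambda>x. \<phi> (x - t)) \<xi> = (LINT x|lborel. (\<lambda>x. exp (- (\<i> * of_real ((x + t) * \<xi>))) * \<phi> x) (x - t))"
      unfolding ft_def by simp
    also have "\<dots> = (LINT x|lborel. exp (- (\<i> * of_real ((x + t) * \<xi>))) * \<phi> x)" by (rule integral_shift)
    also have "\<dots> = (LINT x|lborel. exp (- (\<i> * of_real (t * \<xi>))) * (exp (- (\<i> * of_real (x * \<xi>))) * \<phi> x))"
    proof (intro Bochner_Integration.integral_cong refl)
      fix x
      have "exp (- (\<i> * of_real ((x + t) * \<xi>))) = exp (- (\<i> * of_real (t * \<xi>))) * exp (- (\<i> * of_real (x * \<xi>)))"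
        by (simp add: algebra_simps flip: exp_add)
      then show "exp (- (\<i> * of_real ((x + t) * \<xi>))) * \<phi> x = exp (- (\<i> * of_real (t * \<xi>))) * (exp (- (\<i> * of_real (x * \<xi>))) * \<phi> x)"
        by (simp only: mult.assoc)
    qed
    also have "\<dots> = exp (- (\<i> * of_real (t * \<xi>))) * ft \<phi> \<xi>" unfolding ft_def by (rule integral_mult_right_zero)
    finally show ?thesis .
  qed
  have "exp (\<i> * of_real (x * \<xi>)) * half_derivative_ft (\<lambda>x. \<phi> (x - t)) \<xi> = exp (\<i> * of_real ((x - t) * \<xi>)) * half_derivative_ft \<phi> \<xi>" for \<xi>
  proof -
    have "exp (\<i> * of_real ((x - t) * \<xi>)) = exp (\<i> * of_real (x * \<xi>)) * exp (- (\<i> * of_real (t * \<xi>)))"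
      by (simp add: algebra_simps flip: exp_add)
    then show ?thesis by (simp only: half_derivative_ft_def ft mult_ac)
  qed
  then show ?thesis unfolding frac_lap_eq[OF \<phi>] frac_lap_eq[OF schwartz_shift[OF \<phi>]] by simp
qed

lemma schwartz_cutoff_approx:
  assumes \<phi>: "schwartz \<phi>"
  obtains K where "\<And>n. 0 < n \<Longrightarrow> schwartz (\<lambda>x. \<phi> x * cutoff (x / n))"
    "\<And>n. 1 \<le> n \<Longrightarrow> quadratic_decay (K / n) (\<lambda>x. \<phi> x - \<phi> x * cutoff (x / n))"
    "\<And>n. 0 < n \<Longrightarrow> schwartz (\<lambda>x. \<phi> x - \<phi> x * cutoff (x / n))"
proof -
  have sc: "smooth_line (\<lambda>x. cutoff (x / n))" for n
    using smooth_line_affine[OF smooth_line_cutoff, of "1/n" 0] by simp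
  have s1: "schwartz (\<lambda>x. \<phi> x * cutoff (x / n))" if "0 < n" for n
  proof (rule schwartz_compact[of _ n])
    show "smooth_line (\<lambda>x. \<phi> x * cutoff (x / n))" by (intro smooth_line_mult schwartz_smooth_line \<phi> sc)
    show "\<phi> x * cutoff (x / n) = 0" if "n \<le> \<bar>x\<bar>" for x
      using that \<open>0 < n\<close> cutoff_eq_0[of "x / n"] by simp
  qed fact
  have lin: "schwartz (\<lambda>x. f x - g x)" if "schwartz f" "schwartz g" for f g
    unfolding schwartz_def
  proof (intro conjI allI)
    have D: "(D1 ^^ n) (\<lambda>x. f x - g x) = (\<lambda>x. (D1 ^^ n) f x - (D1 ^^ n) g x)" for n
    proof (induction n)
      case (Suc n)
      have "((\<lambda>x. (D1 ^^ n) f x - (D1 ^^ n) g x) has_vector_derivative D1 ((D1 ^^ n) f) x - D1 ((D1 ^^ n) g) x) (at x)" for x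
        by (intro has_vector_derivative_diff D1_has_vector_derivative schwartz_differentiable that)
      from D1_eqI[OF this] show ?case using Suc by simp
    qed simp
    show "(D1 ^^ n) (\<lambda>x. f x - g x) differentiable at x" for n x
      unfolding D using that by (intro derivative_intros schwartz_differentiable)
    show "bounded (range (\<lambda>x. of_real (x ^ m) * (D1 ^^ n) (\<lambda>x. f x - g x) x))" for m n
    proof -
      have "bounded (range (\<lambda>x. of_real (x ^ m) * (D1 ^^ n) f x))" "bounded (range (\<lambda>x. of_real (x ^ m) * (D1 ^^ n) g x))"
        using that by (auto simp: schwartz_def)
      then have "bounded (range (\<lambda>x. of_real (x ^ m) * (D1 ^^ n) f x - of_real (x ^ m) * (D1 ^^ n) g x))"
        by (rule bounded_minus_comp)
      then show ?thesis unfolding D by (simp add: right_diff_distrib)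
    qed
  qed
  have xb: "\<exists>A. \<forall>x. \<bar>x\<bar> * norm (\<psi> x) \<le> A / (1 + x\<^sup>2)" if \<psi>: "schwartz \<psi>" for \<psi>
  proof -
    obtain A where A: "\<And>x. norm (of_real (x ^ 1) * (D1 ^^ 0) \<psi> x) \<le> A"
      using schwartz_bound[OF \<psi>] by blast
    obtain B where B: "\<And>x. norm (of_real (x ^ 3) * (D1 ^^ 0) \<psi> x) \<le> B"
      using schwartz_bound[OF \<psi>] by blast
    have "\<bar>x\<bar> * norm (\<psi> x) \<le> (A + B) / (1 + x\<^sup>2)" for x
    proof -
      have "(\<bar>x\<bar> * norm (\<psi> x)) * (1 + x\<^sup>2) = norm (of_real (x ^ 1) * (D1 ^^ 0) \<psi> x) + norm (of_real (x ^ 3) * (D1 ^^ 0) \<psi> x)"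
        by (simp add: norm_mult norm_power power2_eq_square power3_eq_cube algebra_simps)
      then have "(\<bar>x\<bar> * norm (\<psi> x)) * (1 + x\<^sup>2) \<le> A + B" using A[of x] B[of x] by linarith
      then show ?thesis by (simp add: pos_le_divide_eq)
    qed
    then show ?thesis by blast
  qed
  obtain A where A: "\<And>x. \<bar>x\<bar> * norm (\<phi> x) \<le> A / (1 + x\<^sup>2)" using xb[OF \<phi>] by blast
  obtain A' where A': "\<And>x. \<bar>x\<bar> * norm (D1 \<phi> x) \<le> A' / (1 + x\<^sup>2)" using xb[OF schwartz_D1[OF \<phi>]] by blast
  obtain N where N: "quadratic_decay N \<phi>" using schwartz_quadratic_decay[OF \<phi>] by blast
  have c1: "D1 cutoff x = 0" if "1 \<le> \<bar>x\<bar>" for x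
    by (rule D1_eq_0_outside_closed[OF smooth_line_cutoff cutoff_eq_0 that]) auto
  obtain C where C: "\<And>x. norm (D1 cutoff x) \<le> C"
    using smooth_compact_bounded[OF smooth_line_D1[OF smooth_line_cutoff] c1] by blast
  have C0: "0 \<le> C" using order_trans[OF norm_ge_zero C[of 0]] .
  have lip: "norm (1 - cutoff s) \<le> C * \<bar>s\<bar>" for s
  proof -
    have "norm (cutoff 0 - cutoff s) \<le> C * norm (0 - s)"
    proof (rule differentiable_bound[of UNIV cutoff "\<lambda>t r. r *\<^sub>R D1 cutoff t"])
      show "(cutoff has_derivative (\<lambda>r. r *\<^sub>R D1 cutoff t)) (at t within UNIV)" for t
        using D1_has_vector_derivative[OF smooth_line_differentiable[OF smooth_line_cutoff], of t]
        by (simp add: has_vector_derivative_def)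
      show "onorm (\<lambda>r. r *\<^sub>R D1 cutoff t) \<le> C" for t
        using C0 mult_right_mono[OF C[of t] abs_ge_zero] by (intro onorm_bound) (auto simp: mult.commute)
    qed auto
    then show ?thesis by (simp add: cutoff_0)
  qed
  define K where "K = C * (\<bar>A\<bar> + \<bar>A'\<bar> + N)"
  have s3: "schwartz (\<lambda>x. \<phi> x - \<phi> x * cutoff (x / n))" if "0 < n" for n by (intro lin \<phi> s1 that)
  have "quadratic_decay (K / n) (\<lambda>x. \<phi> x - \<phi> x * cutoff (x / n))" if n: "1 \<le> n" for n
    unfolding quadratic_decay_def
  proof (intro conjI allI)
    show "(\<lambda>x. \<phi> x - \<phi> x * cutoff (x / n)) differentiable at x" for x
      using schwartz_differentiable[OF s3, of n 0] n by simp
    have l: "norm (1 - cutoff (x / n)) \<le> C * \<bar>x\<bar> / n" for x using lip[of "x / n"] n by simp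
    show "norm (\<phi> x - \<phi> x * cutoff (x / n)) \<le> K / n / (1 + x\<^sup>2)" for x
    proof -
      have "norm (\<phi> x - \<phi> x * cutoff (x / n)) = norm (\<phi> x) * norm (1 - cutoff (x / n))"
        by (simp add: norm_mult[symmetric] right_diff_distrib)
      also have "\<dots> \<le> norm (\<phi> x) * (C * \<bar>x\<bar> / n)" by (intro mult_left_mono l) auto
      also have "\<dots> = C / n * (\<bar>x\<bar> * norm (\<phi> x))" by simp
      also have "\<dots> \<le> C / n * ((\<bar>A\<bar> + \<bar>A'\<bar> + N) / (1 + x\<^sup>2))"
        using quadratic_decayD(4)[OF N] C0 n
        by (intro mult_left_mono order_trans[OF A] divide_right_mono) auto
      finally show ?thesis by (simp add: K_def)
    qed
    show "norm (D1 (\<lambda>x. \<phi> x - \<phi> x * cutoff (x / n)) x) \<le> K / n / (1 + x\<^sup>2)" for x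
    proof -
      have "((\<lambda>x. cutoff (x / n)) has_vector_derivative (1 / n) *\<^sub>R D1 cutoff (x / n)) (at x)"
      proof -
        have "((\<lambda>x. x / n) has_vector_derivative 1 / n) (at x)"
          using n by (auto intro!: derivative_eq_intros simp flip: has_real_derivative_iff_has_vector_derivative)
        from vector_diff_chain_at[OF this D1_has_vector_derivative[OF smooth_line_differentiable[OF smooth_line_cutoff]]]
        show ?thesis by (simp add: o_def)
      qed
      note d\<phi> = D1_has_vector_derivative[OF quadratic_decayD(1)[OF N], of x]
      have "((\<lambda>x. \<phi> x - \<phi> x * cutoff (x / n)) has_vector_derivative
          D1 \<phi> x - (\<phi> x * ((1 / n) *\<^sub>R D1 cutoff (x / n)) + D1 \<phi> x * cutoff (x / n))) (at x)"
        by (intro has_vector_derivative_diff has_vector_derivative_mult d\<phi>) fact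
      then have "D1 (\<lambda>x. \<phi> x - \<phi> x * cutoff (x / n)) x = D1 \<phi> x - (\<phi> x * ((1 / n) *\<^sub>R D1 cutoff (x / n)) + D1 \<phi> x * cutoff (x / n))"
        by (simp add: D1_def vector_derivative_at)
      also have "\<dots> = D1 \<phi> x * (1 - cutoff (x / n)) - \<phi> x * ((1 / n) *\<^sub>R D1 cutoff (x / n))"
        by (simp add: algebra_simps)
      finally have "norm (D1 (\<lambda>x. \<phi> x - \<phi> x * cutoff (x / n)) x) \<le> norm (D1 \<phi> x) * norm (1 - cutoff (x / n)) + norm (\<phi> x) * (norm (D1 cutoff (x / n)) / n)"
        using norm_triangle_ineq4[of "D1 \<phi> x * (1 - cutoff (x / n))" "\<phi> x * ((1 / n) *\<^sub>R D1 cutoff (x / n))"] n by (simp add: norm_mult)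
      also have "\<dots> \<le> norm (D1 \<phi> x) * (C * \<bar>x\<bar> / n) + norm (\<phi> x) * (C / n)"
        using n by (intro add_mono mult_left_mono l divide_right_mono C) auto
      also have "\<dots> = C / n * (\<bar>x\<bar> * norm (D1 \<phi> x) + norm (\<phi> x))"
        by (simp add: distrib_left mult.commute mult.left_commute)
      also have "\<dots> \<le> C / n * (A' / (1 + x\<^sup>2) + N / (1 + x\<^sup>2))"
        using C0 n by (intro mult_left_mono add_mono A' quadratic_decayD(2)[OF N]) auto
      also have "\<dots> \<le> C / n * ((\<bar>A\<bar> + \<bar>A'\<bar> + N) / (1 + x\<^sup>2))"
        unfolding add_divide_distrib[symmetric] using C0 n by (intro mult_left_mono divide_right_mono) auto
      finally show ?thesis by (simp add: K_def)
    qed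
  qed
  then show ?thesis using that s1 s3 by blast
qed

lemma continuous_eq_0_if_weakly_0:
  fixes H :: "real \<Rightarrow> complex"
  assumes H: "\<And>x. isCont H x" "\<And>x. norm (H x) \<le> B"
    and 0: "\<And>\<phi>. schwartz \<phi> \<Longrightarrow> (LINT x|lborel. H x * \<phi> x) = 0"
  shows "H x0 = 0"
proof -
  have [measurable]: "H \<in> borel_measurable borel"
    by (intro borel_measurable_continuous_onI continuous_at_imp_continuous_on ballI H)
  obtain N where N: "quadratic_decay N (\<lambda>x. of_real (bump x))" using schwartz_quadratic_decay[OF schwartz_bump] by blast
  have bi: "integrable lborel (\<lambda>x. of_real (bump x) :: complex)" using quadratic_decayD(7)[OF N] .
  then have bir: "integrable lborel bump" by (simp add: complex_of_real_integrable_eq)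
  note [measurable] = borel_measurable_integrable[OF bir, simplified]
  have "(\<lambda>n. LINT s|lborel. H (x0 + inverse (real (Suc n)) * s) * of_real (bump s)) \<longlonglongrightarrow> (LINT s|lborel. H x0 * of_real (bump s))"
  proof (rule integral_dominated_convergence[where w = "\<lambda>s. B * bump s"])
    show "integrable lborel (\<lambda>s. B * bump s)" using bir by simp
    show "AE s in lborel. (\<lambda>n. H (x0 + inverse (real (Suc n)) * s) * of_real (bump s)) \<longlonglongrightarrow> H x0 * of_real (bump s)"
    proof (intro AE_I2 tendsto_mult tendsto_const)
      fix s
      have "(\<lambda>n. x0 + inverse (real (Suc n)) * s) \<longlonglongrightarrow> x0 + 0 * s" by (intro tendsto_intros LIMSEQ_inverse_real_of_nat)
      then show "(\<lambda>n. H (x0 + inverse (real (Suc n)) * s)) \<longlonglongrightarrow> H x0" using isCont_tendsto_compose[OF H(1)] by simp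
    qed
    show "AE s in lborel. norm (H (x0 + inverse (real (Suc n)) * s) * of_real (bump s)) \<le> B * bump s" for n
      using H(2) bump_nonneg by (auto simp: norm_mult intro!: mult_right_mono)
  qed measurable
  moreover have "(LINT s|lborel. H (x0 + inverse (real (Suc n)) * s) * of_real (bump s)) = 0" for n
  proof -
    let ?m = "real (Suc n)"
    have "0 = (LINT t|lborel. H t * of_real (bump (?m * (t - x0))))" using 0[OF schwartz_bump_scaled[of ?m x0]] by simp
    also have "\<dots> = inverse ?m *\<^sub>R (LINT s|lborel. H (x0 + inverse ?m * s) * of_real (bump (?m * (x0 + inverse ?m * s - x0))))"
      using lborel_integral_real_affine[of "inverse ?m" "\<lambda>t. H t * of_real (bump (?m * (t - x0)))" x0] by simp
    also have "\<dots> = inverse ?m *\<^sub>R (LINT s|lborel. H (x0 + inverse ?m * s) * of_real (bump s))"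
    proof -
      have "?m * (x0 + inverse ?m * s - x0) = s" for s by simp
      then show ?thesis by (simp only:)
    qed
    finally show ?thesis by simp
  qed
  ultimately have "(LINT s|lborel. H x0 * of_real (bump s)) = 0" by (simp add: LIMSEQ_const_iff)
  then have "H x0 * of_real (integral\<^sup>L lborel bump) = 0" by simp
  moreover have "integral\<^sup>L lborel bump \<noteq> 0"
  proof
    assume "integral\<^sup>L lborel bump = 0"
    then have "AE x in lborel. bump x = 0" using integral_nonneg_eq_0_iff_AE[OF bir] bump_nonneg by simp
    then have "AE x in lborel. x \<notin> {-1<..<1::real}"
      by eventually_elim (auto simp: bump_def flat_exp_def)
    then have "{-1<..<1::real} \<in> null_sets lborel" by (subst AE_iff_null_sets) auto
    then have "emeasure lborel {-1<..<1::real} = 0" by blast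
    then show False by (subst (asm) emeasure_lborel_Ioo) auto
  qed
  ultimately show ?thesis by simp
qed


lemma lebesgue_measurable_reflect_shift:
  fixes f :: "real \<Rightarrow> 'a :: topological_space"
  assumes "f \<in> borel_measurable lebesgue"
  shows "(\<lambda>h. f (x - h)) \<in> borel_measurable lebesgue"
proof -
  have "(\<lambda>h. x - h) \<in> lebesgue \<rightarrow>\<^sub>M (lebesgue :: real measure)"
    using lebesgue_affine_measurable[of "\<lambda>_. - 1 :: real" x] by simp
  then show ?thesis using assms by (rule measurable_compose)
qed

lemma borel_imp_lebesgue_measurable: "f \<in> borel_measurable borel \<Longrightarrow> f \<in> borel_measurable lebesgue"
  by (simp add: measurable_completion)

lemma
  fixes f g h :: "real \<Rightarrow> complex"
  assumes f: "f \<in> borel_measurable lebesgue" and g: "g \<in> borel_measurable borel"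
    and fg: "AE x in lebesgue. f x = g x" and h: "h \<in> borel_measurable borel"
  shows integrable_lebesgue_cong_borel: "integrable lebesgue (\<lambda>x. f x * h x) \<longleftrightarrow> integrable lborel (\<lambda>x. g x * h x)"
    and integral_lebesgue_cong_borel: "(LINT x|lebesgue. f x * h x) = (LINT x|lborel. g x * h x)"
proof -
  have m: "(\<lambda>x. f x * h x) \<in> borel_measurable lebesgue" "(\<lambda>x. g x * h x) \<in> borel_measurable lebesgue"
    using f borel_imp_lebesgue_measurable[OF g] borel_imp_lebesgue_measurable[OF h] by (auto intro!: borel_measurable_times)
  have ae: "AE x in lebesgue. f x * h x = g x * h x" using fg by eventually_elim simp
  have gh: "(\<lambda>x. g x * h x) \<in> borel_measurable lborel" using g h by measurable
  show "integrable lebesgue (\<lambda>x. f x * h x) \<longleftrightarrow> integrable lborel (\<lambda>x. g x * h x)"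
    using integrable_cong_AE[OF m ae] integrable_completion[OF gh] by simp
  show "(LINT x|lebesgue. f x * h x) = (LINT x|lborel. g x * h x)"
    using integral_cong_AE[OF m ae] integral_completion[OF gh] by simp
qed

lemma
  fixes f g :: "real \<Rightarrow> complex"
  assumes f: "f \<in> borel_measurable lebesgue" and g: "g \<in> borel_measurable lebesgue"
    and fg: "AE x in lebesgue. f x = g x"
  shows cs_ext_cong_AE: "cs_ext f = cs_ext g"
    and has_cs_ext_cong_AE: "has_cs_ext f \<longleftrightarrow> has_cs_ext g"
proof -
  have m: "(\<lambda>h. of_real (poisson_kernel y h) * k (x - h)) \<in> borel_measurable lebesgue" if "k \<in> borel_measurable lebesgue" for k :: "real \<Rightarrow> complex" and x y
  proof -
    have "(\<lambda>h. of_real (poisson_kernel y h) :: complex) \<in> borel_measurable lebesgue"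
      by (rule borel_imp_lebesgue_measurable) measurable
    then show ?thesis using lebesgue_measurable_reflect_shift[OF that] by (rule borel_measurable_times)
  qed
  have ae: "AE h in lebesgue. of_real (poisson_kernel y h) * f (x - h) = of_real (poisson_kernel y h) * g (x - h)" for x y
    using AE_lebesgue_reflect_shift[OF fg, of x] by eventually_elim simp
  show "cs_ext f = cs_ext g"
    by (rule ext) (simp add: cs_ext_def integral_cong_AE[OF m[OF f] m[OF g] ae])
  show "has_cs_ext f \<longleftrightarrow> has_cs_ext g"
    unfolding has_cs_ext_def using integrable_cong_AE[OF m[OF f] m[OF g] ae] by simp
qed

lemma poisson_kernel_1: "poisson_kernel 1 h = c_star * weight h"
  by (simp add: poisson_kernel_def weight_def add.commute)

lemma has_cs_ext_imp_measurable:
  assumes "has_cs_ext f" shows "f \<in> borel_measurable lebesgue"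
proof -
  have "integrable lebesgue (\<lambda>h. of_real (poisson_kernel 1 h) * f (0 - h))"
    using assms unfolding has_cs_ext_def by (metis zero_less_one)
  then have "(\<lambda>h. of_real (poisson_kernel 1 h) * f (0 - h)) \<in> borel_measurable lebesgue" by auto
  moreover have "(\<lambda>h. of_real (1 / poisson_kernel 1 h) :: complex) \<in> borel_measurable lebesgue"
    by (rule borel_imp_lebesgue_measurable) measurable
  ultimately have "(\<lambda>h. of_real (1 / poisson_kernel 1 h) * (of_real (poisson_kernel 1 h) * f (0 - h))) \<in> borel_measurable lebesgue"
    using borel_measurable_times by blast
  then have "(\<lambda>h. f (0 - h)) \<in> borel_measurable lebesgue"
    using c_star_pos by (simp add: poisson_kernel_1)
  from lebesgue_measurable_reflect_shift[OF this, of 0] show ?thesis by simp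
qed

lemma has_cs_ext_iff_weighted_L1:
  assumes [measurable]: "g \<in> borel_measurable borel"
  shows "has_cs_ext g \<longleftrightarrow> weighted_L1 g"
proof
  assume "has_cs_ext g"
  then have "integrable lebesgue (\<lambda>h. of_real (poisson_kernel 1 h) * g (0 - h))"
    unfolding has_cs_ext_def by (metis zero_less_one)
  then have "integrable lborel (\<lambda>h. of_real (poisson_kernel 1 h) * g (0 - h))"
    by (simp add: integrable_completion)
  from integrable_reflect_shift[OF this, of 0]
  have "integrable lborel (\<lambda>t. of_real (1 / c_star) * (of_real (poisson_kernel 1 t) * g t))"
    by (intro integrable_mult_right) (simp add: poisson_kernel_1)
  then show "weighted_L1 g" using c_star_pos by (simp add: weighted_L1_def poisson_kernel_1)
next
  assume g: "weighted_L1 g"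
  show "has_cs_ext g"
    unfolding has_cs_ext_def
  proof (intro allI impI)
    fix x y :: real assume y: "0 < y"
    define z where "z = sqrt (2 * y)"
    have z: "0 < z" "y = z\<^sup>2 / 2" using y by (auto simp: z_def)
    have "integrable lborel (\<lambda>t. of_real ext_const * (of_real (ker 1 0 (3/4) z (x - t)) * g t))"
      by (intro integrable_mult_right integrable_pot g z) auto
    moreover have "poisson_kernel y h = ext_const * ker 1 0 (3/4) z h" for h
      unfolding z(2) by (rule poisson_kernel_eq_ker[OF z(1)])
    ultimately have "integrable lborel (\<lambda>t. of_real (poisson_kernel y (x - t)) * g t)"
      by (simp add: mult.assoc)
    from integrable_reflect_shift[OF this, of x]
    show "integrable lebesgue (\<lambda>h. of_real (poisson_kernel y h) * g (x - h))"
      by (simp add: integrable_completion)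
  qed
qed

lemma borel_representative:
  assumes "has_cs_ext f"
  obtains g where "weighted_L1 g" "g \<in> borel_measurable borel" "AE x in lebesgue. f x = g x" "cs_ext f = cs_ext g" "f \<in> borel_measurable lebesgue"
proof -
  note f = has_cs_ext_imp_measurable[OF assms]
  obtain g where g: "g \<in> borel_measurable borel" "AE x in lebesgue. f x = g x" using exists_borel_version[OF f] by blast
  note gl = borel_imp_lebesgue_measurable[OF g(1)]
  show ?thesis
    using that[of g] g f assms cs_ext_cong_AE[OF f gl g(2)] has_cs_ext_cong_AE[OF f gl g(2)] has_cs_ext_iff_weighted_L1[OF g(1)] by blast
qed

lemma integrable_weighted_mult:
  assumes f: "weighted_L1 f" and [measurable]: "m \<in> borel_measurable borel" and m: "\<And>t. norm (m t) \<le> C * weight t"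
  shows "integrable lborel (\<lambda>t. f t * m t)"
proof (rule Bochner_Integration.integrable_bound)
  show "integrable lborel (\<lambda>t. of_real C * (of_real (weight t) * f t))"
    using f by (intro integrable_mult_right) (auto simp: weighted_L1_def)
  show "(\<lambda>t. f t * m t) \<in> borel_measurable lborel" using f by (auto simp: weighted_L1_def)
  show "AE t in lborel. norm (f t * m t) \<le> norm (of_real C * (of_real (weight t) * f t))"
  proof (intro AE_I2)
    fix t
    have "norm (f t) * norm (m t) \<le> norm (f t) * (\<bar>C\<bar> * weight t)"
      using m[of t] by (intro mult_left_mono) (auto intro: order_trans mult_right_mono)
    then show "norm (f t * m t) \<le> norm (of_real C * (of_real (weight t) * f t))"
      by (simp add: norm_mult mult_ac)
  qed
qed

lemma integrable_lborel_product:
  fixes a b :: "real \<Rightarrow> complex"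
  assumes a: "integrable lborel a" and b: "integrable lborel b"
  shows "integrable (lborel \<Otimes>\<^sub>M lborel) (\<lambda>(x, t). a x * b t)"
proof (rule lborel_pair.Fubini_integrable)
  have [measurable]: "a \<in> borel_measurable borel" "b \<in> borel_measurable borel" using a b by auto
  show "(\<lambda>(x, t). a x * b t) \<in> borel_measurable (lborel \<Otimes>\<^sub>M lborel)" by measurable
  show "integrable lborel (\<lambda>x. LINT t|lborel. norm (case (x, t) of (x, t) \<Rightarrow> a x * b t))"
    using a by (simp add: norm_mult)
  show "AE x in lborel. integrable lborel (\<lambda>t. case (x, t) of (x, t) \<Rightarrow> a x * b t)" using b by simp
qed

lemma schwartz_quartic_decay:
  assumes "schwartz \<phi>" obtains K where "\<And>x. (1 + x\<^sup>2) * norm (\<phi> x) \<le> K / (1 + x\<^sup>2)"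
proof -
  obtain A where A: "\<And>x. norm (of_real (x ^ 0) * (D1 ^^ 0) \<phi> x) \<le> A" using schwartz_bound[OF assms] by blast
  obtain B where B: "\<And>x. norm (of_real (x ^ 2) * (D1 ^^ 0) \<phi> x) \<le> B" using schwartz_bound[OF assms] by blast
  obtain C where C: "\<And>x. norm (of_real (x ^ 4) * (D1 ^^ 0) \<phi> x) \<le> C" using schwartz_bound[OF assms] by blast
  have "(1 + x\<^sup>2) * norm (\<phi> x) \<le> (A + 2 * B + C) / (1 + x\<^sup>2)" for x
  proof -
    have "(1 + x\<^sup>2) * norm (\<phi> x) * (1 + x\<^sup>2) = norm (\<phi> x) + 2 * (x\<^sup>2 * norm (\<phi> x)) + x ^ 4 * norm (\<phi> x)"
      by (simp add: power2_eq_square power4_eq_xxxx algebra_simps)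
    also have "\<dots> \<le> A + 2 * B + C"
      using A[of x] B[of x] C[of x] by (simp add: norm_mult norm_power)
    finally show ?thesis by (simp add: pos_le_divide_eq)
  qed
  then show ?thesis using that by blast
qed

lemma integrable_quadratic_schwartz:
  assumes "schwartz \<phi>" shows "integrable lborel (\<lambda>x. of_real (1 + x\<^sup>2) * \<phi> x)"
proof -
  obtain K where K: "\<And>x. (1 + x\<^sup>2) * norm (\<phi> x) \<le> K / (1 + x\<^sup>2)" using schwartz_quartic_decay[OF assms] by blast
  obtain N where N: "quadratic_decay N \<phi>" using schwartz_quadratic_decay[OF assms] by blast
  note [measurable] = quadratic_decayD(6)[OF N]
  have p: "\<bar>1 + x\<^sup>2\<bar> = 1 + x\<^sup>2" for x :: real using one_plus_square_pos[of x] by linarith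
  show ?thesis
    by (rule integrable_quadratic_decay(1)[of _ K]) (use K in \<open>auto simp: norm_mult p simp del: of_real_add\<close>)
qed

lemma integral_W_z_schwartz:
  assumes f: "weighted_L1 f" and \<phi>: "schwartz \<phi>" and z: "0 < z"
  shows "(LINT x|lborel. W_z f (x, z) * \<phi> x) = - of_real flux_const * (LINT t|lborel. f t * gen_conv (5/4) (z\<^sup>2 / 2) (frac_lap \<phi>) t)"
proof -
  obtain N where N: "quadratic_decay N \<phi>" using schwartz_quadratic_decay[OF \<phi>] by blast
  have [measurable]: "f \<in> borel_measurable borel" "\<phi> \<in> borel_measurable borel"
    using f quadratic_decayD(6)[OF N] by (auto simp: weighted_L1_def)
  obtain C where C: "0 \<le> C" "\<And>x t. \<bar>flux_kernel z (x - t)\<bar> \<le> C * (1 + x\<^sup>2) * weight t"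
    using flux_kernel_weight_bound[OF z] by metis
  have p: "\<bar>1 + x\<^sup>2\<bar> = 1 + x\<^sup>2" for x :: real using one_plus_square_pos[of x] by linarith
  have i: "integrable (lborel \<Otimes>\<^sub>M lborel) (\<lambda>(x, t). of_real (flux_kernel z (x - t)) * f t * \<phi> x)"
  proof (rule Bochner_Integration.integrable_bound)
    show "integrable (lborel \<Otimes>\<^sub>M lborel) (\<lambda>(x, t). (of_real C * (of_real (1 + x\<^sup>2) * \<phi> x)) * (of_real (weight t) * f t))"
      using f integrable_quadratic_schwartz[OF \<phi>] by (intro integrable_lborel_product integrable_mult_right) (auto simp: weighted_L1_def)
    show "AE p in lborel \<Otimes>\<^sub>M lborel. norm (case p of (x, t) \<Rightarrow> of_real (flux_kernel z (x - t)) * f t * \<phi> x) \<le>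
       norm (case p of (x, t) \<Rightarrow> (of_real C * (of_real (1 + x\<^sup>2) * \<phi> x)) * (of_real (weight t) * f t))"
    proof (intro AE_I2, clarify)
      fix x t
      have "\<bar>flux_kernel z (x - t)\<bar> * (norm (f t) * norm (\<phi> x)) \<le> C * (1 + x\<^sup>2) * weight t * (norm (f t) * norm (\<phi> x))"
        by (intro mult_right_mono C) auto
      then show "norm (of_real (flux_kernel z (x - t)) * f t * \<phi> x) \<le> norm ((of_real C * (of_real (1 + x\<^sup>2) * \<phi> x)) * (of_real (weight t) * f t))"
        using C(1) by (simp add: norm_mult p mult_ac del: of_real_add)
    qed
  qed measurable
  have "(LINT x|lborel. W_z f (x, z) * \<phi> x) = (LINT x|lborel. LINT t|lborel. of_real (flux_kernel z (x - t)) * f t * \<phi> x)"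
    unfolding W_z_eq_flux[OF f z] using integrable_flux_conv[OF f z] by simp
  also have "\<dots> = (LINT t|lborel. LINT x|lborel. of_real (flux_kernel z (x - t)) * f t * \<phi> x)"
    using lborel_pair.Fubini_integral[OF i] by simp
  also have "\<dots> = (LINT t|lborel. f t * (LINT x|lborel. of_real (flux_kernel z (t - x)) * \<phi> x))"
  proof (intro Bochner_Integration.integral_cong refl)
    fix t
    have "(LINT x|lborel. of_real (flux_kernel z (x - t)) * f t * \<phi> x) = (LINT x|lborel. f t * (of_real (flux_kernel z (t - x)) * \<phi> x))"
      by (intro Bochner_Integration.integral_cong refl) (simp add: flux_kernel_commute[of z t])
    then show "(LINT x|lborel. of_real (flux_kernel z (x - t)) * f t * \<phi> x) = f t * (LINT x|lborel. of_real (flux_kernel z (t - x)) * \<phi> x)"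
      by simp
  qed
  also have "\<dots> = (LINT t|lborel. - of_real flux_const * (f t * gen_conv (5/4) (z\<^sup>2 / 2) (frac_lap \<phi>) t))"
    unfolding flux_conv_schwartz[OF \<phi> z] by (simp add: mult.left_commute)
  also have "\<dots> = - of_real flux_const * (LINT t|lborel. f t * gen_conv (5/4) (z\<^sup>2 / 2) (frac_lap \<phi>) t)"
    by (rule integral_mult_right_zero)
  finally show ?thesis .
qed

lemma half_square_tendsto:
  assumes "\<And>n. 0 < z n" "z \<longlonglongrightarrow> (0::real)"
  shows "0 < (z n)\<^sup>2 / 2" "(\<lambda>n. (z n)\<^sup>2 / 2) \<longlonglongrightarrow> 0"
proof -
  have "(\<lambda>n. (z n)\<^sup>2 / 2) \<longlonglongrightarrow> 0\<^sup>2 / 2" by (intro tendsto_intros assms) auto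
  then show "0 < (z n)\<^sup>2 / 2" "(\<lambda>n. (z n)\<^sup>2 / 2) \<longlonglongrightarrow> 0" using assms(1)[of n] by auto
qed

lemma integrable_mult_frac_lap:
  assumes f: "weighted_L1 f" and \<phi>: "schwartz \<phi>"
  shows "integrable lborel (\<lambda>t. f t * frac_lap \<phi> t)"
proof -
  obtain N where N: "quadratic_decay N \<phi>" using schwartz_quadratic_decay[OF \<phi>] by blast
  show ?thesis by (rule integrable_weighted_mult[OF f frac_lap_measurable[OF \<phi>] frac_lap_weight_bound[OF \<phi> N]])
qed

lemma integral_W_z_schwartz_tendsto:
  assumes f: "weighted_L1 f" and \<phi>: "schwartz \<phi>" and z: "\<And>n. 0 < z n" "z \<longlonglongrightarrow> 0"
  shows "(\<lambda>n. LINT x|lborel. W_z f (x, z n) * \<phi> x) \<longlonglongrightarrow> - of_real flux_const * (LINT t|lborel. f t * frac_lap \<phi> t)"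
  unfolding integral_W_z_schwartz[OF f \<phi> z(1)]
proof (intro tendsto_mult tendsto_const)
  obtain N where N: "quadratic_decay N \<phi>" using schwartz_quadratic_decay[OF \<phi>] by blast
  obtain B where B: "\<And>x. norm (frac_lap \<phi> x) \<le> B" using frac_lap_bounded[OF \<phi>] by blast
  note [measurable] = frac_lap_measurable[OF \<phi>]
  have [measurable]: "f \<in> borel_measurable borel" using f by (simp add: weighted_L1_def)
  define C where "C = flux_bound_const / flux_const * N"
  have C: "norm (gen_conv (5/4) ((z n)\<^sup>2 / 2) (frac_lap \<phi>) t) \<le> C * weight t" for n t
  proof -
    have "flux_const * norm (gen_conv (5/4) ((z n)\<^sup>2 / 2) (frac_lap \<phi>) t) \<le> flux_bound_const * N * weight t"
      using norm_flux_conv_le[OF z(1) N, of n t] flux_const_pos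
      unfolding flux_conv_schwartz[OF \<phi> z(1)] by (simp add: norm_mult)
    then show ?thesis using flux_const_pos by (simp add: C_def field_simps)
  qed
  have C0: "0 \<le> C" using flux_bound_const_nonneg flux_const_pos quadratic_decayD(4)[OF N] by (simp add: C_def)
  show "(\<lambda>n. LINT t|lborel. f t * gen_conv (5/4) ((z n)\<^sup>2 / 2) (frac_lap \<phi>) t) \<longlonglongrightarrow> (LINT t|lborel. f t * frac_lap \<phi> t)"
  proof (rule integral_dominated_convergence[where w = "\<lambda>t. C * norm (of_real (weight t) * f t)"])
    show "integrable lborel (\<lambda>t. C * norm (of_real (weight t) * f t))"
      using f by (intro integrable_mult_right integrable_norm) (auto simp: weighted_L1_def)
    show "AE t in lborel. (\<lambda>n. f t * gen_conv (5/4) ((z n)\<^sup>2 / 2) (frac_lap \<phi>) t) \<longlonglongrightarrow> f t * frac_lap \<phi> t"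
      using half_square_tendsto[OF z]
      by (intro AE_I2 tendsto_mult tendsto_const gen_conv_tendsto_pointwise[OF _ frac_lap_measurable[OF \<phi>] B isCont_frac_lap[OF \<phi>]]) auto
    show "AE t in lborel. norm (f t * gen_conv (5/4) ((z n)\<^sup>2 / 2) (frac_lap \<phi>) t) \<le> C * norm (of_real (weight t) * f t)" for n
    proof (intro AE_I2)
      fix t
      have "norm (f t) * norm (gen_conv (5/4) ((z n)\<^sup>2 / 2) (frac_lap \<phi>) t) \<le> norm (f t) * (C * weight t)"
        by (intro mult_left_mono C) auto
      then show "norm (f t * gen_conv (5/4) ((z n)\<^sup>2 / 2) (frac_lap \<phi>) t) \<le> C * norm (of_real (weight t) * f t)"
        by (simp add: norm_mult mult_ac)
    qed
  qed measurable
qed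

lemma W_slice_continuous:
  assumes "weighted_L1 f" "0 < z"
  shows "continuous_on UNIV (\<lambda>x. W_fun f (x, z))" "continuous_on UNIV (\<lambda>x. W_x f (x, z))" "continuous_on UNIV (\<lambda>x. W_z f (x, z))"
proof -
  have c: "continuous_on UNIV (\<lambda>x. (x, z))" by (intro continuous_on_Pair continuous_on_id continuous_on_const)
  have s: "(\<lambda>x. (x, z)) ` UNIV \<subseteq> half_plane" using assms(2) by auto
  show "continuous_on UNIV (\<lambda>x. W_fun f (x, z))" "continuous_on UNIV (\<lambda>x. W_x f (x, z))" "continuous_on UNIV (\<lambda>x. W_z f (x, z))"
    by (rule continuous_on_compose2[OF continuous_on_W(1)[OF assms(1)] c s]
        continuous_on_compose2[OF continuous_on_W(2)[OF assms(1)] c s]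
        continuous_on_compose2[OF continuous_on_W(3)[OF assms(1)] c s])+
qed

lemma W_slice_measurable:
  assumes "weighted_L1 f" "0 < z"
  shows "(\<lambda>x. W_fun f (x, z)) \<in> borel_measurable borel" "(\<lambda>x. W_x f (x, z)) \<in> borel_measurable borel"
    "(\<lambda>x. W_z f (x, z)) \<in> borel_measurable borel"
  using W_slice_continuous[OF assms] by (auto intro: borel_measurable_continuous_onI)

lemma dtn_limit:
  assumes f: "has_cs_ext f" and \<phi>: "schwartz \<phi>"
  shows "((\<lambda>y. LINT x|lebesgue. of_real (y powr (1/2)) * Dsnd (cs_ext f) (x, y) * \<phi> x)
     \<longlongrightarrow> - of_real (flux_const / sqrt 2) * (LINT x|lebesgue. f x * frac_lap \<phi> x)) (at_right 0)"
  unfolding tendsto_at_iff_sequentially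
proof (intro allI impI)
  fix Y :: "nat \<Rightarrow> real" assume Y: "\<forall>i. Y i \<in> {0<..} - {0}" "Y \<longlonglongrightarrow> 0"
  obtain g where g: "weighted_L1 g" "g \<in> borel_measurable borel" "AE x in lebesgue. f x = g x" "cs_ext f = cs_ext g" "f \<in> borel_measurable lebesgue"
    using borel_representative[OF f] by blast
  obtain N where N: "quadratic_decay N \<phi>" using schwartz_quadratic_decay[OF \<phi>] by blast
  note [measurable] = quadratic_decayD(6)[OF N]
  define z where "z n = sqrt (2 * Y n)" for n
  have z: "0 < z n" "Y n = (z n)\<^sup>2 / 2" for n
  proof -
    have "0 < Y n" using Y(1) by auto
    then show "0 < z n" "Y n = (z n)\<^sup>2 / 2" by (simp_all add: z_def)
  qed
  have "z \<longlonglongrightarrow> sqrt (2 * 0)" unfolding z_def by (intro tendsto_intros Y)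
  then have zl: "z \<longlonglongrightarrow> 0" by simp
  have "(\<lambda>n. of_real (1 / sqrt 2) * (LINT x|lborel. W_z g (x, z n) * \<phi> x)) \<longlonglongrightarrow> of_real (1 / sqrt 2) * (- of_real flux_const * (LINT t|lborel. g t * frac_lap \<phi> t))"
    by (intro tendsto_mult tendsto_const integral_W_z_schwartz_tendsto g \<phi> z zl)
  moreover have "(LINT x|lebesgue. of_real (Y n powr (1/2)) * Dsnd (cs_ext f) (x, Y n) * \<phi> x) = of_real (1 / sqrt 2) * (LINT x|lborel. W_z g (x, z n) * \<phi> x)" for n
  proof -
    have Yn: "0 < Y n" using Y(1) by auto
    have e: "Y n powr (1/2) = z n / sqrt 2"
      unfolding z_def real_sqrt_mult using Yn by (simp add: powr_half_sqrt)
    have e2: "sqrt (2 * Y n) = z n" by (simp only: z_def)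
    note [measurable] = W_slice_measurable(3)[OF g(1) z(1)[of n]]
    have "(LINT x|lebesgue. of_real (Y n powr (1/2)) * Dsnd (cs_ext f) (x, Y n) * \<phi> x) = (LINT x|lebesgue. of_real (1 / sqrt 2) * (W_z g (x, z n) * \<phi> x))"
      using z(1)[of n] unfolding g(4) Dsnd_cs_ext[OF g(1) Yn] e e2 by simp
    also have "\<dots> = (LINT x|lborel. of_real (1 / sqrt 2) * (W_z g (x, z n) * \<phi> x))" by (simp add: integral_completion)
    finally show ?thesis by simp
  qed
  moreover have "(LINT x|lebesgue. f x * frac_lap \<phi> x) = (LINT t|lborel. g t * frac_lap \<phi> t)"
    by (rule integral_lebesgue_cong_borel[OF g(5,2,3) frac_lap_measurable[OF \<phi>]])
  ultimately show "((\<lambda>y. LINT x|lebesgue. of_real (y powr (1/2)) * Dsnd (cs_ext f) (x, y) * \<phi> x) \<circ> Y)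
     \<longlonglongrightarrow> - of_real (flux_const / sqrt 2) * (LINT x|lebesgue. f x * frac_lap \<phi> x)"
    by (simp add: o_def)
qed

lemma dtn_identity_flux_const: "dtn_identity (sqrt 2 / flux_const)"
  unfolding dtn_identity_def
proof (intro ballI allI impI)
  fix f \<phi> assume f: "f \<in> trace_space" and \<phi>: "schwartz \<phi>"
  have "((\<lambda>y. - of_real (sqrt 2 / flux_const) * (LINT x|lebesgue. of_real (y powr (1/2)) * Dsnd (cs_ext f) (x, y) * \<phi> x))
     \<longlongrightarrow> - of_real (sqrt 2 / flux_const) * (- of_real (flux_const / sqrt 2) * (LINT x|lebesgue. f x * frac_lap \<phi> x))) (at_right 0)"
    using f by (intro tendsto_mult tendsto_const dtn_limit \<phi>) (auto simp: trace_space_def)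
  moreover have "- of_real (sqrt 2 / flux_const) * (- of_real (flux_const / sqrt 2) * c) = c" for c :: complex
  proof -
    have "(- a) * ((- b) * c) = (a * b) * c" for a b :: complex by simp
    then have "- of_real (sqrt 2 / flux_const) * (- of_real (flux_const / sqrt 2) * c) = of_real (sqrt 2 / flux_const * (flux_const / sqrt 2)) * c"
      by (simp only: of_real_mult)
    also have "sqrt 2 / flux_const * (flux_const / sqrt 2) = 1" using flux_const_pos by simp
    finally show ?thesis by simp
  qed
  ultimately show "((\<lambda>y. - of_real (sqrt 2 / flux_const) * (LINT x|lebesgue. of_real (y powr (1/2)) * Dsnd (cs_ext f) (x, y) * \<phi> x))
     \<longlongrightarrow> (LINT x|lebesgue. f x * frac_lap \<phi> x)) (at_right 0)" by (simp only:)
qed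

lemma integral_bump_frac_lap_bump:
  "(LINT x|lborel. of_real (bump x) * frac_lap (\<lambda>x. of_real (bump x)) x) \<noteq> 0"
proof
  let ?b = "\<lambda>x. of_real (bump x) :: complex"
  assume 0: "(LINT x|lborel. ?b x * frac_lap ?b x) = 0"
  obtain N where N: "quadratic_decay N ?b" using schwartz_quadratic_decay[OF schwartz_bump] by blast
  note bi = quadratic_decayD(7)[OF N]
  have real: "ft ?b \<xi> = of_real (Re (ft ?b \<xi>))" for \<xi>
  proof -
    have "cnj (ft ?b \<xi>) = (LINT x|lborel. cnj (exp (- (\<i> * of_real (x * \<xi>))) * ?b x))"
      unfolding ft_def by (rule Bochner_Integration.integral_cnj[symmetric])
    also have "\<dots> = (LINT x|lborel. exp (\<i> * of_real (x * \<xi>)) * ?b x)"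
      by (intro Bochner_Integration.integral_cong refl) (simp add: exp_cnj)
    also have "\<dots> = (LINT x|lborel. exp (\<i> * of_real ((0 - x) * \<xi>)) * ?b (0 - x))"
      by (rule integral_reflect_shift[symmetric])
    also have "\<dots> = ft ?b \<xi>" unfolding ft_def by (simp add: bump_even)
    finally show ?thesis by (simp add: complex_eq_iff)
  qed
  have eq: "half_derivative_ft ?b \<xi> * ft ?b \<xi> = of_real (\<bar>\<xi>\<bar> powr (1/2) * (Re (ft ?b \<xi>))\<^sup>2)" for \<xi>
    unfolding half_derivative_ft_def by (subst (1 2) real) (simp add: power2_eq_square)
  have "(LINT t|lborel. ?b (0 - t) * (LINT \<xi>|lborel. exp (\<i> * of_real (t * \<xi>)) * half_derivative_ft ?b \<xi>)) =
     (LINT \<xi>|lborel. exp (\<i> * of_real (0 * \<xi>)) * (ft ?b \<xi> * half_derivative_ft ?b \<xi>))"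
    by (rule convolution_fourier_integral[OF bi integrable_schwartz_ft(2)[OF schwartz_bump]])
  also have "\<dots> = (LINT \<xi>|lborel. of_real (\<bar>\<xi>\<bar> powr (1/2) * (Re (ft ?b \<xi>))\<^sup>2))"
    by (simp only: eq[symmetric]) (simp add: mult.commute)
  also have "\<dots> = of_real (LINT \<xi>|lborel. \<bar>\<xi>\<bar> powr (1/2) * (Re (ft ?b \<xi>))\<^sup>2)"
    by (rule integral_complex_of_real)
  finally have "of_real (1 / (2 * pi)) * of_real (LINT \<xi>|lborel. \<bar>\<xi>\<bar> powr (1/2) * (Re (ft ?b \<xi>))\<^sup>2) =
     (LINT t|lborel. ?b t * frac_lap ?b t)"
    unfolding frac_lap_eq[OF schwartz_bump] by (simp add: bump_even mult.left_commute)
  then have I0: "(LINT \<xi>|lborel. \<bar>\<xi>\<bar> powr (1/2) * (Re (ft ?b \<xi>))\<^sup>2) = 0" using 0 by simp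
  have "integrable lborel (\<lambda>\<xi>. half_derivative_ft ?b \<xi> * ft ?b \<xi>)"
    by (rule integrable_bounded_mult[OF integrable_schwartz_ft(2)[OF schwartz_bump] _ norm_ft_le])
      (use quadratic_decayD(6)[OF N] in measurable)
  then have "integrable lborel (\<lambda>\<xi>. \<bar>\<xi>\<bar> powr (1/2) * (Re (ft ?b \<xi>))\<^sup>2)"
    unfolding eq complex_of_real_integrable_eq .
  then have "AE \<xi> in lborel. \<bar>\<xi>\<bar> powr (1/2) * (Re (ft ?b \<xi>))\<^sup>2 = 0"
    using I0 by (subst (asm) integral_nonneg_eq_0_iff_AE) auto
  then have "AE \<xi> in lborel. ft ?b \<xi> = 0"
    using AE_lborel_singleton[of 0]
  proof eventually_elim
    case (elim \<xi>)
    then have "Re (ft ?b \<xi>) = 0" by simp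
    then show ?case using real[of \<xi>] by simp
  qed
  then have "AE \<xi> in lborel. exp (\<i> * of_real (0 * \<xi>)) * ft ?b \<xi> = 0" by eventually_elim simp
  then have "(LINT \<xi>|lborel. exp (\<i> * of_real (0 * \<xi>)) * ft ?b \<xi>) = 0" by (rule integral_eq_zero_AE)
  moreover have "isCont ?b x" for x using differentiable_imp_continuous_within[OF quadratic_decayD(1)[OF N]] .
  ultimately have "of_real (2 * pi) * ?b 0 = 0"
    using fourier_inversion[OF bi _ quadratic_decayD(5)[OF N] integrable_schwartz_ft(1)[OF schwartz_bump], of 0] by simp
  then show False using bump_0 by simp
qed


definition grad_kernel :: "real \<Rightarrow> real \<Rightarrow> real" where
  "grad_kernel z h = - (3/2) * ext_const * ker 1 1 (7/4) z h"

lemma grad_kernel_measurable [measurable]: "grad_kernel z \<in> borel_measurable borel"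
  unfolding grad_kernel_def[abs_def] by measurable

lemma W_x_eq_grad: "W_x f (x, z) = (LINT t|lborel. of_real (grad_kernel z (x - t)) * f t)"
proof -
  have "(LINT t|lborel. of_real (grad_kernel z (x - t)) * f t) = (LINT t|lborel. of_real (- (3/2) * ext_const) * (of_real (ker 1 1 (7/4) z (x - t)) * f t))"
    unfolding grad_kernel_def by (simp only: of_real_mult mult.assoc)
  also have "\<dots> = of_real (- (3/2) * ext_const) * pot 1 1 (7/4) f (x, z)"
    unfolding pot_def by (subst integral_mult_right_zero) simp
  finally show ?thesis by (simp add: W_x_def)
qed

context
  fixes z h :: real
  assumes z: "0 < z"
begin

private lemma S_pos: "0 < h\<^sup>2 + z ^ 4 / 4" by (rule square_plus_pos[OF z])

lemma abs_grad_kernel: "\<bar>grad_kernel z h\<bar> = 3/2 * ext_const * z * (\<bar>h\<bar> * (h\<^sup>2 + z ^ 4 / 4) powr (- (7/4)))"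
  using z ext_const_pos by (simp add: grad_kernel_def ker_def abs_mult)

lemma abs_grad_kernel_le: "\<bar>grad_kernel z h\<bar> \<le> 3/2 * ext_const * z * (h\<^sup>2 + z ^ 4 / 4) powr (- (5/4))"
proof -
  let ?S = "h\<^sup>2 + z ^ 4 / 4"
  have "\<bar>h\<bar> = sqrt (h\<^sup>2)" by simp
  also have "\<dots> \<le> sqrt ?S" by (intro real_sqrt_le_mono) auto
  also have "\<dots> = ?S powr (1/2)" using S_pos by (simp add: powr_half_sqrt)
  finally have "\<bar>h\<bar> * ?S powr (- (7/4)) \<le> ?S powr (1/2) * ?S powr (- (7/4))" by (intro mult_right_mono) auto
  also have "\<dots> = ?S powr (- (5/4))" by (simp only: powr_add[symmetric]) simp
  finally show ?thesis unfolding abs_grad_kernel using z ext_const_pos by (intro mult_left_mono) auto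
qed

lemma S_powr_split: "(h\<^sup>2 + z ^ 4 / 4) powr (- (3/4)) = (h\<^sup>2 + z ^ 4 / 4) * (h\<^sup>2 + z ^ 4 / 4) powr (- (7/4))"
proof -
  let ?S = "h\<^sup>2 + z ^ 4 / 4"
  have "?S powr (- (3/4)) = ?S powr (1 + - (7/4))" by simp
  also have "\<dots> = ?S * ?S powr (- (7/4))" using S_pos by (subst powr_add) simp
  finally show ?thesis .
qed

lemma poisson_kernel_z: "poisson_kernel (z\<^sup>2 / 2) h = ext_const * z * (h\<^sup>2 + z ^ 4 / 4) powr (- (3/4))"
  by (simp add: poisson_kernel_eq_ker[OF z] ker_def)

lemma abs_grad_kernel_mult_le: "\<bar>grad_kernel z h\<bar> * \<bar>h\<bar> \<le> 3/2 * poisson_kernel (z\<^sup>2 / 2) h"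
proof -
  let ?S = "h\<^sup>2 + z ^ 4 / 4"
  have "\<bar>grad_kernel z h\<bar> * \<bar>h\<bar> = 3/2 * (ext_const * z) * (h\<^sup>2 * ?S powr (- (7/4)))"
    unfolding abs_grad_kernel by (simp add: power2_eq_square)
  also have "\<dots> \<le> 3/2 * (ext_const * z) * (?S * ?S powr (- (7/4)))"
    using z ext_const_pos by (intro mult_left_mono mult_right_mono) auto
  finally show ?thesis unfolding poisson_kernel_z S_powr_split by (simp add: mult.assoc)
qed

lemma abs_grad_kernel_le_poisson: "\<bar>grad_kernel z h\<bar> \<le> 3/2 / z\<^sup>2 * poisson_kernel (z\<^sup>2 / 2) h"
proof -
  let ?S = "h\<^sup>2 + z ^ 4 / 4"
  have "0 \<le> (\<bar>h\<bar> - z\<^sup>2 / 2)\<^sup>2" by simp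
  moreover have "(\<bar>h\<bar> - z\<^sup>2 / 2)\<^sup>2 = h\<^sup>2 - \<bar>h\<bar> * z\<^sup>2 + z ^ 4 / 4"
    by (simp add: power2_diff power_divide)
  ultimately have "\<bar>h\<bar> * z\<^sup>2 \<le> ?S" by linarith
  then have "\<bar>h\<bar> \<le> ?S / z\<^sup>2" using z by (simp add: pos_le_divide_eq)
  then have "\<bar>h\<bar> * ?S powr (- (7/4)) \<le> ?S / z\<^sup>2 * ?S powr (- (7/4))" by (intro mult_right_mono) auto
  also have "\<dots> = ?S powr (- (3/4)) / z\<^sup>2" by (simp add: S_powr_split)
  finally have "3/2 * ext_const * z * (\<bar>h\<bar> * ?S powr (- (7/4))) \<le> 3/2 * ext_const * z * (?S powr (- (3/4)) / z\<^sup>2)"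
    using z ext_const_pos by (intro mult_left_mono) auto
  then show ?thesis unfolding abs_grad_kernel poisson_kernel_z by simp
qed

end

lemma poisson_kernel_nonneg: "0 \<le> poisson_kernel y h"
  unfolding poisson_kernel_eq_gen by (rule gen_poisson_nonneg) simp

lemma integrable_poisson_kernel: "0 < y \<Longrightarrow> integrable lborel (poisson_kernel y)"
  and integral_poisson_kernel: "0 < y \<Longrightarrow> integral\<^sup>L lborel (poisson_kernel y) = 1"
  unfolding poisson_kernel_eq_gen by (auto intro!: integrable_gen_poisson integral_gen_poisson)

lemma integrable_grad_kernel:
  assumes z: "0 < z" shows "integrable lborel (grad_kernel z)"
proof (rule Bochner_Integration.integrable_bound)
  show "integrable lborel (\<lambda>h. 3/2 / z\<^sup>2 * poisson_kernel (z\<^sup>2 / 2) h)"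
    using z by (intro integrable_mult_right integrable_poisson_kernel) auto
  show "AE h in lborel. norm (grad_kernel z h) \<le> norm (3/2 / z\<^sup>2 * poisson_kernel (z\<^sup>2 / 2) h)"
    by (intro AE_I2) (auto intro!: order_trans[OF abs_grad_kernel_le_poisson[OF z]] divide_right_mono)
qed measurable

lemma integral_grad_kernel: "integral\<^sup>L lborel (grad_kernel z) = 0"
proof -
  have "integral\<^sup>L lborel (grad_kernel z) = (LINT h|lborel. grad_kernel z (0 - h))" by (rule integral_reflect_shift[symmetric])
  also have "\<dots> = (LINT h|lborel. - grad_kernel z h)"
    by (intro Bochner_Integration.integral_cong refl) (simp add: grad_kernel_def ker_def)
  finally show ?thesis by simp
qed

lemma norm_W_x_lipschitz:
  assumes z: "0 < z" and N: "quadratic_decay N \<phi>"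
  shows "norm (W_x \<phi> (x, z)) \<le> 3/2 * N"
proof -
  note [measurable] = quadratic_decayD(6)[OF N]
  let ?k = "\<lambda>h. of_real (grad_kernel z h) :: complex" and ?P = "poisson_kernel (z\<^sup>2 / 2)"
  have y: "0 < z\<^sup>2 / 2" using z by simp
  have lip: "norm (\<phi> (x - h) - \<phi> x) \<le> N * \<bar>h\<bar>" for h
  proof -
    have "norm (\<phi> (x - h) - \<phi> x) \<le> N * norm (x - h - x)"
    proof (rule differentiable_bound[of UNIV \<phi> "\<lambda>t s. s *\<^sub>R D1 \<phi> t"])
      show "(\<phi> has_derivative (\<lambda>s. s *\<^sub>R D1 \<phi> t)) (at t within UNIV)" for t
        using D1_has_vector_derivative[OF quadratic_decayD(1)[OF N], of t] by (simp add: has_vector_derivative_def)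
      show "onorm (\<lambda>s. s *\<^sub>R D1 \<phi> t) \<le> N" for t
      proof (rule onorm_bound)
        have "N / (1 + t\<^sup>2) \<le> N / 1" using quadratic_decayD(4)[OF N] by (intro divide_left_mono) auto
        then have "norm (D1 \<phi> t) \<le> N" using quadratic_decayD(3)[OF N, of t] by simp
        then show "norm (s *\<^sub>R D1 \<phi> t) \<le> N * norm s" for s
          using mult_right_mono[of "norm (D1 \<phi> t)" N "norm s"] by (simp add: mult.commute)
      qed (use quadratic_decayD(4)[OF N] in auto)
    qed auto
    then show ?thesis by simp
  qed
  have ki: "integrable lborel ?k" using integrable_grad_kernel[OF z] by simp
  have kpi: "integrable lborel (\<lambda>h. ?k h * \<phi> (x - h))"
    by (rule integrable_bounded_mult[OF ki]) (use quadratic_decayD(5)[OF N] in auto)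
  have d: "integrable lborel (\<lambda>h. ?k h * (\<phi> (x - h) - \<phi> x))"
    using Bochner_Integration.integrable_diff[OF kpi integrable_mult_left[OF ki, of "\<phi> x"]] by (simp add: right_diff_distrib)
  have "W_x \<phi> (x, z) = (LINT h|lborel. ?k h * \<phi> (x - h))"
    unfolding W_x_eq_grad using integral_reflect_shift[of "\<lambda>t. of_real (grad_kernel z (x - t)) * \<phi> t" x] by simp
  also have "\<dots> = (LINT h|lborel. ?k h * \<phi> (x - h)) - (LINT h|lborel. ?k h * \<phi> x)"
    using integral_grad_kernel[of z] by simp
  also have "\<dots> = (LINT h|lborel. ?k h * (\<phi> (x - h) - \<phi> x))"
    using kpi ki by (simp add: right_diff_distrib)
  finally have "norm (W_x \<phi> (x, z)) \<le> (LINT h|lborel. norm (?k h * (\<phi> (x - h) - \<phi> x)))" by simp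
  also have "\<dots> \<le> (LINT h|lborel. 3/2 * N * ?P h)"
  proof (rule integral_mono)
    show "integrable lborel (\<lambda>h. norm (?k h * (\<phi> (x - h) - \<phi> x)))" using d by (rule integrable_norm)
    show "integrable lborel (\<lambda>h. 3/2 * N * ?P h)" using integrable_poisson_kernel[OF y] by simp
    show "norm (?k h * (\<phi> (x - h) - \<phi> x)) \<le> 3/2 * N * ?P h" for h
    proof -
      have "norm (?k h * (\<phi> (x - h) - \<phi> x)) \<le> \<bar>grad_kernel z h\<bar> * (N * \<bar>h\<bar>)"
        unfolding norm_mult norm_of_real by (intro mult_left_mono lip) auto
      also have "\<dots> = N * (\<bar>grad_kernel z h\<bar> * \<bar>h\<bar>)" by simp
      also have "\<dots> \<le> N * (3/2 * ?P h)"
        using quadratic_decayD(4)[OF N] by (intro mult_left_mono abs_grad_kernel_mult_le[OF z]) auto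
      finally show ?thesis by simp
    qed
  qed
  also have "\<dots> = 3/2 * N" using integral_poisson_kernel[OF y] by simp
  finally show ?thesis .
qed

lemma norm_conv_le_of_support:
  fixes k :: "real \<Rightarrow> real" and f :: "real \<Rightarrow> complex"
  assumes f: "integrable lborel f" and "\<And>t. 1 \<le> \<bar>t\<bar> \<Longrightarrow> f t = 0" "\<And>t. \<bar>t\<bar> \<le> 1 \<Longrightarrow> \<bar>k t\<bar> \<le> M" "0 \<le> M"
  shows "norm (LINT t|lborel. of_real (k t) * f t) \<le> M * (LINT t|lborel. norm (f t))"
proof (cases "integrable lborel (\<lambda>t. of_real (k t) * f t)")
  case True
  have "norm (LINT t|lborel. of_real (k t) * f t) \<le> (LINT t|lborel. norm (of_real (k t) * f t))" by simp
  also have "\<dots> \<le> (LINT t|lborel. M * norm (f t))"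
  proof (rule integral_mono)
    show "norm (of_real (k t) * f t) \<le> M * norm (f t)" for t
      using assms(2)[of t] assms(3)[of t] by (cases "1 \<le> \<bar>t\<bar>") (auto simp: norm_mult intro!: mult_right_mono)
  qed (use True f in auto)
  finally show ?thesis by simp
next
  case False
  then show ?thesis using assms(4) by (simp add: not_integrable_integral_eq)
qed

lemma square_plus_far:
  fixes x y t :: real
  assumes "\<bar>t\<bar> \<le> 1" "2 \<le> \<bar>x\<bar> \<or> 1 \<le> y"
  shows "(x\<^sup>2 + y\<^sup>2) / 4 \<le> (x - t)\<^sup>2 + y\<^sup>2"
  using assms(2)
proof
  assume "2 \<le> \<bar>x\<bar>"
  then have "\<bar>x / 2\<bar> \<le> \<bar>x - t\<bar>" using assms(1) by linarith
  then have "(x / 2)\<^sup>2 \<le> (x - t)\<^sup>2" by (simp only: abs_le_square_iff)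
  moreover have "0 \<le> y\<^sup>2" by simp
  moreover have "(x / 2)\<^sup>2 = x\<^sup>2 / 4" by (simp add: power_divide)
  ultimately show ?thesis unfolding add_divide_distrib by linarith
next
  assume "1 \<le> y"
  then have "1\<^sup>2 \<le> y\<^sup>2" by (intro power_mono) auto
  moreover have "t\<^sup>2 \<le> 1\<^sup>2" using assms(1) by (metis abs_1 abs_le_square_iff)
  moreover have "0 \<le> 3/4 * (x - 4/3 * t)\<^sup>2" by simp
  moreover have "3/4 * (x - 4/3 * t)\<^sup>2 = (x - t)\<^sup>2 - x\<^sup>2 / 4 + t\<^sup>2 / 3" by (simp add: power2_eq_square algebra_simps)
  ultimately show ?thesis unfolding add_divide_distrib power_one by linarith
qed

definition decay_profile :: "real \<Rightarrow> real" where
  "decay_profile y = indicator {h. \<bar>h\<bar> \<le> 1} y * \<bar>y\<bar> powr (- (1/2)) + indicator {h. 1 \<le> \<bar>h\<bar>} y * \<bar>y\<bar> powr (- 2)"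

lemma integrable_decay_profile: "integrable lborel decay_profile"
  unfolding decay_profile_def[abs_def]
  using has_bochner_integral_abs_powr_local[of "1/2" 1] has_bochner_integral_abs_powr_tail[of 2 1]
  by (intro Bochner_Integration.integrable_add) (auto simp: has_bochner_integral_iff)

lemma decay_profile_ge:
  assumes "0 < y" shows "y < 1 \<Longrightarrow> decay_profile y = y powr (- (1/2))" "1 \<le> y \<Longrightarrow> y powr (- 2) \<le> decay_profile y"
  using assms by (auto simp: decay_profile_def indicator_def)

lemma decay_profile_nonneg: "0 \<le> decay_profile y" by (auto simp: decay_profile_def)

lemma energy_density_cs_ext:
  assumes "weighted_L1 f" "0 < y"
  shows "energy_density (cs_ext f) (x, y) =
    y powr (1/2) * ((norm (W_x f (x, sqrt (2 * y))))\<^sup>2 + (norm (W_z f (x, sqrt (2 * y))))\<^sup>2 / (2 * y))"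
  unfolding energy_density_def using assms
  by (simp add: Dfst_cs_ext Dsnd_cs_ext norm_divide power_divide)

lemma energy_density_borel:
  assumes f: "weighted_L1 f"
  shows "(\<lambda>p. indicator half_plane p *\<^sub>R energy_density (cs_ext f) p) \<in> borel_measurable borel"
proof -
  let ?g = "\<lambda>p. snd p powr (1/2) * ((norm (W_x f (fst p, sqrt (2 * snd p))))\<^sup>2 + (norm (W_z f (fst p, sqrt (2 * snd p))))\<^sup>2 / (2 * snd p))"
  have c: "continuous_on half_plane (\<lambda>p. (fst p, sqrt (2 * snd p)))" by (intro continuous_intros)
  have s: "(\<lambda>p. (fst p, sqrt (2 * snd p))) ` half_plane \<subseteq> half_plane" by auto
  note cW = continuous_on_compose2[OF continuous_on_W(2)[OF f] c s] continuous_on_compose2[OF continuous_on_W(3)[OF f] c s]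
  have "continuous_on half_plane ?g"
    by (intro continuous_on_mult continuous_on_add continuous_on_power continuous_on_norm cW continuous_on_divide continuous_on_powr continuous_on_snd continuous_on_const continuous_on_id) auto
  then have m: "(\<lambda>p. indicator half_plane p *\<^sub>R ?g p) \<in> borel_measurable borel"
    by (intro borel_measurable_continuous_on_indicator) auto
  have e: "indicator half_plane p *\<^sub>R energy_density (cs_ext f) p = indicator half_plane p *\<^sub>R ?g p" for p
    using energy_density_cs_ext[OF f, of "snd p" "fst p"] by (cases "p \<in> half_plane") auto
  show ?thesis unfolding e by (rule m)
qed

lemma finite_energyI:
  assumes f: "weighted_L1 f" and K: "\<And>x y. 0 < y \<Longrightarrow> energy_density (cs_ext f) (x, y) \<le> K * (weight x * decay_profile y)"
  shows "finite_energy (cs_ext f)"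
proof -
  have "integrable (lborel \<Otimes>\<^sub>M lborel) (\<lambda>(x, t). of_real (weight x) * of_real (decay_profile t) :: complex)"
    using integrable_weight integrable_decay_profile by (intro integrable_lborel_product) auto
  then have "integrable (lborel \<Otimes>\<^sub>M lborel) (\<lambda>p. of_real (weight (fst p) * decay_profile (snd p)) :: complex)"
    by (simp add: split_def)
  then have "integrable (lborel \<Otimes>\<^sub>M lborel) (\<lambda>p. weight (fst p) * decay_profile (snd p))"
    unfolding complex_of_real_integrable_eq .
  then have i: "integrable lborel (\<lambda>p. \<bar>K\<bar> * (weight (fst p) * decay_profile (snd p)))"
    by (simp add: lborel_prod)
  have "integrable lborel (\<lambda>p. indicator half_plane p *\<^sub>R energy_density (cs_ext f) p)"
  proof (rule Bochner_Integration.integrable_bound[OF i])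
    show "(\<lambda>p. indicator half_plane p *\<^sub>R energy_density (cs_ext f) p) \<in> borel_measurable lborel" using energy_density_borel[OF f] by simp
    show "AE p in lborel. norm (indicator half_plane p *\<^sub>R energy_density (cs_ext f) p) \<le> norm (\<bar>K\<bar> * (weight (fst p) * decay_profile (snd p)))"
    proof (intro AE_I2)
      fix p :: "real \<times> real"
      have w: "0 \<le> weight (fst p) * decay_profile (snd p)" using decay_profile_nonneg by simp
      show "norm (indicator half_plane p *\<^sub>R energy_density (cs_ext f) p) \<le> norm (\<bar>K\<bar> * (weight (fst p) * decay_profile (snd p)))"
      proof (cases "p \<in> half_plane")
        case True
        have "0 \<le> energy_density (cs_ext f) p" by (simp add: energy_density_def)
        moreover have "energy_density (cs_ext f) p \<le> K * (weight (fst p) * decay_profile (snd p))"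
          using K[of "snd p" "fst p"] True by simp
        moreover have "K * (weight (fst p) * decay_profile (snd p)) \<le> \<bar>K\<bar> * (weight (fst p) * decay_profile (snd p))"
          using w by (intro mult_right_mono) auto
        moreover have "norm (\<bar>K\<bar> * (weight (fst p) * decay_profile (snd p))) = \<bar>K\<bar> * (weight (fst p) * decay_profile (snd p))"
          using abs_of_nonneg[OF mult_nonneg_nonneg[OF abs_ge_zero w]] by (simp only: real_norm_def)
        moreover have "norm (indicator half_plane p *\<^sub>R energy_density (cs_ext f) p) = \<bar>energy_density (cs_ext f) p\<bar>"
          using True by simp
        ultimately show ?thesis by linarith
      qed (use w in simp)
    qed
  qed
  then show ?thesis
    unfolding finite_energy_def set_integrable_def using energy_density_borel[OF f] by (simp add: integrable_completion)
qed

lemma bump_trace_space: "(\<lambda>x. of_real (bump x)) \<in> trace_space"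
proof -
  let ?b = "\<lambda>x. of_real (bump x) :: complex"
  obtain N where N: "quadratic_decay N ?b" using schwartz_quadratic_decay[OF schwartz_bump] by blast
  note bi = quadratic_decayD(7)[OF N] and bm = quadratic_decayD(6)[OF N] and N0 = quadratic_decayD(4)[OF N]
  have w: "weighted_L1 ?b"
    unfolding weighted_L1_def
  proof
    have "integrable lborel (\<lambda>t. ?b t * of_real (weight t))"
      using weight_le_1 by (intro integrable_bounded_mult[OF bi, where B = 1]) auto
    then show "integrable lborel (\<lambda>t. of_real (weight t) * ?b t)" by (simp add: mult.commute)
  qed (fact bm)
  have supp: "1 \<le> \<bar>t\<bar> \<Longrightarrow> ?b t = 0" for t by (simp add: bump_eq_0)
  define I where "I = (LINT t|lborel. norm (?b t))"
  have I0: "0 \<le> I" by (simp add: I_def)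
  define e where "e = ext_const"
  have e0: "0 < e" using ext_const_pos by (simp add: e_def)
  define C1 where "C1 = (flux_bound_const * N)\<^sup>2"
  define C2 where "C2 = (2 * e * I)\<^sup>2 * (1/4) powr (- (3/2))"
  define C3 where "C3 = (3/2 * e * I)\<^sup>2 * 2 * (1/4) powr (- (5/2))"
  define C4 where "C4 = (3/2 * N)\<^sup>2"
  have C: "0 \<le> C1" "0 \<le> C2" "0 \<le> C3" "0 \<le> C4" by (auto simp: C1_def C2_def C3_def C4_def)
  define K where "K = C1 + C2 + 2 * C3 + 5 * C4"
  have "energy_density (cs_ext ?b) (x, y) \<le> K * (weight x * decay_profile y)" if y: "0 < y" for x y
  proof -
    define z where "z = sqrt (2 * y)"
    have z: "0 < z" "z\<^sup>2 = 2 * y" "z ^ 4 / 4 = y\<^sup>2"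
    proof -
      show "0 < z" and z2: "z\<^sup>2 = 2 * y" using y by (simp_all add: z_def)
      have "z ^ 4 = (z\<^sup>2)\<^sup>2" by simp
      then show "z ^ 4 / 4 = y\<^sup>2" by (simp only: z2) (simp add: power2_eq_square)
    qed
    have yi: "inverse y = y powr (- 1)" using y by (simp add: powr_minus)
    define D where "D = x\<^sup>2 + y\<^sup>2"
    have D: "0 < D" using y by (auto simp: D_def intro: add_nonneg_pos)
    define X where "X = (norm (W_x ?b (x, z)))\<^sup>2"
    define Z where "Z = (norm (W_z ?b (x, z)))\<^sup>2"
    have wx: "weight x * weight x \<le> weight x" using weight_le_1[of x] by (simp add: mult_left_le)
    have Z1: "Z \<le> C1 * weight x"
    proof -
      have "norm (W_z ?b (x, z)) \<le> flux_bound_const * N * weight x"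
        unfolding W_z_eq_flux[OF w z(1)] by (rule norm_flux_conv_le[OF z(1) N])
      then have "Z \<le> (flux_bound_const * N * weight x)\<^sup>2" unfolding Z_def by (intro power_mono) auto
      also have "\<dots> = C1 * (weight x * weight x)" by (simp add: C1_def power2_eq_square)
      also have "\<dots> \<le> C1 * weight x" by (intro mult_left_mono wx C)
      finally show ?thesis .
    qed
    have X4: "X \<le> C4"
      unfolding X_def C4_def using norm_W_x_lipschitz[OF z(1) N] by (intro power_mono) auto
    have far: "(h\<^sup>2 + z ^ 4 / 4) powr (- a) \<le> (1/4) powr (- a) * D powr (- a)"
      if "2 \<le> \<bar>x\<bar> \<or> 1 \<le> y" "h = x - t" "\<bar>t\<bar> \<le> 1" "0 < a" for h t a
    proof -
      have "(D / 4) powr (- a) \<ge> (h\<^sup>2 + z ^ 4 / 4) powr (- a)"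
        using square_plus_far[OF that(3,1)] that D unfolding z(3) D_def by (intro powr_mono2') auto
      moreover have "(D / 4) powr (- a) = (1/4) powr (- a) * D powr (- a)"
        using powr_mult[of "1/4" D "- a"] by simp
      ultimately show ?thesis by simp
    qed
    have Z2: "Z \<le> C2 * D powr (- (3/2))" if f: "2 \<le> \<bar>x\<bar> \<or> 1 \<le> y"
    proof -
      let ?M = "2 * e * ((1/4) powr (- (3/4)) * D powr (- (3/4)))"
      have "norm (W_z ?b (x, z)) \<le> ?M * I"
        unfolding W_z_eq_flux[OF w z(1)] I_def
      proof (rule norm_conv_le_of_support[OF bi supp])
        show "\<bar>flux_kernel z (x - t)\<bar> \<le> ?M" if "\<bar>t\<bar> \<le> 1" for t
          using e0 by (intro order_trans[OF abs_flux_kernel_le[OF z(1)]]) (auto simp: e_def[symmetric] intro!: mult_left_mono far[OF f refl that])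
      qed (use e0 in auto)
      then have "Z \<le> (?M * I)\<^sup>2" unfolding Z_def by (intro power_mono) auto
      also have "\<dots> = (2 * e * I)\<^sup>2 * (((1/4) powr (- (3/4)))\<^sup>2 * (D powr (- (3/4)))\<^sup>2)"
        by (simp add: power_mult_distrib)
      also have "((1/4 :: real) powr (- (3/4)))\<^sup>2 = (1/4) powr (- (3/2))"
        by (simp only: power2_eq_square powr_add[symmetric]) simp
      also have "(D powr (- (3/4)))\<^sup>2 = D powr (- (3/2))"
        by (simp only: power2_eq_square powr_add[symmetric]) simp
      finally show ?thesis by (simp add: C2_def)
    qed
    have X3: "X \<le> C3 * (y * D powr (- (5/2)))" if f: "2 \<le> \<bar>x\<bar> \<or> 1 \<le> y"
    proof -
      let ?M = "3/2 * e * z * ((1/4) powr (- (5/4)) * D powr (- (5/4)))"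
      have "norm (W_x ?b (x, z)) \<le> ?M * I"
        unfolding W_x_eq_grad I_def
      proof (rule norm_conv_le_of_support[OF bi supp])
        show "\<bar>grad_kernel z (x - t)\<bar> \<le> ?M" if "\<bar>t\<bar> \<le> 1" for t
        proof (rule order_trans[OF abs_grad_kernel_le[OF z(1)]])
          show "3/2 * ext_const * z * ((x - t)\<^sup>2 + z ^ 4 / 4) powr (- (5/4)) \<le> ?M"
            unfolding e_def[symmetric] by (intro mult_left_mono far[OF f refl that]) (use e0 z(1) in auto)
        qed
      qed (use e0 z in auto)
      then have "X \<le> (?M * I)\<^sup>2" unfolding X_def by (intro power_mono) auto
      also have "\<dots> = (3/2 * e * I)\<^sup>2 * z\<^sup>2 * (((1/4) powr (- (5/4)))\<^sup>2 * (D powr (- (5/4)))\<^sup>2)"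
        by (simp only: power_mult_distrib mult_ac)
      also have "((1/4 :: real) powr (- (5/4)))\<^sup>2 = (1/4) powr (- (5/2))"
        by (simp only: power2_eq_square powr_add[symmetric]) simp
      also have "(D powr (- (5/4)))\<^sup>2 = D powr (- (5/2))"
        by (simp only: power2_eq_square powr_add[symmetric]) simp
      finally show ?thesis unfolding C3_def z(2) by (simp only: mult_ac)
    qed
    have ed: "energy_density (cs_ext ?b) (x, y) = y powr (1/2) * X + y powr (1/2) * (Z / (2 * y))"
      using energy_density_cs_ext[OF w y, of x] by (simp add: X_def Z_def z_def distrib_left)
    show ?thesis
    proof (cases "1 \<le> y")
      case True
      have Dx: "D powr (- (3/4)) \<le> weight x"
        unfolding weight_def using True D by (intro powr_mono2') (auto simp: D_def one_le_power)
      have Dy: "D powr (- a) \<le> y powr (- (2 * a))" if "0 < a" for a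
      proof -
        have "D powr (- a) \<le> (y powr 2) powr (- a)"
          using that y by (intro powr_mono2') (auto simp: D_def powr_numeral)
        then show ?thesis by (simp only: powr_powr) simp
      qed
      have Z': "Z \<le> C2 * (weight x * y powr (- (3/2)))"
      proof -
        have "D powr (- (3/2)) = D powr (- (3/4)) * D powr (- (3/4))" by (simp only: powr_add[symmetric]) simp
        also have "\<dots> \<le> weight x * y powr (- (2 * (3/4)))" by (intro mult_mono Dx Dy) auto
        finally have "C2 * D powr (- (3/2)) \<le> C2 * (weight x * y powr (- (3/2)))" using C by (intro mult_left_mono) auto
        then show ?thesis using Z2 True by linarith
      qed
      have X': "X \<le> C3 * (y * (weight x * y powr (- (7/2))))"
      proof -
        have "D powr (- (5/2)) = D powr (- (3/4)) * D powr (- (7/4))" by (simp only: powr_add[symmetric]) simp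
        also have "\<dots> \<le> weight x * y powr (- (2 * (7/4)))" by (intro mult_mono Dx Dy) auto
        finally have "C3 * (y * D powr (- (5/2))) \<le> C3 * (y * (weight x * y powr (- (7/2))))" using C y by (intro mult_left_mono) auto
        then show ?thesis using X3 True by linarith
      qed
      have a1: "y powr (1/2) * X \<le> C3 * (weight x * y powr (- 2))"
      proof -
        have "y powr (1/2) * X \<le> y powr (1/2) * (C3 * (y * (weight x * y powr (- (7/2)))))" by (intro mult_left_mono X') auto
        also have "\<dots> = C3 * (weight x * (y powr (1/2) * y powr 1 * y powr (- (7/2))))" using y by simp
        also have "y powr (1/2) * y powr 1 * y powr (- (7/2)) = y powr (- 2)" by (simp only: powr_add[symmetric]) simp
        finally show ?thesis .
      qed
      have a2: "y powr (1/2) * (Z / (2 * y)) \<le> C2 * (weight x * y powr (- 2))"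
      proof -
        have "y powr (1/2) * (Z / (2 * y)) \<le> y powr (1/2) * (C2 * (weight x * y powr (- (3/2))) / (1 * y))"
          using Z' y C by (intro mult_left_mono frac_le) auto
        also have "\<dots> = C2 * (weight x * (y powr (1/2) * y powr (- (3/2)) * y powr (- 1)))"
          by (simp only: divide_inverse mult_1 yi mult_ac)
        also have "y powr (1/2) * y powr (- (3/2)) * y powr (- 1) = y powr (- 2)" by (simp only: powr_add[symmetric]) simp
        finally show ?thesis .
      qed
      have "energy_density (cs_ext ?b) (x, y) \<le> (C3 + C2) * (weight x * y powr (- 2))"
        using a1 a2 unfolding ed by (simp add: distrib_right)
      also have "\<dots> \<le> K * (weight x * decay_profile y)"
        using C decay_profile_ge(2)[OF y True] decay_profile_nonneg[of y]
        by (intro mult_mono mult_left_mono) (auto simp: K_def)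
      finally show ?thesis .
    next
      case False
      have y1: "y < 1" using False by simp
      have ypow: "y powr (1/2) \<le> y powr (- (1/2))" using y y1 by (intro powr_mono') auto
      have X': "X \<le> (2 * C3 + 5 * C4) * weight x"
      proof (cases "2 \<le> \<bar>x\<bar>")
        case True
        have x2: "4 \<le> x\<^sup>2" using power_mono[OF True, of 2] by simp
        have "1 \<le> D" using x2 by (simp add: D_def add_increasing2)
        have "D powr (- (5/2)) \<le> D powr (- (3/4))" using \<open>1 \<le> D\<close> by (intro powr_mono) auto
        also have "\<dots> \<le> ((1/2) * (1 + x\<^sup>2)) powr (- (3/4))"
          using x2 D by (intro powr_mono2') (auto simp: D_def add_increasing2)
        also have "\<dots> = (1/2) powr (- (3/4)) * weight x" by (simp only: powr_mult weight_def)
        also have "(1/2 :: real) powr (- (3/4)) \<le> 2"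
        proof -
          have "(1/2 :: real) powr (- (3/4)) = 2 powr (3/4)" by (simp add: powr_divide powr_minus)
          also have "\<dots> \<le> 2 powr 1" by (intro powr_mono) auto
          finally show ?thesis by simp
        qed
        finally have "y * D powr (- (5/2)) \<le> 1 * (2 * weight x)"
          using y y1 by (intro mult_mono) (auto intro: mult_right_mono)
        then have "C3 * (y * D powr (- (5/2))) \<le> C3 * (2 * weight x)" using C by (intro mult_left_mono) auto
        then have "X \<le> 2 * C3 * weight x" using X3 True by simp
        also have "\<dots> \<le> (2 * C3 + 5 * C4) * weight x" using C by (intro mult_right_mono) auto
        finally show ?thesis .
      next
        case False
        have x2: "x\<^sup>2 \<le> 2\<^sup>2" using False by (intro abs_le_square_iff[THEN iffD1]) auto
        have "(1/5 :: real) \<le> 5 powr (- (3/4))"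
          using powr_mono[of "- 1" "- (3/4)" "5 :: real"] by (simp add: powr_minus)
        also have "\<dots> \<le> weight x" unfolding weight_def using x2 by (intro powr_mono2') auto
        finally have "C4 * 1 \<le> C4 * (5 * weight x)" using C by (intro mult_left_mono) auto
        then have "X \<le> 5 * C4 * weight x" using X4 by simp
        also have "\<dots> \<le> (2 * C3 + 5 * C4) * weight x" using C by (intro mult_right_mono) auto
        finally show ?thesis .
      qed
      have a1: "y powr (1/2) * X \<le> (2 * C3 + 5 * C4) * (weight x * y powr (- (1/2)))"
      proof -
        have "y powr (1/2) * X \<le> y powr (- (1/2)) * ((2 * C3 + 5 * C4) * weight x)"
          using ypow X' by (intro mult_mono) (auto simp: X_def)
        then show ?thesis by (simp add: mult_ac)
      qed
      have a2: "y powr (1/2) * (Z / (2 * y)) \<le> C1 * (weight x * y powr (- (1/2)))"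
      proof -
        have "y powr (1/2) * (Z / (2 * y)) \<le> y powr (1/2) * (C1 * weight x / (1 * y))"
          using Z1 y C by (intro mult_left_mono frac_le) auto
        also have "\<dots> = C1 * (weight x * (y powr (1/2) * y powr (- 1)))"
          by (simp only: divide_inverse mult_1 yi mult_ac)
        also have "y powr (1/2) * y powr (- 1) = y powr (- (1/2))" by (simp only: powr_add[symmetric]) simp
        finally show ?thesis .
      qed
      have "energy_density (cs_ext ?b) (x, y) \<le> (2 * C3 + 5 * C4 + C1) * (weight x * y powr (- (1/2)))"
        using a1 a2 unfolding ed by (simp add: distrib_right)
      also have "\<dots> \<le> K * (weight x * decay_profile y)"
        using C decay_profile_ge(1)[OF y y1]
        by (intro mult_mono) (auto simp: K_def)
      finally show ?thesis .
    qed
  qed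
  then have "finite_energy (cs_ext ?b)" by (rule finite_energyI[OF w])
  then show ?thesis using has_cs_ext_iff_weighted_L1[OF bm] w by (simp add: trace_space_def)
qed

theorem d_quarter_eq: "d_quarter = sqrt 2 / flux_const"
  unfolding d_quarter_def
proof (rule the_equality)
  show "0 < sqrt 2 / flux_const \<and> dtn_identity (sqrt 2 / flux_const)"
    using flux_const_pos dtn_identity_flux_const by simp
next
  fix d assume d: "0 < d \<and> dtn_identity d"
  let ?b = "\<lambda>x. of_real (bump x) :: complex"
  define L where "L y = (LINT x|lebesgue. of_real (y powr (1/2)) * Dsnd (cs_ext ?b) (x, y) * ?b x)" for y
  define I where "I = (LINT x|lebesgue. ?b x * frac_lap ?b x)"
  obtain N where N: "quadratic_decay N ?b" using schwartz_quadratic_decay[OF schwartz_bump] by blast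
  note [measurable] = quadratic_decayD(6)[OF N] frac_lap_measurable[OF schwartz_bump]
  have "I = (LINT x|lborel. ?b x * frac_lap ?b x)" unfolding I_def by (simp add: integral_completion)
  then have I: "I \<noteq> 0" using integral_bump_frac_lap_bump by simp
  have b: "?b \<in> trace_space" by (rule bump_trace_space)
  have "((\<lambda>y. - of_real d * L y) \<longlongrightarrow> I) (at_right 0)"
    using d b schwartz_bump unfolding dtn_identity_def L_def I_def by blast
  moreover have "((\<lambda>y. - of_real d * L y) \<longlongrightarrow> - of_real d * (- of_real (flux_const / sqrt 2) * I)) (at_right 0)"
    unfolding L_def I_def using b
    by (intro tendsto_mult tendsto_const dtn_limit schwartz_bump) (auto simp: trace_space_def)
  ultimately have "I = - of_real d * (- of_real (flux_const / sqrt 2) * I)"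
    by (intro tendsto_unique[OF trivial_limit_at_right_real])
  moreover have "(- a) * ((- b) * I) = (a * b) * I" for a b :: complex by simp
  ultimately have "of_real (d * (flux_const / sqrt 2)) * I = 1 * I" by (simp only: of_real_mult mult_1)
  then have "of_real (d * (flux_const / sqrt 2)) = (1 :: complex)" using I by (metis mult_right_cancel)
  then have "d * (flux_const / sqrt 2) = 1" using of_real_eq_1_iff by blast
  then show "d = sqrt 2 / flux_const" using flux_const_pos by (simp add: field_simps)
qed

lemma kappa_quarter_eq: "kappa_quarter = flux_const"
  unfolding kappa_quarter_def d_quarter_eq using flux_const_pos by simp


lemma has_derivative_outside:
  fixes \<Psi> :: "real \<times> real \<Rightarrow> complex"
  assumes "(\<Psi> has_derivative D) (at p)" "p \<in> half_plane" "R < \<bar>fst p\<bar> \<or> R < snd p"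
    and 0: "\<And>q. q \<in> half_plane \<Longrightarrow> R < \<bar>fst q\<bar> \<or> R < snd q \<Longrightarrow> \<Psi> q = 0"
  shows "D = (\<lambda>_. 0)"
proof -
  have op: "open (half_plane \<inter> ({q. R < \<bar>fst q\<bar>} \<union> {q. R < snd q}))"
    by (intro open_Int open_Un open_half_plane open_Collect_less continuous_intros)
  have "((\<lambda>_. 0) has_derivative (\<lambda>_. 0)) (at p)" by simp
  then have "(\<Psi> has_derivative (\<lambda>_. 0)) (at p)"
    by (rule has_derivative_transform_within_open[OF _ op]) (use assms in auto)
  then show ?thesis using has_derivative_unique assms(1) by blast
qed

locale half_plane_pairing =
  fixes f :: "real \<Rightarrow> complex" and \<Psi> \<Psi>x \<Psi>z :: "real \<times> real \<Rightarrow> complex" and R :: real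
  assumes f: "weighted_L1 f"
    and der: "\<And>p. p \<in> half_plane \<Longrightarrow> (\<Psi> has_derivative (\<lambda>v. of_real (fst v) * \<Psi>x p + of_real (snd v) * \<Psi>z p)) (at p)"
    and cont: "continuous_on half_plane \<Psi>x" "continuous_on half_plane \<Psi>z"
    and supp: "\<And>p. p \<in> half_plane \<Longrightarrow> R < \<bar>fst p\<bar> \<or> R < snd p \<Longrightarrow> \<Psi> p = 0"
    and R: "0 < R"
begin

definition integrand where
  "integrand p = W_z f p * \<Psi>z p + of_real ((snd p)\<^sup>2) * W_x f p * \<Psi>x p"

lemma Dfst_test: "p \<in> half_plane \<Longrightarrow> Dfst \<Psi> p = \<Psi>x p"
  and Dsnd_test: "p \<in> half_plane \<Longrightarrow> Dsnd \<Psi> p = \<Psi>z p"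
  using Dfst_eq[OF der] Dsnd_eq[OF der] by auto

lemma conormal_eq_integrand: "p \<in> half_plane \<Longrightarrow> conormal_integrand (lift (cs_ext f)) \<Psi> p = integrand p"
  using Dfst_lift[OF f, of p] Dsnd_lift[OF f, of p] by (simp add: conormal_integrand_def integrand_def Dfst_test Dsnd_test)

lemma supp_derivatives:
  assumes "p \<in> half_plane" "R < \<bar>fst p\<bar> \<or> R < snd p" shows "\<Psi>x p = 0" "\<Psi>z p = 0"
proof -
  have "(\<lambda>v. of_real (fst v) * \<Psi>x p + of_real (snd v) * \<Psi>z p) = (\<lambda>_. 0)"
    by (rule has_derivative_outside[OF der assms supp]) (use assms in auto)
  from fun_cong[OF this, of "(1,0)"] fun_cong[OF this, of "(0,1)"] show "\<Psi>x p = 0" "\<Psi>z p = 0" by auto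
qed

lemma cont_test: "continuous_on half_plane \<Psi>"
  using der has_derivative_continuous by (intro continuous_at_imp_continuous_on) blast

lemma continuous_integrand: "continuous_on half_plane integrand"
  unfolding integrand_def[abs_def]
  by (intro continuous_on_add continuous_on_mult cont continuous_on_W[OF f] continuous_on_of_real continuous_on_power continuous_on_snd continuous_on_id)

text \<open>Green's formula on \<open>{z > \<epsilon>}\<close>: by the equation for \<open>W\<close>, the integrand is the divergence of
  \<open>(z\<^sup>2 W\<^sub>x \<Psi>, W\<^sub>z \<Psi>)\<close>, and only the side \<open>z = \<epsilon>\<close> of the box meets the support.\<close>

lemma green_box:
  assumes e: "0 < e" "e < R + 1"
  shows "integral (cbox (- (R + 1), e) (R + 1, R + 1)) integrand = - integral {- (R + 1)..R + 1} (\<lambda>x. W_z f (x, e) * \<Psi> (x, e))"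
proof -
  let ?B = "cbox (- (R + 1), e) (R + 1, R + 1)"
  have sub: "?B \<subseteq> half_plane" using e by (auto simp: cbox_Pair_eq)
  define Az where "Az p = W_zz f p * \<Psi> p + W_z f p * \<Psi>z p" for p
  define Bx where "Bx p = of_real ((snd p)\<^sup>2) * (W_xx f p * \<Psi> p + W_x f p * \<Psi>x p)" for p
  have "integrand p = Az p + Bx p" if "p \<in> half_plane" for p
  proof -
    have "W_zz f p = - (of_real ((snd p)\<^sup>2) * W_xx f p)"
      using W_equation[OF f, of p] that by (simp add: add_eq_0_iff2)
    then show ?thesis by (simp add: integrand_def Az_def Bx_def algebra_simps)
  qed
  then have eq: "integral ?B integrand = integral ?B (\<lambda>p. Az p + Bx p)"
    using sub by (intro Henstock_Kurzweil_Integration.integral_cong) auto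
  have cA: "continuous_on half_plane Az" and cB: "continuous_on half_plane Bx"
    unfolding Az_def[abs_def] Bx_def[abs_def]
    by (intro continuous_on_add continuous_on_mult cont cont_test continuous_on_W[OF f] continuous_on_of_real continuous_on_power continuous_on_snd continuous_on_id)+
  note cAB = continuous_on_subset[OF cA sub] continuous_on_subset[OF cB sub]
  have "integral ?B (\<lambda>p. Az p + Bx p) = integral ?B Az + integral ?B Bx"
    by (intro Henstock_Kurzweil_Integration.integral_add integrable_continuous cAB)
  also have "integral ?B Az = integral (cbox (- (R + 1)) (R + 1)) (\<lambda>x. integral (cbox e (R + 1)) (\<lambda>z. Az (x, z)))"
    by (rule integral_prod_continuous[OF cAB(1)])
  also have "\<dots> = integral (cbox (- (R + 1)) (R + 1)) (\<lambda>x. - (W_z f (x, e) * \<Psi> (x, e)))"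
  proof (intro Henstock_Kurzweil_Integration.integral_cong)
    fix x
    have "((\<lambda>z. Az (x, z)) has_integral W_z f (x, R + 1) * \<Psi> (x, R + 1) - W_z f (x, e) * \<Psi> (x, e)) {e..R + 1}"
    proof (rule fundamental_theorem_of_calculus)
      fix z assume "z \<in> {e..R + 1}"
      then have p: "(x, z) \<in> half_plane" and q: "0 < snd (x, z)" using e by auto
      have "((\<lambda>t. (x, t)) has_derivative (\<lambda>s. (0, s))) (at z within {e..R + 1})" by (auto intro!: derivative_eq_intros)
      from has_derivative_compose[OF this has_derivative_mult[OF W_z_has_derivative[OF f q] der[OF p]]]
      have "((\<lambda>t. W_z f (x, t) * \<Psi> (x, t)) has_derivative (\<lambda>s. W_z f (x, z) * (of_real s * \<Psi>z (x, z)) + (of_real s * W_zz f (x, z)) * \<Psi> (x, z))) (at z within {e..R + 1})"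
        by simp
      then show "((\<lambda>t. W_z f (x, t) * \<Psi> (x, t)) has_vector_derivative Az (x, z)) (at z within {e..R + 1})"
        unfolding has_vector_derivative_def by (rule has_derivative_eq_rhs) (simp add: fun_eq_iff Az_def scaleR_conv_of_real algebra_simps)
    qed (use e in auto)
    moreover have "\<Psi> (x, R + 1) = 0" using R by (intro supp) auto
    ultimately show "integral (cbox e (R + 1)) (\<lambda>z. Az (x, z)) = - (W_z f (x, e) * \<Psi> (x, e))"
      by (simp add: integral_unique)
  qed
  also have "integral ?B Bx = integral (cbox (- (R + 1)) (R + 1)) (\<lambda>x. integral (cbox e (R + 1)) (\<lambda>z. Bx (x, z)))"
    by (rule integral_prod_continuous[OF cAB(2)])
  also have "\<dots> = integral (cbox e (R + 1)) (\<lambda>z. integral (cbox (- (R + 1)) (R + 1)) (\<lambda>x. Bx (x, z)))"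
    by (rule integral_swap_continuous) (use cAB(2) in \<open>simp add: case_prod_beta'\<close>)
  also have "\<dots> = integral (cbox e (R + 1)) (\<lambda>z. 0)"
  proof (intro Henstock_Kurzweil_Integration.integral_cong)
    fix z assume z: "z \<in> cbox e (R + 1)"
    have "((\<lambda>x. Bx (x, z)) has_integral of_real (z\<^sup>2) * (W_x f (R + 1, z) * \<Psi> (R + 1, z)) - of_real (z\<^sup>2) * (W_x f (- (R + 1), z) * \<Psi> (- (R + 1), z))) {- (R + 1)..R + 1}"
    proof (rule fundamental_theorem_of_calculus)
      fix x assume "x \<in> {- (R + 1)..R + 1}"
      have p: "(x, z) \<in> half_plane" and q: "0 < snd (x, z)" using e z by auto
      have "((\<lambda>t. (t, z)) has_derivative (\<lambda>s. (s, 0))) (at x within {- (R + 1)..R + 1})" by (auto intro!: derivative_eq_intros)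
      from has_derivative_compose[OF this has_derivative_mult[OF W_x_has_derivative[OF f q] der[OF p]]]
      have "((\<lambda>t. W_x f (t, z) * \<Psi> (t, z)) has_derivative (\<lambda>s. W_x f (x, z) * (of_real s * \<Psi>x (x, z)) + (of_real s * W_xx f (x, z)) * \<Psi> (x, z))) (at x within {- (R + 1)..R + 1})"
        by simp
      from has_derivative_mult_right[OF this, of "of_real (z\<^sup>2)"]
      show "((\<lambda>t. of_real (z\<^sup>2) * (W_x f (t, z) * \<Psi> (t, z))) has_vector_derivative Bx (x, z)) (at x within {- (R + 1)..R + 1})"
        unfolding has_vector_derivative_def by (rule has_derivative_eq_rhs) (simp add: fun_eq_iff Bx_def scaleR_conv_of_real algebra_simps)
    qed (use R in auto)
    moreover have "\<Psi> (R + 1, z) = 0" "\<Psi> (- (R + 1), z) = 0" using e z R by (auto intro!: supp)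
    ultimately show "integral (cbox (- (R + 1)) (R + 1)) (\<lambda>x. Bx (x, z)) = 0"
      by (simp add: integral_unique)
  qed
  finally show ?thesis
    unfolding eq by (simp only: Henstock_Kurzweil_Integration.integral_neg integral_0 add_0_right cbox_interval)
qed

lemma continuous_boundary:
  assumes "0 < e" shows "continuous_on UNIV (\<lambda>x. W_z f (x, e) * \<Psi> (x, e))"
proof -
  have "continuous_on UNIV (\<lambda>x. \<Psi> (x, e))"
    by (rule continuous_on_compose2[OF cont_test]) (use assms in \<open>auto intro!: continuous_intros\<close>)
  then show ?thesis by (intro continuous_on_mult W_slice_continuous[OF f assms])
qed

lemma boundary_integral:
  assumes "0 < e"
  shows "(LINT x|lborel. W_z f (x, e) * \<Psi> (x, e)) = integral {- (R + 1)..R + 1} (\<lambda>x. W_z f (x, e) * \<Psi> (x, e))"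
proof -
  have "(LINT x|lborel. W_z f (x, e) * \<Psi> (x, e)) = (LINT x:{- (R + 1)..R + 1}|lborel. W_z f (x, e) * \<Psi> (x, e))"
    unfolding set_lebesgue_integral_def
    using assms by (intro Bochner_Integration.integral_cong) (auto simp: indicator_def intro!: supp)
  also have "\<dots> = integral {- (R + 1)..R + 1} (\<lambda>x. W_z f (x, e) * \<Psi> (x, e))"
    by (intro set_borel_integral_eq_integral borel_integrable_atLeastAtMost' continuous_on_subset[OF continuous_boundary[OF assms]]) auto
  finally show ?thesis .
qed

lemma green_limit:
  assumes int: "integrable lborel (\<lambda>p. indicator half_plane p *\<^sub>R integrand p)"
    and z: "\<And>n. 0 < z n" "z \<longlonglongrightarrow> 0"
  shows "(\<lambda>n. - (LINT x|lborel. W_z f (x, z n) * \<Psi> (x, z n))) \<longlonglongrightarrow> (LINT p:half_plane|lborel. integrand p)"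
proof -
  define B where "B e = cbox (- (R + 1), e) (R + 1, R + 1)" for e
  have sub: "B (z n) \<subseteq> half_plane" for n using z(1)[of n] by (auto simp: B_def cbox_Pair_eq)
  have Bm: "B e \<in> sets borel" for e by (simp add: B_def)
  have "(\<lambda>n. LINT p|lborel. indicator (B (z n)) p *\<^sub>R integrand p) \<longlonglongrightarrow> (LINT p|lborel. indicator half_plane p *\<^sub>R integrand p)"
  proof (rule integral_dominated_convergence[where w = "\<lambda>p. norm (indicator half_plane p *\<^sub>R integrand p)"])
    show "(\<lambda>p. indicator half_plane p *\<^sub>R integrand p) \<in> borel_measurable lborel" using borel_measurable_integrable[OF int] .
    show "(\<lambda>p. indicator (B (z n)) p *\<^sub>R integrand p) \<in> borel_measurable lborel" for n
      using borel_measurable_continuous_on_indicator[OF Bm continuous_on_subset[OF continuous_integrand sub[of n]]] by simp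
    show "integrable lborel (\<lambda>p. norm (indicator half_plane p *\<^sub>R integrand p))" using int by (rule integrable_norm)
    show "AE p in lborel. norm (indicator (B (z n)) p *\<^sub>R integrand p) \<le> norm (indicator half_plane p *\<^sub>R integrand p)" for n
    proof (intro AE_I2)
      fix p
      show "norm (indicator (B (z n)) p *\<^sub>R integrand p) \<le> norm (indicator half_plane p *\<^sub>R integrand p)"
        using sub[of n] by (cases "p \<in> B (z n)") auto
    qed
    show "AE p in lborel. (\<lambda>n. indicator (B (z n)) p *\<^sub>R integrand p) \<longlonglongrightarrow> indicator half_plane p *\<^sub>R integrand p"
    proof (intro AE_I2)
      fix p :: "real \<times> real"
      show "(\<lambda>n. indicator (B (z n)) p *\<^sub>R integrand p) \<longlonglongrightarrow> indicator half_plane p *\<^sub>R integrand p"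
      proof (cases "p \<in> half_plane")
        case False
        then have "p \<notin> B (z n)" for n using sub by blast
        then show ?thesis using False by simp
      next
        case True
        have "eventually (\<lambda>n. z n < snd p) sequentially" using True z(2) by (intro order_tendstoD(2)[OF z(2)]) auto
        then have "eventually (\<lambda>n. indicator (B (z n)) p *\<^sub>R integrand p = indicator half_plane p *\<^sub>R integrand p) sequentially"
        proof eventually_elim
          case (elim n)
          show ?case
          proof (cases "R < \<bar>fst p\<bar> \<or> R < snd p")
            case outside: True
            then show ?thesis using supp_derivatives[OF True outside] by (simp add: integrand_def)
          next
            case False
            then have "p \<in> B (z n)" using elim by (cases p) (auto simp: B_def cbox_Pair_eq)
            then show ?thesis using True by simp
          qed
        qed
        then show ?thesis by (rule tendsto_eventually)
      qed
    qed
  qed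
  moreover have "eventually (\<lambda>n. (LINT p|lborel. indicator (B (z n)) p *\<^sub>R integrand p) = - (LINT x|lborel. W_z f (x, z n) * \<Psi> (x, z n))) sequentially"
  proof -
    have "eventually (\<lambda>n. z n < R + 1) sequentially" using R by (intro order_tendstoD(2)[OF z(2)]) auto
    then show ?thesis
    proof eventually_elim
      case (elim n)
      have "set_integrable lborel (B (z n)) integrand"
        unfolding set_integrable_def by (intro borel_integrable_compact continuous_on_subset[OF continuous_integrand sub]) (simp add: B_def)
      then have "(LINT p|lborel. indicator (B (z n)) p *\<^sub>R integrand p) = integral (B (z n)) integrand"
        using set_borel_integral_eq_integral(2) unfolding set_lebesgue_integral_def by blast
      then show ?case unfolding B_def green_box[OF z(1) elim] boundary_integral[OF z(1)] .
    qed
  qed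
  ultimately show ?thesis
    unfolding set_lebesgue_integral_def by (rule Lim_transform_eventually)
qed

lemma integrable_integrandI:
  assumes g: "integrable lborel g" and "\<And>p. p \<in> half_plane \<Longrightarrow> \<bar>fst p\<bar> \<le> R \<Longrightarrow> snd p \<le> R \<Longrightarrow> norm (integrand p) \<le> g p"
  shows "integrable lborel (\<lambda>p. indicator half_plane p *\<^sub>R integrand p)"
proof (rule Bochner_Integration.integrable_bound[OF g])
  show "(\<lambda>p. indicator half_plane p *\<^sub>R integrand p) \<in> borel_measurable lborel"
    using borel_measurable_continuous_on_indicator[OF half_plane_sets continuous_integrand] by simp
  show "AE p in lborel. norm (indicator half_plane p *\<^sub>R integrand p) \<le> norm (g p)"
  proof (intro AE_I2)
    fix p :: "real \<times> real"
    show "norm (indicator half_plane p *\<^sub>R integrand p) \<le> norm (g p)"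
    proof (cases "p \<in> half_plane \<and> \<bar>fst p\<bar> \<le> R \<and> snd p \<le> R")
      case True
      then show ?thesis using assms(2)[of p] by simp
    next
      case False
      then show ?thesis using supp_derivatives[of p] by (cases "p \<in> half_plane") (auto simp: integrand_def)
    qed
  qed
qed

lemma conormal_integral:
  assumes "integrable lborel (\<lambda>p. indicator half_plane p *\<^sub>R integrand p)"
  shows "set_integrable lebesgue half_plane (conormal_integrand (lift (cs_ext f)) \<Psi>)"
    and "(LINT p:half_plane|lebesgue. conormal_integrand (lift (cs_ext f)) \<Psi> p) = (LINT p:half_plane|lborel. integrand p)"
proof -
  have e: "indicator half_plane p *\<^sub>R conormal_integrand (lift (cs_ext f)) \<Psi> p = indicator half_plane p *\<^sub>R integrand p" for p
    using conormal_eq_integrand by (cases "p \<in> half_plane") auto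
  have m: "(\<lambda>p. indicator half_plane p *\<^sub>R integrand p) \<in> borel_measurable lborel" using assms by auto
  show "set_integrable lebesgue half_plane (conormal_integrand (lift (cs_ext f)) \<Psi>)"
    unfolding set_integrable_def e using assms integrable_completion[OF m] by simp
  show "(LINT p:half_plane|lebesgue. conormal_integrand (lift (cs_ext f)) \<Psi> p) = (LINT p:half_plane|lborel. integrand p)"
    unfolding set_lebesgue_integral_def e using integral_completion[OF m] by simp
qed

end

lemma weighted_L1_bounded:
  assumes [measurable]: "f \<in> borel_measurable borel" and B: "\<And>x. norm (f x) \<le> B"
  shows "weighted_L1 f"
  unfolding weighted_L1_def using integrable_bounded_mult[of "\<lambda>x. of_real (weight x)" f B] integrable_weight B by auto

lemma integral_mult_gen_conv:
  assumes y: "0 < y" and w [measurable]: "w \<in> borel_measurable borel" and B: "\<And>x. norm (w x) \<le> B" and g: "integrable lborel g"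
  shows "(LINT t|lborel. w t * gen_conv (5/4) y g t) = (LINT s|lborel. of_real (gen_poisson (5/4) y s) * (LINT t|lborel. w t * g (t - s)))"
proof -
  let ?k = "\<lambda>s. of_real (gen_poisson (5/4) y s) :: complex"
  have [measurable]: "g \<in> borel_measurable borel" using g by auto
  have k: "integrable lborel ?k" using integrable_gen_poisson[of "5/4" y] y by simp
  have conv: "gen_conv (5/4) y g t = (LINT s|lborel. ?k s * g (t - s))" for t
    unfolding gen_conv_def using integral_reflect_shift[of "\<lambda>u. ?k (t - u) * g u" t] by simp
  have i: "integrable (lborel \<Otimes>\<^sub>M lborel) (\<lambda>(s, t). w t * (?k s * g (t - s)))"
  proof (rule lborel_pair.Fubini_integrable)
    show "(\<lambda>(s, t). w t * (?k s * g (t - s))) \<in> borel_measurable (lborel \<Otimes>\<^sub>M lborel)" by measurable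
    have j: "integrable lborel (\<lambda>t. w t * g (t - s))" for s
      using integrable_bounded_mult[OF integrable_shift[OF g, of s] w B] by (simp add: mult.commute)
    show "AE s in lborel. integrable lborel (\<lambda>t. case (s, t) of (s, t) \<Rightarrow> w t * (?k s * g (t - s)))"
    proof (intro AE_I2)
      fix s
      have "(\<lambda>t. w t * (?k s * g (t - s))) = (\<lambda>t. ?k s * (w t * g (t - s)))" by (simp only: mult.left_commute)
      then show "integrable lborel (\<lambda>t. case (s, t) of (s, t) \<Rightarrow> w t * (?k s * g (t - s)))"
        using integrable_mult_right[OF j, of "?k s"] by (simp only: prod.case)
    qed
    show "integrable lborel (\<lambda>s. LINT t|lborel. norm (case (s, t) of (s, t) \<Rightarrow> w t * (?k s * g (t - s))))"
    proof (rule Bochner_Integration.integrable_bound)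
      show "integrable lborel (\<lambda>s. norm (?k s) * (B * (LINT t|lborel. norm (g t))))" using k by (intro integrable_mult_left integrable_norm)
      show "AE s in lborel. norm (LINT t|lborel. norm (case (s, t) of (s, t) \<Rightarrow> w t * (?k s * g (t - s)))) \<le> norm (norm (?k s) * (B * (LINT t|lborel. norm (g t))))"
      proof (intro AE_I2)
        fix s
        have "(LINT t|lborel. norm (w t * g (t - s))) \<le> (LINT t|lborel. B * norm (g (t - s)))"
          using integrable_norm[OF j] integrable_norm[OF integrable_shift[OF g, of s]] B
          by (intro integral_mono) (auto simp: norm_mult intro!: mult_right_mono)
        also have "\<dots> = B * (LINT t|lborel. norm (g t))" using integral_shift[of "\<lambda>t. norm (g t)" s] by simp
        finally have "norm (?k s) * (LINT t|lborel. norm (w t * g (t - s))) \<le> norm (?k s) * (B * (LINT t|lborel. norm (g t)))"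
          by (intro mult_left_mono) auto
        moreover have "(LINT t|lborel. norm (w t * (?k s * g (t - s)))) = norm (?k s) * (LINT t|lborel. norm (w t * g (t - s)))"
          by (subst integral_mult_right_zero[symmetric]) (simp add: norm_mult mult.left_commute)
        moreover have "0 \<le> norm (?k s) * (LINT t|lborel. norm (w t * g (t - s)))" by simp
        ultimately show "norm (LINT t|lborel. norm (case (s, t) of (s, t) \<Rightarrow> w t * (?k s * g (t - s)))) \<le> norm (norm (?k s) * (B * (LINT t|lborel. norm (g t))))"
          by (simp only: prod.case real_norm_def)
      qed
    qed measurable
  qed
  have "(LINT t|lborel. w t * gen_conv (5/4) y g t) = (LINT t|lborel. LINT s|lborel. w t * (?k s * g (t - s)))"
    unfolding conv by simp
  also have "\<dots> = (LINT s|lborel. LINT t|lborel. w t * (?k s * g (t - s)))"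
    by (rule lborel_pair.Fubini_integral[OF i])
  also have "\<dots> = (LINT s|lborel. ?k s * (LINT t|lborel. w t * g (t - s)))"
    by (subst integral_mult_right_zero[symmetric]) (simp add: mult.left_commute)
  finally show ?thesis .
qed

lemma norm_conv_le_kernel:
  fixes k p :: "real \<Rightarrow> real" and w :: "real \<Rightarrow> complex"
  assumes k: "\<And>h. \<bar>k h\<bar> \<le> c * p h" and km: "k \<in> borel_measurable borel" and p: "integrable lborel p" "integral\<^sup>L lborel p = 1"
    and w: "w \<in> borel_measurable borel" "\<And>x. norm (w x) \<le> B" and c: "0 \<le> c" and p0: "\<And>h. 0 \<le> p h"
  shows "norm (LINT t|lborel. of_real (k (x - t)) * w t) \<le> c * B"
proof -
  have ki: "integrable lborel k"
    by (rule Bochner_Integration.integrable_bound[where f = "\<lambda>h. c * p h"])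
      (use p(1) km c p0 in \<open>auto intro!: order_trans[OF k] simp: abs_mult\<close>)
  have i: "integrable lborel (\<lambda>t. of_real (k (x - t)) * w t)"
    using integrable_reflect_shift[OF ki, of x] w by (intro integrable_bounded_mult[where B = B]) auto
  have "norm (LINT t|lborel. of_real (k (x - t)) * w t) \<le> (LINT t|lborel. norm (of_real (k (x - t)) * w t))" by simp
  also have "\<dots> \<le> (LINT t|lborel. c * p (x - t) * B)"
  proof (rule integral_mono)
    show "integrable lborel (\<lambda>t. c * p (x - t) * B)" using integrable_reflect_shift[OF p(1), of x] by simp
    show "norm (of_real (k (x - t)) * w t) \<le> c * p (x - t) * B" for t
      unfolding norm_mult norm_of_real using c p0 by (intro mult_mono k w) auto
  qed (use i in auto)
  also have "\<dots> = c * B" using integral_reflect_shift[of p x] p(2) by simp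
  finally show ?thesis .
qed

locale bounded_solution =
  fixes u v :: "real \<Rightarrow> complex" and Bu Bv :: real
  assumes u [measurable]: "u \<in> borel_measurable borel" and Bu: "\<And>x. norm (u x) \<le> Bu"
    and v [measurable]: "v \<in> borel_measurable borel" and Bv: "\<And>x. norm (v x) \<le> Bv"
    and eq: "\<And>\<phi>. schwartz \<phi> \<Longrightarrow> (LINT x|lborel. u x * frac_lap \<phi> x) = - (LINT x|lborel. v x * \<phi> x)"
begin

lemma wu: "weighted_L1 u" and wv: "weighted_L1 v"
  using weighted_L1_bounded[OF u Bu] weighted_L1_bounded[OF v Bv] by auto

lemma Bu0: "0 \<le> Bu" and Bv0: "0 \<le> Bv" using Bu Bv norm_ge_zero order_trans by blast+

definition q_const where "q_const = (1/2) powr (3/2) / japanese_integral (5/4)"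

lemma gen_poisson_54: "0 < z \<Longrightarrow> gen_poisson (5/4) (z\<^sup>2 / 2) h = q_const * ker 3 0 (5/4) z h"
proof -
  assume z: "0 < z"
  have "(z\<^sup>2 / 2) powr (3/2) = (1/2) powr (3/2) * (z\<^sup>2) powr (3/2)" using powr_mult[of "1/2" "z\<^sup>2"] by simp
  also have "z\<^sup>2 = z powr 2" using z by (simp add: powr_numeral)
  also have "(z powr 2) powr (3/2) = z powr 3" by (simp add: powr_powr)
  finally have "(z\<^sup>2 / 2) powr (3/2) = (1/2) powr (3/2) * z ^ 3" using z by (simp add: powr_numeral)
  then show ?thesis unfolding gen_poisson_def powr_quarter_power4[OF z] ker_def q_const_def by simp
qed

lemma gen_conv_eq_pot: "0 < z \<Longrightarrow> gen_conv (5/4) (z\<^sup>2 / 2) v x = of_real q_const * pot 3 0 (5/4) v (x, z)"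
  unfolding gen_conv_def pot_def by (simp add: gen_poisson_54 mult.assoc)

lemma W_z_eq:
  assumes z: "0 < z"
  shows "W_z u (x, z) = of_real flux_const * gen_conv (5/4) (z\<^sup>2 / 2) v x"
proof -
  have y: "0 < z\<^sup>2 / 2" using z by simp
  define H where "H x = W_z u (x, z) - of_real flux_const * gen_conv (5/4) (z\<^sup>2 / 2) v x" for x
  have "isCont (\<lambda>x. W_z u (x, z)) x" for x
    using W_slice_continuous(3)[OF wu z] by (simp add: continuous_on_eq_continuous_at)
  moreover have "isCont (\<lambda>x. gen_conv (5/4) (z\<^sup>2 / 2) v x) x" for x
  proof -
    have "isCont (pot 3 0 (5/4) v) (x, z)"
      by (rule has_derivative_continuous[OF pot_has_derivative[OF wv]]) (use z in auto)
    then have "isCont (pot 3 0 (5/4) v \<circ> (\<lambda>x. (x, z))) x" by (intro continuous_at_compose continuous_intros)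
    then show ?thesis unfolding gen_conv_eq_pot[OF z] by (intro continuous_mult continuous_const) (simp add: o_def)
  qed
  ultimately have Hc: "isCont H x" for x unfolding H_def by (intro continuous_intros)
  define C where "C = Bu * (LINT h|lborel. \<bar>flux_kernel z h\<bar>) + flux_const * Bv"
  have HB: "norm (H x) \<le> C" for x
  proof -
    have "norm (W_z u (x, z)) \<le> (LINT t|lborel. norm (of_real (flux_kernel z (x - t)) * u t))"
      unfolding W_z_eq_flux[OF wu z] by simp
    also have "\<dots> \<le> (LINT t|lborel. Bu * \<bar>flux_kernel z (x - t)\<bar>)"
    proof (rule integral_mono)
      show "integrable lborel (\<lambda>t. norm (of_real (flux_kernel z (x - t)) * u t))"
        using integrable_flux_conv[OF wu z, of x] by (rule integrable_norm)
      show "integrable lborel (\<lambda>t. Bu * \<bar>flux_kernel z (x - t)\<bar>)"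
        using integrable_reflect_shift[OF integrable_flux_kernel[OF z], of x] by (intro integrable_mult_right integrable_abs)
      show "norm (of_real (flux_kernel z (x - t)) * u t) \<le> Bu * \<bar>flux_kernel z (x - t)\<bar>" for t
        unfolding norm_mult norm_of_real by (subst mult.commute) (intro mult_right_mono Bu abs_ge_zero)
    qed
    also have "\<dots> = Bu * (LINT h|lborel. \<bar>flux_kernel z h\<bar>)"
      using integral_reflect_shift[of "\<lambda>h. \<bar>flux_kernel z h\<bar>" x] by simp
    finally have "norm (W_z u (x, z)) \<le> Bu * (LINT h|lborel. \<bar>flux_kernel z h\<bar>)" .
    moreover have "norm (of_real flux_const * gen_conv (5/4) (z\<^sup>2 / 2) v x) \<le> flux_const * Bv"
      unfolding norm_mult norm_of_real using flux_const_pos gen_conv_bounded[of "5/4" "z\<^sup>2/2" v Bv x] y v Bv by simp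
    ultimately show ?thesis unfolding H_def C_def by (intro order_trans[OF norm_triangle_ineq4]) simp
  qed
  have "(LINT x|lborel. H x * \<phi> x) = 0" if \<phi>: "schwartz \<phi>" for \<phi>
  proof -
    obtain N where N: "quadratic_decay N \<phi>" using schwartz_quadratic_decay[OF \<phi>] by blast
    note pi = quadratic_decayD(7)[OF N]
    have Li: "integrable lborel (frac_lap \<phi>)"
    proof (rule Bochner_Integration.integrable_bound)
      show "integrable lborel (\<lambda>x. flux_bound_const / flux_const * N * weight x)" using integrable_weight by simp
      show "AE x in lborel. norm (frac_lap \<phi> x) \<le> norm (flux_bound_const / flux_const * N * weight x)"
        unfolding real_norm_def by (intro AE_I2 order_trans[OF frac_lap_weight_bound[OF \<phi> N] abs_ge_self])
    qed (use frac_lap_measurable[OF \<phi>] in simp)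
    have "(LINT t|lborel. u t * gen_conv (5/4) (z\<^sup>2 / 2) (frac_lap \<phi>) t) =
        (LINT s|lborel. of_real (gen_poisson (5/4) (z\<^sup>2 / 2) s) * (LINT t|lborel. u t * frac_lap \<phi> (t - s)))"
      by (rule integral_mult_gen_conv[OF y u Bu Li])
    also have "\<dots> = (LINT s|lborel. - (of_real (gen_poisson (5/4) (z\<^sup>2 / 2) s) * (LINT t|lborel. v t * \<phi> (t - s))))"
      using eq[OF schwartz_shift[OF \<phi>]] by (simp add: frac_lap_shift[OF \<phi>])
    also have "\<dots> = - (LINT t|lborel. v t * gen_conv (5/4) (z\<^sup>2 / 2) \<phi> t)"
      using integral_mult_gen_conv[OF y v Bv pi] by simp
    also have "\<dots> = - (LINT t|lborel. gen_conv (5/4) (z\<^sup>2 / 2) v t * \<phi> t)"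
      using integral_gen_conv_commute[of "5/4", OF _ y v Bv pi] by simp
    finally have 1: "(LINT x|lborel. W_z u (x, z) * \<phi> x) = of_real flux_const * (LINT t|lborel. gen_conv (5/4) (z\<^sup>2 / 2) v t * \<phi> t)"
      unfolding integral_W_z_schwartz[OF wu \<phi> z] by simp
    have gm: "gen_conv (5/4) (z\<^sup>2 / 2) v \<in> borel_measurable borel" by measurable
    have gB: "norm (gen_conv (5/4) (z\<^sup>2 / 2) v x) \<le> Bv" for x using gen_conv_bounded[of "5/4", OF _ y v Bv] by simp
    have i1: "integrable lborel (\<lambda>t. gen_conv (5/4) (z\<^sup>2 / 2) v t * \<phi> t)"
      using integrable_bounded_mult[OF pi gm gB] by (simp add: mult.commute)
    have Hm: "H \<in> borel_measurable borel"
      by (intro borel_measurable_continuous_onI continuous_at_imp_continuous_on ballI Hc)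
    have i2: "integrable lborel (\<lambda>t. H t * \<phi> t)"
      using integrable_bounded_mult[OF pi Hm HB] by (simp add: mult.commute)
    have "(LINT x|lborel. W_z u (x, z) * \<phi> x) = (LINT x|lborel. H x * \<phi> x + of_real flux_const * (gen_conv (5/4) (z\<^sup>2 / 2) v x * \<phi> x))"
      by (intro Bochner_Integration.integral_cong refl) (simp add: H_def algebra_simps)
    also have "\<dots> = (LINT x|lborel. H x * \<phi> x) + of_real flux_const * (LINT t|lborel. gen_conv (5/4) (z\<^sup>2 / 2) v t * \<phi> t)"
      using i1 i2 by simp
    finally show ?thesis using 1 by simp
  qed
  then have "H x = 0" by (rule continuous_eq_0_if_weakly_0[OF Hc HB])
  then show ?thesis by (simp add: H_def)
qed

lemma W_z_bound: "0 < z \<Longrightarrow> norm (W_z u (x, z)) \<le> flux_const * Bv"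
  unfolding W_z_eq norm_mult norm_of_real using flux_const_pos gen_conv_bounded[of "5/4" "z\<^sup>2/2" v Bv x] v Bv by simp

lemma W_fun_bound: "0 < z \<Longrightarrow> norm (W_fun u (x, z)) \<le> Bu"
  unfolding W_fun_eq_gen_conv using gen_conv_bounded[of "3/4" "z\<^sup>2/2" u Bu x] u Bu by simp

lemma W_xz_bound:
  assumes z: "0 < z" shows "norm (W_xz u (x, z)) \<le> flux_const * (5/2 / z\<^sup>2 * Bv)"
proof -
  let ?k = "\<lambda>h. - (5/2) * q_const * ker 3 1 (9/4) z h"
  have q: "0 < snd (x, z)" using z by simp
  have y: "0 < z\<^sup>2 / 2" using z by simp
  have "(W_z u has_derivative (\<lambda>w. of_real flux_const * (of_real q_const *
      (of_real (fst w) * (of_nat 0 * pot 3 (0 - 1) (5/4) v (x, z) - of_real (2 * (5/4)) * pot 3 (0 + 1) (5/4 + 1) v (x, z)) +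
       of_real (snd w) * (of_nat 3 * pot (3 - 1) 0 (5/4) v (x, z) - of_real (5/4) * pot (3 + 3) 0 (5/4 + 1) v (x, z)))))) (at (x, z))"
  proof (rule has_derivative_transform_within_open[OF _ open_half_plane])
    show "((\<lambda>p. of_real flux_const * (of_real q_const * pot 3 0 (5/4) v p)) has_derivative (\<lambda>w. of_real flux_const * (of_real q_const *
      (of_real (fst w) * (of_nat 0 * pot 3 (0 - 1) (5/4) v (x, z) - of_real (2 * (5/4)) * pot 3 (0 + 1) (5/4 + 1) v (x, z)) +
       of_real (snd w) * (of_nat 3 * pot (3 - 1) 0 (5/4) v (x, z) - of_real (5/4) * pot (3 + 3) 0 (5/4 + 1) v (x, z)))))) (at (x, z))"
      by (intro has_derivative_mult_right pot_has_derivative[OF wv q]) auto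
    show "of_real flux_const * (of_real q_const * pot 3 0 (5/4) v p) = W_z u p" if "p \<in> half_plane" for p
      using W_z_eq[of "snd p" "fst p"] gen_conv_eq_pot[of "snd p" "fst p"] that by simp
  qed (use z in auto)
  from Dfst_eq[OF this] have "Dfst (W_z u) (x, z) = of_real flux_const * (of_real (- (5/2) * q_const) * pot 3 1 (9/4) v (x, z))" by simp
  moreover have "Dfst (W_z u) (x, z) = W_xz u (x, z)" using Dfst_eq[OF W_z_has_derivative[OF wu q]] by simp
  moreover have "of_real (- (5/2) * q_const) * pot 3 1 (9/4) v (x, z) = (LINT t|lborel. of_real (?k (x - t)) * v t)"
    unfolding pot_def by (subst integral_mult_right_zero[symmetric]) (simp add: mult.assoc)
  ultimately have e: "W_xz u (x, z) = of_real flux_const * (LINT t|lborel. of_real (?k (x - t)) * v t)" by simp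
  have k: "\<bar>?k h\<bar> \<le> 5/2 / z\<^sup>2 * gen_poisson (5/4) (z\<^sup>2/2) h" for h
  proof -
    let ?S = "h\<^sup>2 + z ^ 4 / 4"
    have q0: "0 < q_const" using japanese_integral_pos[of "5/4"] by (simp add: q_const_def)
    have S: "0 < ?S" using square_plus_pos[OF z] .
    have "0 \<le> (\<bar>h\<bar> - z\<^sup>2 / 2)\<^sup>2" by simp
    moreover have "(\<bar>h\<bar> - z\<^sup>2 / 2)\<^sup>2 = h\<^sup>2 - \<bar>h\<bar> * z\<^sup>2 + z ^ 4 / 4" by (simp add: power2_diff power_divide)
    ultimately have "\<bar>h\<bar> * z\<^sup>2 \<le> ?S" by linarith
    then have hS: "\<bar>h\<bar> \<le> ?S / z\<^sup>2" using z by (simp add: pos_le_divide_eq)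
    have "?S powr (- (5/4)) = ?S powr (1 + - (9/4))" by simp
    also have "\<dots> = ?S * ?S powr (- (9/4))" using S by (subst powr_add) simp
    finally have Sp: "?S powr (- (5/4)) = ?S * ?S powr (- (9/4))" .
    have "\<bar>?k h\<bar> = 5/2 * q_const * z ^ 3 * (\<bar>h\<bar> * ?S powr (- (9/4)))"
      using q0 z by (simp add: ker_def abs_mult)
    also have "\<dots> \<le> 5/2 * q_const * z ^ 3 * (?S / z\<^sup>2 * ?S powr (- (9/4)))"
      using q0 z by (intro mult_left_mono mult_right_mono hS) auto
    also have "\<dots> = 5/2 / z\<^sup>2 * gen_poisson (5/4) (z\<^sup>2/2) h"
      unfolding gen_poisson_54[OF z] ker_def Sp by simp
    finally show ?thesis .
  qed
  have km: "?k \<in> borel_measurable borel" by measurable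
  have c: "(0::real) \<le> 5/2 / z\<^sup>2" by simp
  have "norm (LINT t|lborel. of_real (?k (x - t)) * v t) \<le> 5/2 / z\<^sup>2 * Bv"
    by (rule norm_conv_le_kernel[OF k km integrable_gen_poisson[OF _ y] integral_gen_poisson[OF _ y] v Bv c gen_poisson_nonneg]) simp_all
  then have "\<bar>flux_const\<bar> * norm (LINT t|lborel. of_real (?k (x - t)) * v t) \<le> \<bar>flux_const\<bar> * (5/2 / z\<^sup>2 * Bv)"
    by (rule mult_left_mono) simp
  moreover have "\<bar>flux_const\<bar> = flux_const" using flux_const_pos by simp
  ultimately show ?thesis unfolding e norm_mult norm_of_real by (simp only:)
qed

lemma W_x_decay:
  assumes z: "0 < z" shows "norm (W_x u (x, z)) \<le> 3/2 / z\<^sup>2 * Bu"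
proof -
  have y: "0 < z\<^sup>2 / 2" and c: "0 \<le> 3/2 / z\<^sup>2" using z by simp_all
  show ?thesis unfolding W_x_eq_grad
    by (rule norm_conv_le_kernel[OF abs_grad_kernel_le_poisson[OF z] grad_kernel_measurable
        integrable_poisson_kernel[OF y] integral_poisson_kernel[OF y] u Bu c poisson_kernel_nonneg])
qed

text \<open>Since \<open>W\<^sub>x\<close> vanishes at height infinity, it is the integral of \<open>W\<^sub>x\<^sub>z = O(z\<^sup>-\<^sup>2)\<close> from above.\<close>

lemma W_x_bound:
  assumes z: "0 < z" shows "z * norm (W_x u (x, z)) \<le> flux_const * (5/2 * Bv)"
proof -
  define K where "K = flux_const * (5/2 * Bv)"
  have K0: "0 \<le> K" using flux_const_pos Bv0 by (simp add: K_def)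
  have step: "norm (W_x u (x, Z) - W_x u (x, z)) \<le> - (K / Z) - - (K / z)" if "z < Z" for Z
  proof (rule differentiable_bound_general[OF that])
    have d: "((\<lambda>t. W_x u (x, t)) has_vector_derivative W_xz u (x, t)) (at t)" if "0 < t" for t
    proof -
      have "((\<lambda>t. (x, t)) has_derivative (\<lambda>s. (0, s))) (at t)" by (auto intro!: derivative_eq_intros)
      from has_derivative_compose[OF this W_x_has_derivative[OF wu]] that
      show ?thesis unfolding has_vector_derivative_def by (simp add: scaleR_conv_of_real)
    qed
    show "continuous_on {z..Z} (\<lambda>t. W_x u (x, t))"
      by (intro continuous_at_imp_continuous_on ballI has_vector_derivative_continuous[OF d]) (use z in auto)
    show "continuous_on {z..Z} (\<lambda>t. - (K / t))" using z by (intro continuous_intros) auto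
    fix t assume t: "z < t" "t < Z"
    show "((\<lambda>t. W_x u (x, t)) has_vector_derivative W_xz u (x, t)) (at t)" using d t z by simp
    show "((\<lambda>t. - (K / t)) has_vector_derivative K / t\<^sup>2) (at t)"
      using t z by (auto intro!: derivative_eq_intros simp: power2_eq_square simp flip: has_real_derivative_iff_has_vector_derivative)
    show "norm (W_xz u (x, t)) \<le> K / t\<^sup>2" using W_xz_bound[of t x] t z by (simp add: K_def)
  qed
  have le: "norm (W_x u (x, z)) \<le> K / z + 3/2 / Z\<^sup>2 * Bu" if "z < Z" for Z
  proof -
    have "norm (W_x u (x, z)) \<le> norm (W_x u (x, Z) - W_x u (x, z)) + norm (W_x u (x, Z))"
      by (metis norm_minus_commute norm_triangle_sub add.commute)
    moreover have "0 \<le> K / Z" using K0 that z by simp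
    ultimately show ?thesis using step[OF that] W_x_decay[of Z x] that z by linarith
  qed
  have "((\<lambda>Z. K / z + 3/2 / Z\<^sup>2 * Bu) \<longlongrightarrow> K / z + 0 * Bu) at_top"
    by (intro tendsto_intros real_tendsto_divide_at_top[OF tendsto_const] filterlim_pow_at_top filterlim_ident) auto
  then have "norm (W_x u (x, z)) \<le> K / z + 0 * Bu"
    by (rule tendsto_lowerbound[OF _ eventually_mono[OF eventually_gt_at_top[of z] le]]) simp_all
  then have "z * norm (W_x u (x, z)) \<le> z * (K / z)" using z by (intro mult_left_mono) simp_all
  then show ?thesis using z by (simp add: K_def)
qed

end


definition z_energy :: "(real \<Rightarrow> complex) \<Rightarrow> real \<times> real \<Rightarrow> real" where
  "z_energy f p = (norm (W_z f p))\<^sup>2 + (snd p)\<^sup>2 * (norm (W_x f p))\<^sup>2"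

abbreviation "strip Z \<equiv> UNIV \<times> {0<..Z::real} :: (real \<times> real) set"

lemma z_energy_nonneg: "0 \<le> z_energy f p" by (simp add: z_energy_def)

lemma strip_sets [measurable]: "strip Z \<in> sets borel" "{-R..R::real} \<times> {0<..Z::real} \<in> sets borel"
  by (auto intro!: borel_Times)

lemma
  fixes F :: "real \<times> real \<Rightarrow> 'a::real_normed_vector"
  assumes F: "continuous_on half_plane F"
  shows borel_indicator_strip: "(\<lambda>p. indicator (strip Z) p *\<^sub>R F p) \<in> borel_measurable borel"
    and borel_indicator_box: "(\<lambda>p. indicator ({-R..R} \<times> {0<..Z}) p *\<^sub>R F p) \<in> borel_measurable borel"
proof -
  have "strip Z \<subseteq> half_plane" "{-R..R} \<times> {0<..Z} \<subseteq> half_plane" by auto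
  from this[THEN continuous_on_subset[OF F]]
  show "(\<lambda>p. indicator (strip Z) p *\<^sub>R F p) \<in> borel_measurable borel"
    and "(\<lambda>p. indicator ({-R..R} \<times> {0<..Z}) p *\<^sub>R F p) \<in> borel_measurable borel"
    by (auto intro!: borel_measurable_continuous_on_indicator strip_sets)
qed

lemma
  fixes F :: "real \<times> real \<Rightarrow> ennreal"
  assumes "F \<in> borel_measurable borel"
  shows nn_integral_iterated: "(\<integral>\<^sup>+x. \<integral>\<^sup>+t. F (x, t) \<partial>lborel \<partial>lborel) = (\<integral>\<^sup>+p. F p \<partial>lborel)"
    and nn_integral_iterated_swap: "(\<integral>\<^sup>+t. \<integral>\<^sup>+x. F (x, t) \<partial>lborel \<partial>lborel) = (\<integral>\<^sup>+p. F p \<partial>lborel)"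
proof -
  have m: "F \<in> borel_measurable (lborel \<Otimes>\<^sub>M lborel)" using assms by (simp add: lborel_prod)
  show "(\<integral>\<^sup>+x. \<integral>\<^sup>+t. F (x, t) \<partial>lborel \<partial>lborel) = (\<integral>\<^sup>+p. F p \<partial>lborel)"
    using lborel.nn_integral_fst[OF m] by (simp add: lborel_prod)
  show "(\<integral>\<^sup>+t. \<integral>\<^sup>+x. F (x, t) \<partial>lborel \<partial>lborel) = (\<integral>\<^sup>+p. F p \<partial>lborel)"
    using lborel_pair.nn_integral_snd[OF m] by (simp add: lborel_prod)
qed

lemma continuous_z_energy: "weighted_L1 f \<Longrightarrow> continuous_on half_plane (z_energy f)"
  unfolding z_energy_def[abs_def]
  by (intro continuous_on_add continuous_on_mult continuous_on_norm continuous_on_W continuous_on_power continuous_on_snd continuous_on_id)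

lemma energy_strip:
  assumes f: "weighted_L1 f" and E: "finite_energy (cs_ext f)" and Z: "0 < Z"
  shows "(\<integral>\<^sup>+p. indicator (strip Z) p *\<^sub>R z_energy f p \<partial>lborel) \<le> ennreal (sqrt 2 * (trace_norm f)\<^sup>2)"
proof -
  define D where "D p = indicator half_plane p *\<^sub>R energy_density (cs_ext f) p" for p
  have Dm [measurable]: "D \<in> borel_measurable borel" unfolding D_def[abs_def] by (rule energy_density_borel[OF f])
  have D0: "0 \<le> D p" for p by (simp add: D_def energy_density_def)
  have em [measurable]: "(\<lambda>p. indicator (strip Z) p *\<^sub>R z_energy f p) \<in> borel_measurable borel"
    by (rule borel_indicator_strip[OF continuous_z_energy[OF f]])
  have De: "D (x, z\<^sup>2 / 2) * z * indicator {0..Z} z = indicator (strip Z) (x, z) *\<^sub>R z_energy f (x, z) / sqrt 2" for x z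
  proof (cases "0 < z \<and> z \<le> Z")
    case True
    then have y: "0 < z\<^sup>2 / 2" and s: "sqrt (2 * (z\<^sup>2 / 2)) = z" by simp_all
    have p: "(z\<^sup>2 / 2) powr (1/2) = z / sqrt 2" using True by (simp add: powr_half_sqrt real_sqrt_divide)
    have "D (x, z\<^sup>2 / 2) = z / sqrt 2 * ((norm (W_x f (x, z)))\<^sup>2 + (norm (W_z f (x, z)))\<^sup>2 / z\<^sup>2)"
      using energy_density_cs_ext[OF f y, of x] y unfolding s p by (simp add: D_def)
    moreover have "z / sqrt 2 * (X + Y / z\<^sup>2) * z = (Y + z\<^sup>2 * X) / sqrt 2" for X Y
      using True by (simp add: field_simps power2_eq_square)
    ultimately show ?thesis using True by (simp add: z_energy_def)
  qed (auto simp: indicator_def)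
  have x_slice: "(\<integral>\<^sup>+z. indicator (strip Z) (x, z) *\<^sub>R z_energy f (x, z) \<partial>lborel) \<le> ennreal (sqrt 2) * (\<integral>\<^sup>+t. D (x, t) \<partial>lborel)" for x
  proof -
    have "(\<integral>\<^sup>+t. D (x, t) * indicator {0\<^sup>2 / 2..Z\<^sup>2 / 2} t \<partial>lborel) = (\<integral>\<^sup>+z. D (x, z\<^sup>2 / 2) * z * indicator {0..Z} z \<partial>lborel)"
    proof (rule nn_integral_substitution)
      have "(\<lambda>t. D (x, t)) \<in> borel_measurable borel" by measurable
      then show "set_borel_measurable borel {0\<^sup>2 / 2..Z\<^sup>2 / 2} (\<lambda>t. D (x, t))"
        unfolding set_borel_measurable_def by measurable
      show "((\<lambda>z. z\<^sup>2 / 2) has_real_derivative z) (at z)" for z :: real by (auto intro!: derivative_eq_intros)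
    qed (use Z in \<open>auto intro: continuous_on_id\<close>)
    also have "\<dots> = (\<integral>\<^sup>+z. ennreal (1 / sqrt 2) * (indicator (strip Z) (x, z) *\<^sub>R z_energy f (x, z)) \<partial>lborel)"
      unfolding De by (intro nn_integral_cong) (simp add: ennreal_mult'[symmetric])
    also have "\<dots> = ennreal (1 / sqrt 2) * (\<integral>\<^sup>+z. indicator (strip Z) (x, z) *\<^sub>R z_energy f (x, z) \<partial>lborel)"
      by (rule nn_integral_cmult) measurable
    finally have "ennreal (1 / sqrt 2) * (\<integral>\<^sup>+z. indicator (strip Z) (x, z) *\<^sub>R z_energy f (x, z) \<partial>lborel) = (\<integral>\<^sup>+t. D (x, t) * indicator {0\<^sup>2 / 2..Z\<^sup>2 / 2} t \<partial>lborel)"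
      by (rule sym)
    also have "\<dots> \<le> (\<integral>\<^sup>+t. D (x, t) \<partial>lborel)"
      using D0 by (intro nn_integral_mono ennreal_leI) (auto simp: indicator_def)
    finally have 1: "ennreal (1 / sqrt 2) * (\<integral>\<^sup>+z. indicator (strip Z) (x, z) *\<^sub>R z_energy f (x, z) \<partial>lborel) \<le> (\<integral>\<^sup>+t. D (x, t) \<partial>lborel)" .
    have "ennreal (sqrt 2) * (ennreal (1 / sqrt 2) * (\<integral>\<^sup>+z. indicator (strip Z) (x, z) *\<^sub>R z_energy f (x, z) \<partial>lborel)) = (\<integral>\<^sup>+z. indicator (strip Z) (x, z) *\<^sub>R z_energy f (x, z) \<partial>lborel)"
      unfolding mult.assoc[symmetric] by (subst ennreal_mult'[symmetric]) simp_all
    then show ?thesis using mult_left_mono[OF 1, of "ennreal (sqrt 2)"] by simp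
  qed
  have "(\<integral>\<^sup>+p. indicator (strip Z) p *\<^sub>R z_energy f p \<partial>lborel) = (\<integral>\<^sup>+x. \<integral>\<^sup>+z. indicator (strip Z) (x, z) *\<^sub>R z_energy f (x, z) \<partial>lborel \<partial>lborel)"
    by (rule nn_integral_iterated[symmetric]) measurable
  also have "\<dots> \<le> (\<integral>\<^sup>+x. ennreal (sqrt 2) * (\<integral>\<^sup>+t. D (x, t) \<partial>lborel) \<partial>lborel)"
    by (intro nn_integral_mono x_slice)
  also have "\<dots> = ennreal (sqrt 2) * (\<integral>\<^sup>+x. \<integral>\<^sup>+t. D (x, t) \<partial>lborel \<partial>lborel)"
    by (rule nn_integral_cmult) measurable
  also have "(\<integral>\<^sup>+x. \<integral>\<^sup>+t. D (x, t) \<partial>lborel \<partial>lborel) = (\<integral>\<^sup>+p. D p \<partial>lborel)"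
    by (rule nn_integral_iterated) measurable
  also have "\<dots> = ennreal ((trace_norm f)\<^sup>2)"
  proof -
    have i: "integrable lborel D"
      using E unfolding finite_energy_def set_integrable_def D_def[symmetric] by (subst (asm) integrable_completion) auto
    have "(LINT p:half_plane|lebesgue. energy_density (cs_ext f) p) = integral\<^sup>L lborel D"
      unfolding set_lebesgue_integral_def D_def[symmetric] by (rule integral_completion) simp
    moreover have "0 \<le> integral\<^sup>L lborel D" using D0 by simp
    ultimately show ?thesis using nn_integral_eq_integral[OF i] D0 by (simp add: trace_norm_def)
  qed
  finally show ?thesis by (simp add: ennreal_mult')
qed

lemma
  assumes f: "weighted_L1 f" and E: "finite_energy (cs_ext f)" and Z: "0 < Z"
  shows integrable_z_energy: "integrable lborel (\<lambda>p. indicator (strip Z) p *\<^sub>R z_energy f p)"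
    and integral_z_energy_le: "(LINT p|lborel. indicator (strip Z) p *\<^sub>R z_energy f p) \<le> sqrt 2 * (trace_norm f)\<^sup>2"
proof -
  have em: "(\<lambda>p. indicator (strip Z) p *\<^sub>R z_energy f p) \<in> borel_measurable lborel"
    unfolding measurable_lborel2 by (rule borel_indicator_strip[OF continuous_z_energy[OF f]])
  have nn: "0 \<le> indicator (strip Z) p *\<^sub>R z_energy f p" for p by (simp add: z_energy_nonneg)
  show i: "integrable lborel (\<lambda>p. indicator (strip Z) p *\<^sub>R z_energy f p)"
  proof (rule integrableI_nonneg[OF em AE_I2[OF nn]])
    show "(\<integral>\<^sup>+p. indicator (strip Z) p *\<^sub>R z_energy f p \<partial>lborel) < \<infinity>"
      using energy_strip[OF f E Z] by (rule order.strict_trans1) simp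
  qed
  have "ennreal (LINT p|lborel. indicator (strip Z) p *\<^sub>R z_energy f p) \<le> ennreal (sqrt 2 * (trace_norm f)\<^sup>2)"
    using energy_strip[OF f E Z] nn_integral_eq_integral[OF i AE_I2[OF nn]] by simp
  then show "(LINT p|lborel. indicator (strip Z) p *\<^sub>R z_energy f p) \<le> sqrt 2 * (trace_norm f)\<^sup>2"
    by (subst (asm) ennreal_le_iff) simp_all
qed

text \<open>A quantity dominated by the square root of the energy density is integrable on boxes; the free
  parameter \<open>\<lambda>\<close> stands in for the Cauchy--Schwarz inequality.\<close>

lemma
  fixes a :: "real \<times> real \<Rightarrow> real"
  assumes f: "weighted_L1 f" and E: "finite_energy (cs_ext f)" and Z: "0 < Z"
    and ac: "continuous_on half_plane a" and a0: "\<And>p. 0 \<le> a p" and ae: "\<And>p. p \<in> half_plane \<Longrightarrow> (a p)\<^sup>2 \<le> z_energy f p"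
  shows energy_integrable_box: "integrable lborel (\<lambda>p. indicator ({-R..R} \<times> {0<..Z}) p *\<^sub>R a p)"
    and energy_box_le: "0 < l \<Longrightarrow> (LINT p|lborel. indicator ({-R..R} \<times> {0<..Z}) p *\<^sub>R a p) \<le>
      l * measure lborel ({-R..R} \<times> {0<..Z}) + sqrt 2 * (trace_norm f)\<^sup>2 / l"
proof -
  let ?B = "{-R..R} \<times> {0<..Z}"
  have am: "(\<lambda>p. indicator ?B p *\<^sub>R a p) \<in> borel_measurable lborel"
    unfolding measurable_lborel2 by (rule borel_indicator_box[OF ac])
  have "bounded ?B" by (intro bounded_Times bounded_closed_interval bounded_subset[OF bounded_closed_interval[of 0 Z]]) auto
  then have Bf: "emeasure lborel ?B < \<infinity>" by (rule emeasure_bounded_finite)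
  have Bi: "integrable lborel (\<lambda>p. l * indicator ?B p + (indicator (strip Z) p *\<^sub>R z_energy f p) / l)" for l :: real
    using Bf integrable_z_energy[OF f E Z] by (intro Bochner_Integration.integrable_add integrable_mult_right integrable_divide) auto
  have le: "indicator ?B p *\<^sub>R a p \<le> l * indicator ?B p + (indicator (strip Z) p *\<^sub>R z_energy f p) / l" if l: "0 < l" for l p
  proof (cases "p \<in> ?B")
    case True
    then have p: "p \<in> strip Z" "p \<in> half_plane" by auto
    have "a p \<le> l + z_energy f p / l"
    proof (cases "a p \<le> l")
      case True
      moreover have "0 \<le> z_energy f p / l" using l z_energy_nonneg by simp
      ultimately show ?thesis by linarith
    next
      case False
      then have "a p * l \<le> (a p)\<^sup>2" using a0[of p] unfolding power2_eq_square by (intro mult_left_mono) auto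
      then have "a p * l \<le> z_energy f p" using ae[OF p(2)] by linarith
      then have "a p \<le> z_energy f p / l" using l by (simp add: pos_le_divide_eq)
      then show ?thesis using l by linarith
    qed
    then show ?thesis unfolding indicator_simps(1)[OF True] indicator_simps(1)[OF p(1)] by simp
  next
    case False
    have "0 \<le> (indicator (strip Z) p *\<^sub>R z_energy f p) / l" using l z_energy_nonneg by simp
    then show ?thesis unfolding indicator_simps(2)[OF False] by simp
  qed
  show i: "integrable lborel (\<lambda>p. indicator ?B p *\<^sub>R a p)"
  proof (rule Bochner_Integration.integrable_bound[OF Bi[of 1] am])
    show "AE p in lborel. norm (indicator ?B p *\<^sub>R a p) \<le> norm (1 * indicator ?B p + (indicator (strip Z) p *\<^sub>R z_energy f p) / 1)"
    proof (intro AE_I2)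
      fix p
      have "0 \<le> indicator ?B p *\<^sub>R a p" using a0 by simp
      then show "norm (indicator ?B p *\<^sub>R a p) \<le> norm (1 * indicator ?B p + (indicator (strip Z) p *\<^sub>R z_energy f p) / 1)"
        using le[of 1 p] unfolding real_norm_def by linarith
    qed
  qed
  assume l: "0 < l"
  have "(LINT p|lborel. indicator ?B p *\<^sub>R a p) \<le> (LINT p|lborel. l * indicator ?B p + (indicator (strip Z) p *\<^sub>R z_energy f p) / l)"
    by (intro integral_mono i Bi le l)
  also have "\<dots> = l * measure lborel ?B + (LINT p|lborel. indicator (strip Z) p *\<^sub>R z_energy f p) / l"
    using Bf integrable_z_energy[OF f E Z] by (subst Bochner_Integration.integral_add) auto
  also have "\<dots> \<le> l * measure lborel ?B + sqrt 2 * (trace_norm f)\<^sup>2 / l"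
    using l integral_z_energy_le[OF f E Z] by (intro add_left_mono divide_right_mono) auto
  finally show "(LINT p|lborel. indicator ?B p *\<^sub>R a p) \<le> l * measure lborel ?B + sqrt 2 * (trace_norm f)\<^sup>2 / l" .
qed

lemma
  assumes f: "weighted_L1 f" and E: "finite_energy (cs_ext f)" and Z: "0 < Z"
  shows integrable_box_W_z: "integrable lborel (\<lambda>p. indicator ({-R..R} \<times> {0<..Z}) p *\<^sub>R norm (W_z f p))"
    and integrable_box_W_x: "integrable lborel (\<lambda>p. indicator ({-R..R} \<times> {0<..Z}) p *\<^sub>R (\<bar>snd p\<bar> * norm (W_x f p)))"
    and box_W_z_le: "(LINT p|lborel. indicator ({-R..R} \<times> {0<..Z}) p *\<^sub>R norm (W_z f p)) \<le>
      (measure lborel ({-R..R} \<times> {0<..Z}) + sqrt 2) * trace_norm f"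
proof -
  have c: "continuous_on half_plane (\<lambda>p. norm (W_z f p))" "continuous_on half_plane (\<lambda>p. \<bar>snd p\<bar> * norm (W_x f p))"
    by (intro continuous_on_mult continuous_on_norm continuous_on_rabs continuous_on_W[OF f] continuous_on_snd continuous_on_id)+
  have e: "(norm (W_z f p))\<^sup>2 \<le> z_energy f p" "(\<bar>snd p\<bar> * norm (W_x f p))\<^sup>2 \<le> z_energy f p" for p
    by (simp_all add: z_energy_def power_mult_distrib)
  show "integrable lborel (\<lambda>p. indicator ({-R..R} \<times> {0<..Z}) p *\<^sub>R norm (W_z f p))"
    by (rule energy_integrable_box[OF f E Z c(1) _ e(1)]) simp
  show "integrable lborel (\<lambda>p. indicator ({-R..R} \<times> {0<..Z}) p *\<^sub>R (\<bar>snd p\<bar> * norm (W_x f p)))"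
    by (rule energy_integrable_box[OF f E Z c(2) _ e(2)]) simp
  let ?I = "LINT p|lborel. indicator ({-R..R} \<times> {0<..Z}) p *\<^sub>R norm (W_z f p)"
  let ?A = "measure lborel ({-R..R} \<times> {0<..Z})"
  have le: "?I \<le> l * ?A + sqrt 2 * (trace_norm f)\<^sup>2 / l" if "0 < l" for l
    by (rule energy_box_le[OF f E Z c(1) _ e(1) that]) simp
  have t0: "0 \<le> trace_norm f" by (simp add: trace_norm_def energy_density_def set_lebesgue_integral_def)
  show "?I \<le> (?A + sqrt 2) * trace_norm f"
  proof (cases "trace_norm f = 0")
    case False
    then show ?thesis using le[of "trace_norm f"] t0 by (simp add: power2_eq_square algebra_simps)
  next
    case True
    have "?I \<le> 0"
    proof (rule field_le_epsilon)
      fix e :: real assume "0 < e"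
      moreover have "e / (?A + 1) * ?A \<le> e * 1" using \<open>0 < e\<close> by (simp add: divide_le_eq add_nonneg_pos mult_left_mono)
      ultimately show "?I \<le> 0 + e" using le[of "e / (?A + 1)"] True by (simp add: add_nonneg_pos)
    qed
    then show ?thesis using True by simp
  qed
qed

lemma vertical_increment_le:
  assumes f: "weighted_L1 f" and z: "0 < z" "z \<le> Z"
    and i: "integrable lborel (\<lambda>p. indicator ({-R..R} \<times> {0<..Z}) p *\<^sub>R norm (W_z f p))"
  shows "(LINT x:{-R..R}|lborel. norm (W_fun f (x, Z) - W_fun f (x, z))) \<le> (LINT p|lborel. indicator ({-R..R} \<times> {0<..Z}) p *\<^sub>R norm (W_z f p))"
proof -
  let ?B = "{-R..R} \<times> {0<..Z}"
  have pt: "ennreal (norm (W_fun f (x, Z) - W_fun f (x, z))) \<le> (\<integral>\<^sup>+t. indicator {0<..Z} t *\<^sub>R norm (W_z f (x, t)) \<partial>lborel)" for x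
  proof -
    have d: "((\<lambda>t. W_fun f (x, t)) has_vector_derivative W_z f (x, t)) (at t within S)" if "0 < t" for t S
    proof -
      have "((\<lambda>t. (x, t)) has_derivative (\<lambda>s. (0, s))) (at t within S)" by (auto intro!: derivative_eq_intros)
      from has_derivative_compose[OF this W_fun_has_derivative[OF f]] that
      show ?thesis unfolding has_vector_derivative_def by (simp add: scaleR_conv_of_real)
    qed
    have "((\<lambda>t. W_z f (x, t)) has_integral W_fun f (x, Z) - W_fun f (x, z)) {z..Z}"
      using z by (intro fundamental_theorem_of_calculus d) auto
    moreover have c: "continuous_on {z..Z} (\<lambda>t. W_z f (x, t))"
      by (rule continuous_on_compose2[OF continuous_on_W(3)[OF f]]) (use z in \<open>auto intro!: continuous_intros\<close>)
    have ci: "integrable lborel (\<lambda>t. indicator {z..Z} t *\<^sub>R W_z f (x, t))"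
      by (rule borel_integrable_compact[OF compact_Icc c])
    ultimately have "W_fun f (x, Z) - W_fun f (x, z) = (LINT t|lborel. indicator {z..Z} t *\<^sub>R W_z f (x, t))"
      using set_borel_integral_eq_integral(2)[of "{z..Z}" "\<lambda>t. W_z f (x, t)"] unfolding set_integrable_def set_lebesgue_integral_def by (simp add: integral_unique)
    then have "ennreal (norm (W_fun f (x, Z) - W_fun f (x, z))) \<le> (\<integral>\<^sup>+t. norm (indicator {z..Z} t *\<^sub>R W_z f (x, t)) \<partial>lborel)"
      using integral_norm_bound_ennreal[OF ci] by simp
    also have "\<dots> \<le> (\<integral>\<^sup>+t. indicator {0<..Z} t *\<^sub>R norm (W_z f (x, t)) \<partial>lborel)"
      using z by (intro nn_integral_mono ennreal_leI) (auto simp: indicator_def)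
    finally show ?thesis .
  qed
  have cont: "continuous_on UNIV (\<lambda>x. norm (W_fun f (x, Z) - W_fun f (x, z)))"
    using z by (intro continuous_on_norm continuous_on_diff W_slice_continuous(1)[OF f]) auto
  have si: "integrable lborel (\<lambda>x. indicator {-R..R} x *\<^sub>R norm (W_fun f (x, Z) - W_fun f (x, z)))"
    by (rule borel_integrable_compact[OF compact_Icc continuous_on_subset[OF cont]]) simp
  have m [measurable]: "(\<lambda>p. indicator ?B p *\<^sub>R norm (W_z f p)) \<in> borel_measurable borel"
    by (rule borel_indicator_box[OF continuous_on_norm[OF continuous_on_W(3)[OF f]]])
  have "ennreal (LINT x|lborel. indicator {-R..R} x *\<^sub>R norm (W_fun f (x, Z) - W_fun f (x, z))) =
     (\<integral>\<^sup>+x. indicator {-R..R} x *\<^sub>R norm (W_fun f (x, Z) - W_fun f (x, z)) \<partial>lborel)"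
    by (rule nn_integral_eq_integral[OF si, symmetric]) simp
  also have "\<dots> \<le> (\<integral>\<^sup>+x. \<integral>\<^sup>+t. indicator ?B (x, t) *\<^sub>R norm (W_z f (x, t)) \<partial>lborel \<partial>lborel)"
  proof (intro nn_integral_mono)
    fix x
    show "ennreal (indicator {-R..R} x *\<^sub>R norm (W_fun f (x, Z) - W_fun f (x, z))) \<le> (\<integral>\<^sup>+t. indicator ?B (x, t) *\<^sub>R norm (W_z f (x, t)) \<partial>lborel)"
      using pt[of x] by (cases "x \<in> {-R..R}") (simp_all add: indicator_times)
  qed
  also have "\<dots> = (\<integral>\<^sup>+p. indicator ?B p *\<^sub>R norm (W_z f p) \<partial>lborel)"
    by (rule nn_integral_iterated) measurable
  also have "\<dots> = ennreal (LINT p|lborel. indicator ?B p *\<^sub>R norm (W_z f p))"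
    by (rule nn_integral_eq_integral[OF i]) simp
  finally show ?thesis unfolding set_lebesgue_integral_def by (subst (asm) ennreal_le_iff) (auto intro: integral_nonneg)
qed

text \<open>For \<open>g\<close> supported in \<open>[-R,R]\<close>, \<open>W(\<cdot>,Z)\<close> at a suitable height \<open>Z\<close> has at most half of the
  \<open>L\<^sup>1\<close> mass of \<open>g\<close> over \<open>[-R,R]\<close>, since the Poisson kernel decays with the height; the rest is paid for by
  the vertical derivative, hence by the energy.\<close>

lemma trace_inequality:
  assumes R: "0 < R"
  obtains C where "\<And>g. \<lbrakk>weighted_L1 g; integrable lborel g; finite_energy (cs_ext g); \<And>x. R < \<bar>x\<bar> \<Longrightarrow> g x = 0\<rbrakk> \<Longrightarrow>
    (LINT x|lborel. norm (g x)) \<le> C * trace_norm g"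
proof -
  define J where "J = japanese_integral (3/4)"
  have J: "0 < J" unfolding J_def by (rule japanese_integral_pos) simp
  define y where "y = 4 * R / J"
  define Z where "Z = sqrt (2 * y)"
  have y: "0 < y" using R J by (simp add: y_def)
  then have Z: "0 < Z" "Z\<^sup>2 / 2 = y" by (simp_all add: Z_def)
  define A where "A = measure lborel ({-R..R} \<times> {0<..Z})"
  show ?thesis
  proof (rule that[of "2 * (A + sqrt 2)"])
    fix g assume g: "weighted_L1 g" "integrable lborel g" "finite_energy (cs_ext g)" "\<And>x. R < \<bar>x\<bar> \<Longrightarrow> g x = 0"
    define N where "N = (LINT x|lborel. norm (g x))"
    define M where "M = (LINT p|lborel. indicator ({-R..R} \<times> {0<..Z}) p *\<^sub>R norm (W_z g p))"
    have M: "M \<le> (A + sqrt 2) * trace_norm g" unfolding M_def A_def by (rule box_W_z_le[OF g(1,3) Z(1)])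
    have top: "norm (W_fun g (x, Z)) \<le> N / (4 * R)" for x
    proof -
      have k: "gen_poisson (3/4) y h \<le> 1 / (y * J)" for h
      proof -
        have "gen_poisson (3/4) y h \<le> y powr (2 * (3/4) - 1) * (y\<^sup>2) powr (- (3/4)) / J"
          unfolding J_def by (rule gen_poisson_le[OF _ y]) simp
        also have "(y\<^sup>2) powr (- (3/4)) = y powr (- (3/2))"
        proof -
          have "y\<^sup>2 = y powr 2" using y by (simp add: powr_numeral)
          then have "(y\<^sup>2) powr (- (3/4)) = (y powr 2) powr (- (3/4))" by (simp only:)
          also have "\<dots> = y powr (- (3/2))" by (simp only: powr_powr) simp
          finally show ?thesis .
        qed
        also have "y powr (2 * (3/4) - 1) * y powr (- (3/2)) = y powr (- 1)" by (simp only: powr_add[symmetric]) simp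
        also have "y powr (- 1) = 1 / y" using y powr_minus_divide[of y 1] by simp
        finally show ?thesis by simp
      qed
      have "norm (W_fun g (x, Z)) \<le> (LINT t|lborel. norm (of_real (gen_poisson (3/4) y (x - t)) * g t))"
        unfolding W_fun_eq_gen_conv[OF Z(1)] Z(2) gen_conv_def by simp
      also have "\<dots> \<le> (LINT t|lborel. 1 / (y * J) * norm (g t))"
      proof (rule integral_mono)
        show "integrable lborel (\<lambda>t. norm (of_real (gen_poisson (3/4) y (x - t)) * g t))"
          by (intro integrable_norm integrable_gen_conv_L1[OF _ y g(2)]) simp
        show "integrable lborel (\<lambda>t. 1 / (y * J) * norm (g t))" using g(2) by (intro integrable_mult_right integrable_norm)
        show "norm (of_real (gen_poisson (3/4) y (x - t)) * g t) \<le> 1 / (y * J) * norm (g t)" for t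
          unfolding norm_mult norm_of_real using k[of "x - t"] gen_poisson_nonneg[of "3/4" y "x - t"] by (intro mult_right_mono) auto
      qed
      also have "\<dots> = N / (4 * R)" using J R by (simp add: N_def y_def)
      finally show ?thesis .
    qed
    define z where "z n = Z / (Suc n)" for n
    have z: "0 < z n" "z n \<le> Z" for n using Z(1) by (simp_all add: z_def divide_le_eq)
    have z0: "z \<longlonglongrightarrow> 0" unfolding z_def by (rule LIMSEQ_Suc[OF lim_const_over_n])
    note hs = half_square_tendsto[OF z(1) z0]
    note L1 = gen_conv_tendsto_L1[OF _ g(2) hs, of "3/4"]
    have le: "N \<le> (LINT x|lborel. norm (gen_conv (3/4) ((z n)\<^sup>2 / 2) g x - g x)) + (M + N / 2)" for n
    proof -
      let ?I = "indicator {-R..R} :: real \<Rightarrow> real"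
      let ?G = "\<lambda>x. norm (gen_conv (3/4) ((z n)\<^sup>2 / 2) g x - g x)"
      let ?D = "\<lambda>x. ?I x *\<^sub>R norm (W_fun g (x, Z) - W_fun g (x, z n))"
      have iG: "integrable lborel ?G" using L1(1)[of n] g(2) by (intro integrable_norm Bochner_Integration.integrable_diff) auto
      have iD: "integrable lborel ?D"
        by (intro borel_integrable_compact compact_Icc continuous_on_norm continuous_on_diff
             continuous_on_subset[OF W_slice_continuous(1)[OF g(1)]] z Z) auto
      have iI: "integrable lborel (\<lambda>x. ?I x * (N / (4 * R)))" by (intro integrable_mult_left) (simp add: emeasure_lborel_Icc_eq)
      have "N \<le> (LINT x|lborel. ?G x + (?D x + ?I x * (N / (4 * R))))"
        unfolding N_def[symmetric]
      proof (subst N_def, rule integral_mono)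
        show "norm (g x) \<le> ?G x + (?D x + ?I x * (N / (4 * R)))" for x
        proof (cases "x \<in> {-R..R}")
          case True
          have "norm (g x) \<le> ?G x + norm (W_fun g (x, Z) - W_fun g (x, z n)) + norm (W_fun g (x, Z))"
            unfolding W_fun_eq_gen_conv[OF z(1)]
            using norm_triangle_ineq4[of "gen_conv (3/4) ((z n)\<^sup>2 / 2) g x - g x" "gen_conv (3/4) ((z n)\<^sup>2 / 2) g x"]
              norm_triangle_ineq4[of "W_fun g (x, Z)" "W_fun g (x, Z) - gen_conv (3/4) ((z n)\<^sup>2 / 2) g x"] by simp
          then show ?thesis using top[of x] True by simp
        next
          case False
          then show ?thesis using g(4)[of x] by (auto simp: indicator_def)
        qed
      qed (use g(2) iG iD iI in auto)
      also have "\<dots> = (LINT x|lborel. ?G x) + ((LINT x|lborel. ?D x) + 2 * R * (N / (4 * R)))"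
        using iG iD iI R by simp
      also have "(LINT x|lborel. ?D x) \<le> M"
        unfolding M_def using vertical_increment_le[OF g(1) z integrable_box_W_z[OF g(1,3) Z(1)]] unfolding set_lebesgue_integral_def .
      finally show ?thesis using R by simp
    qed
    have "N \<le> 0 + (M + N / 2)"
      by (rule LIMSEQ_le_const[OF tendsto_add[OF L1(2) tendsto_const]]) (use le in auto)
    then show "(LINT x|lborel. norm (g x)) \<le> 2 * (A + sqrt 2) * trace_norm g"
      using M unfolding N_def[symmetric] mult.assoc by linarith
  qed
qed

lemma local_trace_representative:
  assumes g: "g \<in> local_trace_space R" and R: "0 < R"
  obtains h where "weighted_L1 h" "h \<in> borel_measurable borel" "integrable lborel h" "\<And>x. R < \<bar>x\<bar> \<Longrightarrow> h x = 0"
    "AE x in lebesgue. g x = h x" "cs_ext g = cs_ext h" "finite_energy (cs_ext h)" "trace_norm g = trace_norm h" "g \<in> borel_measurable lebesgue"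
proof -
  have g': "has_cs_ext g" "finite_energy (cs_ext g)" "\<And>x. R < \<bar>x\<bar> \<Longrightarrow> g x = 0"
    using g by (auto simp: local_trace_space_def trace_space_def)
  obtain k where k: "k \<in> borel_measurable borel" "AE x in lebesgue. g x = k x" "g \<in> borel_measurable lebesgue"
    using borel_representative[OF g'(1)] by metis
  define h where "h x = of_real (indicator {-R..R} x) * k x" for x
  have hm [measurable]: "h \<in> borel_measurable borel" unfolding h_def[abs_def] using k(1) by measurable
  have ae: "AE x in lebesgue. g x = h x"
    using k(2)
  proof eventually_elim
    case (elim x)
    then show ?case using g'(3)[of x] by (cases "x \<in> {-R..R}") (auto simp: h_def not_le)
  qed
  note hl = borel_imp_lebesgue_measurable[OF hm]
  note c = cs_ext_cong_AE[OF k(3) hl ae]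
  have w: "weighted_L1 h"
    using has_cs_ext_cong_AE[OF k(3) hl ae] has_cs_ext_iff_weighted_L1[OF hm] g'(1) by simp
  have "integrable lborel h"
  proof (rule Bochner_Integration.integrable_bound)
    show "integrable lborel (\<lambda>t. of_real (weight t) * h t / of_real (weight R))"
      using w unfolding weighted_L1_def by (intro integrable_divide) simp
    show "AE t in lborel. norm (h t) \<le> norm (of_real (weight t) * h t / of_real (weight R))"
    proof (intro AE_I2)
      fix t
      show "norm (h t) \<le> norm (of_real (weight t) * h t / of_real (weight R))"
      proof (cases "t \<in> {-R..R}")
        case True
        then have "weight R \<le> weight t"
          unfolding weight_def by (intro powr_mono2') (auto simp: abs_le_square_iff[symmetric] add_pos_nonneg)
        then have "norm (h t) * weight R \<le> norm (h t) * weight t" by (intro mult_left_mono) auto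
        then show ?thesis using weight_pos[of R] weight_pos[of t] by (simp add: norm_mult norm_divide pos_le_divide_eq mult.commute)
      qed (simp add: h_def)
    qed
  qed simp
  then show ?thesis
  proof (rule that[OF w hm _ _ ae c _ _ k(3)])
    show "h x = 0" if "R < \<bar>x\<bar>" for x using that by (auto simp: h_def indicator_def)
    show "finite_energy (cs_ext h)" "trace_norm g = trace_norm h" using g'(2) c by (simp_all add: trace_norm_def)
  qed
qed

lemma norm_integral_mult_le:
  fixes w d :: "real \<Rightarrow> complex"
  assumes d: "integrable lborel d" and w: "w \<in> borel_measurable borel" "\<And>x. norm (w x) \<le> B"
  shows "norm (LINT x|lborel. w x * d x) \<le> B * (LINT x|lborel. norm (d x))"
proof -
  have i: "integrable lborel (\<lambda>x. w x * d x)" using integrable_bounded_mult[OF d w] by (simp add: mult.commute)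
  have "norm (LINT x|lborel. w x * d x) \<le> (LINT x|lborel. norm (w x * d x))" by simp
  also have "\<dots> \<le> (LINT x|lborel. B * norm (d x))"
    using i d by (intro integral_mono integrable_norm integrable_mult_right) (auto simp: norm_mult intro!: mult_right_mono w(2))
  finally show ?thesis using d by simp
qed

lemma gen_conv_pairing_tendsto:
  assumes v: "v \<in> borel_measurable borel" "\<And>x. norm (v x) \<le> B" and h: "\<And>n. integrable lborel (h n)" "integrable lborel h0"
    and lim: "(\<lambda>n. LINT x|lborel. norm (h n x - h0 x)) \<longlonglongrightarrow> 0" and y: "\<And>n. 0 < y n" "y \<longlonglongrightarrow> 0"
  shows "(\<lambda>n. LINT x|lborel. gen_conv (5/4) (y n) v x * h n x) \<longlonglongrightarrow> (LINT x|lborel. v x * h0 x)"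
proof (rule LIM_zero_cancel, rule tendsto_0_le[where K = 1])
  let ?e = "\<lambda>n. B * (LINT x|lborel. norm (h n x - h0 x)) + B * (LINT x|lborel. norm (gen_conv (5/4) (y n) h0 x - h0 x))"
  have "(\<lambda>n. LINT x|lborel. norm (gen_conv (5/4) (y n) h0 x - h0 x)) \<longlonglongrightarrow> 0"
    by (rule gen_conv_tendsto_L1[OF _ h(2) y]) simp
  then have "?e \<longlonglongrightarrow> B * 0 + B * 0" by (intro tendsto_add tendsto_mult_left lim)
  then show "?e \<longlonglongrightarrow> 0" by simp
  show "\<forall>\<^sub>F n in sequentially. norm ((LINT x|lborel. gen_conv (5/4) (y n) v x * h n x) - (LINT x|lborel. v x * h0 x)) \<le> norm (?e n) * 1"
  proof (intro always_eventually allI)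
    fix n
    have gm: "gen_conv (5/4) (y n) v \<in> borel_measurable borel" using v(1) by measurable
    have gb: "norm (gen_conv (5/4) (y n) v x) \<le> B" for x by (rule gen_conv_bounded[OF _ y(1) v]) simp
    have gi: "integrable lborel (gen_conv (5/4) (y n) h0)" by (rule gen_conv_tendsto_L1[OF _ h(2) y]) simp
    have i: "integrable lborel (\<lambda>x. gen_conv (5/4) (y n) v x * h n x)" "integrable lborel (\<lambda>x. gen_conv (5/4) (y n) v x * h0 x)"
      using integrable_bounded_mult[OF h(1) gm gb] integrable_bounded_mult[OF h(2) gm gb] by (simp_all add: mult.commute)
    have j: "integrable lborel (\<lambda>x. v x * h0 x)" "integrable lborel (\<lambda>x. v x * gen_conv (5/4) (y n) h0 x)"
      using integrable_bounded_mult[OF h(2) v] integrable_bounded_mult[OF gi v] by (simp_all add: mult.commute)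
    have c: "(LINT x|lborel. gen_conv (5/4) (y n) v x * h0 x) = (LINT x|lborel. v x * gen_conv (5/4) (y n) h0 x)"
      by (rule integral_gen_conv_commute[OF _ y(1) v h(2)]) simp
    have "(LINT x|lborel. gen_conv (5/4) (y n) v x * h n x) - (LINT x|lborel. v x * h0 x) =
      (LINT x|lborel. gen_conv (5/4) (y n) v x * (h n x - h0 x)) + (LINT x|lborel. v x * (gen_conv (5/4) (y n) h0 x - h0 x))"
      using i j c by (simp add: right_diff_distrib)
    also have "norm \<dots> \<le> ?e n"
      by (intro norm_triangle_mono norm_integral_mult_le gm gb v Bochner_Integration.integrable_diff h gi)
    finally show "norm ((LINT x|lborel. gen_conv (5/4) (y n) v x * h n x) - (LINT x|lborel. v x * h0 x)) \<le> norm (?e n) * 1"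
      unfolding real_norm_def mult_1_right by (rule order_trans[OF _ abs_ge_self])
  qed
qed


lemma test_functionE:
  assumes "test_function \<Psi>"
  obtains R K where "0 < R" "\<And>p. R < \<bar>fst p\<bar> \<or> R < snd p \<Longrightarrow> \<Psi> p = 0"
    "\<And>p. (\<Psi> has_derivative (\<lambda>v. of_real (fst v) * Dfst \<Psi> p + of_real (snd v) * Dsnd \<Psi> p)) (at p)"
    "continuous_on UNIV \<Psi>" "continuous_on UNIV (Dfst \<Psi>)" "continuous_on UNIV (Dsnd \<Psi>)" "\<And>p. norm (\<Psi> p) \<le> K"
    "\<And>p. \<bar>fst p\<bar> \<le> R \<Longrightarrow> \<bar>snd p\<bar> \<le> R \<Longrightarrow> norm (Dfst \<Psi> p) \<le> K \<and> norm (Dsnd \<Psi> p) \<le> K"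
proof -
  have "Ck_on (Suc 0) UNIV \<Psi>" and cpt: "compact (closure {p. \<Psi> p \<noteq> 0})" using assms unfolding test_function_def by blast+
  then have d: "\<Psi> differentiable (at p)" and c: "continuous_on UNIV (Dfst \<Psi>)" "continuous_on UNIV (Dsnd \<Psi>)" for p
    unfolding Ck_on.simps by blast+
  have der: "(\<Psi> has_derivative (\<lambda>v. of_real (fst v) * Dfst \<Psi> p + of_real (snd v) * Dsnd \<Psi> p)) (at p)" for p
  proof -
    obtain D where D: "(\<Psi> has_derivative D) (at p)" using d unfolding differentiable_def by blast
    interpret bounded_linear D using D by (rule has_derivative_bounded_linear)
    have "D v = of_real (fst v) * Dfst \<Psi> p + of_real (snd v) * Dsnd \<Psi> p" for v
    proof -
      have "v = fst v *\<^sub>R (1, 0) + snd v *\<^sub>R (0, 1)" by (simp add: prod_eq_iff)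
      then have "D v = D (fst v *\<^sub>R (1, 0) + snd v *\<^sub>R (0, 1))" by (simp only:)
      also have "\<dots> = fst v *\<^sub>R D (1, 0) + snd v *\<^sub>R D (0, 1)" by (simp only: add scaleR)
      finally show ?thesis by (simp add: Dfst_eq[OF D] Dsnd_eq[OF D] scaleR_conv_of_real)
    qed
    then have "D = (\<lambda>v. of_real (fst v) * Dfst \<Psi> p + of_real (snd v) * Dsnd \<Psi> p)" by blast
    then show ?thesis using D by simp
  qed
  have c0: "continuous_on UNIV \<Psi>" using der has_derivative_continuous by (intro continuous_at_imp_continuous_on) blast
  obtain r where r: "\<And>p. p \<in> closure {p. \<Psi> p \<noteq> 0} \<Longrightarrow> norm p \<le> r"
    using compact_imp_bounded[OF cpt] unfolding bounded_iff by blast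
  define R where "R = max r 1"
  have zero: "\<Psi> p = 0" if "R < \<bar>fst p\<bar> \<or> R < \<bar>snd p\<bar>" for p
  proof (rule ccontr)
    assume "\<Psi> p \<noteq> 0"
    then have "norm p \<le> r" by (intro r subsetD[OF closure_subset]) simp
    then show False using that norm_fst_le[of "fst p" "snd p"] norm_snd_le[of "snd p" "fst p"] by (auto simp: R_def)
  qed
  have bd: "\<exists>B. \<forall>p. \<bar>fst p\<bar> \<le> R \<longrightarrow> \<bar>snd p\<bar> \<le> R \<longrightarrow> norm (F p) \<le> B" if "continuous_on UNIV F" for F :: "real \<times> real \<Rightarrow> complex"
  proof -
    have "bounded (F ` cbox (-R, -R) (R, R))"
      by (intro compact_imp_bounded compact_continuous_image continuous_on_subset[OF that] compact_cbox) simp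
    then obtain B where B: "\<And>p. p \<in> cbox (-R, -R) (R, R) \<Longrightarrow> norm (F p) \<le> B" unfolding bounded_iff by blast
    have "p \<in> cbox (-R, -R) (R, R)" if "\<bar>fst p\<bar> \<le> R" "\<bar>snd p\<bar> \<le> R" for p using that by (cases p) (auto simp: cbox_Pair_eq)
    then show ?thesis using B by blast
  qed
  obtain B0 B1 B2 where B: "\<And>p. \<bar>fst p\<bar> \<le> R \<Longrightarrow> \<bar>snd p\<bar> \<le> R \<Longrightarrow> norm (\<Psi> p) \<le> B0"
      "\<And>p. \<bar>fst p\<bar> \<le> R \<Longrightarrow> \<bar>snd p\<bar> \<le> R \<Longrightarrow> norm (Dfst \<Psi> p) \<le> B1" "\<And>p. \<bar>fst p\<bar> \<le> R \<Longrightarrow> \<bar>snd p\<bar> \<le> R \<Longrightarrow> norm (Dsnd \<Psi> p) \<le> B2"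
    using bd[OF c0] bd[OF c(1)] bd[OF c(2)] by metis
  define K where "K = \<bar>B0\<bar> + \<bar>B1\<bar> + \<bar>B2\<bar>"
  show ?thesis
  proof (rule that[of R K])
    show "norm (\<Psi> p) \<le> K" for p
      using B(1)[of p] zero[of p] by (cases "\<bar>fst p\<bar> \<le> R \<and> \<bar>snd p\<bar> \<le> R") (auto simp: K_def not_le)
    show "norm (Dfst \<Psi> p) \<le> K \<and> norm (Dsnd \<Psi> p) \<le> K" if "\<bar>fst p\<bar> \<le> R" "\<bar>snd p\<bar> \<le> R" for p
      using B(2,3)[OF that] by (auto simp: K_def)
    show "\<Psi> p = 0" if "R < \<bar>fst p\<bar> \<or> R < snd p" for p using that by (intro zero) auto
  qed (use der c0 c in \<open>auto simp: R_def\<close>)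
qed

lemma slices_tendsto:
  fixes F :: "real \<times> real \<Rightarrow> complex"
  assumes c: "continuous_on UNIV F" and K: "\<And>p. norm (F p) \<le> K" and w: "integrable lborel w" and z: "z \<longlonglongrightarrow> 0"
  shows "(\<lambda>n. LINT x|lborel. norm ((F (x, z n) - F (x, 0)) * w x)) \<longlonglongrightarrow> 0"
proof -
  have cs: "continuous_on UNIV (\<lambda>x. F (x, t))" for t
    by (rule continuous_on_compose2[OF c]) (auto intro!: continuous_intros)
  have [measurable]: "(\<lambda>x. F (x, t)) \<in> borel_measurable borel" for t by (rule borel_measurable_continuous_onI[OF cs])
  have [measurable]: "w \<in> borel_measurable borel" using w by auto
  have "(\<lambda>n. LINT x|lborel. norm ((F (x, z n) - F (x, 0)) * w x)) \<longlonglongrightarrow> (LINT (x::real)|lborel. 0)"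
  proof (rule integral_dominated_convergence[where w = "\<lambda>x. 2 * K * norm (w x)"])
    show "AE x in lborel. (\<lambda>n. norm ((F (x, z n) - F (x, 0)) * w x)) \<longlonglongrightarrow> 0"
    proof (intro AE_I2 tendsto_norm_zero tendsto_mult_left_zero)
      fix x
      have "isCont F (x, 0)" using c by (simp add: continuous_on_eq_continuous_at)
      then have "(\<lambda>n. F (x, z n)) \<longlonglongrightarrow> F (x, 0)"
        by (rule isCont_tendsto_compose) (intro tendsto_Pair tendsto_const z)
      then show "(\<lambda>n. F (x, z n) - F (x, 0)) \<longlonglongrightarrow> 0" by (rule LIM_zero)
    qed
    show "AE x in lborel. norm (norm ((F (x, z n) - F (x, 0)) * w x)) \<le> 2 * K * norm (w x)" for n
    proof (intro AE_I2)
      fix x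
      have "norm (F (x, z n) - F (x, 0)) \<le> 2 * K"
        using norm_triangle_ineq4[of "F (x, z n)" "F (x, 0)"] K[of "(x, z n)"] K[of "(x, 0)"] by linarith
      then show "norm (norm ((F (x, z n) - F (x, 0)) * w x)) \<le> 2 * K * norm (w x)"
        by (simp add: norm_mult mult_right_mono)
    qed
    show "integrable lborel (\<lambda>x. 2 * K * norm (w x))" using w by (intro integrable_mult_right integrable_norm)
  qed measurable
  then show ?thesis by simp
qed

lemma emeasure_box_finite: "emeasure lborel ({-R..R::real} \<times> {0<..Z::real}) < \<infinity>"
  by (intro emeasure_bounded_finite bounded_Times bounded_closed_interval bounded_subset[OF bounded_closed_interval[of 0 Z]]) auto

lemma integrable_box_const: "integrable lborel (\<lambda>p. indicator ({-R..R::real} \<times> {0<..Z::real}) p *\<^sub>R (c::real))"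
  using emeasure_box_finite[of R Z] by (intro integrable_scaleR_left) simp

lemma integrable_boxI:
  fixes F :: "real \<times> real \<Rightarrow> real"
  assumes "continuous_on half_plane F" and g: "integrable lborel (\<lambda>p. indicator ({-R..R} \<times> {0<..Z}) p *\<^sub>R g p)"
    and le: "\<And>p. p \<in> half_plane \<Longrightarrow> \<bar>fst p\<bar> \<le> R \<Longrightarrow> snd p \<le> Z \<Longrightarrow> \<bar>F p\<bar> \<le> g p"
  shows "integrable lborel (\<lambda>p. indicator ({-R..R} \<times> {0<..Z}) p *\<^sub>R F p)"
proof (rule Bochner_Integration.integrable_bound[OF g])
  show "(\<lambda>p. indicator ({-R..R} \<times> {0<..Z}) p *\<^sub>R F p) \<in> borel_measurable lborel"
    unfolding measurable_lborel2 by (rule borel_indicator_box[OF assms(1)])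
  show "AE p in lborel. norm (indicator ({-R..R} \<times> {0<..Z}) p *\<^sub>R F p) \<le> norm (indicator ({-R..R} \<times> {0<..Z}) p *\<^sub>R g p)"
  proof (intro AE_I2)
    fix p :: "real \<times> real"
    show "norm (indicator ({-R..R} \<times> {0<..Z}) p *\<^sub>R F p) \<le> norm (indicator ({-R..R} \<times> {0<..Z}) p *\<^sub>R g p)"
    proof (cases "p \<in> {-R..R} \<times> {0<..Z}")
      case True
      then have "\<bar>F p\<bar> \<le> g p" by (intro le) auto
      then show ?thesis unfolding indicator_simps(1)[OF True] by simp
    next
      case False
      show ?thesis unfolding indicator_simps(2)[OF False] by simp
    qed
  qed
qed

lemma integrable_box_W_fun:
  assumes h: "weighted_L1 h" "integrable lborel h"
  shows "integrable lborel (\<lambda>p. indicator ({-R..R} \<times> {0<..Z}) p *\<^sub>R norm (W_fun h p))"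
proof -
  let ?F = "\<lambda>p. indicator ({-R..R} \<times> {0<..Z}) p *\<^sub>R norm (W_fun h p)"
  have m: "?F \<in> borel_measurable lborel"
    unfolding measurable_lborel2 by (rule borel_indicator_box[OF continuous_on_norm[OF continuous_on_W(1)[OF h(1)]]])
  have "(\<integral>\<^sup>+p. ?F p \<partial>lborel) = (\<integral>\<^sup>+z. \<integral>\<^sup>+x. ?F (x, z) \<partial>lborel \<partial>lborel)"
    by (rule nn_integral_iterated_swap[symmetric]) (use m in measurable)
  also have "\<dots> \<le> (\<integral>\<^sup>+z. (\<integral>\<^sup>+x. norm (h x) \<partial>lborel) * indicator {0<..Z} z \<partial>lborel)"
  proof (intro nn_integral_mono)
    fix z :: real
    show "(\<integral>\<^sup>+x. ?F (x, z) \<partial>lborel) \<le> (\<integral>\<^sup>+x. norm (h x) \<partial>lborel) * indicator {0<..Z} z"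
    proof (cases "z \<in> {0<..Z}")
      case True
      then have z: "0 < z" and y: "0 < z\<^sup>2 / 2" by auto
      have "(\<integral>\<^sup>+x. ?F (x, z) \<partial>lborel) \<le> (\<integral>\<^sup>+x. norm (gen_conv (3/4) (z\<^sup>2 / 2) h x) \<partial>lborel)"
        by (intro nn_integral_mono ennreal_leI) (auto simp: indicator_def W_fun_eq_gen_conv[OF z])
      also have "\<dots> \<le> (\<integral>\<^sup>+x. norm (h x) \<partial>lborel)" by (rule nn_integral_gen_conv_le[OF _ y h(2)]) simp
      finally show ?thesis using True by simp
    qed (auto simp: indicator_def)
  qed
  also have "\<dots> = (\<integral>\<^sup>+x. norm (h x) \<partial>lborel) * emeasure lborel {0<..Z}" by (rule nn_integral_cmult_indicator) simp
  also have "\<dots> < \<infinity>"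
    using h(2) by (cases "0 \<le> Z") (auto simp: integrable_iff_bounded ennreal_mult_less_top)
  finally show ?thesis by (intro integrableI_nonneg m) auto
qed

lemma (in bounded_solution) conormal_pairing:
  assumes pairing: "half_plane_pairing u \<Psi> \<Psi>x \<Psi>z R"
    and dom: "integrable lborel (\<lambda>p. indicator ({-R..R} \<times> {0<..R}) p *\<^sub>R norm (\<Psi>z p))"
      "integrable lborel (\<lambda>p. indicator ({-R..R} \<times> {0<..R}) p *\<^sub>R (\<bar>snd p\<bar> * norm (\<Psi>x p)))"
    and h: "integrable lborel h" "\<And>n. integrable lborel (\<lambda>x. \<Psi> (x, z n))" "(\<lambda>n. LINT x|lborel. norm (\<Psi> (x, z n) - h x)) \<longlonglongrightarrow> 0"
    and z: "\<And>n. 0 < z n" "z \<longlonglongrightarrow> 0"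
  shows "set_integrable lebesgue half_plane (conormal_integrand (lift (cs_ext u)) \<Psi>)"
    and "(LINT p:half_plane|lebesgue. conormal_integrand (lift (cs_ext u)) \<Psi> p) = - (of_real flux_const * (LINT x|lborel. v x * h x))"
proof -
  interpret P: half_plane_pairing u \<Psi> \<Psi>x \<Psi>z R by (rule pairing)
  let ?I = "indicator ({-R..R} \<times> {0<..R}) :: real \<times> real \<Rightarrow> real"
  have int: "integrable lborel (\<lambda>p. indicator half_plane p *\<^sub>R P.integrand p)"
  proof (rule P.integrable_integrandI)
    show "integrable lborel (\<lambda>p. flux_const * Bv * (?I p *\<^sub>R norm (\<Psi>z p)) + flux_const * (5/2 * Bv) * (?I p *\<^sub>R (\<bar>snd p\<bar> * norm (\<Psi>x p))))"
      by (intro Bochner_Integration.integrable_add integrable_mult_right dom)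
    fix p assume p: "p \<in> half_plane" "\<bar>fst p\<bar> \<le> R" "snd p \<le> R"
    then have s: "0 < snd p" and I: "?I p = 1" by (auto simp: indicator_def mem_Times_iff)
    have "norm (P.integrand p) \<le> norm (W_z u p * \<Psi>z p) + norm (of_real ((snd p)\<^sup>2) * W_x u p * \<Psi>x p)"
      unfolding P.integrand_def by (rule norm_triangle_ineq)
    also have "\<dots> = norm (W_z u p) * norm (\<Psi>z p) + (snd p * norm (W_x u p)) * (snd p * norm (\<Psi>x p))"
      unfolding norm_mult norm_of_real by (simp add: power2_eq_square)
    also have "\<dots> \<le> flux_const * Bv * norm (\<Psi>z p) + flux_const * (5/2 * Bv) * (snd p * norm (\<Psi>x p))"
      using W_z_bound[of "snd p" "fst p"] W_x_bound[of "snd p" "fst p"] s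
      by (intro add_mono mult_right_mono) auto
    finally show "norm (P.integrand p) \<le> flux_const * Bv * (?I p *\<^sub>R norm (\<Psi>z p)) + flux_const * (5/2 * Bv) * (?I p *\<^sub>R (\<bar>snd p\<bar> * norm (\<Psi>x p)))"
      unfolding I using s by simp
  qed
  have "(\<lambda>n. LINT x|lborel. gen_conv (5/4) ((z n)\<^sup>2 / 2) v x * \<Psi> (x, z n)) \<longlonglongrightarrow> (LINT x|lborel. v x * h x)"
    by (rule gen_conv_pairing_tendsto[OF v Bv h(2,1,3) half_square_tendsto[OF z]])
  then have "(\<lambda>n. - (of_real flux_const * (LINT x|lborel. gen_conv (5/4) ((z n)\<^sup>2 / 2) v x * \<Psi> (x, z n)))) \<longlonglongrightarrow> - (of_real flux_const * (LINT x|lborel. v x * h x))"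
    by (intro tendsto_minus tendsto_mult_left)
  moreover have "(LINT x|lborel. W_z u (x, z n) * \<Psi> (x, z n)) = of_real flux_const * (LINT x|lborel. gen_conv (5/4) ((z n)\<^sup>2 / 2) v x * \<Psi> (x, z n))" for n
    unfolding W_z_eq[OF z(1)] mult.assoc by (rule integral_mult_right_zero)
  ultimately have "(\<lambda>n. - (LINT x|lborel. W_z u (x, z n) * \<Psi> (x, z n))) \<longlonglongrightarrow> - (of_real flux_const * (LINT x|lborel. v x * h x))"
    by (simp only:)
  then have "(LINT p:half_plane|lborel. P.integrand p) = - (of_real flux_const * (LINT x|lborel. v x * h x))"
    using P.green_limit[OF int z] LIMSEQ_unique by blast
  then show "set_integrable lebesgue half_plane (conormal_integrand (lift (cs_ext u)) \<Psi>)"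
    "(LINT p:half_plane|lebesgue. conormal_integrand (lift (cs_ext u)) \<Psi> p) = - (of_real flux_const * (LINT x|lborel. v x * h x))"
    using P.conormal_integral[OF int] by simp_all
qed

lemma inverse_Suc_tendsto: "0 < inverse (real (Suc n))" "(\<lambda>n. inverse (real (Suc n))) \<longlonglongrightarrow> 0"
  using LIMSEQ_inverse_real_of_nat by simp_all

lemma slice_measurable:
  assumes "continuous_on UNIV (F :: real \<times> real \<Rightarrow> complex)"
  shows "(\<lambda>x. F (x, t)) \<in> borel_measurable borel"
  by (intro borel_measurable_continuous_onI continuous_on_compose2[OF assms]) (auto intro!: continuous_intros)

lemma test_function_pairing:
  assumes "weighted_L1 f" "0 < R" "\<And>p. R < \<bar>fst p\<bar> \<or> R < snd p \<Longrightarrow> \<Psi> p = 0"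
    "\<And>p. (\<Psi> has_derivative (\<lambda>v. of_real (fst v) * Dfst \<Psi> p + of_real (snd v) * Dsnd \<Psi> p)) (at p)"
    "continuous_on UNIV (Dfst \<Psi>)" "continuous_on UNIV (Dsnd \<Psi>)"
  shows "half_plane_pairing f \<Psi> (Dfst \<Psi>) (Dsnd \<Psi>) R"
  using assms by unfold_locales (auto intro: continuous_on_subset)

lemma (in bounded_solution) conormal_test:
  assumes "test_function \<Psi>"
  shows "set_integrable lebesgue half_plane (conormal_integrand (lift (cs_ext u)) \<Psi>)"
    and "(LINT p:half_plane|lebesgue. conormal_integrand (lift (cs_ext u)) \<Psi> p) = - (of_real flux_const * (LINT x|lborel. v x * \<Psi> (x, 0)))"
proof -
  obtain R K where R: "0 < R" and zero: "\<And>p. R < \<bar>fst p\<bar> \<or> R < snd p \<Longrightarrow> \<Psi> p = 0"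
    and der: "\<And>p. (\<Psi> has_derivative (\<lambda>v. of_real (fst v) * Dfst \<Psi> p + of_real (snd v) * Dsnd \<Psi> p)) (at p)"
    and c: "continuous_on UNIV \<Psi>" "continuous_on UNIV (Dfst \<Psi>)" "continuous_on UNIV (Dsnd \<Psi>)" and K: "\<And>p. norm (\<Psi> p) \<le> K"
    and KD: "\<And>p. \<bar>fst p\<bar> \<le> R \<Longrightarrow> \<bar>snd p\<bar> \<le> R \<Longrightarrow> norm (Dfst \<Psi> p) \<le> K \<and> norm (Dsnd \<Psi> p) \<le> K"
    by (rule test_functionE[OF assms]) blast
  let ?w = "\<lambda>x. of_real (indicator {-R..R} x) :: complex"
  have w: "integrable lborel ?w" unfolding complex_of_real_integrable_eq by (simp add: emeasure_lborel_Icc_eq)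
  have sup: "\<Psi> (x, t) = ?w x * \<Psi> (x, t)" for x t
  proof (cases "x \<in> {-R..R}")
    case False
    then have "R < \<bar>x\<bar>" by auto
    then have "\<Psi> (x, t) = 0" by (intro zero) simp
    then show ?thesis by simp
  qed simp
  have i: "integrable lborel (\<lambda>x. \<Psi> (x, t))" for t
    by (subst sup) (rule integrable_bounded_mult[OF w slice_measurable[OF c(1)] K])
  have dom: "integrable lborel (\<lambda>p. indicator ({-R..R} \<times> {0<..R}) p *\<^sub>R norm (Dsnd \<Psi> p))"
    "integrable lborel (\<lambda>p. indicator ({-R..R} \<times> {0<..R}) p *\<^sub>R (\<bar>snd p\<bar> * norm (Dfst \<Psi> p)))"
  proof -
    have cn: "continuous_on half_plane (\<lambda>p. norm (Dsnd \<Psi> p))" "continuous_on half_plane (\<lambda>p. \<bar>snd p\<bar> * norm (Dfst \<Psi> p))"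
      by (intro continuous_on_norm continuous_on_mult continuous_on_rabs continuous_on_snd continuous_on_id continuous_on_subset[OF c(2)] continuous_on_subset[OF c(3)] subset_UNIV)+
    show "integrable lborel (\<lambda>p. indicator ({-R..R} \<times> {0<..R}) p *\<^sub>R norm (Dsnd \<Psi> p))"
      by (rule integrable_boxI[OF cn(1) integrable_box_const[of R R K]]) (use KD in auto)
    show "integrable lborel (\<lambda>p. indicator ({-R..R} \<times> {0<..R}) p *\<^sub>R (\<bar>snd p\<bar> * norm (Dfst \<Psi> p)))"
      by (rule integrable_boxI[OF cn(2) integrable_box_const[of R R "R * K"]]) (use KD R in \<open>auto simp: abs_mult intro!: mult_mono\<close>)
  qed
  have lim: "(\<lambda>n. LINT x|lborel. norm (\<Psi> (x, inverse (real (Suc n))) - \<Psi> (x, 0))) \<longlonglongrightarrow> 0"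
  proof -
    have "norm ((\<Psi> (x, t) - \<Psi> (x, 0)) * ?w x) = norm (\<Psi> (x, t) - \<Psi> (x, 0))" for x t
      using sup[of x t] sup[of x 0] by (metis left_diff_distrib mult.commute)
    then show ?thesis using slices_tendsto[OF c(1) K w inverse_Suc_tendsto(2)] by simp
  qed
  note conormal_pairing[OF test_function_pairing[OF wu R zero der c(2,3)] dom i i lim inverse_Suc_tendsto]
  then show "set_integrable lebesgue half_plane (conormal_integrand (lift (cs_ext u)) \<Psi>)"
    "(LINT p:half_plane|lebesgue. conormal_integrand (lift (cs_ext u)) \<Psi> p) = - (of_real flux_const * (LINT x|lborel. v x * \<Psi> (x, 0)))"
    by simp_all
qed

lemma (in bounded_solution) conormal_dual:
  assumes h: "weighted_L1 h" "integrable lborel h" "finite_energy (cs_ext h)" and \<eta>: "test_function \<eta>"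
  shows "set_integrable lebesgue half_plane (conormal_integrand (lift (cs_ext u)) (\<lambda>p. \<eta> p * lift (cs_ext h) p))"
    and "(LINT p:half_plane|lebesgue. conormal_integrand (lift (cs_ext u)) (\<lambda>p. \<eta> p * lift (cs_ext h) p) p)
      = - (of_real flux_const * (LINT x|lborel. v x * (\<eta> (x, 0) * h x)))"
proof -
  obtain R K where R: "0 < R" and zero: "\<And>p. R < \<bar>fst p\<bar> \<or> R < snd p \<Longrightarrow> \<eta> p = 0"
    and der: "\<And>p. (\<eta> has_derivative (\<lambda>v. of_real (fst v) * Dfst \<eta> p + of_real (snd v) * Dsnd \<eta> p)) (at p)"
    and c: "continuous_on UNIV \<eta>" "continuous_on UNIV (Dfst \<eta>)" "continuous_on UNIV (Dsnd \<eta>)" and K: "\<And>p. norm (\<eta> p) \<le> K"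
    and KD: "\<And>p. \<bar>fst p\<bar> \<le> R \<Longrightarrow> \<bar>snd p\<bar> \<le> R \<Longrightarrow> norm (Dfst \<eta> p) \<le> K \<and> norm (Dsnd \<eta> p) \<le> K"
    by (rule test_functionE[OF \<eta>]) blast
  have hm: "h \<in> borel_measurable borel" using h(2) by auto
  have ch: "continuous_on half_plane \<eta>" "continuous_on half_plane (Dfst \<eta>)" "continuous_on half_plane (Dsnd \<eta>)"
    using c by (auto intro: continuous_on_subset)
  define \<Psi>x where "\<Psi>x p = \<eta> p * W_x h p + Dfst \<eta> p * W_fun h p" for p
  define \<Psi>z where "\<Psi>z p = \<eta> p * W_z h p + Dsnd \<eta> p * W_fun h p" for p
  have cx: "continuous_on half_plane \<Psi>x" and cz: "continuous_on half_plane \<Psi>z"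
    unfolding \<Psi>x_def[abs_def] \<Psi>z_def[abs_def] by (intro continuous_on_add continuous_on_mult ch continuous_on_W[OF h(1)])+
  have pairing: "half_plane_pairing u (\<lambda>p. \<eta> p * lift (cs_ext h) p) \<Psi>x \<Psi>z R"
  proof (unfold_locales)
    fix p :: "real \<times> real" assume p: "p \<in> half_plane"
    then have q: "0 < snd p" by simp
    show "((\<lambda>p. \<eta> p * lift (cs_ext h) p) has_derivative (\<lambda>v. of_real (fst v) * \<Psi>x p + of_real (snd v) * \<Psi>z p)) (at p)"
      by (rule has_derivative_eq_rhs[OF has_derivative_mult[OF der lift_has_derivative[OF h(1) q]]])
        (simp add: fun_eq_iff \<Psi>x_def \<Psi>z_def lift_cs_ext[OF hm q] algebra_simps)
  qed (use wu cx cz zero R in auto)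
  have dom: "integrable lborel (\<lambda>p. indicator ({-R..R} \<times> {0<..R}) p *\<^sub>R norm (\<Psi>z p))"
    "integrable lborel (\<lambda>p. indicator ({-R..R} \<times> {0<..R}) p *\<^sub>R (\<bar>snd p\<bar> * norm (\<Psi>x p)))"
  proof -
    have cn: "continuous_on half_plane (\<lambda>p. norm (\<Psi>z p))" "continuous_on half_plane (\<lambda>p. \<bar>snd p\<bar> * norm (\<Psi>x p))"
      by (intro continuous_on_norm continuous_on_mult continuous_on_rabs continuous_on_snd continuous_on_id cx cz)+
    let ?I = "indicator ({-R..R} \<times> {0<..R}) :: real \<times> real \<Rightarrow> real"
    note iz = integrable_box_W_z[OF h(1,3) R, of R] and ix = integrable_box_W_x[OF h(1,3) R, of R] and i0 = integrable_box_W_fun[OF h(1,2), of R R]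
    have "integrable lborel (\<lambda>p. K * (?I p *\<^sub>R norm (W_z h p)) + K * (?I p *\<^sub>R norm (W_fun h p)))"
      by (intro Bochner_Integration.integrable_add integrable_mult_right iz i0)
    then have g1: "integrable lborel (\<lambda>p. ?I p *\<^sub>R (K * norm (W_z h p) + K * norm (W_fun h p)))"
      by (simp add: algebra_simps)
    show "integrable lborel (\<lambda>p. ?I p *\<^sub>R norm (\<Psi>z p))"
    proof (rule integrable_boxI[OF cn(1) g1])
      fix p :: "real \<times> real" assume "p \<in> half_plane" "\<bar>fst p\<bar> \<le> R" "snd p \<le> R"
      then have "norm (Dsnd \<eta> p) \<le> K" using KD[of p] by simp
      then have "norm (\<Psi>z p) \<le> K * norm (W_z h p) + K * norm (W_fun h p)"
        unfolding \<Psi>z_def by (intro norm_triangle_mono) (auto simp: norm_mult intro!: mult_right_mono K)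
      then show "\<bar>norm (\<Psi>z p)\<bar> \<le> K * norm (W_z h p) + K * norm (W_fun h p)" by simp
    qed
    have "integrable lborel (\<lambda>p. K * (?I p *\<^sub>R (\<bar>snd p\<bar> * norm (W_x h p))) + R * K * (?I p *\<^sub>R norm (W_fun h p)))"
      by (intro Bochner_Integration.integrable_add integrable_mult_right ix i0)
    then have g2: "integrable lborel (\<lambda>p. ?I p *\<^sub>R (K * (\<bar>snd p\<bar> * norm (W_x h p)) + R * K * norm (W_fun h p)))"
      by (simp add: algebra_simps)
    show "integrable lborel (\<lambda>p. ?I p *\<^sub>R (\<bar>snd p\<bar> * norm (\<Psi>x p)))"
    proof (rule integrable_boxI[OF cn(2) g2])
      fix p :: "real \<times> real" assume p: "p \<in> half_plane" "\<bar>fst p\<bar> \<le> R" "snd p \<le> R"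
      then have D: "norm (Dfst \<eta> p) \<le> K" using KD[of p] by simp
      have K0: "0 \<le> K" using order_trans[OF norm_ge_zero K] .
      have "norm (\<Psi>x p) \<le> K * norm (W_x h p) + K * norm (W_fun h p)"
        unfolding \<Psi>x_def by (intro norm_triangle_mono) (auto simp: norm_mult intro!: mult_right_mono K D)
      then have "\<bar>snd p\<bar> * norm (\<Psi>x p) \<le> \<bar>snd p\<bar> * (K * norm (W_x h p) + K * norm (W_fun h p))" by (intro mult_left_mono) auto
      also have "\<dots> = K * (\<bar>snd p\<bar> * norm (W_x h p)) + \<bar>snd p\<bar> * (K * norm (W_fun h p))" by (simp add: algebra_simps)
      also have "\<dots> \<le> K * (\<bar>snd p\<bar> * norm (W_x h p)) + R * (K * norm (W_fun h p))"
        using p K0 by (intro add_left_mono mult_right_mono) auto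
      finally show "\<bar>\<bar>snd p\<bar> * norm (\<Psi>x p)\<bar> \<le> K * (\<bar>snd p\<bar> * norm (W_x h p)) + R * K * norm (W_fun h p)" by (simp add: abs_mult)
    qed
  qed
  let ?z = "\<lambda>n. inverse (real (Suc n))"
  let ?G = "\<lambda>n. gen_conv (3/4) ((?z n)\<^sup>2 / 2) h"
  note hs = half_square_tendsto[OF inverse_Suc_tendsto]
  note L1 = gen_conv_tendsto_L1[OF _ h(2) hs, of "3/4"]
  have slice: "\<eta> (x, ?z n) * lift (cs_ext h) (x, ?z n) = \<eta> (x, ?z n) * ?G n x" for x n
    using lift_cs_ext[OF hm, of "(x, ?z n)"] W_fun_eq_gen_conv[OF inverse_Suc_tendsto(1)] by simp
  have i: "integrable lborel (\<lambda>x. \<eta> (x, ?z n) * ?G n x)" for n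
    using integrable_bounded_mult[OF L1(1)[of n] slice_measurable[OF c(1)] K] by (simp add: mult.commute)
  have i0: "integrable lborel (\<lambda>x. \<eta> (x, t) * h x)" for t
    using integrable_bounded_mult[OF h(2) slice_measurable[OF c(1)] K] by (simp add: mult.commute)
  have lim: "(\<lambda>n. LINT x|lborel. norm (\<eta> (x, ?z n) * lift (cs_ext h) (x, ?z n) - \<eta> (x, 0) * h x)) \<longlonglongrightarrow> 0"
    unfolding slice
  proof (rule tendsto_0_le[where K = 1])
    let ?e = "\<lambda>n. K * (LINT x|lborel. norm (?G n x - h x)) + (LINT x|lborel. norm ((\<eta> (x, ?z n) - \<eta> (x, 0)) * h x))"
    have "?e \<longlonglongrightarrow> K * 0 + 0" by (intro tendsto_add tendsto_mult_left L1(2) slices_tendsto[OF c(1) K h(2) inverse_Suc_tendsto(2)]) simp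
    then show "?e \<longlonglongrightarrow> 0" by simp
    show "\<forall>\<^sub>F n in sequentially. norm (LINT x|lborel. norm (\<eta> (x, ?z n) * ?G n x - \<eta> (x, 0) * h x)) \<le> norm (?e n) * 1"
    proof (intro always_eventually allI)
      fix n
      have j: "integrable lborel (\<lambda>x. norm (?G n x - h x))" using L1(1)[of n] h(2) by (intro integrable_norm Bochner_Integration.integrable_diff) auto
      have k: "integrable lborel (\<lambda>x. norm ((\<eta> (x, ?z n) - \<eta> (x, 0)) * h x))"
        unfolding left_diff_distrib by (intro integrable_norm Bochner_Integration.integrable_diff i0)
      have "(LINT x|lborel. norm (\<eta> (x, ?z n) * ?G n x - \<eta> (x, 0) * h x)) \<le> (LINT x|lborel. K * norm (?G n x - h x) + norm ((\<eta> (x, ?z n) - \<eta> (x, 0)) * h x))"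
      proof (rule integral_mono)
        show "integrable lborel (\<lambda>x. norm (\<eta> (x, ?z n) * ?G n x - \<eta> (x, 0) * h x))" by (intro integrable_norm Bochner_Integration.integrable_diff i i0)
        show "integrable lborel (\<lambda>x. K * norm (?G n x - h x) + norm ((\<eta> (x, ?z n) - \<eta> (x, 0)) * h x))" by (intro Bochner_Integration.integrable_add integrable_mult_right j k)
        fix x
        have "\<eta> (x, ?z n) * ?G n x - \<eta> (x, 0) * h x = \<eta> (x, ?z n) * (?G n x - h x) + (\<eta> (x, ?z n) - \<eta> (x, 0)) * h x" by (simp add: algebra_simps)
        then show "norm (\<eta> (x, ?z n) * ?G n x - \<eta> (x, 0) * h x) \<le> K * norm (?G n x - h x) + norm ((\<eta> (x, ?z n) - \<eta> (x, 0)) * h x)"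
          by (simp only:) (intro norm_triangle_mono order_refl, simp add: norm_mult mult_right_mono K)
      qed
      also have "\<dots> = ?e n" using j k by simp
      finally show "norm (LINT x|lborel. norm (\<eta> (x, ?z n) * ?G n x - \<eta> (x, 0) * h x)) \<le> norm (?e n) * 1"
        unfolding real_norm_def by (simp add: integral_nonneg)
    qed
  qed
  have i': "integrable lborel (\<lambda>x. \<eta> (x, ?z n) * lift (cs_ext h) (x, ?z n))" for n unfolding slice by (rule i)
  note conormal_pairing[OF pairing dom i0[of 0] i' lim inverse_Suc_tendsto]
  then show "set_integrable lebesgue half_plane (conormal_integrand (lift (cs_ext u)) (\<lambda>p. \<eta> p * lift (cs_ext h) p))"
    "(LINT p:half_plane|lebesgue. conormal_integrand (lift (cs_ext u)) (\<lambda>p. \<eta> p * lift (cs_ext h) p) p)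
      = - (of_real flux_const * (LINT x|lborel. v x * (\<eta> (x, 0) * h x)))"
    by simp_all
qed


lemma
  fixes f g :: "real \<Rightarrow> 'a::{banach, second_countable_topology}"
  assumes f: "f \<in> borel_measurable lebesgue" and g: "g \<in> borel_measurable borel" and fg: "AE x in lebesgue. f x = g x"
  shows integrable_lebesgue_version: "integrable lebesgue f \<longleftrightarrow> integrable lborel g"
    and integral_lebesgue_version: "integral\<^sup>L lebesgue f = integral\<^sup>L lborel g"
proof -
  have g': "g \<in> borel_measurable lebesgue" and g'': "g \<in> borel_measurable lborel" using g by (auto intro: measurable_completion)
  show "integrable lebesgue f \<longleftrightarrow> integrable lborel g"
    unfolding integrable_cong_AE[OF f g' fg] by (rule integrable_completion[OF g''])
  show "integral\<^sup>L lebesgue f = integral\<^sup>L lborel g"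
    unfolding integral_cong_AE[OF f g' fg] by (rule integral_completion[OF g''])
qed

lemma Linfty_borel_version:
  fixes f :: "real \<Rightarrow> complex"
  assumes "Linfty f"
  obtains g B where "g \<in> borel_measurable borel" "\<And>x. norm (g x) \<le> B" "AE x in lebesgue. f x = g x" "f \<in> borel_measurable lebesgue"
proof -
  obtain C where f: "f \<in> borel_measurable lebesgue" and C: "AE x in lebesgue. norm (f x) \<le> C"
    using assms unfolding Linfty_def by blast
  obtain k where k [measurable]: "k \<in> borel_measurable borel" and fk: "AE x in lebesgue. f x = k x" using exists_borel_version[OF f] by blast
  show ?thesis
  proof (rule that[of "\<lambda>x. if norm (k x) \<le> C then k x else 0" "\<bar>C\<bar>"])
    show "AE x in lebesgue. f x = (if norm (k x) \<le> C then k x else 0)" using C fk by eventually_elim auto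
  qed (auto intro: f)
qed

lemma inverse_square_le_weight: "1 / (1 + x\<^sup>2) \<le> weight x"
proof -
  have "1 / (1 + x\<^sup>2) = (1 + x\<^sup>2) powr (- 1)" using powr_minus_divide[of "1 + x\<^sup>2" 1] by (simp add: add_pos_nonneg)
  also have "\<dots> \<le> weight x" unfolding weight_def by (intro powr_mono) auto
  finally show ?thesis .
qed

lemma integrable_bounded_weighted_mult:
  assumes f: "weighted_L1 f" and V [measurable]: "V \<in> borel_measurable borel" and B: "\<And>x. norm (V x) \<le> (B::real)" and N: "quadratic_decay N \<phi>"
  shows "integrable lborel (\<lambda>x. V x * f x * \<phi> x)"
    and "norm (LINT x|lborel. V x * f x * \<phi> x) \<le> B * N * (LINT x|lborel. weight x * norm (f x))"
proof -
  have [measurable]: "\<phi> \<in> borel_measurable borel" by (rule quadratic_decayD(6)[OF N])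
  have B0: "0 \<le> B" using order_trans[OF norm_ge_zero B] .
  have le: "norm (\<phi> x) \<le> N * weight x" for x
    using order_trans[OF quadratic_decayD(2)[OF N, of x], of "N * weight x"]
      mult_left_mono[OF inverse_square_le_weight quadratic_decayD(4)[OF N], of x] by simp
  have le': "norm (V x * \<phi> x) \<le> B * N * weight x" for x
    unfolding norm_mult mult.assoc using B0 by (intro mult_mono B le) auto
  have i: "integrable lborel (\<lambda>x. f x * (V x * \<phi> x))" by (rule integrable_weighted_mult[OF f _ le']) measurable
  have e: "V x * f x * \<phi> x = f x * (V x * \<phi> x)" for x by (simp only: mult_ac)
  show "integrable lborel (\<lambda>x. V x * f x * \<phi> x)" unfolding e by (rule i)
  have "integrable lborel (\<lambda>x. of_real (weight x) * f x)" using f by (simp add: weighted_L1_def)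
  from integrable_norm[OF this] have wi: "integrable lborel (\<lambda>x. weight x * norm (f x))" by (simp add: norm_mult)
  have "norm (LINT x|lborel. f x * (V x * \<phi> x)) \<le> (LINT x|lborel. norm (f x * (V x * \<phi> x)))" by simp
  also have "\<dots> \<le> (LINT x|lborel. B * N * (weight x * norm (f x)))"
  proof (rule integral_mono)
    fix x
    have "norm (f x * (V x * \<phi> x)) \<le> norm (f x) * (B * N * weight x)"
      unfolding norm_mult[of "f x"] by (intro mult_left_mono le' norm_ge_zero)
    also have "\<dots> = B * N * (weight x * norm (f x))" by (simp only: mult_ac)
    finally show "norm (f x * (V x * \<phi> x)) \<le> B * N * (weight x * norm (f x))" .
  qed (intro integrable_norm i integrable_mult_right wi)+
  finally show "norm (LINT x|lborel. V x * f x * \<phi> x) \<le> B * N * (LINT x|lborel. weight x * norm (f x))"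
    unfolding e by simp
qed

lemma distr_solution_iff_borel:
  assumes V: "V \<in> borel_measurable lebesgue" and V0: "V0 \<in> borel_measurable borel" "\<And>x. norm (V0 x) \<le> B" "AE x in lebesgue. of_real (V x) = (V0 x :: complex)"
    and f: "f \<in> borel_measurable lebesgue" and f0: "weighted_L1 f0" "AE x in lebesgue. f x = f0 x"
  shows "distr_solution V f \<longleftrightarrow> (\<forall>\<phi>. schwartz \<phi> \<longrightarrow> (LINT x|lborel. f0 x * frac_lap \<phi> x) = - (LINT x|lborel. V0 x * f0 x * \<phi> x))"
proof -
  have fm: "f0 \<in> borel_measurable borel" using f0(1) by (simp add: weighted_L1_def)
  have Vf: "(\<lambda>x. of_real (V x) * f x) \<in> borel_measurable lebesgue" using V f by measurable
  have Vf0: "(\<lambda>x. V0 x * f0 x) \<in> borel_measurable borel" using V0(1) fm by measurable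
  have ae: "AE x in lebesgue. of_real (V x) * f x = V0 x * f0 x" using V0(3) f0(2) by eventually_elim simp
  have "integrable lebesgue (\<lambda>x. f x * frac_lap \<phi> x) \<and> integrable lebesgue (\<lambda>x. of_real (V x) * f x * \<phi> x) \<and>
      (LINT x|lebesgue. f x * frac_lap \<phi> x) + (LINT x|lebesgue. of_real (V x) * f x * \<phi> x) = 0
     \<longleftrightarrow> (LINT x|lborel. f0 x * frac_lap \<phi> x) = - (LINT x|lborel. V0 x * f0 x * \<phi> x)" if \<phi>: "schwartz \<phi>" for \<phi>
  proof -
    obtain N where N: "quadratic_decay N \<phi>" using schwartz_quadratic_decay[OF \<phi>] by blast
    note m = frac_lap_measurable[OF \<phi>] quadratic_decayD(6)[OF N]
    have "integrable lebesgue (\<lambda>x. f x * frac_lap \<phi> x)"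
      using integrable_lebesgue_cong_borel[OF f fm f0(2) m(1)] integrable_mult_frac_lap[OF f0(1) \<phi>] by simp
    moreover have "integrable lebesgue (\<lambda>x. of_real (V x) * f x * \<phi> x)"
      using integrable_lebesgue_cong_borel[OF Vf Vf0 ae m(2)] integrable_bounded_weighted_mult(1)[OF f0(1) V0(1,2) N] by simp
    ultimately show ?thesis
      unfolding integral_lebesgue_cong_borel[OF f fm f0(2) m(1)] integral_lebesgue_cong_borel[OF Vf Vf0 ae m(2)]
      by (simp add: eq_neg_iff_add_eq_0)
  qed
  then show ?thesis unfolding distr_solution_def by blast
qed

lemma frac_lap_diff:
  assumes \<phi>: "schwartz \<phi>" and \<psi>: "schwartz \<psi>" and d: "schwartz (\<lambda>x. \<phi> x - \<psi> x)"
  shows "frac_lap \<phi> x = frac_lap \<psi> x + frac_lap (\<lambda>x. \<phi> x - \<psi> x) x"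
proof -
  have ip: "integrable lborel \<theta>" if "schwartz \<theta>" for \<theta> using schwartz_quadratic_decay[OF that] quadratic_decayD(7) by metis
  have ft: "half_derivative_ft (\<lambda>x. \<phi> x - \<psi> x) \<xi> = half_derivative_ft \<phi> \<xi> - half_derivative_ft \<psi> \<xi>" for \<xi>
  proof -
    have i: "integrable lborel (\<lambda>x. exp (- (\<i> * of_real (x * \<xi>))) * \<theta> x)" if "schwartz \<theta>" for \<theta>
      using integrable_bounded_mult[OF ip[OF that], of "\<lambda>x. exp (- (\<i> * of_real (x * \<xi>)))" 1] by (simp add: mult.commute)
    show ?thesis
      unfolding half_derivative_ft_def ft_def using i[OF \<phi>] i[OF \<psi>] by (simp add: right_diff_distrib)
  qed
  have i: "integrable lborel (\<lambda>\<xi>. exp (\<i> * of_real (x * \<xi>)) * half_derivative_ft \<theta> \<xi>)" if "schwartz \<theta>" for \<theta>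
    using integrable_bounded_mult[OF integrable_schwartz_ft(2)[OF that], of "\<lambda>\<xi>. exp (\<i> * of_real (x * \<xi>))" 1] by (simp add: mult.commute)
  show ?thesis
    unfolding frac_lap_eq[OF \<phi>] frac_lap_eq[OF \<psi>] frac_lap_eq[OF d] ft right_diff_distrib
    using i[OF \<phi>] i[OF \<psi>] by (simp add: field_simps)
qed

text \<open>Testing against \<open>\<phi>(x) cutoff(z)\<close> gives the equation for compactly supported \<open>\<phi>\<close>; the weighted bound on
  \<open>(-\<Delta>)\<^sup>1\<^sup>/\<^sup>4\<close> then allows to pass to all Schwartz functions, although \<open>f\<close> is unbounded.\<close>

lemma conormal_imp_weak_equation:
  assumes f: "weighted_L1 f" "finite_energy (cs_ext f)" and V: "V \<in> borel_measurable borel" "\<And>x. norm (V x) \<le> B"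
    and eq: "\<And>\<Psi>. test_function \<Psi> \<Longrightarrow> (LINT p:half_plane|lebesgue. conormal_integrand (lift (cs_ext f)) \<Psi> p) = - (of_real flux_const * (LINT x|lborel. V x * f x * \<Psi> (x, 0)))"
    and \<phi>: "schwartz \<phi>"
  shows "(LINT x|lborel. f x * frac_lap \<phi> x) = - (LINT x|lborel. V x * f x * \<phi> x)"
proof -
  have compact_case: "(LINT x|lborel. f x * frac_lap \<psi> x) = - (LINT x|lborel. V x * f x * \<psi> x)"
    if \<psi>: "smooth_line \<psi>" and supp: "\<And>x. r \<le> \<bar>x\<bar> \<Longrightarrow> \<psi> x = 0" and r: "1 \<le> r" for \<psi> r
  proof -
    have s\<psi>: "schwartz \<psi>" by (rule schwartz_compact[OF \<psi> supp]) (use r in auto)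
    define \<Psi> where "\<Psi> p = \<psi> (fst p) * cutoff (snd p)" for p
    have t: "test_function \<Psi>"
      unfolding \<Psi>_def[abs_def] by (rule test_function_tensor[OF \<psi> supp smooth_line_cutoff cutoff_eq_0, of r]) (use r in auto)
    obtain R K where R: "0 < R" and zero: "\<And>p. R < \<bar>fst p\<bar> \<or> R < snd p \<Longrightarrow> \<Psi> p = 0"
      and der: "\<And>p. (\<Psi> has_derivative (\<lambda>v. of_real (fst v) * Dfst \<Psi> p + of_real (snd v) * Dsnd \<Psi> p)) (at p)"
      and c: "continuous_on UNIV \<Psi>" "continuous_on UNIV (Dfst \<Psi>)" "continuous_on UNIV (Dsnd \<Psi>)"
      and KD: "\<And>p. \<bar>fst p\<bar> \<le> R \<Longrightarrow> \<bar>snd p\<bar> \<le> R \<Longrightarrow> norm (Dfst \<Psi> p) \<le> K \<and> norm (Dsnd \<Psi> p) \<le> K"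
      by (rule test_functionE[OF t]) blast
    interpret P: half_plane_pairing f \<Psi> "Dfst \<Psi>" "Dsnd \<Psi>" R by (rule test_function_pairing[OF f(1) R zero der c(2,3)])
    let ?I = "indicator ({-R..R} \<times> {0<..R}) :: real \<times> real \<Rightarrow> real"
    have int: "integrable lborel (\<lambda>p. indicator half_plane p *\<^sub>R P.integrand p)"
    proof (rule P.integrable_integrandI)
      show "integrable lborel (\<lambda>p. K * (?I p *\<^sub>R norm (W_z f p)) + R * K * (?I p *\<^sub>R (\<bar>snd p\<bar> * norm (W_x f p))))"
        by (intro Bochner_Integration.integrable_add integrable_mult_right integrable_box_W_z[OF f R] integrable_box_W_x[OF f R])
      fix p assume p: "p \<in> half_plane" "\<bar>fst p\<bar> \<le> R" "snd p \<le> R"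
      then have s: "0 < snd p" and I: "?I p = 1" by (auto simp: indicator_def mem_Times_iff)
      have D: "norm (Dfst \<Psi> p) \<le> K" "norm (Dsnd \<Psi> p) \<le> K" using KD[of p] p s by auto
      have K0: "0 \<le> K" using order_trans[OF norm_ge_zero D(1)] .
      have "norm (P.integrand p) \<le> norm (W_z f p * Dsnd \<Psi> p) + norm (of_real ((snd p)\<^sup>2) * W_x f p * Dfst \<Psi> p)"
        unfolding P.integrand_def by (rule norm_triangle_ineq)
      also have "\<dots> = norm (Dsnd \<Psi> p) * norm (W_z f p) + (snd p * norm (Dfst \<Psi> p)) * (snd p * norm (W_x f p))"
        unfolding norm_mult norm_of_real by (simp add: power2_eq_square)
      also have "\<dots> \<le> K * norm (W_z f p) + (R * K) * (snd p * norm (W_x f p))"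
        using D p s K0 R by (intro add_mono mult_right_mono mult_mono) auto
      finally show "norm (P.integrand p) \<le> K * (?I p *\<^sub>R norm (W_z f p)) + R * K * (?I p *\<^sub>R (\<bar>snd p\<bar> * norm (W_x f p)))"
        unfolding I using s by simp
    qed
    let ?z = "\<lambda>n. inverse (real (Suc n))"
    have slice: "(LINT x|lborel. W_z f (x, t) * \<Psi> (x, t)) = (LINT x|lborel. W_z f (x, t) * \<psi> x) * cutoff t" for t
      unfolding \<Psi>_def fst_conv snd_conv mult.assoc[symmetric] by (rule integral_mult_left_zero)
    have "isCont cutoff 0" by (rule differentiable_imp_continuous_within[OF smooth_line_differentiable[OF smooth_line_cutoff]])
    then have "(\<lambda>n. cutoff (?z n)) \<longlonglongrightarrow> cutoff 0" by (rule isCont_tendsto_compose[OF _ inverse_Suc_tendsto(2)])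
    then have "(\<lambda>n. - ((LINT x|lborel. W_z f (x, ?z n) * \<psi> x) * cutoff (?z n))) \<longlonglongrightarrow> - ((- of_real flux_const * (LINT t|lborel. f t * frac_lap \<psi> t)) * cutoff 0)"
      by (intro tendsto_minus tendsto_mult integral_W_z_schwartz_tendsto[OF f(1) s\<psi> inverse_Suc_tendsto])
    moreover have "(\<lambda>n. - ((LINT x|lborel. W_z f (x, ?z n) * \<psi> x) * cutoff (?z n))) \<longlonglongrightarrow> (LINT p:half_plane|lborel. P.integrand p)"
      using P.green_limit[OF int inverse_Suc_tendsto] unfolding slice .
    ultimately have "of_real flux_const * (LINT t|lborel. f t * frac_lap \<psi> t) = (LINT p:half_plane|lborel. P.integrand p)"
      using LIMSEQ_unique by (fastforce simp: cutoff_0)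
    also have "\<dots> = - (of_real flux_const * (LINT x|lborel. V x * f x * \<psi> x))"
      using eq[OF t] unfolding P.conormal_integral(2)[OF int] by (simp add: \<Psi>_def cutoff_0)
    finally have "of_real flux_const * (LINT t|lborel. f t * frac_lap \<psi> t) = of_real flux_const * - (LINT x|lborel. V x * f x * \<psi> x)" by simp
    moreover have c: "of_real flux_const \<noteq> (0 :: complex)" using flux_const_pos by simp
    ultimately show ?thesis by (blast dest: mult_left_cancel[OF c, THEN iffD1])
  qed
  obtain K where K: "\<And>n. 0 < n \<Longrightarrow> schwartz (\<lambda>x. \<phi> x * cutoff (x / n))"
    "\<And>n. 1 \<le> n \<Longrightarrow> quadratic_decay (K / n) (\<lambda>x. \<phi> x - \<phi> x * cutoff (x / n))"
    "\<And>n. 0 < n \<Longrightarrow> schwartz (\<lambda>x. \<phi> x - \<phi> x * cutoff (x / n))"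
    by (rule schwartz_cutoff_approx[OF \<phi>]) blast
  define M where "M = (LINT x|lborel. weight x * norm (f x))"
  define C where "C = (flux_bound_const / flux_const + B) * K * M"
  let ?S = "(LINT x|lborel. f x * frac_lap \<phi> x) + (LINT x|lborel. V x * f x * \<phi> x)"
  have "norm ?S \<le> C / real (Suc m)" for m
  proof -
    define n where "n = real (Suc m)"
    have n: "0 < n" "1 \<le> n" by (simp_all add: n_def)
    define \<psi> where "\<psi> x = \<phi> x * cutoff (x / n)" for x
    define d where "d x = \<phi> x - \<psi> x" for x
    have s: "schwartz \<psi>" "schwartz d" and Kd: "quadratic_decay (K / n) d"
      using K(1,3)[OF n(1)] K(2)[OF n(2)] by (simp_all add: \<psi>_def[abs_def] d_def[abs_def])
    obtain N where N: "quadratic_decay N \<psi>" using schwartz_quadratic_decay[OF s(1)] by blast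
    have 0: "(LINT x|lborel. f x * frac_lap \<psi> x) = - (LINT x|lborel. V x * f x * \<psi> x)"
    proof (rule compact_case[OF schwartz_smooth_line[OF s(1)] _ n(2)])
      show "\<psi> x = 0" if "n \<le> \<bar>x\<bar>" for x using that n cutoff_eq_0[of "x / n"] by (simp add: \<psi>_def)
    qed
    have fl: "frac_lap \<phi> x = frac_lap \<psi> x + frac_lap d x" for x
      using frac_lap_diff[OF \<phi> s(1)] s(2) by (simp add: d_def[abs_def])
    have 1: "(LINT x|lborel. f x * frac_lap \<phi> x) = (LINT x|lborel. f x * frac_lap \<psi> x) + (LINT x|lborel. f x * frac_lap d x)"
      unfolding fl distrib_left by (rule Bochner_Integration.integral_add[OF integrable_mult_frac_lap[OF f(1) s(1)] integrable_mult_frac_lap[OF f(1) s(2)]])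
    have "V x * f x * \<phi> x = V x * f x * \<psi> x + V x * f x * d x" for x by (simp add: d_def algebra_simps)
    then have 2: "(LINT x|lborel. V x * f x * \<phi> x) = (LINT x|lborel. V x * f x * \<psi> x) + (LINT x|lborel. V x * f x * d x)"
      using integrable_bounded_weighted_mult(1)[OF f(1) V N] integrable_bounded_weighted_mult(1)[OF f(1) V Kd] by simp
    have L: "norm (LINT x|lborel. f x * frac_lap d x) \<le> flux_bound_const / flux_const * (K / n) * M"
    proof -
      have wi: "integrable lborel (\<lambda>x. weight x * norm (f x))"
      proof -
        have "integrable lborel (\<lambda>x. of_real (weight x) * f x)" using f(1) by (simp add: weighted_L1_def)
        from integrable_norm[OF this] show ?thesis by (simp add: norm_mult)
      qed
      have "norm (LINT x|lborel. f x * frac_lap d x) \<le> (LINT x|lborel. norm (f x * frac_lap d x))" by simp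
      also have "\<dots> \<le> (LINT x|lborel. flux_bound_const / flux_const * (K / n) * (weight x * norm (f x)))"
      proof (rule integral_mono)
        show "norm (f x * frac_lap d x) \<le> flux_bound_const / flux_const * (K / n) * (weight x * norm (f x))" for x
          using mult_left_mono[OF frac_lap_weight_bound[OF s(2) Kd, of x], of "norm (f x)"] unfolding norm_mult by (simp add: mult_ac)
      qed (intro integrable_norm integrable_mult_frac_lap[OF f(1) s(2)] integrable_mult_right wi)+
      finally show ?thesis by (simp add: M_def)
    qed
    have "?S = (LINT x|lborel. f x * frac_lap d x) + (LINT x|lborel. V x * f x * d x)" unfolding 1 2 0 by simp
    also have "norm \<dots> \<le> flux_bound_const / flux_const * (K / n) * M + B * (K / n) * M"
      by (rule norm_triangle_mono[OF L]) (use integrable_bounded_weighted_mult(2)[OF f(1) V Kd] in \<open>simp add: M_def\<close>)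
    also have "\<dots> = C / n" by (simp add: C_def algebra_simps add_divide_distrib)
    finally show ?thesis by (simp only: n_def)
  qed
  moreover have "(\<lambda>m. C / real (Suc m)) \<longlonglongrightarrow> 0" by (rule LIMSEQ_Suc[OF lim_const_over_n])
  ultimately have "norm ?S \<le> 0" by (intro LIMSEQ_le_const[where X = "\<lambda>m. C / real (Suc m)"]) auto
  then show ?thesis by (simp add: eq_neg_iff_add_eq_0)
qed


locale bounded_data =
  fixes V :: "real \<Rightarrow> real" and u V0 u0 :: "real \<Rightarrow> complex" and BV Bu :: real
  assumes V: "V \<in> borel_measurable lebesgue" "AE x in lebesgue. of_real (V x) = V0 x"
    and u: "u \<in> borel_measurable lebesgue" "AE x in lebesgue. u x = u0 x"
    and V0: "V0 \<in> borel_measurable borel" "\<And>x. norm (V0 x) \<le> BV"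
    and u0: "u0 \<in> borel_measurable borel" "\<And>x. norm (u0 x) \<le> Bu"
    and solution: "distr_solution V u"
begin

sublocale S: bounded_solution u0 "\<lambda>x. V0 x * u0 x" Bu "BV * Bu"
proof unfold_locales
  show "u0 \<in> borel_measurable borel" "norm (u0 x) \<le> Bu" for x by (rule u0)+
  show "(\<lambda>x. V0 x * u0 x) \<in> borel_measurable borel" using V0(1) u0(1) by measurable
  show "norm (V0 x * u0 x) \<le> BV * Bu" for x
    unfolding norm_mult by (intro mult_mono V0 u0 norm_ge_zero order_trans[OF norm_ge_zero V0(2)])
  show "(LINT x|lborel. u0 x * frac_lap \<phi> x) = - (LINT x|lborel. V0 x * u0 x * \<phi> x)" if "schwartz \<phi>" for \<phi>
    using solution distr_solution_iff_borel[OF V(1) V0 V(2) u(1) weighted_L1_bounded[OF u0] u(2)] that by blast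
qed

lemma cs_ext_u: "cs_ext u = cs_ext u0"
  by (rule cs_ext_cong_AE[OF u(1) borel_imp_lebesgue_measurable[OF u0(1)] u(2)])

abbreviation "bu x \<equiv> of_real (kappa_quarter * V x) * u x :: complex"

lemma density_measurable: "(\<lambda>x. bu x) \<in> borel_measurable lebesgue"
  using V(1) u(1) by measurable

lemma density_AE: "AE x in lebesgue. bu x = of_real flux_const * (V0 x * u0 x)"
  using V(2) u(2) by eventually_elim (simp add: kappa_quarter_eq)

lemma
  assumes g: "g \<in> borel_measurable lebesgue" "AE x in lebesgue. g x = h x" and h: "h \<in> borel_measurable borel"
  shows integrable_density_mult: "integrable lborel h \<Longrightarrow> integrable lebesgue (\<lambda>x. bu x * g x)"
    and integral_density_mult: "(LINT x|lebesgue. bu x * g x) = of_real flux_const * (LINT x|lborel. V0 x * u0 x * h x)"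
proof -
  have m: "(\<lambda>x. bu x * g x) \<in> borel_measurable lebesgue" using density_measurable g(1) by measurable
  have m': "(\<lambda>x. of_real flux_const * (V0 x * u0 x * h x)) \<in> borel_measurable borel" using V0(1) u0(1) h by measurable
  have ae: "AE x in lebesgue. bu x * g x = of_real flux_const * (V0 x * u0 x * h x)"
    using density_AE g(2) by eventually_elim (simp only: mult.assoc)
  show "(LINT x|lebesgue. bu x * g x) = of_real flux_const * (LINT x|lborel. V0 x * u0 x * h x)"
    unfolding integral_lebesgue_version[OF m m' ae] by (rule integral_mult_right_zero)
  assume "integrable lborel h"
  then have "integrable lborel (\<lambda>x. h x * (V0 x * u0 x))" by (rule integrable_bounded_mult[OF _ S.v S.Bv])
  then have "integrable lborel (\<lambda>x. of_real flux_const * (V0 x * u0 x * h x))" by (intro integrable_mult_right) (simp only: mult.commute)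
  then show "integrable lebesgue (\<lambda>x. bu x * g x)" using integrable_lebesgue_version[OF m m' ae] by blast
qed

lemma has_trace: "has_trace (lift (cs_ext u)) u"
  unfolding has_trace_def
proof (intro allI conjI impI)
  fix R :: real
  define G where "G z x = gen_conv (3/4) (z\<^sup>2 / 2) u0 x" for z x
  have Gm: "G z \<in> borel_measurable borel" for z unfolding G_def[abs_def] using u0(1) by measurable
  have W: "lift (cs_ext u) (x, z) = G z x" if "0 < z" for x z
    unfolding cs_ext_u using lift_cs_ext[OF u0(1), of "(x, z)"] W_fun_eq_gen_conv[OF that] that by (simp add: G_def)
  have ind: "(indicator {-R..R} :: real \<Rightarrow> real) \<in> borel_measurable lebesgue" by (rule borel_measurable_indicator) simp
  have dm: "(\<lambda>x. G z x - u x) \<in> borel_measurable lebesgue" for z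
    by (rule borel_measurable_diff[OF borel_imp_lebesgue_measurable[OF Gm] u(1)])
  have m: "(\<lambda>x. indicator {-R..R} x *\<^sub>R (lift (cs_ext u) (x, z) - u x)) \<in> borel_measurable lebesgue"
    "(\<lambda>x. indicator {-R..R} x *\<^sub>R norm (lift (cs_ext u) (x, z) - u x)) \<in> borel_measurable lebesgue" if "0 < z" for z
    unfolding W[OF that] by (intro borel_measurable_scaleR ind dm measurable_compose[OF dm borel_measurable_norm])+
  have m': "(\<lambda>x. indicator {-R..R} x *\<^sub>R (G z x - u0 x)) \<in> borel_measurable borel"
    "(\<lambda>x. indicator {-R..R} x *\<^sub>R norm (G z x - u0 x)) \<in> borel_measurable borel" for z
    using Gm u0(1) by measurable
  have ae: "AE x in lebesgue. indicator {-R..R} x *\<^sub>R (lift (cs_ext u) (x, z) - u x) = indicator {-R..R} x *\<^sub>R (G z x - u0 x)"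
    "AE x in lebesgue. indicator {-R..R} x *\<^sub>R norm (lift (cs_ext u) (x, z) - u x) = indicator {-R..R} x *\<^sub>R norm (G z x - u0 x)" if "0 < z" for z
    using u(2) by (eventually_elim, simp add: W[OF that])+
  show "set_integrable lebesgue {-R..R} (\<lambda>x. lift (cs_ext u) (x, z) - u x)" if z: "0 < z" for z
  proof -
    have "integrable lborel (\<lambda>x. indicator {-R..R} x *\<^sub>R (G z x - u0 x))"
    proof (rule Bochner_Integration.integrable_bound)
      show "integrable lborel (\<lambda>x. indicator {-R..R} x *\<^sub>R (2 * Bu))" by (intro integrable_scaleR_left) (simp add: emeasure_lborel_Icc_eq)
      show "AE x in lborel. norm (indicator {-R..R} x *\<^sub>R (G z x - u0 x)) \<le> norm (indicator {-R..R} x *\<^sub>R (2 * Bu))"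
      proof (intro AE_I2)
        fix x
        have "norm (G z x) \<le> Bu" unfolding G_def by (rule gen_conv_bounded[OF _ _ u0]) (use z in auto)
        then have "norm (G z x - u0 x) \<le> 2 * Bu" using norm_triangle_ineq4[of "G z x" "u0 x"] u0(2)[of x] by linarith
        then show "norm (indicator {-R..R} x *\<^sub>R (G z x - u0 x)) \<le> norm (indicator {-R..R} x *\<^sub>R (2 * Bu))" by (auto simp: indicator_def)
      qed
    qed (use m' in simp)
    then show ?thesis unfolding set_integrable_def integrable_lebesgue_version[OF m(1)[OF z] m'(1) ae(1)[OF z]] .
  qed
  have "(\<lambda>n. LINT x:{-R..R}|lebesgue. norm (lift (cs_ext u) (x, z n) - u x)) \<longlonglongrightarrow> 0" if z: "\<And>n. 0 < z n" "z \<longlonglongrightarrow> 0" for z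
  proof -
    have "(\<lambda>n. LINT x:{-R..R}|lborel. norm (G (z n) x - u0 x)) \<longlonglongrightarrow> 0"
      unfolding G_def by (rule gen_conv_tendsto_local[OF _ u0 half_square_tendsto[OF z]]) simp
    then show ?thesis
      unfolding set_lebesgue_integral_def integral_lebesgue_version[OF m(2)[OF z(1)] m'(2) ae(2)[OF z(1)]] .
  qed
  then show "((\<lambda>z. LINT x:{-R..R}|lebesgue. norm (lift (cs_ext u) (x, z) - u x)) \<longlongrightarrow> 0) (at_right 0)"
    unfolding tendsto_at_iff_sequentially o_def by auto
qed

lemma
  assumes "test_function \<Psi>"
  shows conormal_integrable: "set_integrable lebesgue half_plane (conormal_integrand (lift (cs_ext u)) \<Psi>)"
    and conormal_eq: "(LINT p:half_plane|lebesgue. conormal_integrand (lift (cs_ext u)) \<Psi> p) = - (LINT x|lebesgue. bu x * \<Psi> (x, 0))"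
proof -
  obtain K where "continuous_on UNIV \<Psi>" by (rule test_functionE[OF assms]) blast
  note m = slice_measurable[OF this, of 0]
  show "set_integrable lebesgue half_plane (conormal_integrand (lift (cs_ext u)) \<Psi>)"
    unfolding cs_ext_u by (rule S.conormal_test(1)[OF assms])
  show "(LINT p:half_plane|lebesgue. conormal_integrand (lift (cs_ext u)) \<Psi> p) = - (LINT x|lebesgue. bu x * \<Psi> (x, 0))"
    unfolding cs_ext_u S.conormal_test(2)[OF assms] integral_density_mult[OF borel_imp_lebesgue_measurable[OF m] AE_I2[OF refl] m] ..
qed

lemma locally_finite_energy: "locally_finite_energy (lift (cs_ext u))"
  unfolding locally_finite_energy_def
proof
  fix R :: real
  let ?B = "{-R..R} \<times> {0<..R}"
  let ?C = "(flux_const * (BV * Bu))\<^sup>2 + (flux_const * (5/2 * (BV * Bu)))\<^sup>2"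
  have e: "indicator ?B p *\<^sub>R ((norm (Dsnd (lift (cs_ext u)) p))\<^sup>2 + (snd p)\<^sup>2 * (norm (Dfst (lift (cs_ext u)) p))\<^sup>2) = indicator ?B p *\<^sub>R z_energy u0 p" for p
  proof (cases "p \<in> ?B")
    case True
    then have "0 < snd p" by auto
    from Dfst_lift[OF S.wu this] Dsnd_lift[OF S.wu this] show ?thesis unfolding cs_ext_u z_energy_def by simp
  next
    case False
    show ?thesis unfolding indicator_simps(2)[OF False] by simp
  qed
  have "integrable lborel (\<lambda>p. indicator ?B p *\<^sub>R z_energy u0 p)"
  proof (rule integrable_boxI[OF continuous_z_energy[OF S.wu] integrable_box_const[of R R ?C]])
    fix p :: "real \<times> real" assume "p \<in> half_plane"
    then have s: "0 < snd p" by simp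
    have "(norm (W_z u0 p))\<^sup>2 \<le> (flux_const * (BV * Bu))\<^sup>2"
      using S.W_z_bound[OF s, of "fst p"] by (intro power_mono) auto
    moreover have "(snd p * norm (W_x u0 p))\<^sup>2 \<le> (flux_const * (5/2 * (BV * Bu)))\<^sup>2"
      using S.W_x_bound[OF s, of "fst p"] s by (intro power_mono) auto
    ultimately show "\<bar>z_energy u0 p\<bar> \<le> ?C"
      using z_energy_nonneg[of u0 p] unfolding z_energy_def power_mult_distrib[of "snd p"] by linarith
  qed
  moreover have "(\<lambda>p. indicator ?B p *\<^sub>R z_energy u0 p) \<in> borel_measurable lborel"
    unfolding measurable_lborel2 by (rule borel_indicator_box[OF continuous_z_energy[OF S.wu]])
  ultimately show "set_integrable lebesgue ?B (\<lambda>p. (norm (Dsnd (lift (cs_ext u)) p))\<^sup>2 + (snd p)\<^sup>2 * (norm (Dfst (lift (cs_ext u)) p))\<^sup>2)"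
    unfolding set_integrable_def e by (simp only: integrable_completion)
qed

lemma local_trace_space_mono: "R \<le> R' \<Longrightarrow> g \<in> local_trace_space R \<Longrightarrow> g \<in> local_trace_space R'"
  by (auto simp: local_trace_space_def)

lemma local_trace_dual: "(\<lambda>g. - (LINT x|lebesgue. bu x * g x)) \<in> local_trace_dual"
  unfolding local_trace_dual_def
proof (intro CollectI allI conjI ballI)
  fix R :: real
  define R' where "R' = max R 1"
  have R': "0 < R'" "R \<le> R'" by (simp_all add: R'_def)
  have i: "integrable lebesgue (\<lambda>x. bu x * g x)" if g: "g \<in> local_trace_space R" for g
  proof -
    obtain h where "h \<in> borel_measurable borel" "integrable lborel h" "AE x in lebesgue. g x = h x" "g \<in> borel_measurable lebesgue"
      by (rule local_trace_representative[OF local_trace_space_mono[OF R'(2) g] R'(1)]) blast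
    then show ?thesis using integrable_density_mult by blast
  qed
  show "- (LINT x|lebesgue. bu x * (g x + h x)) = - (LINT x|lebesgue. bu x * g x) + - (LINT x|lebesgue. bu x * h x)"
    if "g \<in> local_trace_space R" "h \<in> local_trace_space R" for g h
    unfolding distrib_left Bochner_Integration.integral_add[OF i[OF that(1)] i[OF that(2)]] by simp
  show "- (LINT x|lebesgue. bu x * (c * g x)) = c * - (LINT x|lebesgue. bu x * g x)" for g c
    unfolding mult.left_commute[of _ c] integral_mult_right_zero by simp
  obtain C where C: "\<And>g. \<lbrakk>weighted_L1 g; integrable lborel g; finite_energy (cs_ext g); \<And>x. R' < \<bar>x\<bar> \<Longrightarrow> g x = 0\<rbrakk> \<Longrightarrow>
    (LINT x|lborel. norm (g x)) \<le> C * trace_norm g"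
    by (rule trace_inequality[OF R'(1)]) blast
  show "\<exists>C. \<forall>g\<in>local_trace_space R. norm (- (LINT x|lebesgue. bu x * g x)) \<le> C * trace_norm g"
  proof (intro exI ballI)
    fix g assume g: "g \<in> local_trace_space R"
    obtain h where h: "weighted_L1 h" "h \<in> borel_measurable borel" "integrable lborel h" "\<And>x. R' < \<bar>x\<bar> \<Longrightarrow> h x = 0"
      "AE x in lebesgue. g x = h x" "finite_energy (cs_ext h)" "trace_norm g = trace_norm h" "g \<in> borel_measurable lebesgue"
      by (rule local_trace_representative[OF local_trace_space_mono[OF R'(2) g] R'(1)]) blast
    have "norm (- (LINT x|lebesgue. bu x * g x)) = flux_const * norm (LINT x|lborel. V0 x * u0 x * h x)"
      unfolding integral_density_mult[OF h(8,5,2)] using flux_const_pos by (simp add: norm_mult)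
    also have "\<dots> \<le> flux_const * (BV * Bu * (LINT x|lborel. norm (h x)))"
      using flux_const_pos by (intro mult_left_mono norm_integral_mult_le[OF h(3) S.v S.Bv]) simp
    also have "\<dots> \<le> flux_const * (BV * Bu * (C * trace_norm g))"
      using flux_const_pos S.Bv0 C[OF h(1,3,6,4)] unfolding h(7) by (intro mult_left_mono) auto
    finally show "norm (- (LINT x|lebesgue. bu x * g x)) \<le> flux_const * (BV * Bu) * C * trace_norm g"
      by (simp only: mult.assoc)
  qed
qed

lemma neg_conormal_dual: "neg_conormal_dual (lift (cs_ext u)) (\<lambda>g. - (LINT x|lebesgue. bu x * g x))"
  unfolding neg_conormal_dual_def Let_def
proof (intro allI ballI impI, elim conjE)
  fix R g \<eta> assume g: "g \<in> local_trace_space R" and \<eta>: "test_function \<eta>" and \<eta>g: "\<forall>x. \<eta> (x, 0) * g x = g x"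
  obtain h where h: "weighted_L1 h" "h \<in> borel_measurable borel" "integrable lborel h"
    "AE x in lebesgue. g x = h x" "cs_ext g = cs_ext h" "finite_energy (cs_ext h)" "g \<in> borel_measurable lebesgue"
    by (rule local_trace_representative[of g "max R 1"]) (auto intro: local_trace_space_mono[OF _ g])
  have "continuous_on UNIV \<eta>" by (rule test_functionE[OF \<eta>]) blast
  from slice_measurable[OF this] h(2) have m: "(\<lambda>x. \<eta> (x, 0) * h x) \<in> borel_measurable borel" by measurable
  have ae: "AE x in lebesgue. g x = \<eta> (x, 0) * h x"
    using h(4)
  proof eventually_elim
    case (elim x)
    then show ?case using \<eta>g[rule_format, of x] by simp
  qed
  note dual = S.conormal_dual[OF h(1,3,6) \<eta>]
  show "set_integrable lebesgue half_plane (conormal_integrand (lift (cs_ext u)) (\<lambda>p. \<eta> p * lift (cs_ext g) p)) \<and>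
    - (LINT x|lebesgue. bu x * g x) = (LINT p:half_plane|lebesgue. conormal_integrand (lift (cs_ext u)) (\<lambda>p. \<eta> p * lift (cs_ext g) p) p)"
    unfolding cs_ext_u h(5) dual(2) integral_density_mult[OF h(7) ae m] using dual(1) by blast
qed

end

lemma conormal_imp_distr_solution:
  assumes V: "Linfty V" and f: "has_cs_ext f" "finite_energy (cs_ext f)"
    and eq: "\<And>\<Psi>. test_function \<Psi> \<Longrightarrow> (LINT p:half_plane|lebesgue. conormal_integrand (lift (cs_ext f)) \<Psi> p)
      = - (LINT x|lebesgue. of_real (kappa_quarter * V x) * f x * \<Psi> (x, 0))"
  shows "distr_solution V f"
proof -
  have Vm: "V \<in> borel_measurable lebesgue" using V by (simp add: Linfty_def)
  have "Linfty (\<lambda>x. of_real (V x) :: complex)" using V unfolding Linfty_def by (auto intro: borel_measurable_of_real)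
  then obtain V0 B where V0: "V0 \<in> borel_measurable borel" "\<And>x. norm (V0 x) \<le> B" "AE x in lebesgue. of_real (V x) = (V0 x :: complex)"
    by (rule Linfty_borel_version) blast
  obtain f0 where f0: "weighted_L1 f0" "f0 \<in> borel_measurable borel" "AE x in lebesgue. f x = f0 x" "cs_ext f = cs_ext f0" "f \<in> borel_measurable lebesgue"
    by (rule borel_representative[OF f(1)])
  have m: "(\<lambda>x. of_real (kappa_quarter * V x) * f x) \<in> borel_measurable lebesgue" using Vm f0(5) by measurable
  have m': "(\<lambda>x. of_real flux_const * (V0 x * f0 x)) \<in> borel_measurable borel" using V0(1) f0(2) by measurable
  have ae: "AE x in lebesgue. of_real (kappa_quarter * V x) * f x = of_real flux_const * (V0 x * f0 x)"
    using V0(3) f0(3) by eventually_elim (simp add: kappa_quarter_eq)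
  have "(LINT p:half_plane|lebesgue. conormal_integrand (lift (cs_ext f0)) \<Psi> p) = - (of_real flux_const * (LINT x|lborel. V0 x * f0 x * \<Psi> (x, 0)))"
    if \<Psi>: "test_function \<Psi>" for \<Psi>
  proof -
    have "continuous_on UNIV \<Psi>" by (rule test_functionE[OF \<Psi>]) blast
    note s = slice_measurable[OF this, of 0]
    have "(LINT x|lebesgue. of_real (kappa_quarter * V x) * f x * \<Psi> (x, 0)) = of_real flux_const * (LINT x|lborel. V0 x * f0 x * \<Psi> (x, 0))"
      unfolding integral_lebesgue_cong_borel[OF m m' ae s] unfolding mult.assoc by (rule integral_mult_right_zero)
    then show ?thesis using eq[OF \<Psi>] f0(4) by simp
  qed
  then have "(LINT x|lborel. f0 x * frac_lap \<phi> x) = - (LINT x|lborel. V0 x * f0 x * \<phi> x)" if "schwartz \<phi>" for \<phi>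
    using f(2) that unfolding f0(4) by (intro conormal_imp_weak_equation[OF f0(1) _ V0(1,2)]) auto
  then show ?thesis using distr_solution_iff_borel[OF Vm V0 f0(5,1,3)] by blast
qed

theorem proposition3p1:
  fixes V b :: "real \<Rightarrow> real"
  assumes "Linfty V"
    and "b = (\<lambda>x. kappa_quarter * V x)"
  shows "kappa_quarter > 0 \<and>
    (\<forall>u W. Linfty u \<and> distr_solution V u \<and> W = lift (cs_ext u) \<longrightarrow>
       has_trace W u \<and>
       Ck_on 2 half_plane W \<and>
       (\<forall>p\<in>half_plane. Dsnd (Dsnd W) p + of_real ((snd p)\<^sup>2) * Dfst (Dfst W) p = 0) \<and>
       (\<forall>\<Psi>. test_function \<Psi> \<longrightarrow>
          set_integrable lebesgue half_plane
            (\<lambda>p. Dsnd W p * Dsnd \<Psi> p + of_real ((snd p)\<^sup>2) * Dfst W p * Dfst \<Psi> p) \<and>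
          (LINT p:half_plane|lebesgue.
             Dsnd W p * Dsnd \<Psi> p + of_real ((snd p)\<^sup>2) * Dfst W p * Dfst \<Psi> p)
          = - (LINT x|lebesgue. of_real (b x) * u x * \<Psi> (x, 0))) \<and>
       neg_conormal_distr W (\<lambda>\<phi>. - (LINT x|lebesgue. of_real (b x) * u x * \<phi> x)) \<and>
       locally_finite_energy W \<and>
       (\<lambda>g. - (LINT x|lebesgue. of_real (b x) * u x * g x)) \<in> local_trace_dual \<and>
       neg_conormal_dual W (\<lambda>g. - (LINT x|lebesgue. of_real (b x) * u x * g x))) \<and>
    (\<forall>f U W. has_cs_ext f \<and> U = cs_ext f \<and> finite_energy U \<and> W = lift U \<and> has_trace W f \<and>
       (\<forall>\<Psi>. test_function \<Psi> \<longrightarrow>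
          (LINT p:half_plane|lebesgue.
             Dsnd W p * Dsnd \<Psi> p + of_real ((snd p)\<^sup>2) * Dfst W p * Dfst \<Psi> p)
          = - (LINT x|lebesgue. of_real (b x) * f x * \<Psi> (x, 0))) \<longrightarrow>
       distr_solution V f)"
proof (intro conjI)
  show "kappa_quarter > 0" using flux_const_pos by (simp add: kappa_quarter_eq)
next
  show "\<forall>u W. Linfty u \<and> distr_solution V u \<and> W = lift (cs_ext u) \<longrightarrow>
       has_trace W u \<and>
       Ck_on 2 half_plane W \<and>
       (\<forall>p\<in>half_plane. Dsnd (Dsnd W) p + of_real ((snd p)\<^sup>2) * Dfst (Dfst W) p = 0) \<and>
       (\<forall>\<Psi>. test_function \<Psi> \<longrightarrow>
          set_integrable lebesgue half_plane
            (\<lambda>p. Dsnd W p * Dsnd \<Psi> p + of_real ((snd p)\<^sup>2) * Dfst W p * Dfst \<Psi> p) \<and>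
          (LINT p:half_plane|lebesgue.
             Dsnd W p * Dsnd \<Psi> p + of_real ((snd p)\<^sup>2) * Dfst W p * Dfst \<Psi> p)
          = - (LINT x|lebesgue. of_real (b x) * u x * \<Psi> (x, 0))) \<and>
       neg_conormal_distr W (\<lambda>\<phi>. - (LINT x|lebesgue. of_real (b x) * u x * \<phi> x)) \<and>
       locally_finite_energy W \<and>
       (\<lambda>g. - (LINT x|lebesgue. of_real (b x) * u x * g x)) \<in> local_trace_dual \<and>
       neg_conormal_dual W (\<lambda>g. - (LINT x|lebesgue. of_real (b x) * u x * g x))"
  proof (intro allI impI, elim conjE)
    fix u W assume u: "Linfty u" and sol: "distr_solution V u" and W: "W = lift (cs_ext u)"
    have Vm: "V \<in> borel_measurable lebesgue" using assms(1) by (simp add: Linfty_def)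
    have "Linfty (\<lambda>x. of_real (V x) :: complex)" using assms(1) unfolding Linfty_def by (auto intro: borel_measurable_of_real)
    then obtain V0 BV where V0: "V0 \<in> borel_measurable borel" "\<And>x. norm (V0 x) \<le> BV" "AE x in lebesgue. of_real (V x) = (V0 x :: complex)"
      by (rule Linfty_borel_version) blast
    obtain u0 Bu where u0: "u0 \<in> borel_measurable borel" "\<And>x. norm (u0 x) \<le> Bu" "AE x in lebesgue. u x = u0 x" "u \<in> borel_measurable lebesgue"
      by (rule Linfty_borel_version[OF u]) blast
    interpret bounded_data V u V0 u0 BV Bu
      by unfold_locales (use Vm V0 u0 sol in auto)
    have W0: "W = lift (cs_ext u0)" by (simp add: W cs_ext_u)
    have "has_trace W u" unfolding W by (rule has_trace)
    moreover have "Ck_on 2 half_plane W" unfolding W0 by (rule lift_Ck2(1)[OF S.wu])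
    moreover have "\<forall>p\<in>half_plane. Dsnd (Dsnd W) p + of_real ((snd p)\<^sup>2) * Dfst (Dfst W) p = 0"
      unfolding W0 using lift_Ck2(2)[OF S.wu] by blast
    moreover have con: "set_integrable lebesgue half_plane (conormal_integrand W \<Psi>)"
      "(LINT p:half_plane|lebesgue. conormal_integrand W \<Psi> p) = - (LINT x|lebesgue. of_real (b x) * u x * \<Psi> (x, 0))" if "test_function \<Psi>" for \<Psi>
      unfolding W assms(2) by (rule conormal_integrable[OF that], rule conormal_eq[OF that])
    moreover have "neg_conormal_distr W (\<lambda>\<phi>. - (LINT x|lebesgue. of_real (b x) * u x * \<phi> x))"
      unfolding neg_conormal_distr_def using con by simp
    moreover have "locally_finite_energy W" unfolding W by (rule locally_finite_energy)
    moreover have "(\<lambda>g. - (LINT x|lebesgue. of_real (b x) * u x * g x)) \<in> local_trace_dual" unfolding assms(2) by (rule local_trace_dual)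
    moreover have "neg_conormal_dual W (\<lambda>g. - (LINT x|lebesgue. of_real (b x) * u x * g x))" unfolding W assms(2) by (rule neg_conormal_dual)
    ultimately show "has_trace W u \<and>
       Ck_on 2 half_plane W \<and>
       (\<forall>p\<in>half_plane. Dsnd (Dsnd W) p + of_real ((snd p)\<^sup>2) * Dfst (Dfst W) p = 0) \<and>
       (\<forall>\<Psi>. test_function \<Psi> \<longrightarrow>
          set_integrable lebesgue half_plane
            (\<lambda>p. Dsnd W p * Dsnd \<Psi> p + of_real ((snd p)\<^sup>2) * Dfst W p * Dfst \<Psi> p) \<and>
          (LINT p:half_plane|lebesgue.
             Dsnd W p * Dsnd \<Psi> p + of_real ((snd p)\<^sup>2) * Dfst W p * Dfst \<Psi> p)
          = - (LINT x|lebesgue. of_real (b x) * u x * \<Psi> (x, 0))) \<and>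
       neg_conormal_distr W (\<lambda>\<phi>. - (LINT x|lebesgue. of_real (b x) * u x * \<phi> x)) \<and>
       locally_finite_energy W \<and>
       (\<lambda>g. - (LINT x|lebesgue. of_real (b x) * u x * g x)) \<in> local_trace_dual \<and>
       neg_conormal_dual W (\<lambda>g. - (LINT x|lebesgue. of_real (b x) * u x * g x))"
      unfolding conormal_integrand_def[abs_def] by blast
  qed
next
  show "\<forall>f U W. has_cs_ext f \<and> U = cs_ext f \<and> finite_energy U \<and> W = lift U \<and> has_trace W f \<and>
       (\<forall>\<Psi>. test_function \<Psi> \<longrightarrow>
          (LINT p:half_plane|lebesgue.
             Dsnd W p * Dsnd \<Psi> p + of_real ((snd p)\<^sup>2) * Dfst W p * Dfst \<Psi> p)
          = - (LINT x|lebesgue. of_real (b x) * f x * \<Psi> (x, 0))) \<longrightarrow>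
       distr_solution V f"
  proof (intro allI impI, elim conjE)
    fix f U W
    assume "has_cs_ext f" "U = cs_ext f" "finite_energy U" "W = lift U"
      and "\<forall>\<Psi>. test_function \<Psi> \<longrightarrow>
          (LINT p:half_plane|lebesgue. Dsnd W p * Dsnd \<Psi> p + of_real ((snd p)\<^sup>2) * Dfst W p * Dfst \<Psi> p)
          = - (LINT x|lebesgue. of_real (b x) * f x * \<Psi> (x, 0))"
    then show "distr_solution V f"
      by (intro conormal_imp_distr_solution[OF assms(1)]) (auto simp: conormal_integrand_def assms(2))
  qed
qed

end
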